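(* Let $\mathcal{H}$ be a separable Hilbert space, let $\mathcal{K}=L^2(\mathbf{R})$, let $\eta$ be a topologically invariant mean on $CB(\mathbf{R})$, let $\delta$ be an $\eta$-Dirac state on $\mathcal{L}(\mathcal{K})$, and let $X$ be a (possibly unbounded) self-adjoint operator on $\mathcal{H}$. Let $\Pr\{X\in dx;Y\in dy\|\rho\}$ denote the joint distribution of the outcomes of the successive measurement of $X$ and $Y$ given by the canonical measuring process of $X$ with preparation $\delta$ (as defined in the context). Then for every bounded self-adjoint operator $Y\in\mathcal{L}(\mathcal{H})$ and every Borel set $B\in\mathcal{B}(\mathbf{R})$, $$\int_{\mathbf{R}} y\,\Pr\{X\in B;\,Y\in dy\|\rho\}=\mathrm{Tr}\big[X(B)\,\mathcal{E}^X_\eta[Y]\,\rho\big]$$ for all normal states $\rho$ on $\mathcal{L}(\mathcal{H})$. (That is, the canonical measuring process satisfies the Srinivas collapse postulate for the invariant mean $\eta$.)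
   Context: $\mathcal{L}(\mathcal{H})$ is the algebra of bounded operators on $\mathcal{H}$. A state on $\mathcal{L}(\mathcal{H})$ is a positive linear functional of norm one, its value at $A$ is written $\langle A,\sigma\rangle$; it is not required to be normal. A normal state is one of the form $A\mapsto\mathrm{Tr}[A\rho]$ with $\rho$ a density operator, and is identified with $\rho$. $\mathcal{B}(\mathbf{R})$ is the Borel $\sigma$-field, and $X(B)$ is the spectral projection of $X$ for $B\in\mathcal{B}(\mathbf{R})$. $CB(\mathbf{R})$ is the space of bounded continuous functions on $\mathbf{R}$. A mean on $CB(\mathbf{R})$ is a positive linear functional $\eta$ with $\eta(1)=1$; one writes $\eta_u f(u)$ for $\eta(f)$. It is topologically invariant if $\eta(f*g)=\eta(f)$ for all $f\in CB(\mathbf{R})$ and all $g\in L^1(\mathbf{R})$ with $g\ge 0$, $\int g=1$, where $(f*g)(u)=\int f(u-p)g(p)\,dp$. $\mathcal{E}^X_\eta$ is the norm one projection from $\mathcal{L}(\mathcal{H})$ onto the commutant $\{X(B);B\in\mathcal{B}(\mathbf{R})\}'$ determined by $\mathrm{Tr}[\mathcal{E}^X_\eta[A]\rho]=\eta_u\,\mathrm{Tr}[e^{iuX}Ae^{-iuX}\rho]$ for all normal states $\rho$ and $A\in\mathcal{L}(\mathcal{H})$. On $L^2(\mathbf{R})$, $Q$ is the position operator (multiplication by $q$) and $P=-i\,d/dq$ is the momentum operator; $f(Q)$, $f(P)$ are defined by the spectral functional calculus. A state $\delta$ on $\mathcal{L}(L^2(\mathbf{R}))$ is an $\eta$-Dirac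 state if for every $f\in CB(\mathbf{R})$: (D1) $\langle f(Q),\delta\rangle=f(0)$, and (D2) $\langle f(P),\delta\rangle=\eta(f)$. $\mathcal{L}(\mathcal{H})\otimes\mathcal{L}(\mathcal{K})$ is the von Neumann algebra tensor product, i.e. $\mathcal{L}(\mathcal{H}\otimes\mathcal{K})$. For a normal state $\rho$ on $\mathcal{L}(\mathcal{H})$, $\mathcal{E}_\rho:\mathcal{L}(\mathcal{H})\otimes\mathcal{L}(\mathcal{K})\to\mathcal{L}(\mathcal{K})$ is the normal completely positive map with $\mathcal{E}_\rho(A_1\otimes A_2)=\mathrm{Tr}[A_1\rho]A_2$, and $\rho\otimes\delta$ is the state defined by $\langle T,\rho\otimes\delta\rangle=\langle\mathcal{E}_\rho(T),\delta\rangle$. Canonical measuring process of $X$ with preparation $\delta$: let $U=e^{-i(X\otimes P)}$ on $\mathcal{H}\otimes\mathcal{K}$, and let $U(\rho\otimes\delta)U^*$ be the state $T\mapsto\langle U^*TU,\rho\otimes\delta\rangle$. With $\overline{\mathbf{R}}=\mathbf{R}\cup\{+\infty\}\cup\{-\infty\}$, the joint distribution $\Pr\{X\in dx;Y\in dy\|\rho\}$ is the unique $\sigma$-additive Borel probability measure on $\overline{\mathbf{R}}^2$ such that, for all $f\in C(\overline{\mathbf{R}}^2)$, $$\int_{\overline{\mathbf{R}}^2}f(x,y)\Pr\{X\in dx;Y\in dy\|\rho\}=\langle f(1\otimes Q,\,Y\otimes 1),\,U(\rho\otimes\delta)U^*\rangle,$$ where $f(1\otimes Q,Y\otimes 1)$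 is the joint functional calculus of the commuting self-adjoint operators $1\otimes Q$ and $Y\otimes 1$ applied to $f|_{\mathbf{R}^2}$. In the claim, $\Pr\{X\in B;Y\in dy\|\rho\}$ is the measure $C\mapsto\Pr\{X\in B;Y\in C\|\rho\}$ on Borel subsets $C$ of $\mathbf{R}$, i.e. the measure of $B\times C$. *)

theory Defs
  imports "HOL-Analysis.Analysis"
begin

section \<open>Complex Hilbert spaces\<close>

class complex_vector = real_vector +
  fixes scaleC :: "complex \<Rightarrow> 'a \<Rightarrow> 'a"  (infixr \<open>*\<^sub>C\<close> 75)
  assumes scaleC_add_right: "c *\<^sub>C (x + y) = c *\<^sub>C x + c *\<^sub>C y"
    and scaleC_add_left: "(c + d) *\<^sub>C x = c *\<^sub>C x + d *\<^sub>C x"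
    and scaleC_scaleC: "c *\<^sub>C d *\<^sub>C x = (c * d) *\<^sub>C x"
    and scaleR_scaleC: "r *\<^sub>R x = complex_of_real r *\<^sub>C x"

definition clinear :: "('a::complex_vector \<Rightarrow> 'b::complex_vector) \<Rightarrow> bool" where
  "clinear f \<longleftrightarrow> (\<forall>x y. f (x + y) = f x + f y) \<and> (\<forall>c x. f (c *\<^sub>C x) = c *\<^sub>C f x)"

instantiation complex :: complex_vector
begin
definition "scaleC_complex = ((*) :: complex \<Rightarrow> complex \<Rightarrow> complex)"
instance
  by standard (auto simp: scaleC_complex_def algebra_simps scaleR_conv_of_real)
end

text \<open>The inner product is linear in the second argument.  Its real part is the inner product
  of the underlying real Hilbert space, which in particular fixes the norm.\<close>

class chilbert_space = complex_vector + real_inner + complete_space +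
  fixes cinner :: "'a \<Rightarrow> 'a \<Rightarrow> complex"
  assumes cinner_commute: "cinner x y = cnj (cinner y x)"
    and cinner_add_right: "cinner x (y + z) = cinner x y + cinner x z"
    and cinner_scaleC_right: "cinner x (c *\<^sub>C y) = c * cinner x y"
    and inner_eq_Re_cinner: "inner x y = Re (cinner x y)"

lemma cinner_self:
  fixes x :: "'a::chilbert_space"
  shows "cinner x x = complex_of_real ((norm x)\<^sup>2)"
proof -
  have "Im (cinner x x) = 0"
    by (metis Im_complex_of_real cinner_commute Reals_cnj_iff complex_is_Real_iff)
  then show ?thesis
    by (simp add: complex_eq_iff power2_norm_eq_inner inner_eq_Re_cinner)
qed

lemma norm_scaleC:
  fixes x :: "'a::chilbert_space"
  shows "norm (c *\<^sub>C x) = cmod c * norm x"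
proof -
  have "cinner (c *\<^sub>C x) (c *\<^sub>C x) = c * cnj c * cinner x x"
    by (metis (no_types, lifting) ab_semigroup_mult_class.mult_ac(1) cinner_commute cinner_scaleC_right
        complex_cnj_cnj complex_cnj_mult mult.commute)
  then have "complex_of_real ((norm (c *\<^sub>C x))\<^sup>2) = complex_of_real ((cmod c * norm x)\<^sup>2)"
    by (simp add: cinner_self complex_norm_square[symmetric] power_mult_distrib)
  then have "(norm (c *\<^sub>C x))\<^sup>2 = (cmod c * norm x)\<^sup>2"
    using of_real_eq_iff by blast
  then show ?thesis
    by (simp add: power2_eq_iff_nonneg)
qed

section \<open>The algebra of bounded operators\<close>

typedef (overloaded) 'a bop =
  "{A :: 'a::chilbert_space \<Rightarrow>\<^sub>L 'a. \<forall>c x. blinfun_apply A (c *\<^sub>C x) = c *\<^sub>C blinfun_apply A x}"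
proof
  have "c *\<^sub>C (0::'a) = 0" for c
    by (metis add_cancel_right_right scaleC_add_right)
  then show "0 \<in> {A :: 'a \<Rightarrow>\<^sub>L 'a. \<forall>c x. blinfun_apply A (c *\<^sub>C x) = c *\<^sub>C blinfun_apply A x}"
    by simp
qed

setup_lifting type_definition_bop

lift_definition apply_bop :: "'a::chilbert_space bop \<Rightarrow> 'a \<Rightarrow> 'a"  (infixr \<open>*\<^sub>V\<close> 75)
  is blinfun_apply .

lemma scaleC_zero_right: "c *\<^sub>C (0::'a::complex_vector) = 0"
  by (metis add_cancel_right_right scaleC_add_right)

lemma scaleC_minus_right: "c *\<^sub>C (- x::'a::complex_vector) = - (c *\<^sub>C x)"
  by (metis ab_group_add_class.ab_left_minus add_eq_0_iff2 scaleC_add_right scaleC_zero_right)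

lemma scaleC_diff_right: "c *\<^sub>C (x - y::'a::complex_vector) = c *\<^sub>C x - c *\<^sub>C y"
  by (metis (no_types) add_uminus_conv_diff scaleC_add_right scaleC_minus_right)

lemma scaleC_scaleR_commute: "c *\<^sub>C r *\<^sub>R (x::'a::complex_vector) = r *\<^sub>R c *\<^sub>C x"
  by (simp add: scaleR_scaleC scaleC_scaleC mult.commute)

lemma bounded_linear_scaleC: "bounded_linear (\<lambda>x. c *\<^sub>C (x::'a::chilbert_space))"
  by (rule bounded_linear_intro[where K = "cmod c"])
     (auto simp: scaleC_add_right scaleC_scaleR_commute norm_scaleC mult.commute)

instantiation bop :: (chilbert_space) real_normed_vector
begin
lift_definition zero_bop :: "'a bop" is 0
  by (simp add: scaleC_zero_right)
lift_definition plus_bop :: "'a bop \<Rightarrow> 'a bop \<Rightarrow> 'a bop" is "(+)"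
  by (simp add: plus_blinfun.rep_eq scaleC_add_right)
lift_definition minus_bop :: "'a bop \<Rightarrow> 'a bop \<Rightarrow> 'a bop" is "(-)"
  by (simp add: minus_blinfun.rep_eq scaleC_diff_right)
lift_definition uminus_bop :: "'a bop \<Rightarrow> 'a bop" is uminus
  by (simp add: uminus_blinfun.rep_eq scaleC_minus_right)
lift_definition scaleR_bop :: "real \<Rightarrow> 'a bop \<Rightarrow> 'a bop" is scaleR
  by (simp add: scaleR_blinfun.rep_eq scaleC_scaleR_commute)
lift_definition norm_bop :: "'a bop \<Rightarrow> real" is norm .
lift_definition dist_bop :: "'a bop \<Rightarrow> 'a bop \<Rightarrow> real" is dist .
lift_definition sgn_bop :: "'a bop \<Rightarrow> 'a bop" is sgn
  by (simp add: sgn_div_norm scaleR_blinfun.rep_eq scaleC_scaleR_commute)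
definition uniformity_bop :: "('a bop \<times> 'a bop) filter" where
  "uniformity_bop = (INF e\<in>{0<..}. principal {(x, y). dist x y < e})"
definition open_bop :: "'a bop set \<Rightarrow> bool" where
  "open_bop S = (\<forall>x\<in>S. \<forall>\<^sub>F (x', y) in uniformity. x' = x \<longrightarrow> y \<in> S)"
instance
proof
  show "uniformity = (INF e\<in>{0<..}. principal {(x::'a bop, y). dist x y < e})"
    by (rule uniformity_bop_def)
  show "open U = (\<forall>x\<in>U. \<forall>\<^sub>F (x', y) in uniformity. x' = x \<longrightarrow> y \<in> U)" for U :: "'a bop set"
    by (rule open_bop_def)
next
  fix A B C :: "'a bop" and r s :: real
  show "A + B + C = A + (B + C)" by transfer (simp add: add.assoc)
  show "A + B = B + A" by transfer (simp add: add.commute)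
  show "0 + A = A" by transfer simp
  show "- A + A = 0" by transfer simp
  show "A - B = A + - B" by transfer simp
  show "r *\<^sub>R (A + B) = r *\<^sub>R A + r *\<^sub>R B" by transfer (rule scaleR_add_right)
  show "(r + s) *\<^sub>R A = r *\<^sub>R A + s *\<^sub>R A" by transfer (rule scaleR_add_left)
  show "r *\<^sub>R s *\<^sub>R A = (r * s) *\<^sub>R A" by transfer simp
  show "1 *\<^sub>R A = A" by transfer simp
  show "dist A B = norm (A - B)" by transfer (rule dist_norm)
  show "sgn A = inverse (norm A) *\<^sub>R A" by transfer (rule sgn_div_norm)
  show "norm A = 0 \<longleftrightarrow> A = 0" by transfer simp
  show "norm (A + B) \<le> norm A + norm B" by transfer (rule norm_triangle_ineq)
  show "norm (r *\<^sub>R A) = \<bar>r\<bar> * norm A" by transfer simp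
qed
end

lift_definition blinfun_scaleC :: "complex \<Rightarrow> 'a::chilbert_space \<Rightarrow>\<^sub>L 'a" is scaleC
  by (rule bounded_linear_scaleC)

instantiation bop :: (chilbert_space) complex_vector
begin
lift_definition scaleC_bop :: "complex \<Rightarrow> 'a bop \<Rightarrow> 'a bop"
  is "\<lambda>c A. blinfun_scaleC c o\<^sub>L A"
  by (simp add: blinfun_scaleC.rep_eq scaleC_scaleC mult.commute)
instance
proof
  fix A B :: "'a bop" and c d :: complex and r :: real
  note [simp] = blinfun_scaleC.rep_eq blinfun.add_left blinfun.scaleR_left
  show "c *\<^sub>C (A + B) = c *\<^sub>C A + c *\<^sub>C B"
    by transfer (rule blinfun_eqI, simp add: scaleC_add_right)
  show "(c + d) *\<^sub>C A = c *\<^sub>C A + d *\<^sub>C A"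
    by transfer (rule blinfun_eqI, simp add: scaleC_add_left)
  show "c *\<^sub>C d *\<^sub>C A = (c * d) *\<^sub>C A"
    by transfer (rule blinfun_eqI, simp add: scaleC_scaleC)
  show "r *\<^sub>R A = complex_of_real r *\<^sub>C A"
    by transfer (rule blinfun_eqI, simp add: scaleR_scaleC)
qed
end

instantiation bop :: (chilbert_space) monoid_mult
begin
lift_definition one_bop :: "'a bop" is id_blinfun
  by simp
lift_definition times_bop :: "'a bop \<Rightarrow> 'a bop \<Rightarrow> 'a bop" is "(o\<^sub>L)"
  by simp
instance
proof
  fix A B C :: "'a bop"
  show "A * B * C = A * (B * C)" by transfer (rule blinfun_eqI, simp)
  show "1 * A = A" by transfer (rule blinfun_eqI, simp)
  show "A * 1 = A" by transfer (rule blinfun_eqI, simp)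
qed
end

definition adj :: "'a::chilbert_space bop \<Rightarrow> 'a bop" where
  "adj A = (THE B. \<forall>x y. cinner (A *\<^sub>V x) y = cinner x (B *\<^sub>V y))"

definition hermitian :: "'a::chilbert_space bop \<Rightarrow> bool" where
  "hermitian A \<longleftrightarrow> adj A = A"

definition positive_op :: "'a::chilbert_space bop \<Rightarrow> bool" where
  "positive_op A \<longleftrightarrow> (\<forall>x. cinner x (A *\<^sub>V x) \<in> \<real>\<^sub>\<ge>\<^sub>0)"

definition projection :: "'a::chilbert_space bop \<Rightarrow> bool" where
  "projection A \<longleftrightarrow> A * A = A \<and> adj A = A"

section \<open>Trace, states and maps of operator algebras\<close>

definition cspan :: "'a::complex_vector set \<Rightarrow> 'a set" where
  "cspan S = span {c *\<^sub>C x |c x. x \<in> S}"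

definition orthonormal_basis :: "'a::chilbert_space set \<Rightarrow> bool" where
  "orthonormal_basis S \<longleftrightarrow>
     (\<forall>x\<in>S. \<forall>y\<in>S. cinner x y = (if x = y then 1 else 0)) \<and> closure (cspan S) = UNIV"

text \<open>For positive operators the sum below has the same value in \<open>[0, \<infinity>]\<close> for every orthonormal
  basis, and for trace class operators it converges absolutely to the same number for every
  orthonormal basis; so an arbitrary one is fixed.\<close>

definition some_basis :: "'a::chilbert_space set" where
  "some_basis = (SOME S. orthonormal_basis S)"

definition Tr :: "'a::chilbert_space bop \<Rightarrow> complex" where
  "Tr A = (\<Sum>\<^sub>\<infinity>e\<in>some_basis. cinner e (A *\<^sub>V e))"

definition positive_trace_class :: "'a::chilbert_space bop \<Rightarrow> bool" where
  "positive_trace_class A \<longleftrightarrow>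
     positive_op A \<and> (\<lambda>e. cinner e (A *\<^sub>V e)) summable_on some_basis"

definition density_operator :: "'a::chilbert_space bop \<Rightarrow> bool" where
  "density_operator \<rho> \<longleftrightarrow> positive_trace_class \<rho> \<and> Tr \<rho> = 1"

definition state :: "('a::chilbert_space bop \<Rightarrow> complex) \<Rightarrow> bool" where
  "state \<sigma> \<longleftrightarrow> clinear \<sigma> \<and> (\<forall>A. positive_op A \<longrightarrow> \<sigma> A \<in> \<real>\<^sub>\<ge>\<^sub>0)
     \<and> bounded_linear \<sigma> \<and> onorm \<sigma> = 1"

text \<open>A positive map is normal iff it is continuous for the ultraweak topologies, that is, iff it
  pulls normal states back to positive normal functionals.\<close>

definition normal_map :: "('a::chilbert_space bop \<Rightarrow> 'b::chilbert_space bop) \<Rightarrow> bool" where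
  "normal_map \<Phi> \<longleftrightarrow> (\<forall>\<sigma>. density_operator \<sigma> \<longrightarrow>
     (\<exists>\<tau>. positive_trace_class \<tau> \<and> (\<forall>A. Tr (\<Phi> A * \<sigma>) = Tr (A * \<tau>))))"

definition completely_positive :: "('a::chilbert_space bop \<Rightarrow> 'b::chilbert_space bop) \<Rightarrow> bool" where
  "completely_positive \<Phi> \<longleftrightarrow> clinear \<Phi> \<and>
     (\<forall>(n::nat) A.
        (\<forall>x. (\<Sum>i<n. \<Sum>j<n. cinner (x i) (A i j *\<^sub>V x j)) \<in> \<real>\<^sub>\<ge>\<^sub>0) \<longrightarrow>
        (\<forall>y. (\<Sum>i<n. \<Sum>j<n. cinner (y i) (\<Phi> (A i j) *\<^sub>V y j)) \<in> \<real>\<^sub>\<ge>\<^sub>0))"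

section \<open>Unbounded operators and spectral calculus\<close>

text \<open>A possibly unbounded operator is given by its graph.  The adjoint relation of a densely
  defined graph is single-valued, so a self-adjoint \<open>X\<close> is automatically a closed linear operator.\<close>

definition adj_graph :: "('a::chilbert_space \<times> 'a) set \<Rightarrow> ('a \<times> 'a) set" where
  "adj_graph X = {(y, z). \<forall>(x, w)\<in>X. cinner w y = cinner x z}"

definition self_adjoint :: "('a::chilbert_space \<times> 'a) set \<Rightarrow> bool" where
  "self_adjoint X \<longleftrightarrow> closure (Domain X) = UNIV \<and> adj_graph X = X"

definition graph_of :: "'a::chilbert_space bop \<Rightarrow> ('a \<times> 'a) set" where
  "graph_of A = {(x, A *\<^sub>V x) |x. True}"

text \<open>Projection-valued measures are made \<open>0\<close> outside the Borel sets, so that they are determined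
  as functions by their values on Borel sets.\<close>

definition projection_valued_measure ::
    "('s::topological_space set \<Rightarrow> 'a::chilbert_space bop) \<Rightarrow> bool" where
  "projection_valued_measure E \<longleftrightarrow>
     (\<forall>B\<in>sets borel. projection (E B)) \<and> (\<forall>B. B \<notin> sets borel \<longrightarrow> E B = 0) \<and> E UNIV = 1 \<and>
     (\<forall>F::nat \<Rightarrow> 's set. range F \<subseteq> sets borel \<longrightarrow> disjoint_family F \<longrightarrow>
        (\<forall>x. (\<lambda>n. E (F n) *\<^sub>V x) sums (E (\<Union>n. F n) *\<^sub>V x)))"

definition spectral_distribution ::
    "('s::topological_space set \<Rightarrow> 'a::chilbert_space bop) \<Rightarrow> 'a \<Rightarrow> 's measure" where
  "spectral_distribution E x =
     measure_of UNIV (sets borel) (\<lambda>B. ennreal (Re (cinner x (E B *\<^sub>V x))))"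

text \<open>\<open>\<integral> f dE\<close> for bounded Borel functions \<open>f\<close>\<close>

definition spectral_integral ::
    "('s::topological_space set \<Rightarrow> 'a::chilbert_space bop) \<Rightarrow> ('s \<Rightarrow> complex) \<Rightarrow> 'a bop" where
  "spectral_integral E f =
     (THE A. \<forall>x. cinner x (A *\<^sub>V x) = (\<integral>s. f s \<partial>spectral_distribution E x))"

text \<open>\<open>X = \<integral> s dE(s)\<close>, including the domain; by polarization the diagonal matrix elements suffice.\<close>

definition is_spectral_measure ::
    "('a::chilbert_space \<times> 'a) set \<Rightarrow> (real set \<Rightarrow> 'a bop) \<Rightarrow> bool" where
  "is_spectral_measure X E \<longleftrightarrow> projection_valued_measure E \<and>
     Domain X = {x. integrable (spectral_distribution E x) (\<lambda>s. s\<^sup>2)} \<and>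
     (\<forall>(x, w)\<in>X. cinner x w = complex_of_real (\<integral>s. s \<partial>spectral_distribution E x))"

definition spectral_measure :: "('a::chilbert_space \<times> 'a) set \<Rightarrow> real set \<Rightarrow> 'a bop" where
  "spectral_measure X = (THE E. is_spectral_measure X E)"

definition fun_calc :: "(real \<Rightarrow> complex) \<Rightarrow> ('a::chilbert_space \<times> 'a) set \<Rightarrow> 'a bop" where
  "fun_calc f X = spectral_integral (spectral_measure X) f"

text \<open>The joint spectral measure of commuting self-adjoint \<open>S\<close> and \<open>T\<close>\<close>

definition joint_spectral_measure ::
    "('a::chilbert_space \<times> 'a) set \<Rightarrow> ('a \<times> 'a) set \<Rightarrow> (real \<times> real) set \<Rightarrow> 'a bop" where
  "joint_spectral_measure S T = (THE G. projection_valued_measure G \<and>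
     (\<forall>A\<in>sets borel. \<forall>B\<in>sets borel. G (A \<times> B) = spectral_measure S A * spectral_measure T B))"

definition joint_fun_calc ::
    "(real \<times> real \<Rightarrow> complex) \<Rightarrow> ('a::chilbert_space \<times> 'a) set \<Rightarrow> ('a \<times> 'a) set \<Rightarrow> 'a bop" where
  "joint_fun_calc f S T = spectral_integral (joint_spectral_measure S T) f"

section \<open>Tensor products\<close>

text \<open>\<open>tens\<close> exhibits \<open>'g\<close> as the Hilbert space tensor product of \<open>'a\<close> and \<open>'b\<close>, which is thereby
  determined up to a unique unitary.\<close>

definition hilbert_tensor ::
    "('a::chilbert_space \<Rightarrow> 'b::chilbert_space \<Rightarrow> 'g::chilbert_space) \<Rightarrow> bool" where
  "hilbert_tensor tens \<longleftrightarrow>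
     (\<forall>x. clinear (tens x)) \<and> (\<forall>y. clinear (\<lambda>x. tens x y)) \<and>
     (\<forall>x x' y y'. cinner (tens x y) (tens x' y') = cinner x x' * cinner y y') \<and>
     closure (cspan {tens x y |x y. True}) = UNIV"

definition tensor_op ::
    "('a::chilbert_space \<Rightarrow> 'b::chilbert_space \<Rightarrow> 'g::chilbert_space) \<Rightarrow> 'a bop \<Rightarrow> 'b bop \<Rightarrow> 'g bop" where
  "tensor_op tens A B = (THE T. \<forall>x y. T *\<^sub>V tens x y = tens (A *\<^sub>V x) (B *\<^sub>V y))"

text \<open>The tensor product of closed operators is the closure of their algebraic tensor product.
  The set of which the span is taken is closed under complex multiples.\<close>

definition tensor_graph ::
    "('a::chilbert_space \<Rightarrow> 'b::chilbert_space \<Rightarrow> 'g::chilbert_space) \<Rightarrow>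
      ('a \<times> 'a) set \<Rightarrow> ('b \<times> 'b) set \<Rightarrow> ('g \<times> 'g) set" where
  "tensor_graph tens S T =
     closure (span {(tens x y, tens x' y') |x x' y y'. (x, x') \<in> S \<and> (y, y') \<in> T})"

definition slice_map ::
    "('a::chilbert_space \<Rightarrow> 'b::chilbert_space \<Rightarrow> 'g::chilbert_space) \<Rightarrow> 'a bop \<Rightarrow> 'g bop \<Rightarrow> 'b bop" where
  "slice_map tens \<rho> = (THE \<Phi>. completely_positive \<Phi> \<and> normal_map \<Phi> \<and>
     (\<forall>A B. \<Phi> (tensor_op tens A B) = Tr (A * \<rho>) *\<^sub>C B))"

definition product_state ::
    "('a::chilbert_space \<Rightarrow> 'b::chilbert_space \<Rightarrow> 'g::chilbert_space) \<Rightarrow> 'a bop \<Rightarrow>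
      ('b bop \<Rightarrow> complex) \<Rightarrow> 'g bop \<Rightarrow> complex" where
  "product_state tens \<rho> \<delta> T = \<delta> (slice_map tens \<rho> T)"

section \<open>The Hilbert space of square integrable functions on the line\<close>

definition square_integrable :: "(real \<Rightarrow> complex) \<Rightarrow> bool" where
  "square_integrable f \<longleftrightarrow> f \<in> borel_measurable lborel \<and> integrable lborel (\<lambda>x. (cmod (f x))\<^sup>2)"

definition L2_rel :: "(real \<Rightarrow> complex) \<Rightarrow> (real \<Rightarrow> complex) \<Rightarrow> bool" where
  "L2_rel f g \<longleftrightarrow> square_integrable f \<and> square_integrable g \<and> (AE x in lborel. f x = g x)"

lemma square_integrable_measurable [measurable_dest]:
  "square_integrable f \<Longrightarrow> f \<in> borel_measurable lborel"
  by (simp add: square_integrable_def)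

lemma square_integrable_0 [simp]: "square_integrable (\<lambda>_. 0)"
  by (simp add: square_integrable_def)

lemma square_integrable_scale:
  assumes "square_integrable f"
  shows "square_integrable (\<lambda>x. c * f x)"
  using assms unfolding square_integrable_def
  by (auto simp: norm_mult power_mult_distrib)

lemma square_integrable_add:
  assumes f: "square_integrable f" and g: "square_integrable g"
  shows "square_integrable (\<lambda>x. f x + g x)"
proof -
  have [measurable]: "f \<in> borel_measurable lborel" "g \<in> borel_measurable lborel"
    using f g by (auto simp: square_integrable_def)
  have bound: "(cmod (a + b))\<^sup>2 \<le> 2 * (cmod a)\<^sup>2 + 2 * (cmod b)\<^sup>2" for a b :: complex
  proof -
    have "(cmod (a + b))\<^sup>2 \<le> (cmod a + cmod b)\<^sup>2"
      by (intro power_mono norm_triangle_ineq) auto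
    also have "\<dots> \<le> 2 * (cmod a)\<^sup>2 + 2 * (cmod b)\<^sup>2"
      using sum_squares_ge_zero[of "cmod a - cmod b" 0] by (simp add: power2_eq_square algebra_simps)
    finally show ?thesis .
  qed
  have "integrable lborel (\<lambda>x. (cmod (f x + g x))\<^sup>2)"
    by (rule Bochner_Integration.integrable_bound[where f = "\<lambda>x. 2 * (cmod (f x))\<^sup>2 + 2 * (cmod (g x))\<^sup>2"])
       (use f g bound in \<open>auto simp: square_integrable_def intro!: AE_I2\<close>)
  then show ?thesis
    by (simp add: square_integrable_def)
qed

lemma square_integrable_mult:
  assumes f: "square_integrable f" and g: "square_integrable g"
  shows "integrable lborel (\<lambda>x. cnj (f x) * g x)"
proof -
  have [measurable]: "f \<in> borel_measurable lborel" "g \<in> borel_measurable lborel"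
    using f g by (auto simp: square_integrable_def)
  have bound: "cmod a * cmod b \<le> (cmod a)\<^sup>2 + (cmod b)\<^sup>2" for a b :: complex
  proof -
    have "0 \<le> (cmod a - cmod b)\<^sup>2 + (cmod a)\<^sup>2 + (cmod b)\<^sup>2"
      by simp
    then show ?thesis
      by (simp add: power2_eq_square algebra_simps)
  qed
  have [measurable]: "(\<lambda>x. cnj (f x)) \<in> borel_measurable lborel"
    by (rule borel_measurable_continuous_on[of cnj, OF continuous_on_cnj[OF continuous_on_id]]) simp
  show ?thesis
    by (rule Bochner_Integration.integrable_bound[where f = "\<lambda>x. (cmod (f x))\<^sup>2 + (cmod (g x))\<^sup>2"])
       (use f g bound in \<open>auto simp: square_integrable_def norm_mult intro!: AE_I2\<close>)
qed

quotient_type L2 = "real \<Rightarrow> complex" / partial: L2_rel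
proof (rule part_equivpI)
  show "\<exists>f. L2_rel f f"
    by (rule exI[of _ "\<lambda>_. 0"]) (simp add: L2_rel_def)
  show "symp L2_rel"
    by (auto simp: symp_def L2_rel_def)
  show "transp L2_rel"
    unfolding transp_def L2_rel_def by (auto elim: AE_mp)
qed

lemma square_integrable_rep_L2: "square_integrable (rep_L2 f)"
  using Quotient_rel_rep[OF Quotient_L2, of f f] by (simp add: L2_rel_def)

instantiation L2 :: complex_vector
begin
lift_definition zero_L2 :: L2 is "\<lambda>_. 0"
  by (simp add: L2_rel_def)
lift_definition plus_L2 :: "L2 \<Rightarrow> L2 \<Rightarrow> L2" is "\<lambda>f g x. f x + g x"
  unfolding L2_rel_def by (auto intro: square_integrable_add elim!: AE_mp)
lift_definition scaleC_L2 :: "complex \<Rightarrow> L2 \<Rightarrow> L2" is "\<lambda>c f x. c * f x"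
  unfolding L2_rel_def by (auto intro: square_integrable_scale)
definition scaleR_L2 :: "real \<Rightarrow> L2 \<Rightarrow> L2" where
  "scaleR_L2 r f = complex_of_real r *\<^sub>C f"
definition uminus_L2 :: "L2 \<Rightarrow> L2" where
  "uminus_L2 f = (-1) *\<^sub>C f"
definition minus_L2 :: "L2 \<Rightarrow> L2 \<Rightarrow> L2" where
  "minus_L2 f g = f + (-1) *\<^sub>C g"
instance
proof
  fix f g h :: L2 and c d :: complex and r s :: real
  show "f + g + h = f + (g + h)"
    by transfer (auto simp: L2_rel_def add.assoc intro!: square_integrable_add)
  show comm: "f + g = g + f"
    by transfer (auto simp: L2_rel_def add.commute intro!: square_integrable_add)
  show "0 + f = f"
    by transfer (auto simp: L2_rel_def)
  show "- f + f = 0"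
    unfolding uminus_L2_def
    by transfer (auto simp: L2_rel_def intro!: square_integrable_add square_integrable_scale)
  show "f - g = f + - g"
    by (simp add: minus_L2_def uminus_L2_def)
  show C1: "c *\<^sub>C (f + g) = c *\<^sub>C f + c *\<^sub>C g" for c and f g :: L2
    by transfer
       (auto simp: L2_rel_def distrib_left intro!: square_integrable_add square_integrable_scale)
  show C2: "(c + d) *\<^sub>C f = c *\<^sub>C f + d *\<^sub>C f" for c d and f :: L2
    by transfer
       (auto simp: L2_rel_def distrib_right intro!: square_integrable_add square_integrable_scale)
  show C3: "c *\<^sub>C d *\<^sub>C f = (c * d) *\<^sub>C f" for c d and f :: L2
    by transfer (auto simp: L2_rel_def mult.assoc intro!: square_integrable_scale)
  have C4: "1 *\<^sub>C f = f" for f :: L2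
    by transfer (auto simp: L2_rel_def)
  show "r *\<^sub>R f = complex_of_real r *\<^sub>C f"
    by (rule scaleR_L2_def)
  show "r *\<^sub>R (f + g) = r *\<^sub>R f + r *\<^sub>R g"
    by (simp add: scaleR_L2_def C1)
  show "(r + s) *\<^sub>R f = r *\<^sub>R f + s *\<^sub>R f"
    by (simp add: scaleR_L2_def C2)
  show "r *\<^sub>R s *\<^sub>R f = (r * s) *\<^sub>R f"
    by (simp add: scaleR_L2_def C3)
  show "1 *\<^sub>R f = f"
    by (simp add: scaleR_L2_def C4)
qed
end

lift_definition cinner_L2' :: "L2 \<Rightarrow> L2 \<Rightarrow> complex" is "\<lambda>f g. \<integral>x. cnj (f x) * g x \<partial>lborel"
proof -
  fix f f' g g' assume *: "L2_rel f f'" "L2_rel g g'"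
  have "AE x in lborel. cnj (f x) * g x = cnj (f' x) * g' x"
    using * unfolding L2_rel_def by (auto elim!: AE_mp)
  then show "(\<integral>x. cnj (f x) * g x \<partial>lborel) = (\<integral>x. cnj (f' x) * g' x \<partial>lborel)"
    using * unfolding L2_rel_def
    by (intro integral_cong_AE borel_measurable_integrable square_integrable_mult) auto
qed

lemma cinner_L2'_commute: "cinner_L2' f g = cnj (cinner_L2' g f)"
proof transfer
  fix f g :: "real \<Rightarrow> complex"
  have "cnj (\<integral>x. cnj (g x) * f x \<partial>lborel) = (\<integral>x. cnj (cnj (g x) * f x) \<partial>lborel)"
    by (rule Bochner_Integration.integral_cnj[symmetric])
  then show "(\<integral>x. cnj (f x) * g x \<partial>lborel) = cnj (\<integral>x. cnj (g x) * f x \<partial>lborel)"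
    by (simp add: mult.commute)
qed

lemma cinner_L2'_add: "cinner_L2' f (g + h) = cinner_L2' f g + cinner_L2' f h"
  by transfer (simp add: L2_rel_def distrib_left square_integrable_mult)

lemma cinner_L2'_scale: "cinner_L2' f (c *\<^sub>C g) = c * cinner_L2' f g"
proof transfer
  fix f g and c :: complex assume "L2_rel f f" "L2_rel g g"
  show "(\<integral>x. cnj (f x) * (c * g x) \<partial>lborel) = c * (\<integral>x. cnj (f x) * g x \<partial>lborel)"
    by (subst integral_mult_right_zero[symmetric]) (simp add: mult.left_commute)
qed

lemma cinner_L2'_self:
  "Re (cinner_L2' f f) = (\<integral>x. (cmod (rep_L2 f x))\<^sup>2 \<partial>lborel)"
proof -
  have "cinner_L2' f f = (\<integral>x. complex_of_real ((cmod (rep_L2 f x))\<^sup>2) \<partial>lborel)"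
    unfolding cinner_L2'.rep_eq
    by (simp add: complex_norm_square mult.commute del: of_real_power)
  then show ?thesis
    by (simp del: of_real_power)
qed

lemma cinner_L2'_eq_0: "Re (cinner_L2' f f) = 0 \<longleftrightarrow> f = 0"
proof
  assume "Re (cinner_L2' f f) = 0"
  then have "AE x in lborel. (cmod (rep_L2 f x))\<^sup>2 = 0"
    using square_integrable_rep_L2[of f] integral_nonneg_eq_0_iff_AE[of lborel "\<lambda>x. (cmod (rep_L2 f x))\<^sup>2"]
    by (auto simp: cinner_L2'_self square_integrable_def)
  then have "L2_rel (rep_L2 f) (\<lambda>_. 0)"
    by (simp add: L2_rel_def square_integrable_rep_L2)
  then have "abs_L2 (rep_L2 f) = 0"
    unfolding zero_L2_def using Quotient_rel_abs[OF Quotient_L2] by (auto simp: zero_L2.abs_eq)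
  then show "f = 0"
    by (simp add: Quotient_abs_rep[OF Quotient_L2])
next
  have "cinner_L2' 0 0 = 0"
    by transfer simp
  then show "f = 0 \<Longrightarrow> Re (cinner_L2' f f) = 0"
    by simp
qed

instantiation L2 :: real_inner
begin
definition inner_L2 :: "L2 \<Rightarrow> L2 \<Rightarrow> real" where
  "inner_L2 f g = Re (cinner_L2' f g)"
definition norm_L2 :: "L2 \<Rightarrow> real" where
  "norm_L2 f = sqrt (inner f f)"
definition dist_L2 :: "L2 \<Rightarrow> L2 \<Rightarrow> real" where
  "dist_L2 f g = norm (f - g)"
definition sgn_L2 :: "L2 \<Rightarrow> L2" where
  "sgn_L2 f = inverse (norm f) *\<^sub>R f"
definition uniformity_L2 :: "(L2 \<times> L2) filter" where
  "uniformity_L2 = (INF e\<in>{0<..}. principal {(x, y). dist x y < e})"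
definition open_L2 :: "L2 set \<Rightarrow> bool" where
  "open_L2 S = (\<forall>x\<in>S. \<forall>\<^sub>F (x', y) in uniformity. x' = x \<longrightarrow> y \<in> S)"
instance
proof
  fix f g h :: L2 and r :: real and S :: "L2 set"
  show "dist f g = norm (f - g)" by (rule dist_L2_def)
  show "sgn f = inverse (norm f) *\<^sub>R f" by (rule sgn_L2_def)
  show "uniformity = (INF e\<in>{0<..}. principal {(x::L2, y). dist x y < e})"
    by (rule uniformity_L2_def)
  show "open S = (\<forall>x\<in>S. \<forall>\<^sub>F (x', y) in uniformity. x' = x \<longrightarrow> y \<in> S)"
    by (rule open_L2_def)
  show comm: "inner f g = inner g f" for f g :: L2
    unfolding inner_L2_def by (subst cinner_L2'_commute) simp
  show "inner (f + g) h = inner f h + inner g h"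
    unfolding comm[of _ h] by (simp add: inner_L2_def cinner_L2'_add)
  show "inner (r *\<^sub>R f) g = r * inner f g"
    unfolding comm[of _ g] by (simp add: inner_L2_def scaleR_scaleC cinner_L2'_scale)
  show "0 \<le> inner f f"
    by (simp add: inner_L2_def cinner_L2'_self)
  show "inner f f = 0 \<longleftrightarrow> f = 0"
    by (simp add: inner_L2_def cinner_L2'_eq_0)
  show "norm f = sqrt (inner f f)" by (rule norm_L2_def)
qed
end

lemma rep_abs_L2:
  assumes "square_integrable f"
  shows "AE x in lborel. rep_L2 (abs_L2 f) x = f x"
  using Quotient_rep_abs[OF Quotient_L2, of f] assms by (simp add: L2_rel_def)

lemma abs_rep_L2: "abs_L2 (rep_L2 f) = f"
  by (rule Quotient_abs_rep[OF Quotient_L2])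

lemma rep_L2_diff: "AE x in lborel. rep_L2 (f - g) x = rep_L2 f x - rep_L2 g x"
proof -
  have "L2_rel (rep_L2 f) (rep_L2 f)" "L2_rel (rep_L2 g) (rep_L2 g)"
    "L2_rel (\<lambda>x. (-1) * rep_L2 g x) (\<lambda>x. (-1) * rep_L2 g x)"
    using square_integrable_rep_L2[of f] square_integrable_rep_L2[of g]
      square_integrable_scale[of "rep_L2 g" "-1"] by (auto simp: L2_rel_def)
  then have "f - g = abs_L2 (\<lambda>x. rep_L2 f x + (-1) * rep_L2 g x)"
    using plus_L2.abs_eq scaleC_L2.abs_eq by (metis (no_types) abs_rep_L2 minus_L2_def)
  moreover have "square_integrable (\<lambda>x. rep_L2 f x + (-1) * rep_L2 g x)"
    by (intro square_integrable_add square_integrable_scale square_integrable_rep_L2)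
  ultimately have "AE x in lborel. rep_L2 (f - g) x = rep_L2 f x + (-1) * rep_L2 g x"
    by (simp only: rep_abs_L2)
  then show ?thesis
    by simp
qed

lemma nn_integral_L2_diff:
  "(\<integral>\<^sup>+x. ennreal ((cmod (rep_L2 f x - rep_L2 g x))\<^sup>2) \<partial>lborel) = ennreal ((dist f g)\<^sup>2)"
proof -
  have "(dist f g)\<^sup>2 = (\<integral>x. (cmod (rep_L2 (f - g) x))\<^sup>2 \<partial>lborel)"
    by (simp add: dist_norm power2_norm_eq_inner inner_L2_def cinner_L2'_self)
  also have "ennreal \<dots> = (\<integral>\<^sup>+x. ennreal ((cmod (rep_L2 (f - g) x))\<^sup>2) \<partial>lborel)"
    using square_integrable_rep_L2[of "f - g"]
    by (intro nn_integral_eq_integral[symmetric]) (auto simp: square_integrable_def)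
  also have "\<dots> = (\<integral>\<^sup>+x. ennreal ((cmod (rep_L2 f x - rep_L2 g x))\<^sup>2) \<partial>lborel)"
    using rep_L2_diff[of f g] by (intro nn_integral_cong_AE) (auto elim: AE_mp)
  finally show ?thesis ..
qed

text \<open>Riesz--Fischer\<close>

lemma convergent_of_weighted_square_sum:
  fixes a :: "nat \<Rightarrow> complex"
  assumes "(\<Sum>n. ennreal (2 ^ n * (cmod (a (Suc n) - a n))\<^sup>2)) \<noteq> \<infinity>"
  shows "convergent a"
proof -
  have "summable (\<lambda>n. 2 ^ n * (cmod (a (Suc n) - a n))\<^sup>2)"
    using assms by (intro summable_suminf_not_top) auto
  then have "Bseq (\<lambda>n. 2 ^ n * (cmod (a (Suc n) - a n))\<^sup>2)"
    by (intro convergent_imp_Bseq) (auto simp: convergent_def dest: summable_LIMSEQ_zero)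
  then obtain C where "C > 0" and C: "\<And>n. norm (2 ^ n * (cmod (a (Suc n) - a n))\<^sup>2) \<le> C"
    by (auto elim: BseqE)
  have "norm (a (Suc n) - a n) \<le> sqrt C * sqrt (1 / 2) ^ n" for n
  proof -
    have "(cmod (a (Suc n) - a n))\<^sup>2 \<le> C * (1 / 2) ^ n"
      using C[of n] by (simp add: field_simps power_divide)
    then have "cmod (a (Suc n) - a n) \<le> sqrt (C * (1 / 2) ^ n)"
      by (rule real_le_rsqrt)
    then show ?thesis
      by (simp add: real_sqrt_mult real_sqrt_power)
  qed
  moreover have "summable (\<lambda>n. sqrt C * sqrt (1 / 2) ^ n)"
    by (intro summable_mult summable_geometric) (simp add: real_sqrt_lt_1_iff)
  ultimately have "summable (\<lambda>n. a (Suc n) - a n)"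
    by (rule summable_comparison_test'[rotated])
  then have "convergent (\<lambda>n. \<Sum>i<n. a (Suc i) - a i)"
    by (simp add: summable_iff_convergent)
  then have "convergent (\<lambda>n. a n - a 0)"
    by (simp add: sum_lessThan_telescope)
  then have "convergent (\<lambda>n. (a n - a 0) + a 0)"
    by (rule convergent_add) (rule convergent_const)
  then show ?thesis
    by simp
qed

instance L2 :: complete_space
proof
  fix X :: "nat \<Rightarrow> L2" assume X: "Cauchy X"
  have "\<exists>N. \<forall>m\<ge>N. \<forall>k\<ge>N. dist (X m) (X k) < (1 / 2) ^ n" for n :: nat
    using X unfolding Cauchy_def by simp
  then obtain N where N: "\<And>n m k. m \<ge> N n \<Longrightarrow> k \<ge> N n \<Longrightarrow> dist (X m) (X k) < (1 / 2) ^ n"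
    by metis
  define s where "s n = n + (\<Sum>i\<le>n. N i)" for n
  have s_N: "s n \<ge> N n" and s_n: "s n \<ge> n" and s_Suc: "s (Suc n) \<ge> N n" for n
    using member_le_sum[of n "{..n}" N] by (auto simp: s_def)
  define f where "f n = rep_L2 (X (s n))" for n
  have sq_f: "square_integrable (f n)" for n
    by (simp add: f_def square_integrable_rep_L2)
  have [measurable]: "f n \<in> borel_measurable lborel" "rep_L2 F \<in> borel_measurable lborel" for n F
    using sq_f[of n] square_integrable_rep_L2[of F] by (auto simp: square_integrable_def)
  have "(\<integral>\<^sup>+x. (\<Sum>n. ennreal (2 ^ n * (cmod (f (Suc n) x - f n x))\<^sup>2)) \<partial>lborel)
      = (\<Sum>n. \<integral>\<^sup>+x. ennreal (2 ^ n * (cmod (f (Suc n) x - f n x))\<^sup>2) \<partial>lborel)"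
    by (rule nn_integral_suminf) measurable
  also have "\<dots> = (\<Sum>n. ennreal (2 ^ n * (dist (X (s (Suc n))) (X (s n)))\<^sup>2))"
    by (simp add: ennreal_mult nn_integral_cmult f_def nn_integral_L2_diff)
  also have "\<dots> \<le> (\<Sum>n. ennreal ((1 / 2) ^ n))"
  proof (intro suminf_le ennreal_leI)
    fix n
    have "(dist (X (s (Suc n))) (X (s n)))\<^sup>2 \<le> ((1 / 2) ^ n)\<^sup>2"
      by (intro power_mono less_imp_le[OF N[OF s_Suc s_N]]) auto
    then show "2 ^ n * (dist (X (s (Suc n))) (X (s n)))\<^sup>2 \<le> (1 / 2 :: real) ^ n"
      by (simp add: power_divide field_simps power2_eq_square)
  qed auto
  also have "\<dots> = ennreal (\<Sum>n. (1 / 2) ^ n)"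
    by (intro suminf_ennreal2 summable_geometric) auto
  finally have "(\<integral>\<^sup>+x. (\<Sum>n. ennreal (2 ^ n * (cmod (f (Suc n) x - f n x))\<^sup>2)) \<partial>lborel) \<noteq> \<infinity>"
    by (auto simp: top_unique)
  then have "AE x in lborel. (\<Sum>n. ennreal (2 ^ n * (cmod (f (Suc n) x - f n x))\<^sup>2)) \<noteq> \<infinity>"
    by (intro nn_integral_PInf_AE) measurable
  then have conv: "AE x in lborel. convergent (\<lambda>n. f n x)"
    by eventually_elim (rule convergent_of_weighted_square_sum)
  define g where "g x = lim (\<lambda>n. f n x)" for x
  have [measurable]: "g \<in> borel_measurable lborel"
    unfolding g_def by measurable
  have bound: "(\<integral>\<^sup>+x. ennreal ((cmod (g x - rep_L2 (X m) x))\<^sup>2) \<partial>lborel) \<le> ennreal (((1 / 2) ^ k)\<^sup>2)"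
    if "m \<ge> N k" for m k
  proof -
    have "AE x in lborel. ennreal ((cmod (g x - rep_L2 (X m) x))\<^sup>2)
        = liminf (\<lambda>n. ennreal ((cmod (f n x - rep_L2 (X m) x))\<^sup>2))"
      using conv
    proof eventually_elim
      case (elim x)
      then have "(\<lambda>n. f n x) \<longlonglongrightarrow> g x"
        by (simp add: g_def convergent_LIMSEQ_iff)
      then have "(\<lambda>n. ennreal ((cmod (f n x - rep_L2 (X m) x))\<^sup>2))
          \<longlonglongrightarrow> ennreal ((cmod (g x - rep_L2 (X m) x))\<^sup>2)"
        by (intro tendsto_ennrealI tendsto_intros)
      then show ?case
        by (intro lim_imp_Liminf[symmetric]) simp
    qed
    then have "(\<integral>\<^sup>+x. ennreal ((cmod (g x - rep_L2 (X m) x))\<^sup>2) \<partial>lborel)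
        = (\<integral>\<^sup>+x. liminf (\<lambda>n. ennreal ((cmod (f n x - rep_L2 (X m) x))\<^sup>2)) \<partial>lborel)"
      by (rule nn_integral_cong_AE)
    also have "\<dots> \<le> liminf (\<lambda>n. \<integral>\<^sup>+x. ennreal ((cmod (f n x - rep_L2 (X m) x))\<^sup>2) \<partial>lborel)"
      by (rule nn_integral_liminf) measurable
    also have "\<dots> = liminf (\<lambda>n. ennreal ((dist (X (s n)) (X m))\<^sup>2))"
      by (simp add: f_def nn_integral_L2_diff)
    also have "\<dots> \<le> ennreal (((1 / 2) ^ k)\<^sup>2)"
    proof (rule Liminf_le)
      show "\<forall>\<^sub>F n in sequentially. ennreal ((dist (X (s n)) (X m))\<^sup>2) \<le> ennreal (((1 / 2) ^ k)\<^sup>2)"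
        using eventually_ge_at_top[of "N k"]
      proof eventually_elim
        case (elim n)
        then have "s n \<ge> N k"
          using s_n[of n] by linarith
        then show ?case
          by (intro ennreal_leI power_mono less_imp_le[OF N[OF _ that]]) auto
      qed
    qed simp
    finally show ?thesis .
  qed
  have "square_integrable (\<lambda>x. g x - rep_L2 (X (N 0)) x)"
    using le_less_trans[OF bound[of 0 "N 0"] ennreal_less_top] unfolding square_integrable_def
    by (auto intro!: integrableI_bounded)
  then have "square_integrable (\<lambda>x. (g x - rep_L2 (X (N 0)) x) + rep_L2 (X (N 0)) x)"
    by (intro square_integrable_add square_integrable_rep_L2)
  then have sq_g: "square_integrable g"
    by simp
  have lim: "dist (X m) (abs_L2 g) \<le> (1 / 2) ^ k" if "m \<ge> N k" for m k
  proof -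
    have "ennreal ((dist (abs_L2 g) (X m))\<^sup>2) =
        (\<integral>\<^sup>+x. ennreal ((cmod (g x - rep_L2 (X m) x))\<^sup>2) \<partial>lborel)"
      unfolding nn_integral_L2_diff[symmetric]
      using rep_abs_L2[OF sq_g] by (intro nn_integral_cong_AE) (auto elim: AE_mp)
    also have "\<dots> \<le> ennreal (((1 / 2) ^ k)\<^sup>2)"
      by (rule bound[OF that])
    finally have "(dist (abs_L2 g) (X m))\<^sup>2 \<le> ((1 / 2) ^ k)\<^sup>2"
      by (simp add: ennreal_le_iff)
    then have "dist (abs_L2 g) (X m) \<le> (1 / 2) ^ k"
      by (rule power2_le_imp_le) simp
    then show ?thesis
      by (simp add: dist_commute)
  qed
  have "X \<longlonglongrightarrow> abs_L2 g"
  proof (rule metric_LIMSEQ_I)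
    fix e :: real assume "e > 0"
    then obtain k where k: "(1 / 2 :: real) ^ k < e"
      using real_arch_pow_inv[of e "1 / 2"] by auto
    have "dist (X m) (abs_L2 g) < e" if "m \<ge> N k" for m
      using lim[OF that] k by linarith
    then show "\<exists>M. \<forall>m\<ge>M. dist (X m) (abs_L2 g) < e"
      by blast
  qed
  then show "convergent X"
    by (auto simp: convergent_def)
qed

instantiation L2 :: chilbert_space
begin
definition cinner_L2 :: "L2 \<Rightarrow> L2 \<Rightarrow> complex" where
  "cinner_L2 = cinner_L2'"
instance
  by standard
     (auto simp: cinner_L2_def inner_L2_def cinner_L2'_add cinner_L2'_scale intro: cinner_L2'_commute)
end

lemma cinner_L2_eq: "cinner f g = (\<integral>x. cnj (rep_L2 f x) * rep_L2 g x \<partial>lborel)"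
  by (simp add: cinner_L2_def cinner_L2'.rep_eq)

text \<open>Domain \<open>{\<phi>. q \<phi>(q) is square integrable}\<close>\<close>

definition position_op :: "(L2 \<times> L2) set" where
  "position_op = {(\<phi>, \<psi>). AE q in lborel. rep_L2 \<psi> q = complex_of_real q * rep_L2 \<phi> q}"

text \<open>\<open>-\<i> d/dq\<close> on the domain of all \<open>\<phi>\<close> that are locally absolutely continuous (after modification
  on a null set) with square integrable derivative, i.e. indefinite integrals of some \<open>\<i> \<psi>\<close>\<close>

definition momentum_op :: "(L2 \<times> L2) set" where
  "momentum_op = {(\<phi>, \<psi>). \<exists>c. AE q in lborel. rep_L2 \<phi> q = c + \<i> * (LBINT t=0..ereal q. rep_L2 \<psi> t)}"

section \<open>Invariant means and Dirac states\<close>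

text \<open>\<open>bcontfun\<close> is the set of bounded continuous functions; only the values of a mean on this set
  matter.\<close>

definition mean :: "((real \<Rightarrow> complex) \<Rightarrow> complex) \<Rightarrow> bool" where
  "mean \<eta> \<longleftrightarrow>
     (\<forall>f\<in>bcontfun. \<forall>g\<in>bcontfun. \<eta> (\<lambda>u. f u + g u) = \<eta> f + \<eta> g) \<and>
     (\<forall>c. \<forall>f\<in>bcontfun. \<eta> (\<lambda>u. c * f u) = c * \<eta> f) \<and>
     (\<forall>f\<in>bcontfun. (\<forall>u. f u \<in> \<real>\<^sub>\<ge>\<^sub>0) \<longrightarrow> \<eta> f \<in> \<real>\<^sub>\<ge>\<^sub>0) \<and>
     \<eta> (\<lambda>u. 1) = 1"

definition convolution :: "(real \<Rightarrow> complex) \<Rightarrow> (real \<Rightarrow> real) \<Rightarrow> real \<Rightarrow> complex" where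
  "convolution f g u = (\<integral>p. f (u - p) * complex_of_real (g p) \<partial>lborel)"

definition topologically_invariant_mean :: "((real \<Rightarrow> complex) \<Rightarrow> complex) \<Rightarrow> bool" where
  "topologically_invariant_mean \<eta> \<longleftrightarrow> mean \<eta> \<and>
     (\<forall>f\<in>bcontfun. \<forall>g. integrable lborel g \<and> (AE p in lborel. 0 \<le> g p) \<and> (\<integral>p. g p \<partial>lborel) = 1 \<longrightarrow>
        \<eta> (convolution f g) = \<eta> f)"

definition dirac_state :: "((real \<Rightarrow> complex) \<Rightarrow> complex) \<Rightarrow> (L2 bop \<Rightarrow> complex) \<Rightarrow> bool" where
  "dirac_state \<eta> \<delta> \<longleftrightarrow> state \<delta> \<and>
     (\<forall>f\<in>bcontfun. \<delta> (fun_calc f position_op) = f 0 \<and> \<delta> (fun_calc f momentum_op) = \<eta> f)"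

text \<open>The value at \<open>A\<close> of the norm one projection onto the commutant of \<open>X\<close>; the relation below
  determines it uniquely.\<close>

definition mean_projection ::
    "((real \<Rightarrow> complex) \<Rightarrow> complex) \<Rightarrow> ('h::chilbert_space \<times> 'h) set \<Rightarrow> 'h bop \<Rightarrow> 'h bop" where
  "mean_projection \<eta> X A = (THE Z. \<forall>\<rho>. density_operator \<rho> \<longrightarrow>
     Tr (Z * \<rho>) = \<eta> (\<lambda>u. Tr (fun_calc (\<lambda>x. exp (\<i> * complex_of_real (u * x))) X * A *
                               fun_calc (\<lambda>x. exp (- \<i> * complex_of_real (u * x))) X * \<rho>)))"

section \<open>The canonical measuring process\<close>

definition measuring_unitary ::
    "('h::chilbert_space \<Rightarrow> L2 \<Rightarrow> 'g::chilbert_space) \<Rightarrow> ('h \<times> 'h) set \<Rightarrow> 'g bop" where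
  "measuring_unitary tens X =
     fun_calc (\<lambda>t. exp (- \<i> * complex_of_real t)) (tensor_graph tens X momentum_op)"

definition transformed_state :: "'a::chilbert_space bop \<Rightarrow> ('a bop \<Rightarrow> complex) \<Rightarrow> 'a bop \<Rightarrow> complex" where
  "transformed_state U \<sigma> T = \<sigma> (adj U * T * U)"

definition joint_distribution ::
    "('h::chilbert_space \<Rightarrow> L2 \<Rightarrow> 'g::chilbert_space) \<Rightarrow> (L2 bop \<Rightarrow> complex) \<Rightarrow>
      ('h \<times> 'h) set \<Rightarrow> 'h bop \<Rightarrow> 'h bop \<Rightarrow> (ereal \<times> ereal) measure" where
  "joint_distribution tens \<delta> X Y \<rho> = (THE \<mu>. sets \<mu> = sets borel \<and> emeasure \<mu> (space \<mu>) = 1 \<and>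
     (\<forall>f::ereal \<times> ereal \<Rightarrow> complex. continuous_on UNIV f \<longrightarrow>
        (\<integral>z. f z \<partial>\<mu>) =
          transformed_state (measuring_unitary tens X) (product_state tens \<rho> \<delta>)
            (joint_fun_calc (\<lambda>(x, y). f (ereal x, ereal y))
              (tensor_graph tens (graph_of 1) position_op) (graph_of (tensor_op tens Y 1)))))"

text \<open>The measure \<open>C \<mapsto> \<mu> (B \<times> C)\<close> on the Borel subsets of the (finite) real line\<close>

definition section_measure :: "(ereal \<times> ereal) measure \<Rightarrow> real set \<Rightarrow> real measure" where
  "section_measure \<mu> B =
     measure_of UNIV (sets borel) (\<lambda>C. emeasure \<mu> ((ereal ` B) \<times> (ereal ` C)))"

end

(* Let E and F be the spectral measures of X and Y. Conjugation by U = exp(-i (X (x) P)) turns the pointer 1 (x) Q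
into X (x) 1 + 1 (x) Q. Under the Dirac state Q vanishes, so by Cauchy-Schwarz g(X + Q) may be replaced by g(X) when g is
uniformly continuous; slicing Y (x) 1 with rho leaves the function u |-> Tr[g(X) exp(iuX) Y exp(-iuX) rho] of P, which the
Dirac state averages with eta. Hence g(x) y has mean Tr[g(X) Z rho] under the joint distribution, Z being the projection
of Y. The joint distribution is a Riesz measure on the extended plane, and y is almost surely bounded by the norm of Y.
Ramps decreasing to indicators of half lines carry the formula over to half lines; letting these shrink shows that the part
of the distribution at x = -oo does not contribute to the mean of y. A Dynkin argument gives all Borel sets B. *)
theory Submission imports Defs "HOL-Probability.Probability" begin

text \<open>Nearly every object of the claim is a definite description: spectral measure, joint
  spectral measure, tensor operator, slice map, mean projection, joint distribution. Each must be
  shown to exist and to be unique before it can be computed, so most of the proof builds spectral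
  theory, traces and tensor products. The measures obtained by compactness have one source, weakly
  convergent subsequences of discrete measures on [0, 1]. On the circle these give Herglotz' theorem
  and, by the Cayley transform, the spectral theorem; in the plane a space-filling curve reduces
  weak limits to [0, 1] and yields the Riesz measure. The Dirac state is not normal: it is norm
  continuous, but no weak or pointwise limit may be taken under it. Hence g(X + Q) - g(X) must be
  small in norm near Q = 0, which forces uniform continuity of g, and discontinuous functions of x
  enter only once the joint distribution exists and dominated convergence applies. Likewise a mean
  is only finitely additive, so exchanging it with the trace needs finite sums that approximate
  uniformly in u.\<close>

abbreviation (input) "pvm == projection_valued_measure"
abbreviation (input) "SI == spectral_integral"
abbreviation (input) "sdist == spectral_distribution"
abbreviation (input) "cor == complex_of_real"
abbreviation (input) "ind == indicator"
abbreviation (input) "cin == cinner"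
abbreviation (input) "bmeas == borel_measurable borel"
abbreviation (input) "contn == continuous_on UNIV"
abbreviation (input) seqlim (infix "---->" 60) where "F ----> l == (F \<longlonglongrightarrow> l)"
notation apply_bop (infixr "*V" 75)
lemmas continuous_borel = borel_measurable_continuous_onI
notation scaleC (infixr "*C" 75)

section \<open>Complex Hilbert spaces\<close>

lemma scaleC_one [simp]: "1 *C (x::'a::complex_vector) = x" using scaleR_scaleC[of 1 x] by simp

lemma scaleC_zero_left [simp]: "0 *C (x::'a::complex_vector) = 0" using scaleR_scaleC[of 0 x] by simp

lemma scaleC_minus_one: "(-1) *C (x::'a::complex_vector) = - x" using scaleR_scaleC[of "-1" x] by simp

lemma scaleC_minus_left: "(-c) *C (x::'a::complex_vector) = - (c *C x)" by (metis mult_minus1 scaleC_minus_one scaleC_scaleC)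

lemma scaleC_diff_left: "(c - d) *C (x::'a::complex_vector) = c *C x - d *C x" by (metis diff_conv_add_uminus scaleC_add_left scaleC_minus_left)

lemma cinner_add_left: "cin (x + y) z = cin x z + cin y (z::'a::chilbert_space)" by (subst (1 2 3) cinner_commute) (simp add: cinner_add_right)

lemma cinner_scaleC_left: "cin (c *C x) y = cnj c * cin x (y::'a::chilbert_space)" by (subst (1 2) cinner_commute) (simp add: cinner_scaleC_right)

lemma cinner_zero_right [simp]: "cin x (0::'a::chilbert_space) = 0" using cinner_scaleC_right[of x 0 0] by simp

lemma cinner_zero_left [simp]: "cin (0::'a::chilbert_space) x = 0" by (subst cinner_commute) simp

lemma cinner_minus_right: "cin x (- y) = - cin x (y::'a::chilbert_space)" using cinner_scaleC_right[of x "-1" y] by (simp add: scaleC_minus_one)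

lemma cinner_minus_left: "cin (- x) y = - cin x (y::'a::chilbert_space)" by (subst (1 2) cinner_commute) (simp add: cinner_minus_right)

lemma cinner_diff_right: "cin x (y - z) = cin x y - cin x (z::'a::chilbert_space)" using cinner_add_right[of x y "- z"] by (simp add: cinner_minus_right)

lemma cinner_diff_left: "cin (x - y) z = cin x z - cin y (z::'a::chilbert_space)" using cinner_add_left[of x "- y" z] by (simp add: cinner_minus_left)

lemmas cinner_simps = cinner_add_left cinner_add_right cinner_diff_left cinner_diff_right
 cinner_scaleC_left cinner_scaleC_right cinner_minus_right cinner_minus_left

lemma cinner_scaleR_right: "cin x (r *\<^sub>R y) = cor r * cin x (y::'a::chilbert_space)" by (simp add: scaleR_scaleC cinner_scaleC_right)

lemma cinner_scaleR_left: "cin (r *\<^sub>R x) y = cor r * cin x (y::'a::chilbert_space)" by (simp add: scaleR_scaleC cinner_scaleC_left)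

lemma cinner_sum_right: "cin x (sum f S) = (SUM i:S. cin x (f i :: 'a::chilbert_space))"
 by (induction S rule: infinite_finite_induct) (auto simp: cinner_add_right)

lemma cinner_sum_left: "cin (sum f S) x = (SUM i:S. cin (f i) (x :: 'a::chilbert_space))"
 by (induction S rule: infinite_finite_induct) (auto simp: cinner_add_left)

lemma cmod_cinner_le: "cmod (cin x y) <= norm x * norm (y::'a::chilbert_space)"
proof -
 \<comment> \<open>This phase makes the inner product real and nonnegative, so the Cauchy-Schwarz
   inequality of the underlying real space applies.\<close>
 define c where "c = cnj (sgn (cin x y))"
 have "cmod c <= 1" by (simp add: c_def norm_sgn)
 have "c * cin x y = cor (cmod (cin x y))" by (cases "cin x y = 0") (auto simp: c_def sgn_eq complex_norm_square[symmetric] power2_eq_square field_simps)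
 then have "cmod (cin x y) = inner x (c *C y)" by (simp add: inner_eq_Re_cinner cinner_scaleC_right)
 also have "... <= norm x * norm (c *C y)" by (rule norm_cauchy_schwarz)
 also have "... <= norm x * norm y" using `cmod c <= 1` by (intro mult_left_mono) (auto simp: norm_scaleC mult_left_le_one_le)
 finally show ?thesis .
qed

lemma bounded_bilinear_cinner: "bounded_bilinear (cin :: 'a::chilbert_space => _)"
proof
 show "EX K. ALL a b::'a. norm (cin a b) <= norm a * norm b * K" by (intro exI[of _ 1]) (auto simp: cmod_cinner_le)
qed (auto simp: cinner_simps cinner_scaleR_left cinner_scaleR_right scaleR_conv_of_real)

lemmas tendsto_cinner [tendsto_intros] = bounded_bilinear.tendsto[OF bounded_bilinear_cinner]

lemma tendsto_scaleC [tendsto_intros]: "(f \<longlongrightarrow> a) F ==> ((%n. c *C f n :: 'a::chilbert_space) \<longlongrightarrow> c *C a) F"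
 by (rule bounded_linear.tendsto[OF bounded_linear_scaleC])

lemma cinner_extI: "(!!x. cin x y = cin x z) ==> y = (z::'a::chilbert_space)"
 by (metis cinner_diff_right cinner_self eq_iff_diff_eq_0 of_real_eq_0_iff zero_eq_power2 norm_eq_zero)

lemma Re_cinner_self: "Re (cin x x) = (norm (x::'a::chilbert_space))^2" by (simp add: cinner_self)

lemma norm_add_square: "(norm (x + y :: 'a::chilbert_space))^2 = (norm x)^2 + 2 * Re (cin x y) + (norm y)^2"
 by (simp add: power2_norm_eq_inner inner_add_left inner_add_right inner_commute flip: inner_eq_Re_cinner)

lemma norm_diff_square: "(norm (x - y :: 'a::chilbert_space))^2 = (norm x)^2 - 2 * Re (cin x y) + (norm y)^2"
 by (simp add: power2_norm_eq_inner inner_diff_left inner_diff_right inner_commute flip: inner_eq_Re_cinner)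

lemma orthogonal_norm_add: "cin x y = 0 ==> (norm (x + y :: 'a::chilbert_space))^2 = (norm x)^2 + (norm y)^2" by (simp add: norm_add_square)

text \<open>The minimizer of \<open>\<parallel>x\<parallel>\<^sup>2 / 2 - g x\<close> on a closed subspace represents \<open>g\<close>.\<close>

lemma riesz_subspace:
 fixes g :: "'a::{real_inner,complete_space} => real" assumes S: "subspace S" "closed S" and g: "bounded_linear g" shows "EX z:S. ALL h:S. inner z h = g h"
proof -
 interpret g: bounded_linear g by fact
 obtain K where K: "!!x. norm (g x) <= norm x * K" using g.bounded by blast
 define J where "J x = (norm x)^2 / 2 - g x" for x
 have lower: "J x >= - K\<^sup>2 / 2" for x proof -
  have "0 <= (norm x - K)^2 / 2" by simp
  also have "... <= (norm x)^2 / 2 - g x + K\<^sup>2 / 2" using K[of x] by (simp add: power2_eq_square field_simps)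
  finally show ?thesis by (simp add: J_def)
 qed
 define m where "m = Inf (J ` S)"
 have bdd: "bdd_below (J ` S)" using lower by (intro bdd_belowI2) auto
 have ne: "J ` S ~= {}" using subspace_0[OF S(1)] by blast
 have m_le: "m <= J x" if "x : S" for x unfolding m_def by (intro cInf_lower bdd imageI that)
 define r where "r n = 1 / real (Suc n)" for n
 have "EX x:S. J x < m + r n" for n using cInf_lessD[OF ne, of "m + r n"] by (auto simp: m_def r_def)
 then obtain x where x: "!!n. x n : S" "!!n. J (x n) < m + r n" by metis
 \<comment> \<open>The parallelogram identity at the midpoint of u and v: points that nearly
   minimize \<open>J\<close> are close, so a minimizing sequence is Cauchy.\<close>
 have par: "(norm (u - v))^2 <= 4 * (J u + J v - 2 * m)" if "u : S" "v : S" for u v proof -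
  have "m <= J ((1/2) *\<^sub>R (u + v))" by (intro m_le subspace_scale subspace_add S that)
  also have "J ((1/2) *\<^sub>R (u + v)) = (J u + J v) / 2 - (norm (u - v))^2 / 8"
   by (simp add: J_def g.scaleR g.add power2_norm_eq_inner inner_add_left inner_add_right
     inner_diff_left inner_diff_right inner_commute field_simps)
  finally show ?thesis by argo
 qed
 have "Cauchy x" proof (rule metric_CauchyI)
  fix e :: real assume "e > 0"
  obtain N where N: "8 * r N < e\<^sup>2" using reals_Archimedean[of "e\<^sup>2 / 8"] `e > 0` by (auto simp: field_simps r_def)
  have "dist (x i) (x j) < e" if "i >= N" "j >= N" for i j proof -
   have "r i <= r N" "r j <= r N" using that by (auto simp: field_simps r_def)
   then have "(norm (x i - x j))^2 < e\<^sup>2" using par[OF x(1) x(1), of i j] x(2)[of i] x(2)[of j] N by argo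
   then show ?thesis using `e > 0` by (simp add: dist_norm power_less_imp_less_base)
  qed
  then show "EX M. ALL i>=M. ALL j>=M. dist (x i) (x j) < e" by blast
 qed
 then obtain z where z: "x ----> z" using Cauchy_convergent convergent_def by blast
 have zS: "z : S" using S(2) x(1) z by (rule closed_sequentially)
 have "(%n. J (x n)) ----> J z" unfolding J_def by (intro tendsto_intros z g.tendsto) auto
 moreover have "(%n. m + r n) ----> m + 0" by (intro tendsto_intros) (use LIMSEQ_inverse_real_of_nat in "simp add: inverse_eq_divide r_def")
 ultimately have Jz: "J z <= m" using x(2) by (intro LIMSEQ_le[of "%n. J (x n)"]) (auto intro: less_imp_le)
 have "inner z h = g h" if h: "h : S" for h proof (rule ccontr)
  assume ne: "inner z h ~= g h"
  define a where "a = inner z h - g h"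
  \<comment> \<open>Moving z by t along h changes \<open>J\<close> by t a + t^2 |h|^2 / 2. As
    \<open>b\<close> is positive and exceeds the quadratic coefficient, t = - a / (2 b) lowers
    \<open>J\<close> by at least a^2 / (4 b), against minimality.\<close>
  define b where "b = (norm h)^2 / 2 + 1"
  have "b > 0" by (simp add: b_def add_nonneg_pos)
  have "J z <= J (z + (- a / (2 * b)) *\<^sub>R h)" by (intro order_trans[OF Jz] m_le subspace_add subspace_scale S zS h)
  also have "... = J z + (- a / (2 * b)) * a + (- a / (2 * b))^2 * ((norm h)^2 / 2)" proof -
   have "J (z + t *\<^sub>R h) = J z + t * a + (t * t) * ((norm h)^2 / 2)" for t by (simp add: J_def a_def g.scaleR g.add power2_norm_eq_inner inner_add_left
      inner_add_right inner_commute field_simps)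
   then show ?thesis by (simp only: power2_eq_square[of "- a / (2 * b)"])
  qed
  also have "... <= J z + (- a / (2 * b)) * a + (- a / (2 * b))^2 * b" by (intro add_left_mono mult_left_mono) (auto simp: b_def)
  also have "... = J z - a\<^sup>2 / (4 * b)" using `b > 0` by (simp add: power2_eq_square field_simps)
  finally have "a\<^sup>2 / (4 * b) <= 0" by argo
  moreover have "a\<^sup>2 / (4 * b) > 0" using `b > 0` ne by (simp add: a_def)
  ultimately show False by simp
 qed
 with zS show ?thesis by blast
qed

text \<open>Riesz representation on M serves as orthogonal projection: the z in M that represents
  inner v on M leaves v - z orthogonal to M.\<close>

lemma closed_subspace_eq_UNIV:
 fixes M :: "'a::{real_inner,complete_space} set" assumes M: "subspace M" "closed M" and orth: "!!y. (!!x. x : M ==> inner y x = 0) ==> y = 0" shows "M = UNIV"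
proof -
 have "v : M" for v proof -
  obtain z where z: "z : M" "!!h. h : M ==> inner z h = inner v h" using riesz_subspace[OF M bounded_linear_inner_right[of v]] by blast
  have "v - z = 0" by (rule orth) (simp add: z inner_diff_left)
  with z(1) show ?thesis by simp
 qed
 then show ?thesis by blast
qed

lemma cinner_eq_0I:
 fixes y :: "'a::chilbert_space" assumes "!!c. inner y (c *C x) = 0" shows "cin y x = 0"
 using assms[of 1] assms[of \<i>] by (auto simp: inner_eq_Re_cinner cinner_scaleC_right complex_eq_iff)

lemma closed_csubspace_eq_UNIV:
 fixes M :: "'a::chilbert_space set" assumes M: "subspace M" "closed M" "!!c x. x : M ==> c *C x : M" and orth: "!!y. (!!x. x : M ==> cin y x = 0) ==> y = 0"
 shows "M = UNIV" using M by (intro closed_subspace_eq_UNIV orth) (auto intro!: cinner_eq_0I)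

text \<open>A complex linear functional is determined by its real part, since Im f(x) = - Re f(i x);
  the real theorem represents that part.\<close>

lemma riesz_cfunctional:
 fixes f :: "'a::chilbert_space => complex" assumes add: "!!x y. f (x + y) = f x + f y" and scale: "!!c x. f (c *C x) = c * f x"
  and bdd: "!!x. cmod (f x) <= K * norm x" shows "EX z. ALL x. f x = cin z x"
proof -
 have "bounded_linear (%x. Re (f x))" proof (rule bounded_linear_intro[where K = K])
  fix x show "norm (Re (f x)) <= norm x * K" using abs_Re_le_cmod[of "f x"] bdd[of x] by (simp add: mult.commute)
 qed (auto simp: add scale scaleR_scaleC)
 then obtain z where z: "!!h. inner z h = Re (f h)" using riesz_subspace[OF subspace_UNIV closed_UNIV, of "%x. Re (f x)"] by blast
 have "f x = cin z x" for x using z[of x] z[of "\<i> *C x"] by (auto simp: inner_eq_Re_cinner scale cinner_scaleC_right complex_eq_iff)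
 then show ?thesis by blast
qed

section \<open>Bounded operators\<close>

lemma apply_add [simp]: "A *V (x + y) = A *V x + A *V y" by transfer (simp add: blinfun.add_right)
lemma apply_diff [simp]: "A *V (x - y) = A *V x - A *V y" by transfer (simp add: blinfun.diff_right)
lemma apply_minus [simp]: "A *V (- x) = - (A *V x)" by transfer (simp add: blinfun.minus_right)
lemma apply_zero [simp]: "A *V 0 = 0" by transfer simp
lemma apply_scaleC [simp]: "A *V (c *C x) = c *C (A *V x)" by transfer simp
lemma apply_scaleR [simp]: "A *V (r *\<^sub>R x) = r *\<^sub>R (A *V x)" by transfer (simp add: blinfun.scaleR_right)
lemma plus_bop_apply [simp]: "(A + B) *V x = A *V x + B *V x" by transfer (simp add: blinfun.add_left)
lemma minus_bop_apply [simp]: "(A - B) *V x = A *V x - B *V x" by transfer (simp add: blinfun.diff_left)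
lemma uminus_bop_apply [simp]: "(- A) *V x = - (A *V x)" by transfer (simp add: blinfun.minus_left)
lemma zero_bop_apply [simp]: "0 *V x = 0" by transfer simp
lemma one_bop_apply [simp]: "1 *V x = x" by transfer simp
lemma times_bop_apply [simp]: "(A * B) *V x = A *V B *V x" by transfer simp
lemma scaleC_bop_apply [simp]: "(c *C A) *V x = c *C (A *V x)" by transfer (simp add: blinfun_scaleC.rep_eq)
lemma scaleR_bop_apply [simp]: "(r *\<^sub>R A) *V x = r *\<^sub>R (A *V x)" by transfer (simp add: blinfun.scaleR_left)
lemma norm_apply_le: "norm (A *V x) <= norm A * norm x" by transfer (rule norm_blinfun)
lemma bounded_linear_apply: "bounded_linear (%x. A *V x)" by transfer (rule blinfun.bounded_linear_right)

lemma apply_sum: "A *V (sum f S) = (SUM i:S. A *V f i)" by (induction S rule: infinite_finite_induct) auto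

lemma sum_bop_apply: "(sum F S) *V x = (SUM i:S. F i *V x)" by (induction S rule: infinite_finite_induct) auto

lemma bop_eqI: "(!!x. A *V x = B *V x) ==> A = B" by transfer (auto intro: blinfun_eqI)

lemma norm_bop_le: "(!!x. norm (A *V x) <= K * norm x) ==> 0 <= K ==> norm A <= K" by transfer (rule norm_blinfun_bound)

lemmas tendsto_apply_bop [tendsto_intros] = bounded_linear.tendsto[OF bounded_linear_apply]

lemma bop_exists:
 fixes f :: "'a::chilbert_space => 'a" assumes "clinear f" and "!!x. norm (f x) <= K * norm x" shows "EX A. ALL x. A *V x = f x"
proof -
 have bl: "bounded_linear f" using assms by (intro bounded_linear_intro[where K = K]) (auto simp: clinear_def scaleR_scaleC mult.commute)
 have "Abs_bop (Blinfun f) *V x = f x" for x using assms(1) by (simp add: apply_bop.rep_eq Abs_bop_inverse bounded_linear_Blinfun_apply[OF bl] clinear_def)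
 then show ?thesis by blast
qed

text \<open>Riesz representation in the first variable for each fixed second one. This is the source
  of most operators below: forms given by limits, sums, integrals or means become operators.\<close>

lemma form_bop:
 fixes B :: "'a::chilbert_space => 'a => complex" assumes addl: "!!x y z. B (x + y) z = B x z + B y z" and scl: "!!c x z. B (c *C x) z = cnj c * B x z"
  and addr: "!!x y z. B x (y + z) = B x y + B x z" and scr: "!!c x z. B x (c *C z) = c * B x z" and bdd: "!!x y. cmod (B x y) <= K * norm x * norm y"
 shows "EX A. ALL x y. cin x (A *V y) = B x y"
proof -
 have "EX z. ALL x. cnj (B x y) = cin z x" for y proof (rule riesz_cfunctional[where K = "K * norm y"])
  show "cmod (cnj (B x y)) <= K * norm y * norm x" for x using bdd[of x y] by (simp add: ac_simps)
 qed (auto simp: addl scl)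
 then obtain F where F: "!!x y. cnj (B x y) = cin (F y) x" by metis
 then have F': "B x y = cin x (F y)" for x y by (metis cinner_commute complex_cnj_cnj)
 have "clinear F" unfolding clinear_def proof (intro conjI allI)
  show "F (y + z) = F y + F z" for y z by (rule cinner_extI) (simp only: cinner_add_right addr F'[symmetric])
  show "F (c *C y) = c *C F y" for c y by (rule cinner_extI) (simp only: cinner_scaleC_right scr F'[symmetric])
 qed
 moreover have "norm (F y) <= (abs K) * norm y" for y proof (cases "F y = 0")
  case False
  have "(norm (F y))^2 = cmod (B (F y) y)" by (simp add: F' cinner_self norm_power del: of_real_power)
  also have "... <= K * norm (F y) * norm y" by (rule bdd)
  also have "... <= (abs K) * norm (F y) * norm y" by (intro mult_right_mono) auto
  finally show ?thesis using False by (simp add: power2_eq_square)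
 qed simp
 ultimately obtain A where "!!x. A *V x = F x" using bop_exists by metis
 then show ?thesis using F' by metis
qed

lemma polarization:
 fixes x y :: "'a::chilbert_space" shows "4 * cin x (A *V y) = cin (x + y) (A *V (x + y)) - cin (x - y) (A *V (x - y))
   - \<i> * (cin (x + \<i> *C y) (A *V (x + \<i> *C y)) - cin (x - \<i> *C y) (A *V (x - \<i> *C y)))"
 unfolding apply_add apply_diff apply_scaleC cinner_simps complex_cnj_i by (simp add: complex_eq_iff)

lemma bop_eqI_diag: assumes "!!x::'a::chilbert_space. cin x (A *V x) = cin x (B *V x)" shows "A = B"
proof (rule bop_eqI, rule cinner_extI)
 fix x y show "cin x (A *V y) = cin x (B *V y)" using trans[OF polarization[of x A y, unfolded assms] polarization[of x B y, symmetric]] by simp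
qed

lemma tendsto_cinner_of_diag:
 fixes x y :: "'a::chilbert_space" assumes "!!x::'a. ((%n. cin x (A n *V x)) \<longlongrightarrow> cin x (B *V x)) F"
 shows "((%n. cin x (A n *V y)) \<longlongrightarrow> cin x (B *V y)) F"
proof -
 have "((%n. (1/4) * (4 * cin x (A n *V y))) \<longlongrightarrow> (1/4) * (4 * cin x (B *V y))) F" unfolding polarization by (intro tendsto_intros assms)
 then show ?thesis by simp
qed

text \<open>Polarization and the parallelogram law bound the form by c (|x|^2 + |y|^2). Rescaling
  both vectors to length one turns the sum into a product; this is where the factor 2 comes
  from.\<close>

lemma cmod_cinner_le_of_diag:
 fixes x y :: "'a::chilbert_space" assumes c: "!!x::'a. cmod (cin x (A *V x)) <= c * (norm x)^2" shows "cmod (cin x (A *V y)) <= 2 * c * norm x * norm y"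
proof (cases "x = 0 | y = 0")
 case False
 have *: "cmod (cin x (A *V y)) <= c * ((norm x)^2 + (norm y)^2)" for x y :: 'a proof -
  have "4 * cmod (cin x (A *V y)) = cmod (4 * cin x (A *V y))" by (simp add: norm_mult)
  also have "... <= (cmod (cin (x + y) (A *V (x + y))) + cmod (cin (x - y) (A *V (x - y))))
   + (cmod (cin (x + \<i> *C y) (A *V (x + \<i> *C y))) + cmod (cin (x - \<i> *C y) (A *V (x - \<i> *C y))))" unfolding polarization
   by (intro order_trans[OF norm_triangle_ineq4] add_mono) (auto simp: norm_mult norm_triangle_ineq4)
  also have "... <= (c * (norm (x + y))^2 + c * (norm (x - y))^2) + (c * (norm (x + \<i> *C y))^2 + c * (norm (x - \<i> *C y))^2)" by (intro add_mono c)
  also have "... = 4 * (c * ((norm x)^2 + (norm y)^2))" by (simp add: norm_add_square norm_diff_square norm_scaleC algebra_simps)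
  finally show ?thesis by simp
 qed
 have "cin x (A *V y) = of_real (norm x * norm y) * cin ((1 / norm x) *\<^sub>R x) (A *V ((1 / norm y) *\<^sub>R y))"
  using False by (simp add: cinner_scaleR_left cinner_scaleR_right field_simps)
 then have "cmod (cin x (A *V y)) = (norm x * norm y) * cmod (cin ((1 / norm x) *\<^sub>R x) (A *V ((1 / norm y) *\<^sub>R y)))" by (simp add: norm_mult)
 also have "... <= (norm x * norm y) * (c * ((norm ((1 / norm x) *\<^sub>R x))^2 + (norm ((1 / norm y) *\<^sub>R y))^2))" by (intro mult_left_mono *) auto
 also have "... = 2 * c * norm x * norm y" using False by simp
 finally show ?thesis .
next
 case True
 then show ?thesis by (elim disjE) simp_all
qed

text \<open>By polarization convergence on the diagonal is convergence of all matrix elements;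
  sesquilinearity and the bound then pass to the limit form, and \<open>form_bop\<close> gives the
  operator.\<close>

lemma weak_limit_bop:
 fixes A :: "nat => 'a::chilbert_space bop" assumes lim: "!!x. (%n. cin x (A n *V x)) ----> q x" and bdd: "!!n x. cmod (cin x (A n *V x)) <= c * (norm x)^2"
 shows "EX B. ALL x. cin x (B *V x) = q x"
proof -
 define R where "R x y = (1/4) * (q (x + y) - q (x - y) - \<i> * (q (x + \<i> *C y) - q (x - \<i> *C y)))" for x y
 have R: "(%n. cin x (A n *V y)) ----> R x y" for x y proof -
  have "(%n. (1/4) * (4 * cin x (A n *V y))) ----> R x y" unfolding polarization R_def by (intro tendsto_intros lim)
  then show ?thesis by simp
 qed
 have "EX B. ALL x y. cin x (B *V y) = R x y" proof (rule form_bop[where K = "2 * c"])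
  fix x y z :: 'a and c' :: complex
  show "R (x + y) z = R x z + R y z" by (rule LIMSEQ_unique[OF R]) (use tendsto_add[OF R[of x z] R[of y z]] in "simp add: cinner_simps")
  show "R x (y + z) = R x y + R x z" by (rule LIMSEQ_unique[OF R]) (use tendsto_add[OF R[of x y] R[of x z]] in "simp add: cinner_simps")
  show "R (c' *C x) z = cnj c' * R x z" by (rule LIMSEQ_unique[OF R]) (use tendsto_mult_left[OF R[of x z], of "cnj c'"] in "simp add: cinner_simps")
  show "R x (c' *C z) = c' * R x z" by (rule LIMSEQ_unique[OF R]) (use tendsto_mult_left[OF R[of x z], of "c'"] in "simp add: cinner_simps")
  show "cmod (R x y) <= 2 * c * norm x * norm y" by (intro LIMSEQ_le_const2[OF tendsto_norm[OF R]] exI[of _ 0] allI impI cmod_cinner_le_of_diag bdd)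
 qed
 then obtain B where B: "!!x y. cin x (B *V y) = R x y" by blast
 have "cin x (B *V x) = q x" for x using LIMSEQ_unique[OF R[of x x] lim[of x]] by (simp add: B)
 then show ?thesis by blast
qed

lemma adj_exists: "EX B. ALL x y. cin (A *V x) y = cin x (B *V y)"
proof -
 have "EX B. ALL x y. cin x (B *V y) = cin (A *V x) y" proof (rule form_bop[where K = "norm A"])
  fix x y
  have "cmod (cin (A *V x) y) <= norm (A *V x) * norm y" by (rule cmod_cinner_le)
  also have "... <= norm A * norm x * norm y" by (intro mult_right_mono norm_apply_le) auto
  finally show "cmod (cin (A *V x) y) <= norm A * norm x * norm y" .
 qed (auto simp: cinner_simps)
 then show ?thesis by metis
qed

lemma cinner_adj_right: "cin x (adj A *V y) = cin (A *V x) y"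
proof -
 obtain B where B: "!!x y. cin (A *V x) y = cin x (B *V y)" using adj_exists by blast
 have "adj A = B" unfolding adj_def proof (rule the_equality)
  fix C assume "ALL x y. cin (A *V x) y = cin x (C *V y)"
  then show "C = B" by (intro bop_eqI cinner_extI) (simp flip: B)
 qed (simp add: B)
 then show ?thesis by (simp add: B)
qed

lemma cinner_adj_left: "cin (adj A *V x) y = cin x (A *V y)" by (metis cinner_adj_right cinner_commute)

lemma adj_eqI: "(!!x y. cin (A *V x) y = cin x (B *V y)) ==> adj A = B" by (intro bop_eqI cinner_extI) (simp add: cinner_adj_right)

lemma adj_adj [simp]: "adj (adj A) = A" by (rule adj_eqI) (rule cinner_adj_left)

lemma adj_mult: "adj (A * B) = adj B * adj A" by (rule adj_eqI) (simp add: cinner_adj_right)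

lemma adj_add: "adj (A + B) = adj A + adj B" by (rule adj_eqI) (simp add: cinner_adj_right cinner_simps)

lemma adj_scaleC: "adj (c *C A) = cnj c *C adj A" by (rule adj_eqI) (simp add: cinner_adj_right cinner_simps)

lemma adj_one [simp]: "adj 1 = 1" by (rule adj_eqI) simp

lemma adj_zero [simp]: "adj 0 = 0" by (rule adj_eqI) simp

lemma adj_self_of_real_diag: assumes "!!x::'a::chilbert_space. cin x (A *V x) : \<real>" shows "adj A = A"
proof (rule bop_eqI_diag)
 fix x show "cin x (adj A *V x) = cin x (A *V x)" by (metis assms Reals_cnj_iff cinner_adj_right cinner_commute)
qed

lemma positive_op_adj: "positive_op A ==> adj A = A" by (rule adj_self_of_real_diag) (auto simp: positive_op_def complex_is_Real_iff complex_nonneg_Reals_iff)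

lemma projection_norm: "projection P ==> cin x (P *V x) = of_real ((norm (P *V x))^2)" by (metis cinner_adj_left cinner_self projection_def times_bop_apply)

lemma bop_distrib:
 fixes A B C :: "'a::chilbert_space bop" shows "(A + B) * C = A * C + B * C" "A * (B + C) = A * B + A * C"
  "(A - B) * C = A * C - B * C" "A * (B - C) = A * B - A * C" "(c *C A) * B = c *C (A * B)" "A * (c *C B) = c *C (A * B)" "0 * A = 0" "A * 0 = 0"
 by (auto intro!: bop_eqI)

lemma norm_bop_mult_le: "norm (A * B) <= norm A * norm (B::'a::chilbert_space bop)"
proof (rule norm_bop_le)
 fix x
 have "norm (A *V (B *V x)) <= norm A * norm (B *V x)" by (rule norm_apply_le)
 also have "... <= norm A * (norm B * norm x)" by (intro mult_left_mono norm_apply_le) auto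
 finally show "norm ((A * B) *V x) <= norm A * norm B * norm x" by (simp add: mult.assoc)
qed simp

lemma norm_bop_le_form: assumes "!!x y::'a::chilbert_space. cmod (cin x (A *V y)) <= K * norm x * norm y" "0 <= K" shows "norm A <= K"
proof (rule norm_bop_le[OF _ assms(2)])
 fix y
 have "(norm (A *V y))^2 = cmod (cin (A *V y) (A *V y))" by (simp add: cinner_self norm_power del: of_real_power)
 also have "... <= K * norm (A *V y) * norm y" by (rule assms)
 finally show "norm (A *V y) <= K * norm y" by (cases "A *V y = 0") (auto simp: power2_eq_square assms(2))
qed

section \<open>Projection-valued measures and their bounded functional calculus\<close>

definition bborel :: "('s::topological_space => complex) => bool" where "bborel f \<longleftrightarrow> f : bmeas & (EX K. ALL s. cmod (f s) <= K)"

lemma bborelI: "f : bmeas ==> (!!s. cmod (f s) <= K) ==> bborel f" by (auto simp: bborel_def)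

lemma bborel_measurable [measurable_dest]: "bborel f ==> f : bmeas" by (simp add: bborel_def)

lemma bborel_indicator [intro]: "B : sets borel ==> bborel (ind B)" by (rule bborelI[where K = 1]) (auto simp: indicator_def)

lemma bborel_const [intro]: "bborel (%_. c)" by (rule bborelI[where K = "cmod c"]) auto

lemma bborel_add [intro]: assumes "bborel f" "bborel g" shows "bborel (%s. f s + g s)"
proof -
 obtain K L where "!!s. cmod (f s) <= K" "!!s. cmod (g s) <= L" using assms by (auto simp: bborel_def)
 then show ?thesis using assms by (intro bborelI[where K = "K + L"]) (auto simp: bborel_def intro: norm_triangle_mono)
qed

lemma bborel_mult [intro]: assumes "bborel f" "bborel g" shows "bborel (%s. f s * g s)"
proof -
 obtain K L where KL: "!!s. cmod (f s) <= K" "!!s. cmod (g s) <= L" using assms by (auto simp: bborel_def)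
 then have "0 <= K" using norm_ge_zero order_trans by blast
 with KL show ?thesis using assms by (intro bborelI[where K = "K * L"]) (auto simp: bborel_def norm_mult intro: mult_mono)
qed

lemma bborel_minus [intro]: "bborel f ==> bborel (%s. - f s)" using bborel_mult[OF bborel_const[of "-1"], of f] by simp

lemma bborel_diff [intro]: "bborel f ==> bborel g ==> bborel (%s. f s - g s)" using bborel_add[OF _ bborel_minus, of f g] by simp

lemma borel_measurable_cnj [measurable]: "cnj : bmeas" by (intro continuous_borel continuous_on_cnj continuous_on_id)

lemma bborel_cnj [intro]: assumes "bborel f" shows "bborel (%s. cnj (f s))"
proof -
 obtain K where "!!s. cmod (f s) <= K" using assms by (auto simp: bborel_def)
 moreover have "(%s. cnj (f s)) : bmeas" using assms by measurable
 ultimately show ?thesis by (intro bborelI[where K = K]) auto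
qed

lemma bborel_comp [intro]: assumes "bborel f" "ph : bmeas" shows "bborel (%s. f (ph s))"
proof -
 obtain K where "!!s. cmod (f s) <= K" using assms by (auto simp: bborel_def)
 moreover have "(%s. f (ph s)) : bmeas" by (rule measurable_compose[OF assms(2) bborel_measurable[OF assms(1)]])
 ultimately show ?thesis by (intro bborelI[where K = K]) auto
qed

lemma bborel_sum [intro]: "(!!i. i : I ==> bborel (f i)) ==> bborel (%s. SUM i:I. f i s)" by (induction I rule: infinite_finite_induct) auto

lemma bborel_limit: assumes "!!i. bborel (F i)" "!!i s. cmod (F i s) <= K" "!!s. (%i. F i s) ----> f s" shows "bborel f"
proof (rule bborelI)
 show "f : bmeas" by (rule borel_measurable_LIMSEQ_metric[where f = F]) (use assms in "auto simp: bborel_def")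
 show "cmod (f s) <= K" for s by (rule LIMSEQ_le_const2[OF tendsto_norm[OF assms(3)]]) (use assms(2) in auto)
qed

text \<open>Bounded Borel functions are bounded pointwise limits of simple functions.\<close>

lemma bborel_induct [consumes 1, case_names ind add mult limit]:
 fixes f :: "'s::topological_space => complex" assumes f: "bborel f" and ind: "!!B. B : sets borel ==> P (ind B)"
  and add: "!!f g. bborel f ==> P f ==> bborel g ==> P g ==> P (%s. f s + g s)" and mult: "!!f c. bborel f ==> P f ==> P (%s. c * f s)"
  and lim: "!!f F K. (!!i. bborel (F i)) ==> (!!i s. cmod (F i s) <= K) ==> (!!i::nat. P (F i)) ==>
   bborel f ==> (!!s. (%i. F i s) ----> f s) ==> P f" shows "P f"
proof -
 have P0: "P (%_. 0)" proof -
  have "(ind {} :: 's => complex) = (%_. 0)" by auto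
  with ind[of "{}"] show ?thesis by simp
 qed
 have sums: "P (%s. SUM y:Y. y * ind (B y) s) & bborel (%s. SUM y:Y. y * ind (B y) s)"
  if "finite Y" "!!y. y : Y ==> B y : sets borel" for Y and B :: "complex => 's set" using that proof (induction Y)
  case (insert y Y)
  have 1: "bborel (%s. y * ind (B y) s)" "P (%s. y * ind (B y) s)" using insert.prems by (auto intro!: mult ind bborel_mult)
  have 2: "P (%s. SUM y:Y. y * ind (B y) s)" "bborel (%s. SUM y:Y. y * ind (B y) s)" using insert.IH insert.prems by blast+
  show ?case unfolding sum.insert[OF insert.hyps] using add[OF 1 2(2,1)] bborel_add[OF 1(1) 2(2)] by blast
 qed (simp add: P0 bborel_const)
 obtain K where K: "!!s. cmod (f s) <= K" using f by (auto simp: bborel_def)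
 obtain F :: "nat => 's => complex" where F0: "ALL i. simple_function borel (F i)"
  "ALL s:space borel. (%i. F i s) ----> f s" "ALL i. ALL s:space borel. dist (F i s) 0 <= 2 * dist (f s) 0"
  using borel_measurable_implies_sequence_metric[OF bborel_measurable[OF f], of 0] by blast
 then have F: "!!i. simple_function borel (F i)" "!!s. (%i. F i s) ----> f s" "!!i s. dist (F i s) 0 <= 2 * dist (f s) 0" by auto
 have rep: "F i = (%s. SUM y:range (F i). y * ind (F i -` {y}) s)" for i proof
  fix s
  have "(SUM y:range (F i). y * ind (F i -` {y}) s) = (SUM y:range (F i). if y = F i s then y else 0)" by (intro sum.cong) (auto simp: indicator_def)
  also have "... = F i s" using F(1)[of i] by (simp add: simple_function_def)
  finally show "F i s = (SUM y:range (F i). y * ind (F i -` {y}) s)" ..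
 qed
 have *: "P (F i) & bborel (F i)" for i using sums[of "range (F i)" "%y. F i -` {y}"] F(1)[of i]
  unfolding rep[of i, symmetric] by (auto simp: simple_function_def)
 show ?thesis proof (rule lim[of F "2 * K"])
  show "cmod (F i s) <= 2 * K" for i s using F(3)[of i s] K[of s] by simp
 qed (use * f F(2) in auto)
qed

text \<open>For projections weak countable additivity is already strong. The remainder of the series
  is E of the tail union \<open>U n\<close>, again a projection, and the squared norm of a
  projection at x is its diagonal matrix element, which tends to 0.\<close>

lemma pvmI:
 fixes E :: "'s::topological_space set => 'a::chilbert_space bop" assumes proj: "!!B. B : sets borel ==> projection (E B)"
  and zero: "!!B. B \<notin> sets borel ==> E B = 0" and one: "E UNIV = 1" and sums: "!!F x. range F <= sets borel ==> disjoint_family F ==>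
   (%n::nat. Re (cin x (E (F n) *V x))) sums Re (cin x (E (UN n. F n) *V x))" shows "pvm E" unfolding projection_valued_measure_def
proof (intro conjI allI ballI impI proj zero one)
 fix F :: "nat => 's set" and x
 assume F: "range F <= sets borel" "disjoint_family F"
 define U where "U n = (UN i. F (i + n))" for n
 have U: "U n : sets borel" for n using F(1) by (auto simp: U_def)
 have re: "Re (cin x (E (U n) *V x)) = Re (cin x (E (U 0) *V x)) - (SUM i<n. Re (cin x (E (F i) *V x)))" for n x proof (rule sums_unique2)
  show "(%i. Re (cin x (E (F (i + n)) *V x))) sums Re (cin x (E (U n) *V x))" unfolding U_def using F by (intro sums) (auto simp: disjoint_family_on_def)
  show "(%i. Re (cin x (E (F (i + n)) *V x))) sums (Re (cin x (E (U 0) *V x)) - (SUM i<n. Re (cin x (E (F i) *V x))))"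
   using sums_split_initial_segment[OF sums[OF F]] by (simp add: U_def)
 qed
 have real: "cin x (E B *V x) = of_real (Re (cin x (E B *V x)))" if "B : sets borel" for B x using projection_norm[OF proj[OF that], of x] by simp
 have E: "E (U n) = E (U 0) - (SUM i<n. E (F i))" for n proof (rule bop_eqI_diag)
  fix x
  have "(SUM i<n. cin x (E (F i) *V x)) = of_real (SUM i<n. Re (cin x (E (F i) *V x)))" unfolding of_real_sum using F(1) by (intro sum.cong real) auto
  then show "cin x (E (U n) *V x) = cin x ((E (U 0) - (SUM i<n. E (F i))) *V x)" using re[where n = n and x = x] real[OF U, of x n] real[OF U, of x 0]
   by (simp add: cinner_diff_right sum_bop_apply cinner_sum_right)
 qed
 have "(%n. (norm ((SUM i<n. E (F i) *V x) - E (U 0) *V x))^2) = (%n. Re (cin x (E (U n) *V x)))" proof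
  fix n
  have "(SUM i<n. E (F i) *V x) - E (U 0) *V x = - (E (U n) *V x)" by (simp add: E[of n] sum_bop_apply)
  then show "(norm ((SUM i<n. E (F i) *V x) - E (U 0) *V x))^2 = Re (cin x (E (U n) *V x))" by (simp add: projection_norm[OF proj[OF U]])
 qed
 also have "... = (%n. Re (cin x (E (U 0) *V x)) - (SUM i<n. Re (cin x (E (F i) *V x))))" by (intro ext re)
 also have "... ----> Re (cin x (E (U 0) *V x)) - Re (cin x (E (U 0) *V x))" using sums[OF F, of x] by (intro tendsto_intros) (simp add: sums_def U_def)
 finally have "(%n. sqrt ((norm ((SUM i<n. E (F i) *V x) - E (U 0) *V x))^2)) ----> sqrt 0" by (intro tendsto_real_sqrt) simp
 then have "(%n. (SUM i<n. E (F i) *V x) - E (U 0) *V x) ----> 0" by (simp add: tendsto_norm_zero_iff)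
 then have "(%n. SUM i<n. E (F i) *V x) ----> E (U 0) *V x" by (rule LIM_zero_cancel)
 then show "(%n. E (F n) *V x) sums (E (UN n. F n) *V x)" by (simp add: sums_def U_def)
qed

lemma projection_norm_le: assumes "projection (P::'a::chilbert_space bop)" shows "norm (P *V x) <= norm x"
proof -
 have "(norm (P *V x))^2 = cmod (cin x (P *V x))" using projection_norm[OF assms, of x] by (simp add: norm_power del: of_real_power)
 also have "... <= norm x * norm (P *V x)" by (rule cmod_cinner_le)
 finally show ?thesis by (cases "P *V x = 0") (auto simp: power2_eq_square)
qed

context
 fixes E :: "'s::topological_space set => 'a::chilbert_space bop" assumes E: "pvm E"
begin

lemma pvm_projection: "B : sets borel ==> projection (E B)" using E by (simp add: projection_valued_measure_def)

lemma pvm_UNIV: "E UNIV = 1" using E by (simp add: projection_valued_measure_def)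

lemma pvm_sums: "range F <= sets borel ==> disjoint_family F ==> (%n. E (F n) *V x) sums (E (UN n. F n) *V x)"
 using E unfolding projection_valued_measure_def by blast

lemma pvm_adj: "B : sets borel ==> adj (E B) = E B" using pvm_projection by (simp add: projection_def)

lemma pvm_idem: "B : sets borel ==> E B * E B = E B" using pvm_projection by (simp add: projection_def)

lemma pvm_empty: "E {} = 0"
proof (rule bop_eqI)
 fix x
 have "(%n::nat. E {} *V x) sums (E (UN n::nat. {}) *V x)" by (rule pvm_sums) (auto simp: disjoint_family_on_def)
 then have "(%n::nat. E {} *V x) ----> 0" by (intro summable_LIMSEQ_zero) (rule sums_summable)
 then show "E {} *V x = 0 *V x" by (simp add: LIMSEQ_const_iff)
qed

lemma pvm_Un: assumes "A : sets borel" "B : sets borel" "A Int B = {}" shows "E (A Un B) = E A + E B"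
proof (rule bop_eqI)
 fix x
 have *: "(%n. E (binaryset A B n) *V x) sums (E (UN n. binaryset A B n) *V x)"
  by (rule pvm_sums) (use assms in "auto simp: binaryset_def disjoint_family_on_def")
 have "(%n. E (binaryset A B n) *V x) sums (SUM n:{0,1}. E (binaryset A B n) *V x)" by (rule sums_finite) (auto simp: binaryset_def pvm_empty)
 from sums_unique2[OF * this] show "E (A Un B) *V x = (E A + E B) *V x" by (simp add: UN_binaryset_eq) (simp add: binaryset_def)
qed

text \<open>For y in the range of E B additivity gives |E A y|^2 + |y|^2 = |E (A Un B) y|^2, and the
  right side is at most |y|^2.\<close>

lemma pvm_disjoint: assumes "A : sets borel" "B : sets borel" "A Int B = {}" shows "E A * E B = 0"
proof (rule bop_eqI)
 fix x
 define y where "y = E B *V x"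
 have By: "E B *V y = y" using pvm_idem[OF assms(2)] by (metis times_bop_apply y_def)
 have "of_real ((norm (E A *V y))^2) + of_real ((norm y)^2) = cin y (E (A Un B) *V y)"
  by (simp add: pvm_Un[OF assms] cinner_add_right projection_norm[OF pvm_projection] assms By cinner_self)
 also have "... = of_real ((norm (E (A Un B) *V y))^2)" using assms by (intro projection_norm pvm_projection) auto
 finally have "(norm (E A *V y))^2 + (norm y)^2 = (norm (E (A Un B) *V y))^2" by (metis of_real_add of_real_eq_iff)
 also have "... <= (norm y)^2" using assms by (intro power_mono projection_norm_le pvm_projection) auto
 finally show "(E A * E B) *V x = 0 *V x" by (simp add: y_def)
qed

lemma pvm_Int: assumes "A : sets borel" "B : sets borel" shows "E A * E B = E (A Int B)"
proof -
 have A: "E A = E (A - B) + E (A Int B)" and B: "E B = E (B - A) + E (A Int B)" by (subst pvm_Un[symmetric]; use assms in "auto intro!: arg_cong[where f = E]")+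
 have "E (A - B) * E (B - A) = 0" "E (A - B) * E (A Int B) = 0" "E (A Int B) * E (B - A) = 0" by (rule pvm_disjoint; use assms in auto)+
 moreover have "E (A Int B) * E (A Int B) = E (A Int B)" by (rule pvm_idem) (use assms in auto)
 ultimately show ?thesis unfolding A B bop_distrib by simp
qed

lemma sets_sdist [simp, measurable_cong]: "sets (sdist E x) = sets borel" unfolding spectral_distribution_def
 by (simp add: sets.sigma_sets_eq[of borel, simplified])

lemma space_sdist [simp]: "space (sdist E x) = UNIV" by (simp add: spectral_distribution_def space_measure_of_conv)

lemma emeasure_sdist: assumes "B : sets borel" shows "emeasure (sdist E x) B = ennreal ((norm (E B *V x))^2)"
proof -
 have "emeasure (sdist E x) B = ennreal (Re (cin x (E B *V x)))" unfolding spectral_distribution_def proof (rule emeasure_measure_of_sigma)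
  show "sigma_algebra UNIV (sets (borel :: 's measure))" using sets.sigma_algebra_axioms[of borel] by simp
  show "positive (sets borel) (%B. ennreal (Re (cin x (E B *V x))))" by (simp add: positive_def pvm_empty)
  show "countably_additive (sets borel) (%B. ennreal (Re (cin x (E B *V x))))" proof (rule countably_additiveI)
   fix F :: "nat => 's set" assume F: "range F <= sets borel" "disjoint_family F"
   have "(%n. Re (cin x (E (F n) *V x))) sums Re (cin x (E (UN n. F n) *V x))" by (intro bounded_linear.sums[OF bounded_linear_Re]
      bounded_linear.sums[OF bounded_bilinear.bounded_linear_right[OF bounded_bilinear_cinner]] pvm_sums F)
   then show "(\<Sum>i. ennreal (Re (cin x (E (F i) *V x)))) = ennreal (Re (cin x (E (\<Union> (range F)) *V x)))"
    by (intro suminf_ennreal_eq) (use F in "auto simp: projection_norm[OF pvm_projection] subset_eq")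
  qed
 qed fact
 then show ?thesis by (simp add: projection_norm[OF pvm_projection] assms)
qed

lemma finite_measure_sdist: "finite_measure (sdist E x)" by (rule finite_measureI) (simp add: emeasure_sdist)

lemma measure_sdist: "B : sets borel ==> measure (sdist E x) B = (norm (E B *V x))^2" by (simp add: measure_def emeasure_sdist)

lemma measure_sdist_UNIV: "measure (sdist E x) UNIV = (norm x)^2" by (simp add: measure_sdist pvm_UNIV)

lemma integral_sdist_indicator: assumes "B : sets borel" shows "(LINT s|sdist E x. ind B s) = cin x (E B *V x)"
proof -
 have "(ind B :: 's => complex) = (%s. cor (ind B s))" by (auto simp: indicator_def)
 then have "(LINT s|sdist E x. ind B s) = cor (LINT s|sdist E x. ind B s)" by (simp only: integral_complex_of_real)
 then show ?thesis using assms by (simp add: measure_sdist projection_norm[OF pvm_projection] del: of_real_power)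
qed

lemma bborel_integrable: assumes "bborel f" shows "integrable (sdist E x) f"
proof -
 interpret finite_measure "sdist E x" by (rule finite_measure_sdist)
 obtain K where "!!s. cmod (f s) <= K" using assms by (auto simp: bborel_def)
 then show ?thesis using bborel_measurable[OF assms] by (intro integrable_const_bound[of _ K]) auto
qed

lemma cmod_integral_sdist_le: assumes "bborel f" "!!s. cmod (f s) <= K" shows "cmod (LINT s|sdist E x. f s) <= K * (norm x)^2"
proof -
 interpret finite_measure "sdist E x" by (rule finite_measure_sdist)
 have "cmod (LINT s|sdist E x. f s) <= (LINT s|sdist E x. cmod (f s))" by (rule integral_norm_bound)
 also have "... <= (LINT s|sdist E x. K)" by (intro integral_mono integrable_norm bborel_integrable assms) auto
 also have "... = K * (norm x)^2" by (simp add: measure_sdist_UNIV mult.commute)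
 finally show ?thesis .
qed

lemma bborel_tendsto_integral: assumes "!!i. bborel (F i)" "!!i s. cmod (F i s) <= K" "!!s. (%i. F i s) ----> f s" "bborel f"
 shows "(%i. \<integral>s. F i s \<partial>sdist E x) ----> (LINT s|sdist E x. f s)"
proof (rule integral_dominated_convergence[where w = "%_. K"])
 show "f : borel_measurable (sdist E x)" using assms(4) by simp
 show "F i : borel_measurable (sdist E x)" for i using assms(1) by simp
 show "integrable (sdist E x) (%_. K)" using finite_measure.integrable_const[OF finite_measure_sdist] .
qed (use assms in auto)

text \<open>Without this existence the definite description in \<open>spectral_integral\<close>
  would carry no information. The limit step of the induction is
  \<open>weak_limit_bop\<close>.\<close>

lemma SI_exists: assumes "bborel f" shows "EX A. ALL x. cin x (A *V x) = (LINT s|sdist E x. f s)" using assms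
proof (induction rule: bborel_induct)
 case (ind B)
 show ?case by (rule exI[of _ "E B"]) (simp add: ind integral_sdist_indicator)
next
 case (add f g)
 then obtain A B where "ALL x. cin x (A *V x) = (LINT s|sdist E x. f s)" "ALL x. cin x (B *V x) = (LINT s|sdist E x. g s)" by blast
 then show ?case by (intro exI[of _ "A + B"]) (simp add: bborel_integrable add cinner_add_right)
next
 case (mult f c)
 then obtain A where "ALL x. cin x (A *V x) = (LINT s|sdist E x. f s)" by blast
 then show ?case by (intro exI[of _ "c *C A"]) (simp add: cinner_scaleC_right)
next
 case (limit f F K)
 then obtain A where A: "!!i x. cin x (A i *V x) = (LINT s|sdist E x. F i s)" by metis
 show ?case by (rule weak_limit_bop[where A = A and c = K]) (auto simp: A intro!: bborel_tendsto_integral limit cmod_integral_sdist_le)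
qed

lemma SI_diag: assumes "bborel f" shows "cin x (SI E f *V x) = (LINT s|sdist E x. f s)"
proof -
 obtain A where A: "!!x. cin x (A *V x) = (LINT s|sdist E x. f s)" using SI_exists[OF assms] by blast
 have "SI E f = A" unfolding spectral_integral_def by (rule the_equality) (auto simp: A intro!: bop_eqI_diag)
 then show ?thesis by (simp add: A)
qed

lemma SI_eqI: assumes "!!x. cin x (A *V x) = (LINT s|sdist E x. f s)" shows "SI E f = A"
 unfolding spectral_integral_def by (rule the_equality) (auto simp: assms intro!: bop_eqI_diag)

lemma SI_indicator: "B : sets borel ==> SI E (ind B) = E B" by (rule SI_eqI) (simp add: integral_sdist_indicator)

lemma SI_add: "bborel f ==> bborel g ==> SI E (%s. f s + g s) = SI E f + SI E g" by (rule SI_eqI) (simp add: cinner_add_right SI_diag bborel_integrable)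

lemma SI_diff: "bborel f ==> bborel g ==> SI E (%s. f s - g s) = SI E f - SI E g" by (rule SI_eqI) (simp add: cinner_diff_right SI_diag bborel_integrable)

lemma SI_scale: "bborel f ==> SI E (%s. c * f s) = c *C SI E f" by (rule SI_eqI) (simp add: cinner_scaleC_right SI_diag bborel_integrable)

lemma SI_one: "SI E (%_. 1) = 1" using SI_indicator[of UNIV] by (simp add: pvm_UNIV indicator_def)

lemma SI_const: "SI E (%_. c) = c *C 1" using SI_scale[OF bborel_const, of c 1] by (simp add: SI_one)

lemma SI_sum: "(!!i. i : I ==> bborel (f i)) ==> SI E (%s. SUM i:I. f i s) = (SUM i:I. SI E (f i))"
proof (induction I rule: infinite_finite_induct)
 case (insert i I)
 then show ?case by (simp add: SI_add bborel_sum)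
qed (simp_all add: SI_const bop_eqI)

lemma SI_weak_limit: assumes "!!i. bborel (F i)" "!!i s. cmod (F i s) <= K" "!!s. (%i. F i s) ----> f s"
 shows "(%i. cin x (SI E (F i) *V y)) ----> cin x (SI E f *V y)" by (rule tendsto_cinner_of_diag)
   (simp add: SI_diag assms(1) bborel_limit[OF assms] bborel_tendsto_integral[OF assms bborel_limit[OF assms]])

lemma SI_adj: "bborel f ==> adj (SI E f) = SI E (%s. cnj (f s))" by (rule SI_eqI[symmetric])
   (simp add: cinner_adj_right cinner_commute[of "SI E f *V _"] SI_diag)

text \<open>Multiplicativity spreads from sets, \<open>pvm_Int\<close>, to functions by two
  inductions, over g with f an indicator and then over f. The limits are weak, so only one factor
  may vary at a time; the fixed one is absorbed into a vector.\<close>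

lemma SI_mult: assumes f: "bborel f" and g: "bborel g" shows "SI E (%s. f s * g s) = SI E f * SI E g"
proof -
 have *: "SI E (%s. ind A s * g s) = E A * SI E g" if A: "A : sets borel" for A using g proof (induction rule: bborel_induct)
  case (ind B)
  then show ?case using A by (simp add: SI_indicator pvm_Int flip: indicator_inter_arith)
 next
  case (add f g)
  with A show ?case by (simp add: distrib_left SI_add bborel_mult bborel_indicator bop_distrib)
 next
  case (mult f c)
  have "(%s. ind A s * (c * f s)) = (%s. c * (ind A s * f s))" by (auto simp: ac_simps)
  with mult A show ?case by (simp add: SI_scale bborel_mult bborel_indicator bop_distrib)
 next
  case (limit f F K)
  show ?case proof (rule bop_eqI_diag)
   fix x
   have K: "cmod (ind A s * F i s) <= K" for s i using limit(2)[of i s] order_trans[OF norm_ge_zero limit(2)[of i s]] by (auto simp: indicator_def)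
   have "(%i. cin x (SI E (%s. ind A s * F i s) *V x)) ----> cin x (SI E (%s. ind A s * f s) *V x)"
    by (rule SI_weak_limit[OF _ K]) (simp_all add: tendsto_mult_left limit A bborel_mult bborel_indicator)
   moreover have "(%i. cin (adj (E A) *V x) (SI E (F i) *V x)) ----> cin (adj (E A) *V x) (SI E f *V x)" by (rule SI_weak_limit[OF limit(1,2,4)])
   ultimately show "cin x (SI E (%s. ind A s * f s) *V x) = cin x ((E A * SI E f) *V x)" unfolding limit(5) by (simp add: cinner_adj_left LIMSEQ_unique)
  qed
 qed
 show ?thesis using f proof (induction rule: bborel_induct)
  case (ind B)
  then show ?case by (simp add: * SI_indicator)
 next
  case (add f h)
  then show ?case by (simp add: distrib_right SI_add bborel_mult g bop_distrib)
 next
  case (mult f c)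
  then show ?case by (simp add: mult.assoc SI_scale bborel_mult g bop_distrib)
 next
  case (limit f F K)
  show ?case proof (rule bop_eqI_diag)
   fix x
   obtain L where L: "!!s. cmod (g s) <= L" using g by (auto simp: bborel_def)
   have "(%i. cin x (SI E (%s. F i s * g s) *V x)) ----> cin x (SI E (%s. f s * g s) *V x)" proof (rule SI_weak_limit)
    show "cmod (F i s * g s) <= K * L" for i s unfolding norm_mult by (intro mult_mono limit(2) L) (use order_trans[OF norm_ge_zero limit(2)] in auto)
   qed (simp_all add: tendsto_mult_right limit g bborel_mult)
   moreover have "(%i. cin x (SI E (F i) *V (SI E g *V x))) ----> cin x (SI E f *V (SI E g *V x))" by (rule SI_weak_limit[OF limit(1,2,4)])
   ultimately show "cin x (SI E (%s. f s * g s) *V x) = cin x ((SI E f * SI E g) *V x)" unfolding limit(5) by (simp add: LIMSEQ_unique)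
  qed
 qed
qed

lemma SI_mult_commute: "bborel f ==> bborel g ==> SI E f * SI E g = SI E g * SI E f" by (simp add: mult.commute flip: SI_mult)

lemma norm_SI: assumes "bborel f" shows "(norm (SI E f *V x))^2 = (LINT s|sdist E x. (cmod (f s))^2)"
proof -
 have "of_real ((norm (SI E f *V x))^2) = cin x ((adj (SI E f) * SI E f) *V x)" by (simp add: cinner_adj_right cinner_self)
 also have "... = cin x (SI E (%s. cnj (f s) * f s) *V x)" using assms by (simp add: SI_adj SI_mult bborel_cnj)
 also have "... = (LINT s|sdist E x. cnj (f s) * f s)" using assms by (intro SI_diag) auto
 also have "... = (LINT s|sdist E x. cor ((cmod (f s))^2))"
  by (intro Bochner_Integration.integral_cong) (auto simp: complex_norm_square mult.commute simp del: of_real_power)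
 finally show ?thesis by (simp only: integral_complex_of_real of_real_eq_iff)
qed

text \<open>\<open>norm_SI\<close> turns the distance of the vectors into an L2 distance of the
  functions, to which dominated convergence applies.\<close>

lemma SI_strong_limit: assumes "!!i. bborel (F i)" "!!i s. cmod (F i s) <= K" "!!s. (%i. F i s) ----> f s" shows "(%i. SI E (F i) *V x) ----> SI E f *V x"
proof -
 have f: "bborel f" by (rule bborel_limit[OF assms])
 have fK: "cmod (f s) <= K" for s by (rule LIMSEQ_le_const2[OF tendsto_norm[OF assms(3)]]) (use assms(2) in auto)
 have "(%i. (norm (SI E (F i) *V x - SI E f *V x))^2) = (%i. \<integral>s. (cmod (F i s - f s))^2 \<partial>sdist E x)"
  using assms(1) f by (simp flip: norm_SI minus_bop_apply add: bborel_diff SI_diff)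
 also have "... ----> (LINT s|sdist E x. 0)" proof (rule integral_dominated_convergence[where w = "%_. (2 * K)^2"])
  show "integrable (sdist E x) (%_. (2 * K)^2)" using finite_measure.integrable_const[OF finite_measure_sdist] .
  have [measurable]: "f : bmeas" "F i : bmeas" for i using f assms(1) by (auto simp: bborel_def)
  show "(%s. (cmod (F i s - f s))^2) : borel_measurable (sdist E x)" for i by measurable
  show "AE s in sdist E x. (%i. (cmod (F i s - f s))^2) ----> 0" proof (rule AE_I2)
   fix s
   have "(%i. (cmod (F i s - f s))^2) ----> (cmod (f s - f s))^2" by (intro tendsto_intros assms)
   then show "(%i. (cmod (F i s - f s))^2) ----> 0" by simp
  qed
  show "AE s in sdist E x. norm ((cmod (F i s - f s))^2) <= (2 * K)^2" for i proof (rule AE_I2)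
   fix s
   have "cmod (F i s - f s) <= 2 * K" using norm_triangle_ineq4[of "F i s" "f s"] assms(2)[of i s] fK[of s] by linarith
   from power_mono[OF this, of 2] show "norm ((cmod (F i s - f s))^2) <= (2 * K)^2" by simp
  qed
 qed simp
 finally have "(%i. sqrt ((norm (SI E (F i) *V x - SI E f *V x))^2)) ----> sqrt 0" by (intro tendsto_real_sqrt) simp
 then show ?thesis by (simp add: tendsto_norm_zero_iff LIM_zero_iff)
qed

lemma norm_SI_le: assumes "bborel f" "!!s. cmod (f s) <= K" "0 <= K" shows "norm (SI E f) <= K"
proof (rule norm_bop_le[OF _ assms(3)])
 interpret finite_measure "sdist E x" for x by (rule finite_measure_sdist)
 fix x
 have "(norm (SI E f *V x))^2 = Re (LINT s|sdist E x. cnj (f s) * f s)" unfolding norm_SI[OF assms(1)]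
  by (subst mult.commute) (simp add: complex_norm_square[symmetric] del: of_real_power)
 also have "... <= cmod (LINT s|sdist E x. cnj (f s) * f s)" by (rule complex_Re_le_cmod)
 also have "... <= (K * K) * (norm x)^2" by (rule cmod_integral_sdist_le) (use assms in "auto simp: norm_mult intro!: mult_mono")
 also have "... = (K * norm x)^2" by (simp add: power2_eq_square)
 finally show "norm (SI E f *V x) <= K * norm x" by (rule power2_le_imp_le) (simp add: assms(3))
qed

lemma SI_support: assumes S: "S : sets borel" "E S = 1" and fg: "bborel f" "bborel g" "!!s. s : S ==> f s = g s" shows "SI E f = SI E g"
proof -
 have "SI E f = E S * SI E f" by (simp add: S)
 also have "... = SI E (%s. ind S s * f s)" using S fg by (simp add: SI_mult SI_indicator bborel_indicator)
 also have "(%s. ind S s * f s) = (%s. ind S s * g s)" using fg(3) by (auto simp: indicator_def)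
 also have "SI E (%s. ind S s * g s) = E S * SI E g" using S fg by (simp add: SI_mult SI_indicator bborel_indicator)
 also have "... = SI E g" by (simp add: S)
 finally show ?thesis .
qed

lemma SI_positive: assumes "bborel f" "!!s. f s : \<real>\<^sub>\<ge>\<^sub>0" shows "positive_op (SI E f)"
proof -
 have "f = (%s. cor (Re (f s)))" and Re: "!!s. 0 <= Re (f s)" using assms(2) by (auto simp: fun_eq_iff complex_nonneg_Reals_iff complex_eq_iff)
 then have "(LINT s|sdist E x. f s) = of_real (LINT s|sdist E x. Re (f s))" for x by (metis integral_complex_of_real)
 moreover have "0 <= (LINT s|sdist E x. Re (f s))" for x by (intro integral_nonneg_AE AE_I2 Re)
 ultimately show ?thesis by (simp add: positive_op_def SI_diag[OF assms(1)])
qed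

end

lemma pvm_eqI: assumes "pvm E" "pvm F" and "!!B. B : sets borel ==> E B = F B" shows "E = F"
proof
 fix B show "E B = F B" using assms by (cases "B : sets borel") (auto simp: projection_valued_measure_def)
qed

lemma pvm_eqI_sd: assumes E: "pvm E" and F: "pvm F" and eq: "!!x. sdist E x = sdist F x" shows "E = F"
proof (rule pvm_eqI[OF E F], rule bop_eqI_diag)
 fix B x assume B: "B : sets (borel :: 'a measure)"
 have "(norm (E B *V x))^2 = (norm (F B *V x))^2" using measure_sdist[OF E B, of x] measure_sdist[OF F B, of x] by (simp add: eq)
 then show "cin x (E B *V x) = cin x (F B *V x)" using projection_norm[OF pvm_projection[OF E B], of x] projection_norm[OF pvm_projection[OF F B], of x] by simp
qed

text \<open>The case distinction keeps the convention that the measure is 0 outside the Borel sets,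
  since the preimage of a set that is not Borel may be Borel.\<close>

definition push_pvm :: "('s::topological_space => 't::topological_space) => ('s set => 'a::chilbert_space bop) => 't set => 'a bop" where
 "push_pvm ph E = (%B. if B : sets borel then E (ph -` B) else 0)"

lemma push_pvm_apply: "B : sets borel ==> push_pvm ph E B = E (ph -` B)" by (simp add: push_pvm_def)

context
 fixes E :: "'s::topological_space set => 'a::chilbert_space bop" and ph :: "'s => 't::topological_space" assumes E: "pvm E" and ph [measurable]: "ph : bmeas"
begin

lemma vimage_borel: "B : sets borel ==> ph -` B : sets borel" using measurable_sets[OF ph, of B] by simp

lemma pvm_push: "pvm (push_pvm ph E)" unfolding projection_valued_measure_def
proof (intro conjI allI ballI impI)
 fix F :: "nat => 't set" and x
 assume F: "range F <= sets borel" "disjoint_family F"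
 have "(%n. E (ph -` F n) *V x) sums (E (UN n. ph -` F n) *V x)" by (rule pvm_sums[OF E]) (use F vimage_borel in "auto simp: disjoint_family_on_def")
 moreover have "(UN n. F n) : sets borel" using F by auto
 ultimately show "(%n. push_pvm ph E (F n) *V x) sums (push_pvm ph E (UN n. F n) *V x)" using F by (simp add: push_pvm_def vimage_UN subset_eq)
qed (auto simp: push_pvm_def pvm_projection[OF E] vimage_borel pvm_UNIV[OF E])

lemma spectral_distribution_push: "sdist (push_pvm ph E) x = distr (sdist E x) borel ph" by (rule measure_eqI)
   (auto simp: sets_sdist[OF pvm_push] emeasure_distr space_sdist[OF E]
    emeasure_sdist[OF pvm_push] emeasure_sdist[OF E] vimage_borel push_pvm_apply
    measurable_cong_sets[OF sets_sdist[OF E] refl])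

lemma SI_push: assumes "bborel f" shows "SI (push_pvm ph E) f = SI E (%s. f (ph s))"
proof (rule SI_eqI[OF pvm_push])
 fix x
 have "(\<integral>s. f s \<partial>sdist (push_pvm ph E) x) = (LINT s|sdist E x. f (ph s))" unfolding spectral_distribution_push by (rule integral_distr)
    (use bborel_measurable[OF assms] in "simp_all add: measurable_cong_sets[OF sets_sdist[OF E] refl]")
 then show "cin x (SI E (%s. f (ph s)) *V x) = (\<integral>s. f s \<partial>sdist (push_pvm ph E) x)"
  using bborel_comp[OF assms ph] by (simp add: SI_diag[OF E])
qed

end

text \<open>Dynkin induction. Multiplicativity belongs to the induction hypothesis: it makes the projections of
  disjoint sets orthogonal, and only then do their sums stay bounded.\<close>

lemma pvm_of_diagonal:
 fixes M :: "'i => 's::topological_space measure" and ph :: "'i => 'a::chilbert_space" and e :: "'s set => 'a bop"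
 assumes M: "!!i. sets (M i) = sets borel" "!!i. finite_measure (M i)" "!!i. measure (M i) UNIV = (norm (ph i))^2"
  and det: "!!A B. (!!i. cin (ph i) (A *V ph i) = cin (ph i) (B *V ph i)) ==> A = B" and gen: "Int_stable \<G>" "sigma_sets UNIV \<G> = sets borel"
  and e: "!!C i. C : \<G> ==> cin (ph i) (e C *V ph i) = of_real (measure (M i) C)"
  and mult: "!!C S A i. C : \<G> ==> S : sets borel ==> (!!i. cin (ph i) (A *V ph i) = of_real (measure (M i) S)) ==>
   cin (ph i) ((e C * A) *V ph i) = of_real (measure (M i) (C Int S))" shows "EX G. pvm G & (ALL C:\<G>. G C = e C)"
proof -
 interpret M: finite_measure "M i" for i by (rule M)
 define d where "d S A \<longleftrightarrow> (ALL i. cin (ph i) (A *V ph i) = of_real (measure (M i) S))" for S A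
 \<comment> \<open>Besides having the diagonal of S, A must multiply with every operator that has
   the diagonal of some Borel set as intersections do. The choice A' = A makes A idempotent.\<close>
 define m where "m S A \<longleftrightarrow> d S A & (ALL S' A'. S' : sets borel --> d S' A' --> d (S Int S') (A * A'))" for S A
 have uniq: "A = B" if "d S A" "d S B" for S A B using that unfolding d_def by (intro det) simp
 have d0: "d {} 0" by (simp add: d_def)
 have herm: "adj A = A" if "d S A" for S A proof (rule uniq[OF _ that])
  show "d S (adj A)" using that unfolding d_def by (metis cinner_adj_right cinner_commute complex_cnj_complex_of_real)
 qed
 have proj: "projection A" if "m S A" "S : sets borel" for S A using that uniq[of S "A * A" A] herm[of S A] unfolding m_def projection_def by (metis Int_absorb)
 have sums: "(%n. SUM j<n. cor (measure (M i) (F j))) ----> of_real (measure (M i) (UN j. F j))"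
  if "disjoint_family F" "range F <= sets borel" for F :: "nat => 's set" and i
  using M.finite_measure_UNION[of F i] that M(1) by (simp add: sums_def tendsto_of_real flip: of_real_sum)
 have disj_union: "EX A. m (UN j. F j) A & (ALL x. (%j. Re (cin x (T j *V x))) sums Re (cin x (A *V x)))"
  if F: "disjoint_family F" "range F <= sets borel" and T: "!!j. m (F j) (T j)" for F :: "nat => 's set" and T proof -
  have Fb: "F j : sets borel" for j using F(2) by blast
  have pT: "projection (T j)" for j by (rule proj[OF T Fb])
  have orth: "T j * T k = 0" if "j ~= k" for j k proof (rule uniq[OF _ d0])
   have "F j Int F k = {}" using disjoint_family_onD[OF F(1)] that by auto
   then show "d {} (T j * T k)" using T[of j] T[of k] Fb unfolding m_def by metis
  qed
  define P where "P n = (SUM j<n. T j)" for n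
  have PT: "P n * T k = 0" if "n <= k" for n k using that unfolding P_def by (induction n) (simp_all add: bop_distrib orth)
  have pP: "projection (P n)" for n proof (induction n)
   case 0
   show ?case by (auto simp: P_def projection_def bop_distrib intro: adj_eqI)
  next
   case (Suc n)
   have PS: "P (Suc n) = P n + T n" by (simp add: P_def)
   have "adj (P n * T n) = 0" by (simp add: PT adj_zero)
   then have "T n * P n = 0" using Suc pT by (simp add: adj_mult projection_def)
   then show ?case using Suc pT[of n] PT[of n n] unfolding PS projection_def by (simp add: adj_add bop_distrib)
  qed
  have PR: "Re (cin x (P n *V x)) = (SUM j<n. (norm (T j *V x))^2)" for x n
   unfolding P_def by (simp add: sum_bop_apply cinner_sum_right projection_norm[OF pT] Re_sum del: of_real_power)
  have Pb: "cmod (cin x (P n *V x)) <= 1 * (norm x)^2" for x n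
   using projection_norm_le[OF pP, of n x] by (simp add: projection_norm[OF pP] power_mono del: of_real_power)
  have Pc: "cin x (P n *V x) = of_real (SUM j<n. (norm (T j *V x))^2)" for x n unfolding PR[symmetric] by (simp add: projection_norm[OF pP] del: of_real_power)
  have summ: "summable (%j. (norm (T j *V x))^2)" for x
   using Pb[of x] unfolding Pc by (intro summableI_nonneg_bounded[of _ "(norm x)^2"]) (auto simp: abs_le_iff simp del: of_real_sum)
  have lim0: "(%n. cin x (P n *V x)) ----> of_real (\<Sum>j. (norm (T j *V x))^2)" for x unfolding Pc by (intro tendsto_of_real summable_LIMSEQ summ)
  then obtain A where A: "!!x. cin x (A *V x) = of_real (\<Sum>j. (norm (T j *V x))^2)" using weak_limit_bop[OF lim0 Pb] by blast
  have lim: "(%n. cin x (P n *V x)) ----> cin x (A *V x)" for x using lim0 by (simp only: A)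
  have dU: "d (UN j. F j) A" unfolding d_def proof
   fix i
   have "cin (ph i) (P n *V ph i) = (SUM j<n. cor (measure (M i) (F j)))" for n
    using T unfolding P_def m_def d_def by (simp add: sum_bop_apply cinner_sum_right)
   then show "cin (ph i) (A *V ph i) = of_real (measure (M i) (UN j. F j))" using lim[of "ph i"] sums[OF F, of i] by (simp add: LIMSEQ_unique)
  qed
  have "m (UN j. F j) A" unfolding m_def proof (intro conjI allI impI dU)
   fix S' A' assume S': "S' : sets borel" "d S' A'"
   show "d ((UN j. F j) Int S') (A * A')" unfolding d_def proof
    fix i
    have "cin (ph i) (P n *V A' *V ph i) = (SUM j<n. cor (measure (M i) (F j Int S')))" for n
     using T S' unfolding P_def m_def d_def by (simp add: sum_bop_apply cinner_sum_right)
    moreover have "(%n. SUM j<n. cor (measure (M i) (F j Int S'))) ----> of_real (measure (M i) (UN j. F j Int S'))"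
     using F S'(1) by (intro sums) (auto simp: disjoint_family_on_def)
    ultimately show "cin (ph i) ((A * A') *V ph i) = of_real (measure (M i) ((UN j. F j) Int S'))"
     using tendsto_cinner_of_diag[OF lim, of "ph i" "A' *V ph i"] by (simp add: LIMSEQ_unique)
   qed
  qed
  moreover have "(%j. Re (cin x (T j *V x))) sums Re (cin x (A *V x))" for x
   using summable_sums[OF summ] by (simp add: A projection_norm[OF pT] del: of_real_power)
  ultimately show ?thesis by blast
 qed
 have "EX A. m C A" if "C : sigma_sets UNIV \<G>" for C using gen(1) subset_UNIV[of \<G>, folded Pow_UNIV] that
 proof (induction rule: sigma_sets_induct_disjoint)
  case (basic C)
  then show ?case using e mult unfolding m_def d_def by blast
 next
  case empty
  show ?case by (rule exI[of _ 0]) (simp add: m_def d_def bop_distrib)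
 next
  case (compl C)
  then obtain T where T: "m C T" by blast
  have C: "C : sets borel" using compl.hyps gen by simp
  have diff: "measure (M i) ((UNIV - C) Int S) = measure (M i) S - measure (M i) (C Int S)" if "S : sets borel" for i S
   using M.finite_measure_Diff'[of S i C] C that M(1) by (simp add: Int_commute Diff_eq)
  have "d ((UNIV - C) Int S) ((1 - T) * A)" if "S : sets borel" "d S A" for S A
   using T that unfolding m_def d_def by (simp add: diff bop_distrib cinner_diff_right)
  moreover have "d (UNIV - C) (1 - T)" using T diff[of UNIV] unfolding m_def d_def by (simp add: cinner_diff_right cinner_self M)
  ultimately show ?case unfolding m_def by blast
 next
  case (union F)
  then obtain T where T: "!!j. m (F j) (T j)" by metis
  have "range F <= sets borel" using union(2) by (simp add: gen)
  then show ?case using disj_union[OF union(1) _ T] by blast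
 qed
 then obtain T where T: "!!C. C : sets borel ==> m C (T C)" unfolding gen(2) by metis
 define G where "G C = (if C : sets borel then T C else 0)" for C
 have G: "m C (G C)" if "C : sets borel" for C using T that by (simp add: G_def)
 have Gd: "d C (G C)" if "C : sets borel" for C using G[OF that] by (simp add: m_def)
 have "pvm G" proof (rule pvmI)
  show "projection (G B)" if "B : sets borel" for B by (rule proj[OF G[OF that] that])
  show "G UNIV = 1" by (rule uniq[OF Gd]) (simp_all add: d_def M cinner_self)
  show "(%n. Re (cin x (G (F n) *V x))) sums Re (cin x (G (\<Union> (range F)) *V x))"
   if F: "range F <= sets borel" "disjoint_family F" for F :: "nat => 's set" and x proof -
   have U: "(UN j. F j) : sets borel" using F(1) by blast
   have "m (F j) (G (F j))" for j using F(1) by (intro G) blast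
   from disj_union[OF F(2,1) this] obtain A where A: "m (UN j. F j) A" "ALL x. (%j. Re (cin x (G (F j) *V x))) sums Re (cin x (A *V x))" by blast
   have "A = G (UN j. F j)" using A(1) by (intro uniq[OF _ Gd[OF U]]) (simp add: m_def)
   then show ?thesis using A(2) by simp
  qed
 qed (simp add: G_def)
 moreover have "G C = e C" if "C : \<G>" for C using that gen(2) e by (intro uniq[OF Gd]) (auto simp: d_def)
 ultimately show ?thesis by blast
qed

section \<open>Self-adjoint operators from projection-valued measures\<close>

definition cutoff :: "nat => real set" where "cutoff n = {- real n..real n}"

definition idc :: "nat => real => complex" where "idc n s = of_real s * ind (cutoff n) s"

text \<open>The operator "integral of s dE(s)", with domain, described by its bounded truncations
  only: closedness, linearity and symmetry can be checked for each n.\<close>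

definition sgraph :: "(real set => 'a::chilbert_space bop) => ('a \<times> 'a) set" where "sgraph E = {(x, w). ALL n. E (cutoff n) *V w = SI E (idc n) *V x}"

lemma cut_borel [measurable, simp]: "cutoff n : sets borel" by (simp add: cutoff_def)

lemma bborel_idc [intro, simp]: "bborel (idc n)" unfolding idc_def [abs_def] by (rule bborelI[where K = "real n"]) (auto simp: cutoff_def indicator_def)

lemma bborel_indicator_cut [intro, simp]: "bborel (ind (cutoff n))" by auto

lemma eventually_in_cut: "\<forall>\<^sub>F n in sequentially. s : cutoff n"
proof -
 obtain N where N: "(abs s) <= real N" using real_arch_simple by blast
 show ?thesis by (rule eventually_sequentiallyI[of N]) (use N in "auto simp: cutoff_def")
qed

lemma tendsto_indicator_cut: "(%n. c * ind (cutoff n) s :: 'a::{real_normed_algebra_1}) ----> c"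
 by (rule tendsto_eventually) (use eventually_in_cut[of s] in "auto elim: eventually_mono")

lemma indicator_cut_mono: "m <= n ==> ind (cutoff m) s * ind (cutoff n) s = (ind (cutoff m) s :: complex)" by (auto simp: cutoff_def indicator_def)

lemma bborel_resolvent: "Im z ~= 0 ==> bborel (%s. 1 / (cor s - z))"
proof (rule bborelI[where K = "1 / (abs (Im z))"])
 assume z: "Im z ~= 0"
 fix s
 have "(abs (Im z)) <= cmod (cor s - z)" using abs_Im_le_cmod[of "cor s - z"] by simp
 then show "cmod (1 / (cor s - z)) <= 1 / (abs (Im z))" using z by (simp add: norm_divide frac_le)
qed measurable

context
 fixes E :: "real set => 'a::chilbert_space bop" assumes E: "pvm E"
begin

lemma cut_tendsto: "(%n. E (cutoff n) *V x) ----> x"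
proof -
 have "(%n. SI E (ind (cutoff n)) *V x) ----> SI E (%_. 1) *V x" by (rule SI_strong_limit[OF E, where K = 1])
    (use tendsto_indicator_cut[of 1] in "auto simp: indicator_def")
 then show ?thesis by (simp add: SI_indicator[OF E] SI_one[OF E])
qed

lemma cut_extI: assumes "!!n. E (cutoff n) *V x = E (cutoff n) *V y" shows "x = y" by (rule LIMSEQ_unique[OF cut_tendsto[of x]]) (simp add: assms cut_tendsto)

lemma sgraph_add: "(x, w) : sgraph E ==> (y, v) : sgraph E ==> (x + y, w + v) : sgraph E" by (simp add: sgraph_def)

lemma sgraph_diff: "(x, w) : sgraph E ==> (y, v) : sgraph E ==> (x - y, w - v) : sgraph E" by (simp add: sgraph_def)

lemma sgraph_scaleC: "(x, w) : sgraph E ==> (c *C x, c *C w) : sgraph E" by (simp add: sgraph_def)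

lemma sgraph_closed: "closed (sgraph E)"
proof -
 have "closed {p :: 'a \<times> 'a. E (cutoff n) *V snd p = SI E (idc n) *V fst p}" for n
  by (intro closed_Collect_eq bounded_linear.continuous_on[OF bounded_linear_apply] continuous_intros)
 then have "closed (\<Inter>n. {p :: 'a \<times> 'a. E (cutoff n) *V snd p = SI E (idc n) *V fst p})" by blast
 also have "(\<Inter>n. {p. E (cutoff n) *V snd p = SI E (idc n) *V fst p}) = sgraph E" by (auto simp: sgraph_def)
 finally show ?thesis .
qed

lemma sgraph_subspace: "subspace (sgraph E)"
proof (rule subspaceI)
 fix c :: real and p assume "p : sgraph E"
 then show "c *\<^sub>R p : sgraph E" by (cases p) (simp add: sgraph_def)
qed (auto simp: sgraph_add sgraph_def zero_prod_def)

lemma sgraph_unique: "(x, w) : sgraph E ==> (x, w') : sgraph E ==> w = w'" by (rule cut_extI) (simp add: sgraph_def)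

lemma sgraph_symmetric: assumes "(x, w) : sgraph E" "(y, v) : sgraph E" shows "cin w y = cin x v"
proof -
 have "cin (E (cutoff n) *V w) y = cin x (E (cutoff n) *V v)" for n proof -
  have "(%s. cnj (idc n s)) = idc n" by (auto simp: idc_def indicator_def)
  then have "adj (SI E (idc n)) = SI E (idc n)" by (simp add: SI_adj[OF E])
  then have "cin (SI E (idc n) *V x) y = cin x (SI E (idc n) *V y)" by (metis cinner_adj_right)
  then show ?thesis using assms by (simp add: sgraph_def)
 qed
 then have "(%n. cin (E (cutoff n) *V w) y) = (%n. cin x (E (cutoff n) *V v))" by auto
 moreover have "(%n. cin (E (cutoff n) *V w) y) ----> cin w y" "(%n. cin x (E (cutoff n) *V v)) ----> cin x v" by (intro tendsto_intros cut_tendsto)+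
 ultimately show ?thesis by (simp add: LIMSEQ_unique)
qed

text \<open>Vectors produced by a bounded function \<open>f\<close> for which \<open>s f(s)\<close> is bounded too.\<close>

lemma sgraph_integral: assumes "bborel f" "bborel g" "!!s. g s = of_real s * f s" shows "(SI E f *V x, SI E g *V x) : sgraph E"
proof -
 have "E (cutoff n) * SI E g = SI E (idc n) * SI E f" for n using assms(1,2)
  by (simp add: SI_indicator[OF E, symmetric] SI_mult[OF E, symmetric] assms(3) idc_def ac_simps)
 then show ?thesis by (simp add: sgraph_def flip: times_bop_apply)
qed

lemma sgraph_cut: "(E (cutoff n) *V x, SI E (idc n) *V x) : sgraph E" using sgraph_integral[of "ind (cutoff n)" "idc n" x]
 by (simp add: idc_def SI_indicator[OF E])

lemma dense_Domain_sgraph: "closure (Domain (sgraph E)) = UNIV"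
proof -
 have "x : closure (Domain (sgraph E))" for x unfolding closure_sequential
  by (rule exI[of _ "%n. E (cutoff n) *V x"]) (use cut_tendsto[of x] sgraph_cut in blast)
 then show ?thesis by blast
qed

lemma cmod_idc: "(cmod (idc n s))^2 = s\<^sup>2 * ind (cutoff n) s" by (simp add: idc_def norm_mult power_mult_distrib indicator_def)

lemma sgraph_integrable: assumes "(x, w) : sgraph E" shows "integrable (sdist E x) (%s. s\<^sup>2)"
proof (rule integrable_monotone_convergence[where f = "%n s. s\<^sup>2 * ind (cutoff n) s" and x = "(norm w)^2"])
 show "integrable (sdist E x) (%s. s\<^sup>2 * ind (cutoff n) s)" for n
 proof (rule finite_measure.integrable_const_bound[OF finite_measure_sdist[OF E], where B = "(real n)^2"])
  have "\<bar>s\<^sup>2 * ind (cutoff n) s\<bar> <= (real n)^2" for s by (cases "s : cutoff n") (auto simp: cutoff_def intro!: abs_le_square_iff[THEN iffD1])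
  then show "AE s in sdist E x. norm (s\<^sup>2 * ind (cutoff n) s) <= (real n)^2" by simp
 qed (simp add: E)
 show "AE s in sdist E x. mono (%n. s\<^sup>2 * ind (cutoff n) s)" by (intro AE_I2) (auto simp: mono_def cutoff_def indicator_def)
 show "AE s in sdist E x. (%n. s\<^sup>2 * ind (cutoff n) s) ----> s\<^sup>2" by (intro AE_I2 tendsto_indicator_cut)
 have "(%n. (norm (E (cutoff n) *V w))^2) ----> (norm w)^2" by (intro tendsto_intros cut_tendsto)
 moreover have "(norm (E (cutoff n) *V w))^2 = (LINT s|sdist E x. s\<^sup>2 * ind (cutoff n) s)" for n
  using assms norm_SI[OF E bborel_idc, of n x] by (simp add: sgraph_def cmod_idc)
 ultimately show "(%n. \<integral>s. s\<^sup>2 * ind (cutoff n) s \<partial>sdist E x) ----> (norm w)^2" by simp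
qed (simp add: E)

text \<open>The truncations \<open>v n\<close> are Cauchy, because their squared distances are
  bounded by the tail \<open>r n\<close> of the second moment; their limit is the value at
  x.\<close>

lemma Domain_sgraph: assumes int: "integrable (sdist E x) (%s. s\<^sup>2)" shows "EX w. (x, w) : sgraph E"
proof -
 define v where "v n = SI E (idc n) *V x" for n
 define r where "r n = (LINT s|sdist E x. s\<^sup>2 * (1 - ind (cutoff n) s))" for n
 have int_c: "integrable (sdist E x) (%s. s\<^sup>2 * (1 - ind (cutoff n) s))" for n
  by (rule Bochner_Integration.integrable_bound[OF int]) (auto simp: E indicator_def)
 have "r ----> (LINT s|sdist E x. 0)" unfolding r_def proof (rule integral_dominated_convergence[OF _ _ int])
  show "AE s in sdist E x. (%n. s\<^sup>2 * (1 - ind (cutoff n) s)) ----> 0" proof (rule AE_I2)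
   fix s :: real
   have "(%n. s\<^sup>2 * (1 - 1 * ind (cutoff n) s)) ----> s\<^sup>2 * (1 - 1)" by (intro tendsto_intros tendsto_indicator_cut)
   then show "(%n. s\<^sup>2 * (1 - ind (cutoff n) s)) ----> 0" by simp
  qed
 qed (auto simp: E indicator_def)
 then have r: "r ----> 0" by simp
 have dist: "(norm (v m - v n))^2 <= r n" if "n <= m" for m n proof -
  have "(norm (v m - v n))^2 = (norm (SI E (%s. idc m s - idc n s) *V x))^2" by (simp add: v_def SI_diff[OF E])
  also have "... = (LINT s|sdist E x. (cmod (idc m s - idc n s))^2)" by (rule norm_SI[OF E]) auto
  also have "... <= r n" unfolding r_def proof (rule integral_mono')
   show "(cmod (idc m s - idc n s))^2 <= s\<^sup>2 * (1 - ind (cutoff n) s)" for s using that by (auto simp: idc_def indicator_def cutoff_def)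
  qed (auto simp: int_c)
  finally show ?thesis .
 qed
 have "Cauchy v" proof (rule metric_CauchyI)
  fix e :: real assume "e > 0"
  then have "\<forall>\<^sub>F n in sequentially. r n < e\<^sup>2" using order_tendstoD(2)[OF r, of "e\<^sup>2"] by simp
  then obtain N where N: "!!n. n >= N ==> r n < e\<^sup>2" by (auto simp: eventually_sequentially)
  have lt: "dist (v m) (v n) < e" if "N <= n" "n <= m" for m n using dist[OF that(2)] N[OF that(1)] `e > 0`
   by (auto simp: dist_norm intro: power_less_imp_less_base[of _ 2])
  then have "dist (v m) (v n) < e" if "N <= n" "N <= m" for m n using lt[of n m] lt[of m n] that by (cases "n <= m") (simp_all add: dist_commute[of "v m"])
  then show "EX M. ALL m>=M. ALL n>=M. dist (v m) (v n) < e" by blast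
 qed
 then obtain w where w: "v ----> w" using Cauchy_convergent convergent_def by blast
 have "E (cutoff n) *V w = SI E (idc n) *V x" for n proof (rule LIMSEQ_unique)
  show "(%m. E (cutoff n) *V v m) ----> E (cutoff n) *V w" by (intro tendsto_intros w)
  have "E (cutoff n) *V v m = SI E (idc n) *V x" if "n <= m" for m proof -
   have "E (cutoff n) * SI E (idc m) = SI E (%s. ind (cutoff n) s * idc m s)" by (simp add: SI_indicator[OF E, symmetric] SI_mult[OF E])
   also have "(%s. ind (cutoff n) s * idc m s) = idc n" using indicator_cut_mono[OF that] by (auto simp: idc_def fun_eq_iff ac_simps)
   finally show ?thesis by (simp add: v_def flip: times_bop_apply)
  qed
  then show "(%m. E (cutoff n) *V v m) ----> SI E (idc n) *V x" by (intro tendsto_eventually eventually_sequentiallyI[of n])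
 qed
 then show ?thesis by (auto simp: sgraph_def)
qed

lemma sgraph_diag: assumes "(x, w) : sgraph E" shows "cin x w = cor (LINT s|sdist E x. s)"
proof (rule LIMSEQ_unique)
 interpret finite_measure "sdist E x" by (rule finite_measure_sdist[OF E])
 have int: "integrable (sdist E x) (%s. 1 + s\<^sup>2)" using sgraph_integrable[OF assms] by simp
 show "(%n. cin x (E (cutoff n) *V w)) ----> cin x w" by (intro tendsto_intros cut_tendsto)
 have le: "(abs s) <= 1 + s\<^sup>2" for s :: real using zero_le_power2[of "(abs s) - 1"] abs_ge_zero[of s] zero_le_power2[of s]
  unfolding power2_diff power2_abs by (simp del: zero_le_power2)
 have "cin x (E (cutoff n) *V w) = (LINT s|sdist E x. idc n s)" for n using assms SI_diag[OF E bborel_idc, of x n] by (simp add: sgraph_def)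
 moreover have "(%n. \<integral>s. idc n s \<partial>sdist E x) ----> (LINT s|sdist E x. cor s)" unfolding idc_def
 proof (rule integral_dominated_convergence[OF _ _ int])
  show "AE s in sdist E x. (%n. cor s * ind (cutoff n) s) ----> cor s" by (intro AE_I2 tendsto_indicator_cut)
  show "AE s in sdist E x. norm (cor s * ind (cutoff n) s) <= 1 + s\<^sup>2" for n using le by (intro AE_I2) (auto simp: indicator_def norm_mult)
 qed (auto simp: E)
 ultimately show "(%n. cin x (E (cutoff n) *V w)) ----> cor (LINT s|sdist E x. s)" by simp
qed

lemma is_spectral_measure_sgraph: "is_spectral_measure (sgraph E) E" unfolding is_spectral_measure_def using E Domain_sgraph sgraph_integrable sgraph_diag
 by (auto simp: Domain_iff)

text \<open>Polarization recovers the operator from its quadratic form on the (dense) domain.\<close>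

lemma is_spectral_measure_eq_sgraph: assumes X: "is_spectral_measure X E" and add: "!!p q. p : X ==> q : X ==> p + q : X"
  and scale: "!!c x w. (x, w) : X ==> (c *C x, c *C w) : X" shows "X = sgraph E"
proof -
 have dom: "Domain X = Domain (sgraph E)" using X is_spectral_measure_sgraph by (auto simp: is_spectral_measure_def)
 have diag: "cin x w = cin x w'" if "(x, w) : X" "(x, w') : sgraph E" for x w w' using X that sgraph_diag[OF that(2)] by (auto simp: is_spectral_measure_def)
 have sub: "(x, w) : sgraph E" if xw: "(x, w) : X" for x w proof -
  obtain w' where w': "(x, w') : sgraph E" using xw dom by blast
  have 0: "cin y (w - w') = 0" if "(y, v') : sgraph E" for y v' proof -
   have "y : Domain X" using DomainI[OF that] dom by simp
   then obtain v where v: "(y, v) : X" by (rule DomainE)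
   define d e where "d = w - w'" and "e = v - v'"
   \<comment> \<open>Both graphs are linear and have the same quadratic form, so they agree at y + c
     x; the cases c = 1 and c = i separate the two cross terms.\<close>
   have "cin (y + c *C x) (v + c *C w) = cin (y + c *C x) (v' + c *C w')" for c
    using add[OF v scale[OF xw]] by (intro diag sgraph_add sgraph_scaleC that w') simp
   then have *: "cin (y + c *C x) (e + c *C d) = 0" for c by (simp add: d_def e_def cinner_simps scaleC_diff_right algebra_simps)
   have "cin x d = 0" "cin y e = 0" using diag[OF xw w'] diag[OF v that] by (simp_all add: d_def e_def cinner_diff_right)
   with *[of 1] *[of \<i>] have "cin y d + cin x e = 0" "\<i> * cin y d - \<i> * cin x e = 0" by (simp_all add: cinner_simps)
   then have "cin y d = 0" by (simp add: algebra_simps add_eq_0_iff)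
   then show ?thesis by (simp add: d_def)
  qed
  have "closed {y. cin y (w - w') = 0}"
   by (intro closed_Collect_eq continuous_intros bounded_linear.continuous_on[OF bounded_bilinear.bounded_linear_left[OF bounded_bilinear_cinner]])
  moreover have "Domain (sgraph E) <= {y. cin y (w - w') = 0}" using 0 by blast
  ultimately have "closure (Domain (sgraph E)) <= {y. cin y (w - w') = 0}" by (intro closure_minimal)
  then have "cin (w - w') (w - w') = 0" by (auto simp: dense_Domain_sgraph)
  then have "w = w'" by (simp add: cinner_self)
  with w' show ?thesis by simp
 qed
 have "(x, w) : X" if "(x, w) : sgraph E" for x w proof -
  have "x : Domain X" using DomainI[OF that] dom by simp
  then obtain v where v: "(x, v) : X" by (rule DomainE)
  with sgraph_unique[OF that sub[OF v]] show ?thesis by simp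
 qed
 with sub show ?thesis by auto
qed

text \<open>One bounded operator, the resolvent at a nonreal point, determines the whole graph.
  Comparing unbounded operators thereby becomes comparing resolvents.\<close>

lemma sgraph_resolvent: assumes z: "Im z ~= 0"
 defines "R == SI E (%s. 1 / (cor s - z))" shows "(x, w) : sgraph E \<longleftrightarrow> x = R *V (w - z *C x)"
proof -
 have R: "(R *V y, y + z *C (R *V y)) : sgraph E" for y proof -
  have "(R *V y, SI E (%s. 1 + z * (1 / (cor s - z))) *V y) : sgraph E" unfolding R_def proof (rule sgraph_integral)
   fix s
   have "cor s ~= z" using z by auto
   then show "1 + z * (1 / (cor s - z)) = cor s * (1 / (cor s - z))" by (simp add: field_simps)
  qed (intro bborel_add bborel_mult bborel_const bborel_resolvent z)+
  moreover have "SI E (%s. 1 + z * (1 / (cor s - z))) = 1 + z *C R" unfolding R_def SI_scale[OF E bborel_resolvent[OF z], symmetric]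
    SI_one[OF E, symmetric] by (intro SI_add[OF E] bborel_mult bborel_const bborel_resolvent z)
  ultimately show ?thesis by simp
 qed
 show ?thesis proof
  assume xw: "(x, w) : sgraph E"
  \<comment> \<open>\<open>d\<close> would be an eigenvector of a symmetric operator for the nonreal
    eigenvalue z, hence it is 0.\<close>
  define d where "d = x - R *V (w - z *C x)"
  have "(d, z *C d) : sgraph E" using sgraph_diff[OF xw R[of "w - z *C x"]] by (simp add: d_def scaleC_diff_right)
  from sgraph_symmetric[OF this this] have "cnj z * cin d d = z * cin d d" by (simp add: cinner_simps)
  then have "d = 0" using z by (auto simp: cinner_self complex_eq_iff)
  then show "x = R *V (w - z *C x)" by (simp add: d_def)
 next
  assume "x = R *V (w - z *C x)"
  with R[of "w - z *C x"] show "(x, w) : sgraph E" by simp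
 qed
qed

end

section \<open>Weak limits of discrete measures on curves\<close>

text \<open>Measures on a curve are measures on its parameter interval, where
  \<open>tight_imp_convergent_subsubsequence\<close> provides a limit; its image under the curve is
  the measure sought. Total mass W is normalized away, so W = 0 is treated apart.\<close>

lemma discrete_weak_limit:
 fixes c :: "real => 'm::t2_space" and t :: "nat => 'i => real" and w :: "nat => 'i => real" assumes c: "continuous_on {0..1} c" and fin: "!!n. finite (I n)"
  and t: "!!n i. i : I n ==> t n i : {0..1}" and w: "!!n i. i : I n ==> 0 <= w n i" and W: "!!n. (SUM i:I n. w n i) = W"
 shows "EX s M. strict_mono s & sets M = sets borel & finite_measure M & measure M UNIV = W &
  emeasure M (- c ` {0..1}) = 0 & (ALL f::'m => complex. contn f --> (%n. SUM i:I (s n). of_real (w (s n) i) * f (c (t (s n) i))) ----> (LINT x|M. f x))"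
proof (cases "W = 0")
 case True
 have "w n i = 0" if "i : I n" for n i using W[of n] sum_nonneg_eq_0_iff[OF fin, of n "w n"] w that by (simp add: True)
 then have 0: "(SUM i:I n. cor (w n i) * f (c (t n i))) = 0" for n and f :: "'m => complex" by (intro sum.neutral) simp
 have "finite_measure (null_measure (borel :: 'm measure))" by (rule finite_measureI) simp
 moreover have "strict_mono (%n::nat. n)" by (simp add: strict_mono_def)
 ultimately show ?thesis by (intro exI[of _ "%n. n"] exI[of _ "null_measure borel"]) (simp add: True 0 measure_def)
next
 case False
 have "0 <= W" using W[of 0] w sum_nonneg by metis
 with False have Wpos: "W > 0" by simp
 define \<nu> where "\<nu> n = distr (point_measure (I n) (%i. ennreal (w n i / W))) borel (t n)" for n
 have tm [measurable]: "t n : borel_measurable (point_measure (I n) (%i. ennreal (w n i / W)))" for n by simp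
 have sum1: "(SUM i:I n. ennreal (w n i / W)) = 1" for n using w Wpos W[of n] by (subst sum_ennreal) (auto simp flip: sum_divide_distrib)
 have emeas: "emeasure (\<nu> n) A = 1" if "A : sets borel" "{0..1} <= A" for n A proof -
  have "t n -` A Int I n = I n" using t[of _ n] that by blast
  then show ?thesis using that fin[of n] by (simp add: \<nu>_def emeasure_distr space_point_measure emeasure_point_measure_finite sum1)
 qed
 have rd: "real_distribution (\<nu> n)" for n proof -
  have "prob_space (\<nu> n)" proof (rule prob_spaceI)
   have "space (\<nu> n) = UNIV" by (simp add: \<nu>_def)
   then show "emeasure (\<nu> n) (space (\<nu> n)) = 1" by (simp add: emeas)
  qed
  then show ?thesis by (simp add: real_distribution_def real_distribution_axioms_def \<nu>_def)
 qed
 have "tight \<nu>" unfolding tight_def proof (intro conjI allI impI rd)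
  fix e :: real assume "e > 0"
  have "measure (\<nu> n) {-1<..1} = 1" for n using emeas[of "{-1<..1}" n] by (simp add: measure_def subset_eq)
  with `e > 0` show "EX a b. a < b & (ALL n. 1 - e < measure (\<nu> n) {a<..b})" by (intro exI[of _ "-1"] exI[of _ 1]) auto
 qed
 then obtain r N where r: "strict_mono (r :: nat => nat)" and N: "real_distribution N" and conv: "weak_conv_m (\<nu> o r) N"
  using tight_imp_convergent_subsubsequence[of \<nu> "%n. n"] by (auto simp: strict_mono_def comp_def)
 interpret N: real_distribution N by fact
 \<comment> \<open>The curve is continuous on [0, 1] only. Clamping the parameter gives a continuous
   function on the line without changing the sums, whose nodes lie in [0, 1].\<close>
 define clamp :: "real => real" where "clamp u = max 0 (min 1 u)" for u
 have clamp: "clamp u : {0..1}" "u : {0..1} ==> clamp u = u" for u by (auto simp: clamp_def)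
 have cc: "contn (%u. c (clamp u))" by (rule continuous_on_compose2[OF c]) (auto simp: clamp_def intro!: continuous_intros)
 have cm [measurable]: "(%u. c (clamp u)) : bmeas" by (rule continuous_borel[OF cc])
 define M where "M = distr (density N (%_. ennreal W)) borel (%u. c (clamp u))"
 have "compact (c ` {0..1})" by (intro compact_continuous_image c) auto
 then have img: "c ` {0..1} : sets borel" by (simp add: compact_imp_closed)
 have M_UNIV: "emeasure M UNIV = ennreal W" using N.emeasure_space_1 by (simp add: M_def emeasure_distr emeasure_density nn_integral_cmult)
 have "finite_measure M" by (rule finite_measureI) (use M_UNIV in "simp add: M_def")
 moreover have "measure M UNIV = W" using M_UNIV Wpos by (simp add: measure_def)
 moreover have "emeasure M (- c ` {0..1}) = 0" proof -
  have "(%u. c (clamp u)) -` (- c ` {0..1}) = {}" using clamp(1) by auto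
  then show ?thesis using img by (simp add: M_def emeasure_distr)
 qed
 moreover have "(%n. SUM i:I (r n). of_real (w (r n) i) * f (c (t (r n) i))) ----> (LINT x|M. f x)" if f: "contn f" for f :: "'m => complex" proof -
  define g where "g u = f (c (clamp u))" for u
  have g: "contn g" unfolding g_def by (rule continuous_on_compose2[OF f cc]) auto
  have gm: "g : bmeas" by (rule continuous_borel[OF g])
  have "compact (g ` {0..1})" by (intro compact_continuous_image continuous_on_subset[OF g]) auto
  then have "bounded (g ` {0..1})" by (rule compact_imp_bounded)
  then obtain B where B: "!!u. u : {0..1} ==> cmod (g u) <= B" unfolding bounded_iff by blast
  have "g u = g (clamp u)" for u using clamp(2)[OF clamp(1)] by (simp add: g_def)
  then have B': "cmod (g u) <= B" for u using B[OF clamp(1)] by metis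
  have "(%n. \<integral>u. g u \<partial>(\<nu> o r) n) ----> (LINT u|N. g u)" by (rule weak_conv_imp_integral_bdd_continuous_conv[OF _ N conv _ B'])
     (use rd g in "auto simp: continuous_on_eq_continuous_at")
  then have "(%n. of_real W * (LINT u|\<nu> (r n). g u)) ----> of_real W * (LINT u|N. g u)" by (intro tendsto_mult_left) simp
  moreover have "of_real W * (LINT u|\<nu> n. g u) = (SUM i:I n. of_real (w n i) * f (c (t n i)))" for n proof -
   have "(LINT u|\<nu> n. g u) = (SUM i:I n. (w n i / W) *\<^sub>R g (t n i))" unfolding \<nu>_def using fin[of n] w[of _ n] Wpos gm
    by (simp add: integral_distr lebesgue_integral_point_measure_finite)
   also have "... = (SUM i:I n. of_real (w n i) * f (c (t n i))) / of_real W" unfolding sum_divide_distrib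
    by (intro sum.cong) (use t[of _ n] clamp in "auto simp: g_def scaleR_conv_of_real")
   finally show ?thesis using Wpos by simp
  qed
  moreover have "of_real W * (LINT u|N. g u) = (LINT x|M. f x)" proof -
   have "(LINT x|M. f x) = (LINT u|density N (%_. ennreal W). f (c (clamp u)))" unfolding M_def
    by (rule integral_distr) (use continuous_borel[OF f] in simp_all)
   also have "... = (LINT u|N. W *\<^sub>R g u)" unfolding g_def[symmetric] using gm Wpos by (subst integral_density) auto
   finally show ?thesis by (simp add: scaleR_conv_of_real)
  qed
  ultimately show ?thesis by simp
 qed
 ultimately show ?thesis using r by (intro exI[of _ r] exI[of _ M]) (auto simp: M_def)
qed

section \<open>Trigonometric polynomials in a unitary operator\<close>

text \<open>A relation rather than a map, because many expressions give the same function. For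
  unitary V it is single-valued by \<open>herglotz\<close>, which recovers the diagonal of the
  operator from the function.\<close>

inductive trig_rel :: "'a::chilbert_space bop => (real => complex) => 'a bop => bool" for V where one: "trig_rel V (%_. 1) 1"
| pos: "trig_rel V f A ==> trig_rel V (%t. cis t * f t) (V * A)"
| neg: "trig_rel V f A ==> trig_rel V (%t. cis (-t) * f t) (adj V * A)"
| add: "trig_rel V f A ==> trig_rel V g B ==> trig_rel V (%t. f t + g t) (A + B)"
| scale: "trig_rel V f A ==> trig_rel V (%t. c * f t) (c *C A)"

lemma trig_rel_mult: assumes "trig_rel V f A" "trig_rel V g B" shows "trig_rel V (%t. f t * g t) (A * B)" using assms(1)
proof induction
 case one
 then show ?case using assms(2) by simp
next
 case (pos f A)
 then show ?case using trig_rel.pos[OF pos.IH] by (simp add: mult.assoc)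
next
 case (neg f A)
 then show ?case using trig_rel.neg[OF neg.IH] by (simp add: mult.assoc)
next
 case (add f A g B)
 then show ?case using trig_rel.add[OF add.IH] by (simp add: distrib_right bop_distrib)
next
 case (scale f A c)
 then show ?case using trig_rel.scale[OF scale.IH, where c = c] by (simp add: mult.assoc bop_distrib)
qed

lemma trig_rel_polynomial: assumes "real_polynomial_function g" shows "EX A. trig_rel V (%t. cor (g (cis t))) A" using assms
proof induction
 case (linear f)
 interpret bounded_linear f by fact
 \<comment> \<open>These are the coefficients of f(1) cos t + f(i) sin t in terms of cis t and cis
   (-t).\<close>
 define a b where "a = (cor (f 1) - \<i> * of_real (f \<i>)) / 2" and "b = (cor (f 1) + \<i> * of_real (f \<i>)) / 2"
 have "cor (f (cis t)) = a * (cis t * 1) + b * (cis (-t) * 1)" for t proof -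
  have "cis t = cos t *\<^sub>R 1 + sin t *\<^sub>R \<i>" by (simp add: complex_eq_iff)
  then have "f (cis t) = cos t * f 1 + sin t * f \<i>" by (simp add: add scaleR)
  then show ?thesis by (simp add: a_def b_def complex_eq_iff field_simps)
 qed
 then show ?case
  using trig_rel.add[OF trig_rel.scale[OF trig_rel.pos[OF trig_rel.one], where c = a] trig_rel.scale[OF trig_rel.neg[OF trig_rel.one], where c = b]]
  by (simp only:) blast
next
 case (const c)
 then show ?case using trig_rel.scale[OF trig_rel.one, where c = "of_real c"] by auto
next
 case (add f g)
 then show ?case using trig_rel.add by fastforce
next
 case (mult f g)
 then show ?case using trig_rel_mult by fastforce
qed

text \<open>Continuous functions built from the distance to C decrease to its indicator, and
  Stone-Weierstrass on the circle approximates the k-th within 1 / (k + 1). The bound 2 is 1 for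
  these functions plus at most 1 for the error. The empty set is separate because
  \<open>infdist\<close> to it is 0.\<close>

lemma trig_rel_approx_closed:
 fixes V :: "'a::chilbert_space bop" assumes C: "closed C" shows "EX p A. (ALL k::nat. trig_rel V (p k) (A k)) & (ALL k t. cmod (p k t) <= 2) &
  (ALL t. (%k. p k t) ----> ind C (cis t))"
proof (cases "C = {}")
 case True
 then show ?thesis using trig_rel.scale[OF trig_rel.one, where V = V and c = 0] by (intro exI[of _ "%k t. 0"] exI[of _ "%k. 0"]) (simp add: bop_eqI)
next
 case False
 define f where "f k z = max 0 (1 - real k * infdist z C)" for k z
 have f_cont: "continuous_on S (f k)" for S k unfolding f_def by (intro continuous_intros)
 have f_lim: "(%k. f k z) ----> ind C z" for z proof (cases "z : C")
  case True
  then show ?thesis by (simp add: f_def)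
 next
  case z: False
  then have pos: "infdist z C > 0" using in_closed_iff_infdist_zero[OF C False, of z] infdist_nonneg[of z C] by linarith
  obtain K where K: "1 / infdist z C <= real K" using real_arch_simple by blast
  have "f k z = 0" if "k >= K" for k proof -
   have "1 / infdist z C <= real k" using K that by linarith
   then show ?thesis using pos by (simp add: f_def field_simps)
  qed
  then show ?thesis using z by (intro tendsto_eventually eventually_sequentiallyI[of K]) simp
 qed
 have "EX g. real_polynomial_function g & (ALL z:sphere 0 1. (abs (f k z - g z)) < 1 / Suc k)" for k
  by (rule Stone_Weierstrass_real_polynomial_function[of "sphere 0 1" "f k" "1 / Suc k"]) (auto simp: f_cont)
 then obtain g where g: "!!k. real_polynomial_function (g k)" "!!k z. z : sphere 0 1 ==> (abs (f k z - g k z)) < 1 / Suc k" by metis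
 obtain A where A: "!!k. trig_rel V (%t. cor (g k (cis t))) (A k)" using trig_rel_polynomial[OF g(1)] by metis
 have close: "(abs (f k (cis t) - g k (cis t))) < 1 / Suc k" for k t by (rule g) simp
 have "(abs (g k (cis t))) <= 2" for k t proof -
  have "0 <= f k (cis t)" "f k (cis t) <= 1" by (auto simp: f_def infdist_nonneg)
  moreover have "1 / real (Suc k) <= 1" by simp
  ultimately show ?thesis using close[of k t] by linarith
 qed
 moreover have "(%k. cor (g k (cis t))) ----> ind C (cis t)" for t proof -
  have "(%k. f k (cis t) - g k (cis t)) ----> 0" by (rule Lim_null_comparison[OF _ LIMSEQ_Suc[OF lim_1_over_n]])
     (auto simp del: of_nat_Suc intro!: always_eventually less_imp_le[OF close])
  from tendsto_diff[OF f_lim[of "cis t"] this] have "(%k. g k (cis t)) ----> ind C (cis t)" by simp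
  then have "(%k. cor (g k (cis t))) ----> cor (ind C (cis t))" by (rule tendsto_of_real)
  then show ?thesis by (cases "cis t : C") simp_all
 qed
 ultimately show ?thesis using A by (intro exI[of _ "%k t. cor (g k (cis t))"] exI[of _ A]) simp
qed

lemma continuous_trig_rel: "trig_rel V f A ==> contn f" by (induction rule: trig_rel.induct) (auto intro!: continuous_intros)

lemma bounded_trig_rel: "trig_rel V f A ==> EX K. ALL t. cmod (f t) <= K"
proof (induction rule: trig_rel.induct)
 case (add f A g B)
 then obtain K L where "!!t. cmod (f t) <= K" "!!t. cmod (g t) <= L" by blast
 then show ?case by (intro exI[of _ "K + L"]) (auto intro: norm_triangle_mono)
next
 case (scale f A c)
 then obtain K where "!!t. cmod (f t) <= K" by blast
 then show ?case by (intro exI[of _ "cmod c * K"]) (auto simp: norm_mult intro: mult_left_mono)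
qed (auto simp: norm_mult)

lemma bborel_trig_rel: "trig_rel V f A ==> bborel f" using bounded_trig_rel[of V f A] continuous_trig_rel[of V f A]
 by (auto simp: bborel_def intro: continuous_borel)

section \<open>The spectral theorem\<close>

lemma sum_roots_of_unity:
 fixes N a b :: nat assumes N: "N > 0"
 defines "om == %m::nat. cis (2 * pi * m / N)" shows "(SUM j<N. (om a / om b) ^ j) = (if a mod N = b mod N then of_nat N else 0)"
proof -
 have om: "om m = exp (2 * of_real pi * \<i> * of_nat m / of_nat N)" for m by (simp add: om_def cis_conv_exp mult_ac)
 have nz: "om m ~= 0" for m by (simp add: om_def)
 have pow: "om m ^ N = 1" for m proof -
  have "real N * (2 * pi * real m / real N) = 2 * pi * real m" using N by simp
  then show ?thesis unfolding om_def Complex.DeMoivre by (simp only: cis_multiple_2pi Ints_of_nat)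
 qed
 have eq: "om a / om b = 1 \<longleftrightarrow> a mod N = b mod N" using complex_root_unity_eq[of N a b] N nz[of b] by (simp add: om field_simps)
 show ?thesis proof (cases "om a / om b = 1")
  case False
  have "(om a / om b) ^ N = 1" unfolding power_divide pow by simp
  then have "(SUM j<N. (om a / om b) ^ j) = 0" using geometric_sum[OF False, of N] by (simp only:) simp
  moreover have "a mod N ~= b mod N" using False eq by blast
  ultimately show ?thesis by (simp only: if_False)
 qed (use eq in simp)
qed

context
 fixes V :: "'a::chilbert_space bop" assumes V: "V * adj V = 1" "adj V * V = 1"
begin

lemma unitary_cinner_power: "cin (V ^ a *V x) (V ^ (a + k) *V y) = cin x (V ^ k *V y)"
proof (induction a)
 case (Suc a)
 have "cin (V *V u) (V *V v) = cin u v" for u v by (metis V(2) cinner_adj_right one_bop_apply times_bop_apply)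
 with Suc show ?case by simp
qed simp

lemma unitary_norm_power: "norm (V ^ a *V x) = norm x"
proof -
 have "cor ((norm (V ^ a *V x))^2) = cor ((norm x)^2)" using unitary_cinner_power[of a x 0 x] by (simp add: cinner_self)
 then have "(norm (V ^ a *V x))^2 = (norm x)^2" by (simp only: of_real_eq_iff)
 then show ?thesis by simp
qed

definition vpow :: "int => 'a bop" where "vpow k = (if k >= 0 then V ^ nat k else adj V ^ nat (- k))"

lemma vpow_add_1: "vpow (k + 1) = vpow k * V"
proof (cases "k >= 0")
 case True
 then show ?thesis by (simp add: vpow_def nat_add_distrib power_commutes)
next
 case False
 define n where "n = nat (- k) - 1"
 have k: "nat (- k) = Suc n" "nat (- (k + 1)) = n" using False by (auto simp: n_def)
 have "vpow k * V = adj V ^ n * (adj V * V)" using False k by (simp add: vpow_def power_Suc2 mult.assoc del: power_Suc)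
 also have "... = vpow (k + 1)" proof (cases "k = -1")
  case True
  then show ?thesis using k by (simp add: vpow_def V)
 next
  case False
  then show ?thesis using k `~ k >= 0` by (simp add: vpow_def V)
 qed
 finally show ?thesis ..
qed

lemma vpow_diff_1: "vpow (k - 1) = vpow k * adj V" using vpow_add_1[of "k - 1"] by (simp add: mult.assoc V)

lemma cinner_vpow_minus: "cin x (vpow (- k) *V x) = cnj (cin x (vpow k *V x))"
proof -
 have adj: "adj (A ^ n) = adj A ^ n" for A :: "'a bop" and n by (induction n) (simp_all add: adj_mult power_commutes)
 have "adj (vpow k) = vpow (- k)" by (cases "k = 0") (auto simp: vpow_def adj)
 then show ?thesis by (metis cinner_adj_right cinner_commute)
qed

text \<open>Herglotz' theorem, with \<open>N\<close>-th roots of unity in place of the Fejer kernel.\<close>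

lemma herglotz: "EX M::real measure. sets M = sets borel & finite_measure M & measure M UNIV = (norm x)^2 &
  (ALL f A. trig_rel V f A --> (LINT t|M. f t) = cin x (A *V x))"
proof -
 define om where "om n m = cis (2 * pi * real m / real (Suc n))" for n m :: nat
 \<comment> \<open>The weight of the j-th root of unity is the squared norm of a discrete Fourier
   coefficient of the orbit x, V x, ..., V^n x; so it is nonnegative.\<close>
 define w where "w n j = (norm (SUM l<Suc n. (cnj (om n j)) ^ l *C (V ^ l *V x)) / Suc n)^2" for n j
 have om_pow: "om n j ^ l = om n l ^ j" for n j l unfolding om_def Complex.DeMoivre by (rule arg_cong[where f = cis]) (simp add: mult_ac)
 have om_cnj: "cnj (om n j) = 1 / om n j" for n j by (simp add: om_def cis_cnj divide_inverse)
 have om_add: "om n (a + b) = om n a * om n b" for n a b by (simp add: om_def cis_mult add_divide_distrib distrib_left)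
 define S where "S n k = (SUM j<Suc n. of_real (w n j) * om n k ^ j)" for n k
 \<comment> \<open>Orthogonality of the roots of unity turns the k-th moment into the cyclic
   autocorrelation of the orbit.\<close>
 have S: "S n k = (SUM a<Suc n. cin (V ^ a *V x) (V ^ ((a + k) mod Suc n) *V x)) / of_nat (Suc n)" for n k proof -
  define N where "N = Suc n"
  have rou: "(SUM j<N. (om n a / om n b) ^ j) = (if a mod N = b mod N then of_nat N else 0)" for a b unfolding om_def N_def by (rule sum_roots_of_unity) simp
  have w_eq: "cor (w n j) = (SUM a<N. SUM b<N. om n j ^ a * cnj (om n j) ^ b * cin (V ^ a *V x) (V ^ b *V x)) / (of_nat N)^2" for j proof -
   define v where "v = (SUM l<N. (cnj (om n j)) ^ l *C (V ^ l *V x))"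
   have "cor (w n j) = cor ((norm v)^2) / (of_nat N)^2" unfolding w_def v_def N_def power_divide of_real_divide of_real_power of_real_of_nat_eq ..
   also have "cor ((norm v)^2) = cin v v" by (simp only: cinner_self)
   also have "cin v v = (SUM a<N. SUM b<N. om n j ^ a * cnj (om n j) ^ b * cin (V ^ a *V x) (V ^ b *V x))"
    unfolding v_def cinner_sum_left cinner_sum_right by (subst sum.swap) (simp add: cinner_scaleC_left cinner_scaleC_right mult_ac)
   finally show ?thesis .
  qed
  have om_eq: "om n j ^ a * cnj (om n j) ^ b * om n k ^ j = (om n (a + k) / om n b) ^ j" for a b j
   by (simp add: om_cnj om_add power_divide power_mult_distrib om_pow[of n j])
  have "of_real (w n j) * om n k ^ j = (SUM a<N. SUM b<N. (om n (a + k) / om n b) ^ j * cin (V ^ a *V x) (V ^ b *V x)) / (of_nat N)^2" for j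
   unfolding w_eq times_divide_eq_left sum_distrib_right om_eq[symmetric] by (simp only: mult_ac)
  then have "S n k = (SUM j<N. (SUM a<N. SUM b<N. (om n (a + k) / om n b) ^ j * cin (V ^ a *V x) (V ^ b *V x))) / (of_nat N)^2"
   by (simp add: S_def N_def sum_divide_distrib del: sum.lessThan_Suc)
  also have "(SUM j<N. (SUM a<N. SUM b<N. (om n (a + k) / om n b) ^ j * cin (V ^ a *V x) (V ^ b *V x)))
   = (SUM a<N. SUM b<N. (SUM j<N. (om n (a + k) / om n b) ^ j) * cin (V ^ a *V x) (V ^ b *V x))"
   unfolding sum_distrib_right by (subst sum.swap, rule sum.cong[OF refl], subst sum.swap, rule refl)
  also have "... = (SUM a<N. SUM b<N. if b = (a + k) mod N then of_nat N * cin (V ^ a *V x) (V ^ b *V x) else 0)" unfolding rou by (intro sum.cong refl) auto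
  also have "... = of_nat N * (SUM a<N. cin (V ^ a *V x) (V ^ ((a + k) mod N) *V x))" by (simp add: sum_distrib_left N_def del: sum.lessThan_Suc)
  finally show ?thesis by (simp add: N_def power2_eq_square field_simps del: sum.lessThan_Suc of_nat_Suc)
 qed
 have lim: "(%n. S n k) ----> cin x (V ^ k *V x)" for k proof -
  \<comment> \<open>Only the last k of the n + 1 indices wrap around. Each of these terms is wrong
    by at most 2 |x|^2, all others are exact.\<close>
  have bnd: "cmod (S n k - cin x (V ^ k *V x)) <= 2 * real k * (norm x)^2 * (1 / real (Suc n))" for n proof -
   define d where "d a = cin (V ^ a *V x) (V ^ ((a + k) mod Suc n) *V x) - cin x (V ^ k *V x)" for a
   have d0: "d a = 0" if "a < Suc n - k" for a using that unitary_cinner_power[of a x k x] by (simp add: d_def)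
   have "cmod (cin u v) <= (norm x)^2" if "norm u = norm x" "norm v = norm x" for u v :: 'a using cmod_cinner_le[of u v] that by (simp add: power2_eq_square)
   then have d1: "cmod (d a) <= 2 * (norm x)^2" for a unfolding d_def by (intro order_trans[OF norm_triangle_ineq4]) (smt (verit) unitary_norm_power)
   have "S n k - cin x (V ^ k *V x) = (SUM a<Suc n. d a) / of_nat (Suc n)"
    by (simp add: S d_def sum_subtractf diff_divide_distrib del: sum.lessThan_Suc of_nat_Suc)
   then have "cmod (S n k - cin x (V ^ k *V x)) = cmod (SUM a<Suc n. d a) / real (Suc n)" by (simp add: norm_divide del: sum.lessThan_Suc of_nat_Suc)
   also have "(SUM a<Suc n. d a) = (SUM a:{Suc n - k..<Suc n}. d a)" by (rule sum.mono_neutral_right) (auto intro!: d0)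
   also have "cmod ... <= (SUM a:{Suc n - k..<Suc n}. 2 * (norm x)^2)" by (rule sum_norm_le) (rule d1)
   also have "... <= 2 * real k * (norm x)^2" by (auto intro!: mult_right_mono)
   finally show ?thesis by (simp add: divide_right_mono del: of_nat_Suc)
  qed
  have "(%n. 2 * real k * (norm x)^2 * (1 / real (Suc n))) ----> 0" by (rule tendsto_mult_right_zero[OF LIMSEQ_Suc[OF lim_1_over_n]])
  then have "(%n. S n k - cin x (V ^ k *V x)) ----> 0" by (rule Lim_null_comparison[OF always_eventually[OF allI[OF bnd]]])
  then show ?thesis by (rule LIM_zero_cancel)
 qed
 have W: "(SUM j<Suc n. w n j) = (norm x)^2" for n proof -
  have "cor (SUM j<Suc n. w n j) = S n 0" by (simp add: S_def om_def del: sum.lessThan_Suc)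
  also have "... = (SUM a<Suc n. cor ((norm x)^2)) / of_nat (Suc n)"
   unfolding S by (intro arg_cong2[where f = "(/)"] sum.cong) (auto simp: cinner_self unitary_norm_power)
  also have "... = cor ((norm x)^2)" by (simp del: of_nat_Suc)
  finally show ?thesis by (simp only: of_real_eq_iff)
 qed
 have c1: "continuous_on {0..1} (%u::real. 2 * pi * u)" by (intro continuous_intros)
 have f1: "finite {..<Suc n}" for n by simp
 have f2: "real j / real (Suc n) : {0..1}" if "j : {..<Suc n}" for n j using that by simp
 have f3: "0 <= w n j" for n j by (simp add: w_def)
 have "EX s M. strict_mono s & sets M = sets borel & finite_measure M &
  measure M UNIV = (norm x)^2 & emeasure M (- (%u. 2 * pi * u) ` {0..1}) = 0 & (ALL f::real => complex. contn f -->
   (%n. SUM j<Suc (s n). of_real (w (s n) j) * f (2 * pi * (real j / real (Suc (s n))))) ----> (LINT t|M. f t))"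
  by (rule discrete_weak_limit[where I = "%n. {..<Suc n}" and t = "%n j. real j / real (Suc n)", OF c1 f1 f2 f3 W])
 then obtain s and M :: "real measure" where s: "strict_mono (s :: nat => nat)" and M: "sets M = sets borel" "finite_measure M" "measure M UNIV = (norm x)^2"
  and conv0: "ALL f::real => complex. contn f --> (%n. SUM j<Suc (s n). of_real (w (s n) j) * f (2 * pi * (real j / real (Suc (s n))))) ----> (LINT t|M. f t)"
  by (elim exE conjE) (rule that, assumption+)
 note conv = conv0[rule_format]
 interpret finite_measure M by fact
 have nn: "(LINT t|M. cis (real k * t)) = cin x (V ^ k *V x)" for k proof (rule LIMSEQ_unique)
  show "(%n. S (s n) k) ----> (LINT t|M. cis (real k * t))" using conv[of "%t. cis (real k * t)"]
   unfolding S_def om_def Complex.DeMoivre by (simp add: mult_ac continuous_intros del: sum.lessThan_Suc)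
  show "(%n. S (s n) k) ----> cin x (V ^ k *V x)" using LIMSEQ_subseq_LIMSEQ[OF lim s] by (simp add: comp_def)
 qed
 have int: "(LINT t|M. cis (of_int k * t)) = cin x (vpow k *V x)" for k proof (cases "k >= 0")
  case True
  then show ?thesis using nn[of "nat k"] by (simp add: vpow_def)
 next
  case False
  then have "(LINT t|M. cis (of_int k * t)) = (LINT t|M. cnj (cis (real (nat (- k)) * t)))" by (simp add: cis_cnj)
  also have "... = cnj (cin x (vpow (- k) *V x))" using False nn[of "nat (- k)"] by (simp add: vpow_def)
  finally show ?thesis by (simp flip: cinner_vpow_minus)
 qed
 have Mint: "integrable M f" if "bborel f" for f :: "real => complex"
  using that M(1) unfolding bborel_def by (auto intro!: integrable_const_bound AE_I2 simp: measurable_cong_sets[OF M(1) refl])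
 have bb: "bborel (%t. cis (of_int k * t))" for k by (rule bborelI[where K = 1]) (auto intro!: continuous_borel continuous_intros)
 \<comment> \<open>The extra factor with arbitrary k carries the induction: \<open>pos\<close> and
   \<open>neg\<close> put cis (t) or cis (-t) in front, which only shifts k by one.\<close>
 have "ALL k. (LINT t|M. cis (of_int k * t) * f t) = cin x (vpow k *V A *V x)" if "trig_rel V f A" for f A using that proof induction
  case one
  then show ?case by (simp add: int)
 next
  case (pos f A)
  have "cis (of_int k * t) * (cis t * f t) = cis (of_int (k + 1) * t) * f t" for k t by (simp add: cis_mult distrib_right flip: mult.assoc)
  then show ?case using pos.IH by (simp only:) (simp add: vpow_add_1)
 next
  case (neg f A)
  have "cis (of_int k * t) * (cis (- t) * f t) = cis (of_int (k - 1) * t) * f t" for k t by (simp add: cis_mult left_diff_distrib flip: mult.assoc)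
  then show ?case using neg.IH by (simp only:) (simp add: vpow_diff_1)
 next
  case (add f A g B)
  have "integrable M (%t. cis (of_int k * t) * f t)" "integrable M (%t. cis (of_int k * t) * g t)" for k
   using add.hyps by (intro Mint bborel_mult bb bborel_trig_rel; blast)+
  then show ?case using add.IH by (simp add: distrib_left cinner_add_right)
 next
  case (scale f A c)
  have "cis (of_int k * t) * (c * f t) = c * (cis (of_int k * t) * f t)" for k t by simp
  then show ?case using scale.IH by (simp only:) (simp add: cinner_scaleC_right)
 qed
 from this[THEN spec, of _ _ 0] show ?thesis using M by (intro exI[of _ M]) (simp add: vpow_def)
qed

end

section \<open>Spectral measures of unitary operators\<close>

lemma finite_measure_integral_tendsto:
 fixes F :: "nat => 's::topological_space => complex" assumes M: "finite_measure M" "sets M = sets borel"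
  and F: "!!i. F i : bmeas" "!!i s. cmod (F i s) <= K" "!!s. (%i. F i s) ----> f s" and f: "f : bmeas"
 shows "(%i. \<integral>s. F i s \<partial>M) ----> (LINT s|M. f s)"
proof (rule integral_dominated_convergence[where w = "%_. K"])
 show "integrable M (%_. K)" using finite_measure.integrable_const[OF M(1)] .
qed (use F f in "auto simp: measurable_cong_sets[OF M(2) refl]")

lemma measure_eqI_closed:
 fixes M N :: "'s::topological_space measure" assumes "sets M = sets borel" "sets N = sets borel" "finite_measure M"
  and eq: "!!C. closed C ==> emeasure M C = emeasure N C" shows "M = N"
proof (rule measure_eqI_generator_eq[where E = "Collect closed" and \<Omega> = UNIV and A = "%_. UNIV"])
 show "sets M = sigma_sets UNIV (Collect closed)" "sets N = sigma_sets UNIV (Collect closed)" using assms(1,2) by (simp_all add: borel_eq_closed)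
 show "emeasure M UNIV ~= \<infinity>" using assms(3) finite_measure.emeasure_finite by auto
qed (auto simp: Int_stable_def eq)

lemma integral_indicator_complex: assumes "finite_measure M" "A : sets M" shows "(LINT s|M. ind A s) = cor (measure M A)"
proof -
 have "(ind A :: _ => complex) = (%s. cor (ind A s))" by (auto simp: indicator_def)
 then have "(LINT s|M. ind A s) = cor (LINT s|M. ind A s)" by (simp only: integral_complex_of_real)
 then show ?thesis using assms by (simp add: Int_absorb2 sets.sets_into_space)
qed

text \<open>The identity, cut off outside the circle so that it is a bounded Borel function on the
  plane.\<close>

definition sphere_id :: "complex => complex" where "sphere_id z = (if cmod z = 1 then z else 0)"

lemma bborel_sphere_id: "bborel sphere_id" unfolding sphere_id_def[abs_def] by (rule bborelI[where K = 1]) auto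

text \<open>The Herglotz measures of all vectors, moved to the circle, form the diagonal of the
  measure sought, which \<open>pvm_of_diagonal\<close> assembles. Closed sets generate, since their
  projections are weak limits of trigonometric polynomials in V.\<close>

lemma unitary_pvm:
 fixes V :: "'a::chilbert_space bop" assumes V: "V * adj V = 1" "adj V * V = 1" shows "EX G. pvm G & G (sphere 0 1) = 1 & SI G sphere_id = V"
proof -
 obtain N :: "'a => real measure" where N: "!!x. sets (N x) = sets borel" "!!x. finite_measure (N x)" "!!x. measure (N x) UNIV = (norm x)^2"
  and trig: "!!x f A. trig_rel V f A ==> (LINT t|N x. f t) = cin x (A *V x)" using herglotz[OF V] by metis
 interpret N: finite_measure "N x" for x by (rule N)
 have cis_m [measurable]: "cis : bmeas" by (intro continuous_borel continuous_intros)
 have cis_N: "cis : measurable (N x) borel" for x by (simp add: measurable_cong_sets[OF N(1) refl])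
 define M where "M x = distr (N x) borel cis" for x
 have M_sets: "sets (M x) = sets borel" for x by (simp add: M_def)
 have M_measure: "measure (M x) B = measure (N x) (cis -` B)" if "B : sets borel" for B x unfolding M_def using that sets_eq_imp_space_eq[OF N(1), of x]
  by (simp add: measure_distr[OF cis_N])
 have M_UNIV: "measure (M x) UNIV = (norm x)^2" for x by (simp add: M_measure N)
 have M_fin: "finite_measure (M x)" for x unfolding M_def by (rule N.finite_measure_distr[OF cis_N])
 have ind: "(LINT t|N x. ind C (cis t)) = cor (measure (M x) C)" if "C : sets borel" for C x proof -
  have "(%t. ind C (cis t) :: complex) = ind (cis -` C)" by (auto simp: indicator_def)
  moreover have "cis -` C : sets (N x)" using measurable_sets[OF cis_m that] by (simp add: N)
  ultimately show ?thesis by (simp add: integral_indicator_complex[OF N(2)] M_measure that)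
 qed
 have ind_m: "(%t. ind C (cis t) :: complex) : bmeas" if "C : sets borel" for C by (rule measurable_compose[OF cis_m]) (use that in simp)
 have approx: "EX p A. (ALL k::nat. trig_rel V (p k) (A k)) & (ALL k t. cmod (p k t) <= 2) &
  (ALL t. (%k. p k t) ----> ind C (cis t)) & (ALL x. (%k. cin x (A k *V x)) ----> of_real (measure (M x) C))" if C: "closed C" for C proof -
  obtain p A where pA: "!!k::nat. trig_rel V (p k) (A k)" "!!k t. cmod (p k t) <= 2" "!!t. (%k. p k t) ----> ind C (cis t)"
   using trig_rel_approx_closed[OF C, of V] by blast
  have "(%k. cin x (A k *V x)) ----> of_real (measure (M x) C)" for x unfolding trig[OF pA(1), symmetric] ind[OF borel_closed[OF C], symmetric]
   by (rule finite_measure_integral_tendsto[OF N(2) N(1) bborel_measurable[OF bborel_trig_rel[OF pA(1)]] pA(2,3) ind_m]) (use C in simp)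
  with pA show ?thesis by (intro exI[of _ p] exI[of _ A]) simp
 qed
 have bnd: "cmod (cin x (A *V x)) <= 2 * (norm x)^2" if "trig_rel V p A" "!!t. cmod (p t) <= 2" for x p A proof -
  have "cmod (LINT t|N x. p t) <= (LINT t|N x. cmod (p t))" by (rule integral_norm_bound)
  also have "... <= (LINT t|N x. 2)" proof (rule integral_mono')
  qed (use that in auto)
  also have "... = 2 * (norm x)^2" using N(3)[of x] sets_eq_imp_space_eq[OF N(1), of x] by simp
  finally show ?thesis by (simp add: trig[OF that(1)])
 qed
 have "EX T. ALL x. cin x (T *V x) = of_real (measure (M x) C)" if C: "closed C" for C proof -
  obtain p A where pA: "!!k::nat. trig_rel V (p k) (A k)" "!!k t. cmod (p k t) <= 2" and lim: "!!x. (%k. cin x (A k *V x)) ----> of_real (measure (M x) C)"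
   using approx[OF C] by blast
  show ?thesis by (rule weak_limit_bop[OF lim bnd[OF pA]])
 qed
 then obtain e where e: "!!C x. closed C ==> cin x (e C *V x) = of_real (measure (M x) C)" by metis
 \<comment> \<open>The limits are taken one after the other, first for C and then for D, because
   weak convergence does not survive two varying factors.\<close>
 have e_mult: "cin x (e C *V e D *V x) = of_real (measure (M x) (C Int D))" if C: "closed C" and D: "closed D" for C D x proof -
  have CB: "C : sets borel" "D : sets borel" using C D by auto
  obtain p A where p: "!!k::nat. trig_rel V (p k) (A k)" "!!k t. cmod (p k t) <= 2" "!!t. (%k. p k t) ----> ind C (cis t)"
   and plim: "!!x. (%k. cin x (A k *V x)) ----> of_real (measure (M x) C)" using approx[OF C] by blast
  obtain q B where q: "!!k::nat. trig_rel V (q k) (B k)" "!!k t. cmod (q k t) <= 2" "!!t. (%k. q k t) ----> ind D (cis t)"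
   and qlim: "!!x. (%k. cin x (B k *V x)) ----> of_real (measure (M x) D)" using approx[OF D] by blast
  have pm: "p k : bmeas" and qm: "q k : bmeas" for k
   by (rule bborel_measurable[OF bborel_trig_rel[OF p(1)]], rule bborel_measurable[OF bborel_trig_rel[OF q(1)]])
  have 1: "cin x (e C *V B m *V x) = (LINT t|N x. ind C (cis t) * q m t)" for m proof (rule LIMSEQ_unique)
   have "!!x. (%k. cin x (A k *V x)) ----> cin x (e C *V x)" using plim by (simp add: e C)
   from tendsto_cinner_of_diag[OF this] show "(%k. cin x (A k *V B m *V x)) ----> cin x (e C *V B m *V x)" .
   have "cin x (A k *V B m *V x) = (LINT t|N x. p k t * q m t)" for k using trig[OF trig_rel_mult[OF p(1) q(1)], of x k m] by simp
   moreover have "(%k. \<integral>t. p k t * q m t \<partial>N x) ----> (LINT t|N x. ind C (cis t) * q m t)"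
   proof (rule finite_measure_integral_tendsto[OF N(2) N(1), where K = 4])
    show "cmod (p k t * q m t) <= 4" for k t unfolding norm_mult using mult_mono[OF p(2)[of k t] q(2)[of m t]] by simp
   qed (use pm qm p(3) ind_m[OF CB(1)] in "auto intro: tendsto_mult_right")
   ultimately show "(%k. cin x (A k *V B m *V x)) ----> (LINT t|N x. ind C (cis t) * q m t)" by simp
  qed
  show ?thesis proof (rule LIMSEQ_unique)
   have "!!x. (%m. cin x (B m *V x)) ----> cin x (e D *V x)" using qlim by (simp add: e D)
   from tendsto_cinner_of_diag[OF this, of "adj (e C) *V x" x]
   show "(%m. cin x (e C *V B m *V x)) ----> cin x (e C *V e D *V x)" by (simp add: cinner_adj_left)
   have "(%m. \<integral>t. ind C (cis t) * q m t \<partial>N x) ----> (LINT t|N x. ind C (cis t) * ind D (cis t))"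
   proof (rule finite_measure_integral_tendsto[OF N(2) N(1), where K = 2])
    show "cmod (ind C (cis t) * q m t) <= 2" for m t using q(2)[of m t] by (simp add: norm_mult indicator_def)
   qed (use qm q(3) ind_m CB in "auto intro!: tendsto_mult_left borel_measurable_times")
   then show "(%m. cin x (e C *V B m *V x)) ----> of_real (measure (M x) (C Int D))" using CB by (simp add: 1 ind flip: indicator_inter_arith)
  qed
 qed
 have closed_gen: "Int_stable (Collect closed :: complex set set)" "sigma_sets UNIV (Collect closed :: complex set set) = sets borel"
  by (auto simp: Int_stable_def borel_eq_closed)
 have M_eqI: "M x = K" if K: "sets K = sets borel" "!!C. closed C ==> emeasure (M x) C = emeasure K C" for x K
 proof (rule measure_eqI_generator_eq[where E = "Collect closed" and \<Omega> = UNIV and A = "%_. UNIV", OF closed_gen(1)])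
  show "emeasure (M x) UNIV ~= \<infinity>" using finite_measure.emeasure_finite[OF M_fin] by simp
 qed (use K in "auto simp: closed_gen(2) M_sets")
 have M_emeasure: "emeasure (M x) C = ennreal (measure (M x) C)" for x C by (rule finite_measure.emeasure_eq_measure[OF M_fin])
 have ee: "e C * e C = e C" if "closed C" for C by (rule bop_eqI_diag) (simp add: e e_mult that)
 have ae: "adj (e C) = e C" if "closed C" for C by (rule adj_self_of_real_diag) (simp add: e that)
 have ce: "e C * e D = e D * e C" if "closed C" "closed D" for C D by (rule bop_eqI_diag) (simp add: e_mult that Int_commute)
 have trig_comm: "A * B = B * A" if A: "trig_rel V f A" and B: "trig_rel V g B" for f A g B
  by (rule bop_eqI_diag, subst (1 2) trig[symmetric], rule trig_rel_mult[OF B A], rule trig_rel_mult[OF A B]) (simp add: mult.commute)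
 have tV: "trig_rel V (%t. cis t * 1) (V * 1)" by (rule trig_rel.pos[OF trig_rel.one])
 have MV: "M (V *V x) = M x" for x proof (rule M_eqI[OF M_sets])
  fix C :: "complex set" assume C: "closed C"
  obtain p A where p: "!!k::nat. trig_rel V (p k) (A k)" and lim: "!!x. (%k. cin x (A k *V x)) ----> of_real (measure (M x) C)" using approx[OF C] by blast
  have "cin (V *V x) (A k *V V *V x) = cin x ((adj V * V * A k) *V x)" for k proof -
   have "A k *V V *V x = V *V A k *V x" using trig_comm[OF p tV, of k] by (metis mult_1_right times_bop_apply)
   then show ?thesis by (simp add: cinner_adj_right)
  qed
  then have "(%k. cin x (A k *V x)) ----> of_real (measure (M (V *V x)) C)" using lim[of "V *V x"] by (simp add: V)
  from LIMSEQ_unique[OF this lim] have "measure (M (V *V x)) C = measure (M x) C" by simp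
  then show "emeasure (M (V *V x)) C = emeasure (M x) C" by (simp add: M_emeasure)
 qed
 have Me: "M (e C *V x) = density (M x) (ind C)" if C: "closed C" for C x proof (rule M_eqI)
  fix D :: "complex set" assume D: "closed D"
  have "e C * (e D * e C) = e C * e D" using ce[OF C D] ee[OF C] by (metis mult.assoc)
  from arg_cong[OF this, of "%B. cin x (B *V x)"]
  have "cin (e C *V x) (e D *V e C *V x) = cin x (e C *V e D *V x)" using cinner_adj_right[of x "e C"] by (simp add: ae C)
  then have "measure (M (e C *V x)) D = measure (M x) (C Int D)" using e[OF D, of "e C *V x"] e_mult[OF C D, of x] by simp
  then show "emeasure (M (e C *V x)) D = emeasure (density (M x) (ind C)) D" using C D by (subst emeasure_restricted) (auto simp: M_emeasure M_sets)
 qed (simp add: M_sets)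
 have "EX G. pvm G & (ALL C:Collect closed. G C = e C)" proof (rule pvm_of_diagonal[OF M_sets M_fin M_UNIV bop_eqI_diag closed_gen])
  show "cin x (e C *V x) = of_real (measure (M x) C)" if "C : Collect closed" for C x using that by (simp add: e)
  fix C S :: "complex set" and W and x :: 'a
  assume "C : Collect closed" and S: "S : sets borel" and W: "!!x. cin x (W *V x) = of_real (measure (M x) S)"
  then have C: "closed C" by simp
  \<comment> \<open>V preserves every \<open>M x\<close>, so conjugation by V does not change the
    diagonal of W. Thus W commutes with V, with all trigonometric polynomials in V, and with their
    weak limit \<open>e C\<close>.\<close>
  have VWV: "adj V * W * V = W" by (rule bop_eqI_diag) (simp add: cinner_adj_right W MV)
  have "V * W = V * adj V * W * V" using VWV by (simp add: mult.assoc)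
  then have VW: "V * W = W * V" by (simp add: V)
  have "W * adj V = adj V * (W * V) * adj V" using VWV by (simp add: mult.assoc)
  then have aVW: "adj V * W = W * adj V" by (simp add: mult.assoc V)
  have AW: "A * W = W * A" if "trig_rel V f A" for f A
   using that by induction (simp_all add: bop_distrib, simp_all add: mult.assoc, simp_all add: VW aVW flip: mult.assoc)
  obtain p A where p: "!!k::nat. trig_rel V (p k) (A k)" and lim: "!!x. (%k. cin x (A k *V x)) ----> cin x (e C *V x)" using approx[OF C] by (auto simp: e C)
  have eW: "e C * W = W * e C" proof (rule bop_eqI_diag, rule LIMSEQ_unique)
   fix x
   show "(%k. cin x (A k *V W *V x)) ----> cin x ((e C * W) *V x)" unfolding times_bop_apply by (rule tendsto_cinner_of_diag[OF lim])
   have "(%k. cin (adj W *V x) (A k *V x)) ----> cin (adj W *V x) (e C *V x)" by (rule tendsto_cinner_of_diag[OF lim])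
   then show "(%k. cin x (A k *V W *V x)) ----> cin x ((W * e C) *V x)" by (simp add: cinner_adj_left AW[OF p] flip: times_bop_apply)
  qed
  \<comment> \<open>Sandwiched between two copies of \<open>e C\<close>, the diagonal of W is
    evaluated at the vectors e C x, whose measure is the restriction of \<open>M x\<close> to
    C.\<close>
  have "e C * W = e C * (W * e C)" using ee[OF C] eW by (metis mult.assoc)
  from arg_cong[OF this, of "%B. cin x (B *V x)"]
  have "cin x ((e C * W) *V x) = cin (e C *V x) (W *V e C *V x)" using cinner_adj_right[of x "e C"] by (simp add: ae C)
  also have "... = of_real (measure (M x) (C Int S))" using C S unfolding W Me[OF C] measure_def by (subst emeasure_restricted) (auto simp: M_sets)
  finally show "cin x ((e C * W) *V x) = of_real (measure (M x) (C Int S))" .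
 qed
 then obtain G where G: "pvm G" and Ge: "!!C. closed C ==> G C = e C" by auto
 have sd: "sdist G x = M x" for x proof (rule M_eqI[symmetric])
  fix C :: "complex set" assume C: "closed C"
  have "cor ((norm (G C *V x))^2) = of_real (measure (M x) C)"
   using projection_norm[OF pvm_projection[OF G borel_closed[OF C]], of x] e[OF C, of x] by (simp add: Ge C)
  then show "emeasure (M x) C = emeasure (sdist G x) C" using C by (simp only: of_real_eq_iff) (simp add: emeasure_sdist[OF G] M_emeasure)
 qed (rule sets_sdist[OF G])
 have "G (sphere 0 1) = 1" proof (rule bop_eqI_diag)
  fix x
  have "(norm (G (sphere 0 1) *V x))^2 = measure (M x) (sphere 0 1)" using measure_sdist[OF G, of "sphere 0 1" x] by (simp add: sd)
  also have "... = measure (M x) UNIV" by (simp add: M_measure vimage_def)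
  finally show "cin x (G (sphere 0 1) *V x) = cin x (1 *V x)" by (simp add: projection_norm[OF pvm_projection[OF G]] M_UNIV cinner_self flip: of_real_power)
 qed
 moreover have "SI G sphere_id = V" proof (rule SI_eqI[OF G])
  fix x
  have "(LINT z|M x. sphere_id z) = (LINT t|N x. sphere_id (cis t))" unfolding M_def by (rule integral_distr[OF cis_N bborel_measurable[OF bborel_sphere_id]])
  also have "... = cin x (V *V x)" using trig[OF trig_rel.pos[OF trig_rel.one], of x] by (simp add: sphere_id_def)
  finally show "cin x (V *V x) = (LINT z|sdist G x. sphere_id z)" by (simp add: sd)
 qed
 ultimately show ?thesis using G by blast
qed

section \<open>Self-adjoint relations and the Cayley transform\<close>

lemma adj_graph_add: "(x, w) : adj_graph X ==> (y, v) : adj_graph X ==> (x + y, w + v) : adj_graph X" by (fastforce simp: adj_graph_def cinner_add_right)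

lemma adj_graph_scaleC: "(x, w) : adj_graph X ==> (c *C x, c *C w) : adj_graph X" by (auto simp: adj_graph_def cinner_scaleC_right)

lemma adj_graph_limit: assumes "!!n. (x n, w n) : adj_graph X" "x ----> y" "w ----> z" shows "(y, z) : adj_graph X" unfolding adj_graph_def
proof (clarsimp)
 fix a b assume ab: "(a, b) : X"
 have eq: "cin b (x n) = cin a (w n)" for n using assms(1)[of n] ab by (auto simp: adj_graph_def)
 have "(%n. cin b (x n)) ----> cin b y" "(%n. cin a (w n)) ----> cin a z" by (intro tendsto_intros assms)+
 then show "cin b y = cin a z" unfolding eq by (rule LIMSEQ_unique)
qed

context
 fixes X :: "('a::chilbert_space \<times> 'a) set" assumes X: "self_adjoint X"
begin

lemma self_adjoint_eq: "adj_graph X = X" using X by (simp add: self_adjoint_def)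

lemma self_adjoint_add: "(x, w) : X ==> (y, v) : X ==> (x + y, w + v) : X" using adj_graph_add[of x w X y v] by (simp add: self_adjoint_eq)

lemma self_adjoint_scaleC: "(x, w) : X ==> (c *C x, c *C w) : X" using adj_graph_scaleC[of x w X c] by (simp add: self_adjoint_eq)

lemma self_adjoint_diff: "(x, w) : X ==> (y, v) : X ==> (x - y, w - v) : X"
 using self_adjoint_add[of x w "(-1) *C y" "(-1) *C v"] self_adjoint_scaleC[of y v "-1"] by (simp add: scaleC_minus_one)

lemma self_adjoint_symmetric: assumes "(x, w) : X" "(y, v) : X" shows "cin w y = cin x v"
proof -
 have "(y, v) : adj_graph X" using assms(2) self_adjoint_eq by simp
 with assms(1) show ?thesis by (auto simp: adj_graph_def)
qed

lemma self_adjoint_zero: assumes "(0, w) : X" shows "w = 0"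
proof -
 have "Domain X <= {x. cin x w = 0}" using self_adjoint_symmetric[OF _ assms] by auto
 moreover have "closed {x. cin x w = 0}"
  by (intro closed_Collect_eq continuous_intros bounded_linear.continuous_on[OF bounded_bilinear.bounded_linear_left[OF bounded_bilinear_cinner]])
 ultimately have "closure (Domain X) <= {x. cin x w = 0}" by (rule closure_minimal)
 then have "cin w w = 0" using X by (auto simp: self_adjoint_def)
 then show ?thesis by (simp add: cinner_self)
qed

lemma self_adjoint_norm: assumes "(x, w) : X" "si = \<i> | si = - \<i>" shows "(norm (w + si *C x))^2 = (norm w)^2 + (norm x)^2"
proof -
 have "cin w x = cnj (cin w x)" using self_adjoint_symmetric[OF assms(1) assms(1)] cinner_commute[of x w] by simp
 then have "Im (cin w x) = 0" by (simp add: complex_eq_iff)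
 then have "Re (cin w (si *C x)) = 0" using assms(2) by (auto simp: cinner_scaleC_right)
 moreover have "norm (si *C x) = norm x" using assms(2) by (auto simp: norm_scaleC)
 ultimately show ?thesis by (simp add: norm_add_square)
qed

text \<open>The range is closed because \<open>self_adjoint_norm\<close> controls x and w by w + si
  x. A vector orthogonal to it lies in the adjoint, which is X, as an eigenvector for the nonreal
  number si, and so vanishes.\<close>

lemma self_adjoint_range: assumes si: "si = \<i> | si = - \<i>" shows "EX x w. (x, w) : X & y = w + si *C x"
proof -
 define M where "M = {w + si *C x |x w. (x, w) : X}"
 have scale: "c *C y : M" if "y : M" for c y proof -
  from that obtain x w where xw: "(x, w) : X" "y = w + si *C x" by (auto simp: M_def)
  have "c *C y = c *C w + si *C (c *C x)" by (simp add: xw scaleC_add_right scaleC_scaleC mult.commute)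
  then show ?thesis using self_adjoint_scaleC[OF xw(1), of c] by (auto simp: M_def)
 qed
 have add: "y + z : M" if "y : M" "z : M" for y z proof -
  from that obtain x w a b where xw: "(x, w) : X" "y = w + si *C x" "(a, b) : X" "z = b + si *C a" by (auto simp: M_def)
  have "y + z = (w + b) + si *C (x + a)" by (simp add: xw scaleC_add_right)
  then show ?thesis using self_adjoint_add[OF xw(1,3)] by (auto simp: M_def)
 qed
 have "X ~= {}" proof
  assume "X = {}"
  then show False using X by (simp add: self_adjoint_def)
 qed
 then obtain p0 where "p0 : X" by blast
 then have ne: "0 : M" using scale[of "snd p0 + si *C fst p0" 0] by (cases p0) (auto simp: M_def)
 have "M = UNIV" proof (rule closed_csubspace_eq_UNIV)
  show "subspace M" by (rule subspaceI) (auto simp: ne add scaleR_scaleC scale)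
  show "closed M" unfolding closed_sequential_limits proof (intro allI impI, elim conjE)
   fix y l assume y: "ALL n. y n : M" and lim: "y ----> l"
   have "EX x w. (x, w) : X & y n = w + si *C x" for n using y[rule_format, of n] unfolding M_def by blast
   then obtain x w where xw: "!!n. (x n, w n) : X" "!!n. y n = w n + si *C x n" by metis
   have "Cauchy y" using lim by (rule LIMSEQ_imp_Cauchy)
   have diff: "(norm (y m - y n))^2 = (norm (w m - w n))^2 + (norm (x m - x n))^2" for m n
    using self_adjoint_norm[OF self_adjoint_diff[OF xw(1)[of m] xw(1)[of n]] si] by (simp add: xw(2) scaleC_diff_right algebra_simps)
   have le: "norm (w m - w n) <= norm (y m - y n)" "norm (x m - x n) <= norm (y m - y n)" for m n by (rule power2_le_imp_le; simp add: diff)+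
   have "Cauchy x" "Cauchy w" using `Cauchy y` le unfolding Cauchy_def dist_norm by (meson le_less_trans)+
   then obtain a b where ab: "x ----> a" "w ----> b" using Cauchy_convergent convergent_def by metis
   have "(a, b) : adj_graph X" by (rule adj_graph_limit[OF _ ab]) (simp add: self_adjoint_eq xw)
   then have "(a, b) : X" by (simp add: self_adjoint_eq)
   moreover have "y ----> b + si *C a" unfolding xw(2) by (intro tendsto_intros ab)
   ultimately show "l : M" using LIMSEQ_unique[OF lim] by (auto simp: M_def)
  qed
  fix z assume z: "!!y. y : M ==> cin z y = 0"
  have "cin w z = cin x (si *C z)" if "(x, w) : X" for x w proof -
   have "cin z w + si * cin z x = 0" using z[of "w + si *C x"] that by (auto simp: M_def cinner_add_right cinner_scaleC_right)
   then have "cin z w = - si * cin z x" by (simp add: add_eq_0_iff2)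
   then have "cin w z = - cnj si * cin x z" by (subst (1 2) cinner_commute) simp
   then show ?thesis using si by (auto simp: cinner_scaleC_right)
  qed
  then have "(z, si *C z) : adj_graph X" by (auto simp: adj_graph_def)
  then have "(z, si *C z) : X" by (simp add: self_adjoint_eq)
  from self_adjoint_symmetric[OF this this] have "cnj si * cin z z = si * cin z z" by (simp add: cinner_simps)
  then show "z = 0" using si by (auto simp: cinner_self complex_eq_iff)
 qed (rule scale)
 then have "y : M" by simp
 then show ?thesis by (auto simp: M_def)
qed

lemma self_adjoint_resolvent: "EX R. (ALL y. (R *V y, y - \<i> *C (R *V y)) : X) & (ALL x w. (x, w) : X --> x = R *V (w + \<i> *C x))"
proof -
 have "EX x. (x, y - \<i> *C x) : X" for y proof -
  obtain x w where "(x, w) : X" "y = w + \<i> *C x" using self_adjoint_range[of \<i> y] by blast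
  then show ?thesis by (intro exI[of _ x]) simp
 qed
 then obtain r where r: "!!y. (r y, y - \<i> *C r y) : X" by metis
 have uniq: "x = r (w + \<i> *C x)" if "(x, w) : X" for x w proof -
  define d where "d = x - r (w + \<i> *C x)"
  have "(d, - \<i> *C d) : X" using self_adjoint_diff[OF that r[of "w + \<i> *C x"]] by (simp add: d_def scaleC_diff_right scaleC_minus_left algebra_simps)
  from self_adjoint_norm[OF this, of \<i>] have "norm d = 0" by (simp add: scaleC_minus_left norm_scaleC)
  then show ?thesis by (simp add: d_def)
 qed
 have "clinear r" unfolding clinear_def proof (intro conjI allI)
  fix x y c
  show "r (x + y) = r x + r y" using uniq[OF self_adjoint_add[OF r[of x] r[of y]]] by (simp add: scaleC_add_right algebra_simps)
  show "r (c *C x) = c *C r x" using uniq[OF self_adjoint_scaleC[OF r[of x], of c]] by (simp add: scaleC_diff_right scaleC_scaleC mult.commute)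
 qed
 moreover have "norm (r y) <= 1 * norm y" for y proof (rule power2_le_imp_le)
  show "(norm (r y))^2 <= (1 * norm y)^2" using self_adjoint_norm[OF r[of y], of \<i>] by simp
 qed simp
 ultimately obtain R where R: "!!y. R *V y = r y" using bop_exists by metis
 show ?thesis proof (intro exI[of _ R] conjI allI impI)
  show "(R *V y, y - \<i> *C (R *V y)) : X" for y unfolding R by (rule r)
  show "x = R *V (w + \<i> *C x)" if "(x, w) : X" for x w unfolding R by (rule uniq[OF that])
 qed
qed

text \<open>Spectral theorem: the Cayley transform \<open>-1 + 2\<i> (X + \<i>)\<^sup>-\<^sup>1\<close> is unitary, and its
  projection-valued measure on the circle is moved to the line by \<open>z \<mapsto> Im z / (1 + Re z)\<close>.\<close>

lemma spectral_theorem: "EX E. pvm E & X = sgraph E"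
proof -
 obtain R where R: "!!y. (R *V y, y - \<i> *C (R *V y)) : X" and R': "!!x w. (x, w) : X ==> x = R *V (w + \<i> *C x)" using self_adjoint_resolvent by metis
 define V where "V = (2 * \<i>) *C R - 1"
 have norm_V: "norm (V *V y) = norm y" for y proof -
  \<comment> \<open>With x = R y and w = y - i x one has y = w + i x and V y = - (w - i x). The two
    vectors have equal norms since (x, w) belongs to X.\<close>
  have "V *V y = - ((y - \<i> *C (R *V y)) + (- \<i>) *C (R *V y))" by (simp add: V_def scaleC_minus_left algebra_simps flip: scaleC_add_left)
    (simp flip: scaleC_add_left)?
  then have "(norm (V *V y))^2 = (norm (y - \<i> *C (R *V y)))^2 + (norm (R *V y))^2"
   using self_adjoint_norm[OF R[of y], of "- \<i>"] by (simp only: norm_minus_cancel) simp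
  also have "... = (norm y)^2" using self_adjoint_norm[OF R[of y], of \<i>] by simp
  finally show ?thesis by simp
 qed
 have V1: "adj V * V = 1" by (rule bop_eqI_diag) (simp add: cinner_adj_right cinner_self norm_V)
 have surj: "EX y. V *V y = u" for u proof -
  obtain x w where xw: "(x, w) : X" "- u = w + (- \<i>) *C x" using self_adjoint_range[of "- \<i>" "- u"] by auto
  have "V *V (w + \<i> *C x) = (2 * \<i>) *C x - (w + \<i> *C x)" by (simp only: V_def minus_bop_apply scaleC_bop_apply one_bop_apply R'[OF xw(1), symmetric])
  also have "... = - (w + (- \<i>) *C x)" proof -
   have "(2 * \<i>) *C x = \<i> *C x + \<i> *C x" by (simp flip: scaleC_add_left)
   then show ?thesis by (simp add: scaleC_minus_left)
  qed
  also have "... = u" using xw(2) by (metis minus_minus)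
  finally show ?thesis by blast
 qed
 have V2: "V * adj V = 1" proof (rule bop_eqI)
  fix u
  obtain y where y: "V *V y = u" using surj by blast
  have "(adj V * V) *V y = y" by (simp only: V1 one_bop_apply)
  then show "(V * adj V) *V u = 1 *V u" by (simp flip: y)
 qed
 obtain G where G: "pvm G" and G1: "G (sphere 0 1) = 1" and GV: "SI G sphere_id = V" using unitary_pvm[OF V2 V1] by blast
 \<comment> \<open>The map to the line is singular at -1, so this point must carry no projection: V
   + 1 = 2 i R, and R is injective because X is single-valued.\<close>
 have m1: "G {-1} = 0" proof (rule bop_eqI)
  fix y
  define x where "x = G {-1} *V y"
  have "V * G {-1} = SI G (%z. sphere_id z * ind {-1} z)" unfolding GV[symmetric]
   by (simp add: SI_mult[OF G bborel_sphere_id bborel_indicator] SI_indicator[OF G])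
  also have "(%z. sphere_id z * ind {-1} z) = (%z. (-1) * ind {-1} z)" by (auto simp: sphere_id_def indicator_def)
  also have "SI G ... = (-1) *C G {-1}" by (subst SI_scale[OF G]) (auto simp: SI_indicator[OF G])
  finally have "V *V x = (-1) *C x" unfolding x_def by (metis scaleC_bop_apply times_bop_apply)
  then have "(2 * \<i>) *C (R *V x) = 0" by (simp add: V_def scaleC_minus_one)
  then have "R *V x = 0" by (metis norm_scaleC norm_eq_zero mult_eq_0_iff complex_i_not_zero zero_neq_numeral)
  then have "x = 0" using R[of x] self_adjoint_zero by (simp add: scaleC_zero_right)
  then show "G {-1} *V y = 0 *V y" by (simp add: x_def)
 qed
 define S where "S = sphere 0 1 - {-1 :: complex}"
 have S: "S : sets borel" by (simp add: S_def)
 have "G (S Un {-1}) = G S + G {-1}" by (rule pvm_Un[OF G S]) (auto simp: S_def)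
 moreover have "S Un {-1} = sphere 0 1" by (auto simp: S_def)
 ultimately have GS: "G S = 1" by (simp add: m1 G1)
 define ph :: "complex => real" where "ph z = Im z / (1 + Re z)" for z
 have ph: "ph : bmeas" unfolding ph_def[abs_def] by measurable
 define E where "E = push_pvm ph G"
 have E: "pvm E" unfolding E_def by (rule pvm_push[OF G ph])
 \<comment> \<open>The image measure has the resolvent of X at -i, which identifies the graphs by
   \<open>sgraph_resolvent\<close>.\<close>
 have "SI E (%s. 1 / (cor s - (- \<i>))) = SI G (%z. 1 / (cor (ph z) - (- \<i>)))" unfolding E_def by (rule SI_push[OF G ph]) (rule bborel_resolvent, simp)
 also have "... = SI G (%z. (1 / (2 * \<i>)) * (sphere_id z + 1))" proof (rule SI_support[OF G S GS])
  show "bborel (%z. 1 / (cor (ph z) - (- \<i>)))" by (rule bborel_comp[OF _ ph, where f = "%s. 1 / (cor s - (- \<i>))"]) (rule bborel_resolvent, simp)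
  show "bborel (%z. (1 / (2 * \<i>)) * (sphere_id z + 1))" by (intro bborel_mult bborel_add bborel_const bborel_sphere_id)
  fix z assume "z : S"
  then have z: "cmod z = 1" "z ~= -1" by (auto simp: S_def)
  have sq: "(Re z)^2 + (Im z)^2 = 1" using z(1) cmod_power2[of z] by simp
  have ne: "1 + Re z ~= 0" proof
   assume "1 + Re z = 0"
   then have "Re z = -1" by simp
   with sq have "Im z = 0" by simp
   with `Re z = -1` z(2) show False by (simp add: complex_eq_iff)
  qed
  have ne2: "cor (ph z) + \<i> ~= 0" by (simp add: complex_eq_iff)
  have "(cor (ph z) + \<i>) * (z + 1) = 2 * \<i>" proof -
   have "ph z * (1 + Re z) = Im z" using ne by (simp add: ph_def)
   moreover have "ph z * Im z = 1 - Re z" proof -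
    have "(1 + Re z) * (ph z * Im z) = (Im z)^2" using ne by (simp add: ph_def power2_eq_square)
    also have "... = (1 + Re z) * (1 - Re z)" using sq by (simp add: power2_eq_square algebra_simps)
    finally show ?thesis using ne by simp
   qed
   ultimately show ?thesis by (simp add: complex_eq_iff algebra_simps)
  qed
  then show "1 / (cor (ph z) - (- \<i>)) = (1 / (2 * \<i>)) * (sphere_id z + 1)" using ne2 z(1) by (simp add: sphere_id_def field_simps)
 qed
 also have "... = (1 / (2 * \<i>)) *C (V + 1)" using bborel_sphere_id by (simp only: SI_scale[OF G bborel_add[OF bborel_sphere_id bborel_const]]
   SI_add[OF G bborel_sphere_id bborel_const] SI_one[OF G] GV)
 also have "... = R" by (rule bop_eqI) (simp add: V_def scaleC_scaleC)
 finally have RE: "SI E (%s. 1 / (cor s - (- \<i>))) = R" .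
 have "(x, w) : X \<longleftrightarrow> (x, w) : sgraph E" for x w proof -
  have "(x, w) : sgraph E \<longleftrightarrow> x = R *V (w + \<i> *C x)"
   using sgraph_resolvent[OF E, of "- \<i>" x w] by (simp only: RE) (simp add: scaleC_minus_left)
  moreover have "(x, w) : X" if "x = R *V (w + \<i> *C x)" using R[of "w + \<i> *C x"] that by simp
  ultimately show ?thesis using R' by blast
 qed
 then show ?thesis using E by auto
qed

end

section \<open>Uniqueness of the spectral measure\<close>

lemma cis_double_arctan: "cis (2 * arctan s) = Complex ((1 - s\<^sup>2) / (1 + s\<^sup>2)) (2 * s / (1 + s\<^sup>2))"
proof -
 have pos: "1 + s\<^sup>2 > 0" by (simp add: add_pos_nonneg)
 have "cos (2 * arctan s) = (1 - s\<^sup>2) / (1 + s\<^sup>2)" using pos by (simp add: cos_double cos_arctan sin_arctan power_divide diff_divide_distrib)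
 moreover have "sin (2 * arctan s) = 2 * s / (1 + s\<^sup>2)" proof -
  have "sin (2 * arctan s) = 2 * s / (sqrt (1 + s\<^sup>2))^2" unfolding sin_double cos_arctan sin_arctan power2_eq_square[of "sqrt (1 + s\<^sup>2)"] by simp
  then show ?thesis using pos by simp
 qed
 ultimately show ?thesis by (simp add: complex_eq_iff)
qed

text \<open>The Cayley transform of the real number s has the angle 2 arctan s; it is an affine
  function of the resolvent at -i.\<close>

lemma cis_arctan: "cis (2 * arctan s) = (2 * \<i>) * (1 / (cor s - (- \<i>))) + (-1)"
proof -
 have pos: "1 + s\<^sup>2 ~= 0" using zero_le_power2[of s] by linarith
 have ne: "cor s + \<i> ~= 0" by (simp add: complex_eq_iff)
 have "cis (2 * arctan s) * (cor s + \<i>) = 2 * \<i> - (cor s + \<i>)" unfolding cis_double_arctan using pos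
  by (simp add: complex_eq_iff add_divide_distrib[symmetric] diff_divide_distrib[symmetric] divide_eq_eq power2_eq_square algebra_simps)
 then show ?thesis using ne by (simp add: field_simps)
qed

text \<open>The graph determines the resolvent at -i, hence the Cayley transform V, hence every
  trigonometric polynomial in V, and by approximation the projections of closed subsets of the
  circle. The map s |-> cis (2 arctan s) has a Borel left inverse, so nothing is lost on returning
  to the line.\<close>

lemma sgraph_inject:
 fixes E F :: "real set => 'a::chilbert_space bop" assumes E: "pvm E" and F: "pvm F" and eq: "sgraph E = sgraph F" shows "E = F"
proof -
 define r where "r s = 1 / (cor s - (- \<i>))" for s
 have br: "bborel r" unfolding r_def[abs_def] by (rule bborel_resolvent) simp
 have R: "SI E r = SI F r" proof (rule bop_eqI)
  fix y
  define x where "x = SI E r *V y"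
  have "(x, y - \<i> *C x) : sgraph E" using sgraph_resolvent[OF E, of "- \<i>" x "y - \<i> *C x"] by (simp add: x_def r_def[abs_def] scaleC_minus_left)
  then have "x = SI F r *V y" unfolding eq using sgraph_resolvent[OF F, of "- \<i>" x "y - \<i> *C x"] by (simp add: r_def[abs_def] scaleC_minus_left)
  then show "SI E r *V y = SI F r *V y" by (simp add: x_def)
 qed
 define th where "th s = 2 * arctan s" for s
 have th: "th : bmeas" unfolding th_def[abs_def] by (intro continuous_borel continuous_intros)
 define V where "V = (2 * \<i>) *C SI E r + (-1) *C 1"
 have cis_V: "SI H (%s. cis (th s)) = V" if "pvm H" "SI H r = SI E r" for H unfolding th_def cis_arctan r_def[symmetric] V_def that(2)[symmetric]
  by (simp only: SI_add[OF that(1) bborel_mult[OF bborel_const br] bborel_const]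
   SI_scale[OF that(1) br] SI_const[OF that(1)])
 have bcis: "bborel (%s. cis (th s))" by (rule bborel_comp[OF _ th], rule bborelI[where K = 1]) (auto intro!: continuous_borel continuous_intros)
 have trig: "SI H (%s. f (th s)) = A" if H: "pvm H" "SI H r = SI E r" and "trig_rel V f A" for H f A using that(3) proof induction
  case one
  then show ?case by (rule SI_one[OF H(1)])
 next
  case (pos f A)
  then show ?case using SI_mult[OF H(1) bcis bborel_comp[OF bborel_trig_rel[OF pos.hyps] th]] cis_V[OF H] by simp
 next
  case (neg f A)
  have "adj V = SI H (%s. cis (- th s))" unfolding cis_V[OF H, symmetric] SI_adj[OF H(1) bcis] by (simp add: cis_cnj)
  moreover have "bborel (%s. cis (- th s))" using bborel_cnj[OF bcis] by (simp add: cis_cnj)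
  ultimately show ?case using SI_mult[OF H(1) _ bborel_comp[OF bborel_trig_rel[OF neg.hyps] th], of "%s. cis (- th s)"] neg.IH by simp
 next
  case (add f A g B)
  then show ?case using SI_add[OF H(1) bborel_comp[OF bborel_trig_rel[OF add.hyps(1)] th] bborel_comp[OF bborel_trig_rel[OF add.hyps(2)] th]] by simp
 next
  case (scale f A c)
  then show ?case using SI_scale[OF H(1) bborel_comp[OF bborel_trig_rel[OF scale.hyps] th]] by simp
 qed
 define ka where "ka s = cis (th s)" for s
 have ka: "ka : bmeas" unfolding ka_def[abs_def] by (rule bborel_measurable[OF bcis])
 have lim: "(%k. cin x (A k *V x)) ----> cin x (push_pvm ka H C *V x)" if H: "pvm H" "SI H r = SI E r" and C: "closed C"
   and pA: "!!k::nat. trig_rel V (p k) (A k)" "!!k t. cmod (p k t) <= 2" "!!t. (%k. p k t) ----> ind C (cis t)" for H C x p A proof -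
  have "(%k. cin x (SI H (%s. p k (th s)) *V x)) ----> cin x (SI H (%s. ind C (cis (th s))) *V x)"
   by (rule SI_weak_limit[OF H(1) _ pA(2,3)]) (rule bborel_comp[OF bborel_trig_rel[OF pA(1)] th])
  moreover have "(%s. ind C (cis (th s)) :: complex) = ind (ka -` C)" by (auto simp: ka_def indicator_def)
  ultimately show ?thesis using C trig[OF H pA(1)] vimage_borel[OF H(1) ka, of C] by (simp add: SI_indicator[OF H(1)] push_pvm_apply)
 qed
 have closed_eq: "push_pvm ka E C = push_pvm ka F C" if C: "closed C" for C proof (rule bop_eqI_diag)
  fix x
  obtain p A where pA: "!!k::nat. trig_rel V (p k) (A k)" "!!k t. cmod (p k t) <= 2" "!!t. (%k. p k t) ----> ind C (cis t)"
   using trig_rel_approx_closed[OF C, of V] by blast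
  show "cin x (push_pvm ka E C *V x) = cin x (push_pvm ka F C *V x)" by (rule LIMSEQ_unique[OF lim[OF E refl C pA] lim[OF F R[symmetric] C pA]])
 qed
 have push: "push_pvm ka E = push_pvm ka F" proof (rule pvm_eqI_sd[OF pvm_push[OF E ka] pvm_push[OF F ka]], rule measure_eqI_closed)
  fix x and C :: "complex set" assume "closed C"
  then show "emeasure (sdist (push_pvm ka E) x) C = emeasure (sdist (push_pvm ka F) x) C" using emeasure_sdist[OF pvm_push[OF E ka], of C x]
    emeasure_sdist[OF pvm_push[OF F ka], of C x] closed_eq[of C] by simp
 qed (simp_all add: sets_sdist[OF pvm_push[OF E ka]] sets_sdist[OF pvm_push[OF F ka]]
   finite_measure_sdist[OF pvm_push[OF E ka]])
 show ?thesis proof (rule pvm_eqI[OF E F])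
  fix B :: "real set" assume B: "B : sets borel"
  define ph :: "complex => real" where "ph z = Im z / (1 + Re z)" for z
  have ph: "ph : bmeas" unfolding ph_def[abs_def] by measurable
  have "ph (ka s) = s" for s proof -
   have pos: "1 + s\<^sup>2 > 0" by (simp add: add_pos_nonneg)
   have "1 + (1 - s\<^sup>2) / (1 + s\<^sup>2) = 2 / (1 + s\<^sup>2)" using pos by (simp add: field_simps)
   then show ?thesis using pos by (simp add: ph_def ka_def th_def cis_double_arctan)
  qed
  then have "ka -` (ph -` B) = B" by auto
  moreover have "ph -` B : sets borel" using measurable_sets[OF ph B] by simp
  ultimately show "E B = F B" using fun_cong[OF push, of "ph -` B"] by (simp add: push_pvm_apply)
 qed
qed

lemma spectral_measure_sgraph: assumes E: "pvm E" shows "spectral_measure (sgraph E) = E" unfolding spectral_measure_def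
proof (rule the_equality)
 fix F assume F: "is_spectral_measure (sgraph E) F"
 then have pF: "pvm F" by (simp add: is_spectral_measure_def)
 have "sgraph E = sgraph F" by (rule is_spectral_measure_eq_sgraph[OF pF F]) (auto simp: sgraph_add[OF E] sgraph_scaleC[OF E])
 then show "F = E" using sgraph_inject[OF E pF] by simp
qed (rule is_spectral_measure_sgraph[OF E])

lemma fun_calc_sgraph: "pvm E ==> fun_calc f (sgraph E) = SI E f" by (simp add: fun_calc_def spectral_measure_sgraph)

section \<open>Schoenberg's space-filling curve\<close>

text \<open>An even function of period 2 that is 0 on [0, 1/3] and 1 on [2/3, 1]. A clipped cosine
  replaces Schoenberg's piecewise linear function, which makes continuity and periodicity
  immediate.\<close>

definition sch :: "real => real" where "sch t = max 0 (min 1 (1/2 - cos (pi * t)))"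

lemma sch_bounds: "0 <= sch t" "sch t <= 1" by (auto simp: sch_def)

lemma sch_periodic: "sch (2 * real n + t) = sch t"
proof -
 have "pi * (2 * real n + t) = pi * t + of_nat n * (2 * pi)" by (simp add: algebra_simps)
 then show ?thesis using cos.plus_of_nat[of "pi * t" n] by (simp add: sch_def)
qed

lemma sch_0: "0 <= t ==> t <= 1/3 ==> sch t = 0"
proof -
 assume t: "0 <= t" "t <= 1/3"
 have "cos (pi / 3) <= cos (pi * t)" using t pi_gt_zero by (intro cos_monotone_0_pi_le) auto
 then show ?thesis by (simp add: sch_def cos_60)
qed

lemma sch_1: "2/3 <= t ==> t <= 1 ==> sch t = 1"
proof -
 assume t: "2/3 <= t" "t <= 1"
 have "cos (pi * t) <= cos (2 * pi / 3)" proof (rule cos_monotone_0_pi_le)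
  show "2 * pi / 3 <= pi * t" using t(1) mult_left_mono[of "2/3" t pi] by simp
 qed (use t in auto)
 moreover have "cos (2 * pi / 3) = - (1/2)" using cos_pi_minus[of "pi / 3"] by (simp add: cos_60)
 ultimately show ?thesis by (simp add: sch_def)
qed

text \<open>The point of the Cantor set with ternary digits 2 a_k, for digits a_k in {0, 1}.\<close>

definition sch_digit :: "(nat => nat) => real" where "sch_digit a = (\<Sum>k. 2 * real (a k) / 3 ^ Suc k)"

lemma sch_digit: assumes a: "!!k. a k <= 1" shows "sch_digit a = (2 * real (a 0) + sch_digit (%k. a (Suc k))) / 3" "0 <= sch_digit a" "sch_digit a <= 1"
proof -
 have le: "2 * real (b k) / 3 ^ Suc k <= (2/3) * (1/3) ^ k" if "!!k. b k <= 1" for b :: "nat => nat" and k proof -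
  have "2 * real (b k) / 3 ^ Suc k <= 2 / 3 ^ Suc k" using that[of k] by (intro divide_right_mono) auto
  then show ?thesis by (simp add: power_divide)
 qed
 have geo: "summable (%k. (2/3) * (1/3::real) ^ k)" by (intro summable_mult summable_geometric) simp
 have sm: "summable (%k. 2 * real (b k) / 3 ^ Suc k)" if "!!k. b k <= 1" for b :: "nat => nat"
  by (rule summable_comparison_test'[OF geo, of 0]) (use le[of b] that in auto)
 show "sch_digit a = (2 * real (a 0) + sch_digit (%k. a (Suc k))) / 3" using suminf_split_head[OF sm[of a]] suminf_divide[OF sm[of "%k. a (Suc k)"], of 3] a
  by (simp add: sch_digit_def add_divide_distrib mult.commute)
 show "0 <= sch_digit a" unfolding sch_digit_def by (intro suminf_nonneg sm a) auto
 have "sch_digit a <= (\<Sum>k. (2/3) * (1/3::real) ^ k)" unfolding sch_digit_def by (intro suminf_le le a sm geo)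
 also have "... = (2/3) * (\<Sum>k. (1/3::real) ^ k)" by (rule suminf_mult) (simp add: summable_geometric)
 also have "... = 1" by (subst suminf_geometric) auto
 finally show "sch_digit a <= 1" .
qed

text \<open>Multiplication by 3^k shifts the ternary digits by k places, up to an even integer that
  periodicity removes. The leading digit then puts the point into [0, 1/3] or [2/3, 1].\<close>

lemma sch_sch_digit: assumes a: "!!k. a k <= 1" shows "sch (3 ^ k * sch_digit a) = real (a k)" using a
proof (induction k arbitrary: a)
 case 0
 note d = sch_digit[of a, OF 0] and d' = sch_digit[of "%k. a (Suc k)", OF 0]
 have "a 0 = 0 | a 0 = 1" using 0[of 0] by auto
 then show ?case using d(1) d'(2,3) by (auto intro!: sch_0 sch_1)
next
 case (Suc k)
 have "3 ^ Suc k * sch_digit a = 2 * real (3 ^ k * a 0) + 3 ^ k * sch_digit (%k. a (Suc k))"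
  unfolding sch_digit(1)[of a, OF Suc.prems] by (simp add: algebra_simps)
 then have "sch (3 ^ Suc k * sch_digit a) = sch (3 ^ k * sch_digit (%k. a (Suc k)))" by (simp only: sch_periodic)
 also have "... = real (a (Suc k))" by (rule Suc.IH) (rule Suc.prems)
 finally show ?case .
qed

definition bin_digit :: "real => nat => nat" where "bin_digit x n = nat (\<lfloor>2 ^ Suc n * x\<rfloor> mod 2)"

lemma bin_digit_le: "bin_digit x n <= 1"
proof -
 have "\<lfloor>2 ^ Suc n * x\<rfloor> mod 2 < 2" by simp
 then show ?thesis unfolding bin_digit_def by linarith
qed

lemma bin_digit_sums: assumes "0 <= x" "x < 1" shows "(%n. real (bin_digit x n) / 2 ^ Suc n) sums x"
proof -
 have part: "(SUM n<N. real (bin_digit x n) / 2 ^ Suc n) = of_int \<lfloor>2 ^ N * x\<rfloor> / 2 ^ N" for N proof (induction N)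
  case 0
  then show ?case using assms by (simp add: floor_eq_iff)
 next
  case (Suc N)
  define y where "y = 2 ^ N * x"
  have "\<lfloor>2 * y\<rfloor> = 2 * \<lfloor>y\<rfloor> + \<lfloor>2 * y\<rfloor> mod 2" proof -
   have "\<lfloor>2 * y\<rfloor> = 2 * \<lfloor>y\<rfloor> | \<lfloor>2 * y\<rfloor> = 2 * \<lfloor>y\<rfloor> + 1" by linarith
   then show ?thesis by auto
  qed
  then have "real_of_int \<lfloor>2 * y\<rfloor> = 2 * of_int \<lfloor>y\<rfloor> + real (nat (\<lfloor>2 * y\<rfloor> mod 2))"
   by (simp add: of_nat_nat flip: of_int_add of_int_mult)
  note h = this
  have "(SUM n<Suc N. real (bin_digit x n) / 2 ^ Suc n) = of_int \<lfloor>y\<rfloor> / 2 ^ N + real (nat (\<lfloor>2 * y\<rfloor> mod 2)) / 2 ^ Suc N"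
   unfolding sum.lessThan_Suc Suc by (simp add: bin_digit_def y_def mult.assoc)
  also have "... = (2 * of_int \<lfloor>y\<rfloor> + real (nat (\<lfloor>2 * y\<rfloor> mod 2))) / 2 ^ Suc N" by (simp add: add_divide_distrib)
  also have "... = of_int \<lfloor>2 * y\<rfloor> / 2 ^ Suc N" by (simp only: h)
  finally show ?case by (simp add: y_def mult.assoc)
 qed
 have "(%N. of_int \<lfloor>2 ^ N * x\<rfloor> / 2 ^ N) ----> x" proof (rule tendsto_sandwich[where f = "%N. x - (1/2) ^ N" and h = "%_. x"])
  have "(%N. x - (1/2) ^ N) ----> x - 0" by (intro tendsto_intros LIMSEQ_power_zero) simp
  then show "(%N. x - (1/2) ^ N) ----> x" by simp
  have "x - (1/2) ^ N <= of_int \<lfloor>2 ^ N * x\<rfloor> / 2 ^ N & of_int \<lfloor>2 ^ N * x\<rfloor> / 2 ^ N <= x" for N proof -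
   have "2 ^ N * x - 1 <= of_int \<lfloor>2 ^ N * x\<rfloor>" "of_int \<lfloor>2 ^ N * x\<rfloor> <= 2 ^ N * x" by linarith+
   then have "(2 ^ N * x - 1) / 2 ^ N <= of_int \<lfloor>2 ^ N * x\<rfloor> / 2 ^ N" "of_int \<lfloor>2 ^ N * x\<rfloor> / 2 ^ N <= (2 ^ N * x) / 2 ^ N"
    by (intro divide_right_mono; simp)+
   then show ?thesis by (simp add: power_divide diff_divide_distrib)
  qed
  then show "\<forall>\<^sub>F N in sequentially. x - (1/2) ^ N <= of_int \<lfloor>2 ^ N * x\<rfloor> / 2 ^ N"
   "\<forall>\<^sub>F N in sequentially. of_int \<lfloor>2 ^ N * x\<rfloor> / 2 ^ N <= x" by auto
 qed simp
 then show ?thesis by (simp only: sums_def part)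
qed

text \<open>The two coordinates read off the digits at even and at odd places as binary digits, so
  interleaving the binary expansions of x and y gives a preimage. The half-open square is the range
  where \<open>bin_digit_sums\<close> applies.\<close>

lemma space_filling_curve: "EX c::real => real * real. continuous_on {0..1} c & c ` {0..1} <= {0..1} \<times> {0..1} &
  {0..<1} \<times> {0..<1} <= c ` {0..1}"
proof -
 define g where "g e t = (\<Sum>n. sch (3 ^ (2 * n + e) * t) / 2 ^ Suc n)" for e :: nat and t :: real
 have half: "summable (%n. (1/2) ^ Suc n :: real)" by (simp add: summable_geometric)
 have bnd: "norm (sch (3 ^ (2 * n + e) * t) / 2 ^ Suc n) <= (1/2) ^ Suc n" for n e t
  using sch_bounds[of "3 ^ (2 * n + e) * t"] by (simp add: power_divide field_simps)
 have cont: "continuous_on S (g e)" for e S proof (rule uniform_limit_theorem)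
  show "uniform_limit S (%N t. SUM n<N. sch (3 ^ (2 * n + e) * t) / 2 ^ Suc n) (g e) sequentially"
   unfolding g_def[abs_def] by (rule Weierstrass_m_test[OF bnd half])
  show "\<forall>\<^sub>F N in sequentially. continuous_on S (%t. SUM n<N. sch (3 ^ (2 * n + e) * t) / 2 ^ Suc n)"
   unfolding sch_def by (intro always_eventually allI continuous_intros) auto
 qed simp
 have sm: "summable (%n. sch (3 ^ (2 * n + e) * t) / 2 ^ Suc n)" for e t by (rule summable_comparison_test'[OF half, of 0]) (rule bnd)
 have range: "g e t : {0..1}" for e t proof -
  have "0 <= g e t" unfolding g_def by (intro suminf_nonneg sm) (simp add: sch_bounds)
  moreover have "g e t <= (\<Sum>n. (1/2) ^ Suc n)" unfolding g_def by (intro suminf_le sm half order_trans[OF abs_ge_self bnd[unfolded real_norm_def]])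
  moreover have "(\<Sum>n. (1/2::real) ^ Suc n) = 1" by (rule sums_unique[OF power_half_series, symmetric])
  ultimately show ?thesis by simp
 qed
 have "(x, y) : (%t. (g 0 t, g 1 t)) ` {0..1}" if xy: "0 <= x" "x < 1" "0 <= y" "y < 1" for x y proof -
  define a where "a k = (if even k then bin_digit x (k div 2) else bin_digit y (k div 2))" for k
  have a: "a k <= 1" for k using bin_digit_le[of x "k div 2"] bin_digit_le[of y "k div 2"] by (simp add: a_def)
  have a2: "a (2 * n + 0) = bin_digit x n" "a (2 * n + 1) = bin_digit y n" for n by (simp_all add: a_def)
  have "g 0 (sch_digit a) = x" "g 1 (sch_digit a) = y" unfolding g_def sch_sch_digit[OF a] a2
   by (rule sums_unique[OF bin_digit_sums[OF xy(1,2)], symmetric], rule sums_unique[OF bin_digit_sums[OF xy(3,4)], symmetric])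
  moreover have "sch_digit a : {0..1}" using sch_digit(2,3)[OF a] by simp
  ultimately show ?thesis by (intro image_eqI[of _ _ "sch_digit a"]) simp_all
 qed
 then have "{0..<1} \<times> {0..<1} <= (%t. (g 0 t, g 1 t)) ` {0..1}"
  unfolding subset_eq Ball_def by (simp only: split_paired_All mem_Sigma_iff atLeastLessThan_iff) blast
 moreover have "continuous_on {0..1} (%t. (g 0 t, g 1 t))" by (intro continuous_on_Pair cont)
 moreover have "(%t. (g 0 t, g 1 t)) ` {0..1} <= {0..1} \<times> {0..1}" using range by blast
 ultimately show ?thesis by blast
qed

text \<open>Points of the half-open square lie on the space-filling curve, so discrete measures in
  the plane fall under \<open>discrete_weak_limit\<close>.\<close>

lemma square_weak_limit:
 fixes p :: "nat => 'i => real * real" and w :: "nat => 'i => real"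
 assumes fin: "!!n. finite (I n)" and p: "!!n i. i : I n ==> p n i : {0..<1} \<times> {0..<1}"
  and w: "!!n i. i : I n ==> 0 <= w n i" and W: "!!n. (SUM i:I n. w n i) = W"
 shows "EX s M. strict_mono s & sets M = sets borel & finite_measure M & measure M UNIV = W & (ALL f::real * real => complex. contn f -->
   (%n. SUM i:I (s n). of_real (w (s n) i) * f (p (s n) i)) ----> (LINT x|M. f x))"
proof -
 obtain c :: "real => real * real" where c: "continuous_on {0..1} c" "c ` {0..1} <= {0..1} \<times> {0..1}" "{0..<1} \<times> {0..<1} <= c ` {0..1}"
  using space_filling_curve by blast
 define t where "t n i = (SOME u. u : {0..1} & c u = p n i)" for n i
 have t: "t n i : {0..1} & c (t n i) = p n i" if "i : I n" for n i proof -
  have "p n i : c ` {0..1}" using p[OF that] c(3) by (rule rev_subsetD)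
  then obtain u where "p n i = c u" "u : {0..1}" by (rule imageE)
  then have "EX u. u : {0..1} & c u = p n i" by (intro exI[of _ u]) simp
  then show ?thesis unfolding t_def by (rule someI_ex)
 qed
 have t1: "t n i : {0..1}" if "i : I n" for n i using t[OF that] by blast
 have ex: "EX s M. strict_mono s & sets M = sets borel & finite_measure M & measure M UNIV = W &
  emeasure M (- c ` {0..1}) = 0 & (ALL f::real * real => complex. contn f -->
   (%n. SUM i:I (s n). of_real (w (s n) i) * f (c (t (s n) i))) ----> (LINT x|M. f x))" by (rule discrete_weak_limit[OF c(1) fin t1 w W])
 have eq: "(SUM i:I n. of_real (w n i) * f (c (t n i))) = (SUM i:I n. of_real (w n i) * f (p n i))" for n and f :: "real * real => complex"
  by (intro sum.cong refl) (simp add: t)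
 obtain s M where sM: "strict_mono s" "sets M = sets borel" "finite_measure M" "measure M UNIV = W" "emeasure M (- c ` {0..1}) = 0"
  and lim: "ALL f::real * real => complex. contn f --> (%n. SUM i:I (s n). of_real (w (s n) i) * f (p (s n) i)) ----> (LINT x|M. f x)"
  using ex unfolding eq by (elim exE conjE) (rule that, assumption+)
 then show ?thesis by blast
qed

section \<open>Product measures and projection-valued measures\<close>

definition rectangles :: "('s::topological_space \<times> 't::topological_space) set set" where
 "rectangles = {A \<times> B |A B. A : sets borel & B : sets borel}"

lemma Int_stable_rectangles: "Int_stable rectangles" unfolding rectangles_def by (rule Int_stable_pair_measure_generator)

lemma sigma_sets_rectangles: "sigma_sets UNIV (rectangles :: ('s::second_countable_topology \<times> 't::second_countable_topology) set set) = sets borel"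
 unfolding rectangles_def borel_prod[symmetric] sets_pair_measure by simp

lemma Times_borel:
 fixes A :: "'s::second_countable_topology set" and B :: "'t::second_countable_topology set"
 assumes "A : sets borel" "B : sets borel" shows "A \<times> B : sets borel" using assms unfolding borel_prod[symmetric] by (rule pair_measureI)

lemma measure_eqI_rectangles:
 fixes M N :: "('s::second_countable_topology \<times> 't::second_countable_topology) measure"
 assumes "sets M = sets borel" "sets N = sets borel" "finite_measure M"
  and eq: "!!A B. A : sets borel ==> B : sets borel ==> emeasure M (A \<times> B) = emeasure N (A \<times> B)" shows "M = N"
proof (rule measure_eqI_generator_eq[where E = rectangles and \<Omega> = UNIV and A = "%_. UNIV"])
 show "sets M = sigma_sets UNIV rectangles" "sets N = sigma_sets UNIV rectangles" using assms(1,2) by (simp_all add: sigma_sets_rectangles)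
 have "UNIV \<times> UNIV : (rectangles :: ('s \<times> 't) set set)" unfolding rectangles_def by (rule CollectI, intro exI[of _ UNIV] conjI refl) simp_all
 then show "range (%_. UNIV) <= (rectangles :: ('s \<times> 't) set set)" by simp
 show "emeasure M UNIV ~= \<infinity>" using assms(3) finite_measure.emeasure_finite by auto
 show "emeasure M X = emeasure N X" if "X : rectangles" for X using that by (auto simp: rectangles_def eq)
qed (auto simp: Int_stable_rectangles)

lemma pvm_eqI_rectangles:
 fixes G H :: "('s::second_countable_topology \<times> 't::second_countable_topology) set => 'a::chilbert_space bop" assumes G: "pvm G" and H: "pvm H"
  and eq: "!!A B. A : sets borel ==> B : sets borel ==> G (A \<times> B) = H (A \<times> B)" shows "G = H"
proof (rule pvm_eqI_sd[OF G H], rule measure_eqI_rectangles)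
 fix x and A :: "'s set" and B :: "'t set" assume "A : sets borel" "B : sets borel"
 then show "emeasure (sdist G x) (A \<times> B) = emeasure (sdist H x) (A \<times> B)"
  using eq by (simp add: emeasure_sdist[OF G] emeasure_sdist[OF H] Times_borel)
qed (simp_all add: sets_sdist[OF G] sets_sdist[OF H] finite_measure_sdist[OF G])

lemma closed_approx:
 fixes C :: "'s::metric_space set" assumes "closed C" shows "EX g::nat => 's => complex. (ALL k. contn (g k)) & (ALL k z. cmod (g k z) <= 1) &
  (ALL z. (%k. g k z) ----> ind C z)"
proof (cases "C = {}")
 case True
 then show ?thesis by (intro exI[of _ "%k z. 0"]) simp
next
 case False
 define f where "f k z = max 0 (1 - real k * infdist z C)" for k z
 have f_lim: "(%k. f k z) ----> ind C z" for z proof (cases "z : C")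
  case True
  then show ?thesis by (simp add: f_def)
 next
  case z: False
  then have pos: "infdist z C > 0" using in_closed_iff_infdist_zero[OF assms False, of z] infdist_nonneg[of z C] by linarith
  obtain K where K: "1 / infdist z C <= real K" using real_arch_simple by blast
  have "f k z = 0" if "k >= K" for k proof -
   have "1 / infdist z C <= real k" using K that by linarith
   then show ?thesis using pos by (simp add: f_def field_simps)
  qed
  then show ?thesis using z by (intro tendsto_eventually eventually_sequentiallyI[of K]) simp
 qed
 have "(%k. cor (f k z)) ----> ind C z" for z using tendsto_of_real[OF f_lim[of z], where 'a = complex] by (cases "z : C") simp_all
 moreover have "contn (%z. cor (f k z))" for k unfolding f_def by (intro continuous_intros)
 moreover have "cmod (cor (f k z)) <= 1" for k z by (simp add: f_def infdist_nonneg)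
 ultimately show ?thesis by (intro exI[of _ "%k z. cor (f k z)"] conjI allI)
qed

section \<open>Orthonormal bases and the trace\<close>

lemma subspace_closure: assumes "subspace (V::'a::real_normed_vector set)" shows "subspace (closure V)"
proof (rule subspaceI)
 show "0 : closure V" using assms closure_subset subspace_0 by blast
next
 fix x y assume "x : closure V" "y : closure V"
 then obtain f g where "!!n. f n : V" "f ----> x" "!!n. g n : V" "g ----> y" unfolding closure_sequential by blast
 then show "x + y : closure V" unfolding closure_sequential by (intro exI[of _ "%n. f n + g n"]) (auto intro: tendsto_add subspace_add[OF assms])
next
 fix c x assume "x : closure V"
 then obtain f where "!!n. f n : V" "f ----> x" unfolding closure_sequential by blast
 then show "c *\<^sub>R x : closure V" unfolding closure_sequential
  by (intro exI[of _ "%n. c *\<^sub>R f n"]) (auto intro: tendsto_intros subspace_scale[OF assms])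
qed

lemma cspan_superset: "S <= cspan (S::'a::complex_vector set)" unfolding cspan_def by (force intro: span_base exI[of _ 1])

lemma cspan_scaleC: assumes "x : cspan S" shows "c *C x : cspan (S::'a::complex_vector set)" using assms unfolding cspan_def
proof (induction rule: span_induct_alt)
 case base
 then show ?case by (simp add: scaleC_zero_right span_zero)
next
 case (step r x y)
 then obtain d u where x: "x = d *C u" "u : S" by blast
 have "c *C (r *\<^sub>R x + y) = r *\<^sub>R ((c * d) *C u) + c *C y" by (simp add: x scaleC_add_right scaleC_scaleR_commute scaleC_scaleC)
 moreover have "(c * d) *C u : span {c *C x |c x. x : S}" using x by (intro span_base) blast
 ultimately show ?case using step by (auto intro: span_add span_scale)
qed

lemma closure_cspan_scaleC: assumes "x : closure (cspan S)" shows "c *C x : closure (cspan (S::'a::chilbert_space set))"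
proof -
 obtain f where "!!n. f n : cspan S" "f ----> x" using assms unfolding closure_sequential by blast
 then show ?thesis unfolding closure_sequential by (intro exI[of _ "%n. c *C f n"]) (auto intro: tendsto_scaleC cspan_scaleC)
qed

lemma closure_cspan_eq_UNIV: assumes "!!y::'a::chilbert_space. (!!x. x : S ==> cin y x = 0) ==> y = 0" shows "closure (cspan S) = UNIV"
proof (rule closed_csubspace_eq_UNIV)
 show "subspace (closure (cspan S))" unfolding cspan_def by (intro subspace_closure subspace_span)
 show "y = 0" if "!!x. x : closure (cspan S) ==> cin y x = 0" for y using that cspan_superset[of S] closure_subset[of "cspan S"] by (intro assms) auto
qed (auto intro: closure_cspan_scaleC)

lemma closed_csubspace_superset: assumes "subspace M" "closed M" "!!c x. x : M ==> c *C x : M"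
  and "S <= M" "closure (cspan S) = (UNIV :: 'a::chilbert_space set)" shows "M = UNIV"
proof -
 have "cspan S <= M" unfolding cspan_def using assms by (intro span_minimal) auto
 then show ?thesis using assms(2,5) closure_minimal by blast
qed

text \<open>A maximal orthonormal set, from Zorn's lemma. It gives meaning to the choice in
  \<open>some_basis\<close> and hence to \<open>Tr\<close>.\<close>

lemma orthonormal_basis_exists: "EX S::'a::chilbert_space set. orthonormal_basis S"
proof -
 define on where "on S \<longleftrightarrow> (ALL x:S. ALL y:S. cin x y = (if x = y then 1 else 0))" for S :: "'a set"
 have "EX M:{S. on S}. ALL X:{S. on S}. M <= X --> X = M" proof (rule subset_Zorn)
  fix C assume C: "subset.chain {S. on S} C"
  have "on (\<Union>C)" unfolding on_def proof (intro ballI)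
   fix x y assume "x : \<Union>C" "y : \<Union>C"
   then obtain A B where "A : C" "x : A" "B : C" "y : B" by blast
   then obtain D where "D : C" "x : D" "y : D" using C unfolding subset_chain_def by blast
   then show "cin x y = (if x = y then 1 else 0)" using C unfolding subset_chain_def on_def by blast
  qed
  then show "EX U:{S. on S}. ALL X:C. X <= U" by (intro bexI[of _ "\<Union>C"]) auto
 qed
 then obtain S where S: "on S" and max: "!!X. on X ==> S <= X ==> X = S" by auto
 have "closure (cspan S) = UNIV" proof (rule closure_cspan_eq_UNIV, rule ccontr)
  fix y assume orth: "!!x. x : S ==> cin y x = 0" and "y ~= 0"
  define u where "u = (1 / norm y) *\<^sub>R y"
  have u: "cin u u = 1" using `y ~= 0` by (simp add: u_def cinner_self)
  have ux: "cin u x = 0" "cin x u = 0" if "x : S" for x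
   using orth[OF that] cinner_commute[of x y] by (simp_all add: u_def cinner_scaleR_left cinner_scaleR_right)
  have "on (insert u S)" using S u ux unfolding on_def by auto
  then have "u : S" using max[of "insert u S"] by blast
  then show False using u ux by fastforce
 qed
 then show ?thesis using S unfolding orthonormal_basis_def on_def by blast
qed

abbreviation onb :: "'a::chilbert_space set" where "onb == some_basis"

lemma onb: "orthonormal_basis (onb::'a::chilbert_space set)" unfolding some_basis_def by (rule someI_ex) (rule orthonormal_basis_exists)

lemma onb_cinner: "e : onb ==> f : onb ==> cin e f = (if e = (f::'a::chilbert_space) then 1 else 0)" using onb unfolding orthonormal_basis_def by blast

text \<open>The bound is uniform in F; this uniformity closes the set of expandable vectors in
  \<open>onb_expansion\<close>.\<close>

lemma norm_sub_onb_expansion_le: assumes F: "finite F" "F <= onb" shows "norm (y - (SUM e:F. cin e y *C e)) <= norm (y::'a::chilbert_space)"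
proof -
 define p where "p = (SUM e:F. cin e y *C e)"
 have "cin e p = cin e y" if "e : F" for e proof -
  have "cin e p = (SUM f:F. cin f y * (if e = f then 1 else 0))" unfolding p_def cinner_sum_right cinner_scaleC_right
   using F that by (intro sum.cong) (auto simp: onb_cinner subset_iff)
  then show ?thesis using F that by (simp add: if_distrib sum.delta cong: if_cong)
 qed
 then have "cin e (y - p) = 0" if "e : F" for e using that by (simp add: cinner_simps)
 then have "(SUM e:F. cnj (cin e y) * cin e (y - p)) = 0" by (intro sum.neutral) simp
 then have "cin p (y - p) = 0" by (subst (1) p_def) (simp only: cinner_sum_left cinner_scaleC_left)
 then have "(norm (p + (y - p)))^2 = (norm p)^2 + (norm (y - p))^2" by (rule orthogonal_norm_add)
 then have "(norm (y - p))^2 <= (norm y)^2" by simp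
 then show ?thesis unfolding p_def by (rule power2_le_imp_le) simp
qed

text \<open>The vectors equal to their expansion form a closed complex subspace that contains the
  basis.\<close>

lemma onb_expansion: "((%e. cin e y *C e) has_sum (y::'a::chilbert_space)) onb"
proof -
 define M where "M = {y::'a. ((%e. cin e y *C e) has_sum y) onb}"
 have "M = UNIV" proof (rule closed_csubspace_superset)
  show "closure (cspan onb) = (UNIV::'a set)" using onb unfolding orthonormal_basis_def by blast
  show scale: "c *C x : M" if "x : M" for c x using has_sum_bounded_linear[OF bounded_linear_scaleC[of c] that[unfolded M_def mem_Collect_eq]]
   by (simp add: M_def scaleC_scaleC cinner_simps o_def)
  have "x + y : M" if "x : M" "y : M" for x y using that has_sum_add[of "%e. cin e x *C e" onb x "%e. cin e y *C e" y]
   by (simp add: M_def scaleC_add_left cinner_simps)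
  then show "subspace M" using scale by (auto intro!: subspaceI simp: scaleR_scaleC) (simp add: M_def)
  show "onb <= M" proof
   fix e :: 'a assume e: "e : onb"
   show "e : M" unfolding M_def mem_Collect_eq by (rule has_sum_finite_neutralI[of "{e}"]) (use e in "auto simp: onb_cinner")
  qed
  show "closed M" unfolding closed_sequential_limits proof safe
   fix z :: "nat => 'a" and y assume z: "ALL n. z n : M" "z ----> y"
   show "y : M" unfolding M_def mem_Collect_eq has_sum_def tendsto_iff proof (intro allI impI)
    fix ep :: real assume "0 < ep"
    then obtain n where n: "dist (z n) y < ep / 2" using z(2) unfolding lim_sequentially by (meson half_gt_zero order_refl)
    have "\<forall>\<^sub>F F in finite_subsets_at_top onb. dist (SUM e:F. cin e (z n) *C e) (z n) < ep / 2"
     using z(1) `0 < ep` unfolding M_def mem_Collect_eq has_sum_def tendsto_iff by (metis half_gt_zero)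
    moreover have "\<forall>\<^sub>F F in finite_subsets_at_top (onb::'a set). finite F & F <= onb" by (auto simp: eventually_finite_subsets_at_top)
    ultimately show "\<forall>\<^sub>F F in finite_subsets_at_top onb. dist (SUM e:F. cin e y *C e) y < ep" proof eventually_elim
     case (elim F)
     let ?P = "%x. SUM e:F. cin e x *C e"
     have "y - ?P y = (y - z n) - ?P (y - z n) + (z n - ?P (z n))" by (simp add: cinner_simps scaleC_diff_left sum_subtractf)
     then have "norm (y - ?P y) <= norm ((y - z n) - ?P (y - z n)) + norm (z n - ?P (z n))" by (rule ssubst) (rule norm_triangle_ineq)
     also have "norm ((y - z n) - ?P (y - z n)) <= norm (y - z n)" using elim(2) by (intro norm_sub_onb_expansion_le) auto
     finally have "norm (y - ?P y) <= norm (y - z n) + norm (z n - ?P (z n))" by simp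
     then show ?case using n elim(1) by (simp add: dist_norm norm_minus_commute)
    qed
   qed
  qed
 qed
 then show ?thesis unfolding M_def by blast
qed

lemma parseval: "((%e. cin x e * cin e y) has_sum cin x (y::'a::chilbert_space)) onb"
 using has_sum_bounded_linear[OF bounded_bilinear.bounded_linear_right[OF bounded_bilinear_cinner] onb_expansion, of x y]
 by (simp add: cinner_simps mult.commute o_def)

lemma parseval_norm: "((%e. (cmod (cin e y))^2) has_sum (norm (y::'a::chilbert_space))\<^sup>2) onb"
proof -
 have "cin y e * cin e y = of_real ((cmod (cin e y))^2)" for e using cinner_commute[of y e] complex_norm_square[of "cin e y"] by (simp add: mult.commute)
 then have "((%e. cor ((cmod (cin e y))^2)) has_sum cor ((norm y)^2)) onb" using parseval[of y y] by (simp add: cinner_self)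
 then show ?thesis by (simp only: has_sum_of_real_iff)
qed

lemma summable_cinner_mult: "(%e. cmod (cin x e) * cmod (cin e (y::'a::chilbert_space))) summable_on onb"
 "(\<Sum>\<^sub>\<infinity>e\<in>onb. cmod (cin x e) * cmod (cin e y)) <= ((norm x)^2 + (norm y)^2) / 2"
proof -
 have s: "((%e. ((cmod (cin e x))^2 + (cmod (cin e y))^2) * (1/2)) has_sum ((norm x)^2 + (norm y)^2) * (1/2)) onb"
  by (intro has_sum_cmult_left has_sum_add parseval_norm)
 have le: "cmod (cin x e) * cmod (cin e y) <= ((cmod (cin e x))^2 + (cmod (cin e y))^2) * (1/2)" for e
  using sum_squares_ge_zero[of "cmod (cin e x) - cmod (cin e y)" 0] cinner_commute[of x e] by (simp add: power2_eq_square algebra_simps)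
 show *: "(%e. cmod (cin x e) * cmod (cin e y)) summable_on onb" using has_sum_imp_summable[OF s] by (rule summable_on_comparison_test) (use le in auto)
 have "(\<Sum>\<^sub>\<infinity>e\<in>onb. cmod (cin x e) * cmod (cin e y)) <= ((norm x)^2 + (norm y)^2) * (1/2)"
  by (rule has_sum_mono[OF has_sum_infsum[OF *] s]) (rule le)
 then show "(\<Sum>\<^sub>\<infinity>e\<in>onb. cmod (cin x e) * cmod (cin e y)) <= ((norm x)^2 + (norm y)^2) / 2" by simp
qed

text \<open>\<open>v\<close> represents \<open>rh = \<Sum>\<^sub>i |v\<^sub>i\<rangle>\<langle>v\<^sub>i|\<close>.\<close>

definition represents :: "'i set => ('i => 'a::chilbert_space) => 'a bop => bool" where
 "represents I v rh \<longleftrightarrow> (%i. (norm (v i))^2) summable_on I & (ALL x y. ((%i. cin x (v i) * cin (v i) y) has_sum cin x (rh *V y)) I)"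

lemma form_summable:
 fixes v :: "'i => 'a::chilbert_space" assumes "(%i. (norm (v i))^2) summable_on I" shows "(%i. cmod (cin (v i) (A *V v i))) summable_on I"
proof (rule summable_on_comparison_test)
 show "(%i. norm A * (norm (v i))^2) summable_on I" by (intro summable_on_cmult_right assms)
 show "cmod (cin (v i) (A *V v i)) <= norm A * (norm (v i))^2" for i
  using cmod_cinner_le[of "v i" "A *V v i"] mult_left_mono[OF norm_apply_le[of A "v i"], of "norm (v i)"] by (simp add: power2_eq_square ac_simps)
qed auto

text \<open>The trace over the fixed basis becomes a sum over the vectors \<open>v i\<close>.
  Interchanging the two sums is justified by the summable bounds \<open>b i\<close>, half of |v i|^2
  + |A|^2 |v i|^2. Traces are computed in this form from here on.\<close>

lemma Tr_represents:
 fixes v :: "'i => 'a::chilbert_space" assumes v: "represents I v rh" shows "Tr (A * rh) = (\<Sum>\<^sub>\<infinity>i\<in>I. cin (v i) (A *V v i))"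
  and "(%e. cin e ((A * rh) *V e)) summable_on onb"
proof -
 have sv: "(%i. (norm (v i))^2) summable_on I" and rep: "((%i. cin x (v i) * cin (v i) y) has_sum cin x (rh *V y)) I" for x y
  using v unfolding represents_def by auto
 define g where "g i e = cin (v i) e * cin e (A *V v i)" for i and e :: 'a
 define b where "b i = (norm (v i))^2 * ((1 + (norm A)^2) / 2)" for i
 have nA: "(norm (A *V x))^2 <= (norm A)^2 * (norm x)^2" for x using power_mono[OF norm_apply_le[of A x], of 2] by (simp add: power_mult_distrib)
 have sum_g: "(%e. norm (g i e)) summable_on onb" "(\<Sum>\<^sub>\<infinity>e\<in>onb. norm (g i e)) <= b i" for i
  using summable_cinner_mult[of "v i" "A *V v i"] nA[of "v i"] by (auto simp: g_def norm_mult b_def field_simps)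
 have abs: "(%z. norm (case z of (i, e) => g i e)) summable_on (I \<times> onb)" proof -
  have "(%i. \<Sum>\<^sub>\<infinity>e\<in>onb. norm (g i e)) summable_on I" proof (rule summable_on_comparison_test)
   show "b summable_on I" unfolding b_def by (intro summable_on_cmult_left sv)
  qed (auto intro!: infsum_nonneg sum_g(2))
  then have "(%(i, e). norm (g i e)) summable_on (SIGMA i:I. onb)"
   by (intro summable_on_SigmaI[where g = "%i. \<Sum>\<^sub>\<infinity>e\<in>onb. norm (g i e)"]) (auto intro: has_sum_infsum[OF sum_g(1)])
  then show ?thesis by (simp add: case_prod_unfold)
 qed
 then have su: "(%(i, e). g i e) summable_on (I \<times> onb)" by (rule abs_summable_summable)
 have e: "cin e ((A * rh) *V e) = (\<Sum>\<^sub>\<infinity>i\<in>I. g i e)" for e proof -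
  have "((%i. g i e) has_sum cin (adj A *V e) (rh *V e)) I" using rep[of "adj A *V e" e] by (simp add: g_def cinner_adj_left mult.commute)
  then show ?thesis by (simp add: infsumI cinner_adj_left)
 qed
 have "Tr (A * rh) = (\<Sum>\<^sub>\<infinity>e\<in>onb. \<Sum>\<^sub>\<infinity>i\<in>I. g i e)" unfolding Tr_def e ..
 also have "... = (\<Sum>\<^sub>\<infinity>i\<in>I. \<Sum>\<^sub>\<infinity>e\<in>onb. g i e)" by (rule infsum_swap_banach[symmetric]) (rule su)
 also have "... = (\<Sum>\<^sub>\<infinity>i\<in>I. cin (v i) (A *V v i))" unfolding g_def by (simp add: infsumI[OF parseval])
 finally show "Tr (A * rh) = (\<Sum>\<^sub>\<infinity>i\<in>I. cin (v i) (A *V v i))" .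
 have "(%(e, i). g i e) summable_on (onb \<times> I)" using su by (subst (asm) summable_on_swap) simp
 then show "(%e. cin e ((A * rh) *V e)) summable_on onb" unfolding e by (rule summable_on_Sigma_banach)
qed

text \<open>The point is that one finite F serves all families h with the same kind of bound. It
  replaces dominated convergence when the sum is exchanged with a mean, or with a limit of spectral
  integrals.\<close>

lemma represents_approx:
 fixes v :: "'i => 'a::chilbert_space" assumes v: "(%i. (norm (v i))^2) summable_on I" and "0 < ep"
 shows "EX F. finite F & F <= I & (ALL h K. (ALL i. cmod (h i) <= K * (norm (v i))^2) --> 0 <= K -->
  cmod ((\<Sum>\<^sub>\<infinity>i\<in>I. h i) - (SUM i:F. h i)) <= ep * K)"
proof -
 let ?n = "%i. (norm (v i))^2"
 obtain F where F: "finite F" "F <= I" "dist (sum ?n F) (infsum ?n I) <= ep" using infsum_finite_approximation[OF v `0 < ep`] by blast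
 show ?thesis proof (intro exI[of _ F] conjI allI impI F)
  fix h and K :: real assume h: "ALL i. cmod (h i) <= K * ?n i" and "0 <= K"
  have sm: "(%i. K * ?n i) summable_on J" if "J <= I" for J by (intro summable_on_cmult_right summable_on_subset_banach[OF v that])
  have as: "(%i. cmod (h i)) summable_on J" if "J <= I" for J by (rule summable_on_comparison_test[OF sm[OF that]]) (use h in auto)
  have "(\<Sum>\<^sub>\<infinity>i\<in>I. h i) - (SUM i:F. h i) = (\<Sum>\<^sub>\<infinity>i\<in>I-F. h i)"
   using infsum_Diff[OF abs_summable_summable[OF as[OF order_refl]] abs_summable_summable[OF as[OF F(2)]] F(2)] by (simp add: F)
  also have "cmod ... <= (\<Sum>\<^sub>\<infinity>i\<in>I-F. cmod (h i))" by (rule norm_infsum_bound) (rule as, blast)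
  also have "... <= (\<Sum>\<^sub>\<infinity>i\<in>I-F. K * ?n i)" by (rule infsum_mono) (use as sm h in auto)
  also have "... = K * (\<Sum>\<^sub>\<infinity>i\<in>I-F. ?n i)" by (rule infsum_cmult_right')
  also have "(\<Sum>\<^sub>\<infinity>i\<in>I-F. ?n i) = infsum ?n I - sum ?n F"
   using infsum_Diff[OF v summable_on_subset_banach[OF v F(2)] F(2)] by (simp add: F)
  also have "K * ... <= K * ep" using F(3) `0 <= K` by (intro mult_left_mono) (auto simp: dist_real_def)
  finally show "cmod ((\<Sum>\<^sub>\<infinity>i\<in>I. h i) - (SUM i:F. h i)) <= ep * K" by (simp add: mult.commute)
 qed
qed

lemma sum_form_bop:
 fixes b :: "'i => 'a::chilbert_space => 'a => complex" assumes c: "c summable_on I" and bd: "!!i x y. cmod (b i x y) <= c i * norm x * norm y"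
  and addl: "!!i x y z. b i (x + y) z = b i x z + b i y z" and scl: "!!i d x z. b i (d *C x) z = cnj d * b i x z"
  and addr: "!!i x y z. b i x (y + z) = b i x y + b i x z" and scr: "!!i d x z. b i x (d *C z) = d * b i x z"
 shows "EX A. ALL x y. ((%i. b i x y) has_sum cin x (A *V y)) I"
proof -
 have abs: "(%i. cmod (b i x y)) summable_on I" for x y by (rule summable_on_comparison_test[where f = "%i. c i * (norm x * norm y)"])
   (use bd c in "auto intro!: summable_on_cmult_left simp: mult.assoc")
 have s: "(%i. b i x y) summable_on I" for x y by (rule abs_summable_summable[OF abs])
 have "EX A. ALL x y. cin x (A *V y) = (\<Sum>\<^sub>\<infinity>i\<in>I. b i x y)" proof (rule form_bop)
  show "cmod (\<Sum>\<^sub>\<infinity>i\<in>I. b i x y) <= (\<Sum>\<^sub>\<infinity>i\<in>I. c i) * norm x * norm y" for x y proof -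
   have "cmod (\<Sum>\<^sub>\<infinity>i\<in>I. b i x y) <= (\<Sum>\<^sub>\<infinity>i\<in>I. cmod (b i x y))" by (rule norm_infsum_bound) (rule abs)
   also have "... <= (\<Sum>\<^sub>\<infinity>i\<in>I. c i * (norm x * norm y))"
    by (rule infsum_mono[OF abs summable_on_cmult_left[OF c]]) (use bd in "auto simp: mult.assoc")
   finally show ?thesis by (simp add: infsum_cmult_left' mult.assoc)
  qed
 qed (simp_all add: addl addr scl scr infsum_add s infsum_cmult_right')
 then show ?thesis using has_sum_infsum[OF s] by metis
qed

lemma represents_exists:
 fixes v :: "'i => 'a::chilbert_space" assumes v: "(%i. (norm (v i))^2) summable_on I" shows "EX rh. represents I v rh"
proof -
 have "EX rh. ALL x y. ((%i. cin x (v i) * cin (v i) y) has_sum cin x (rh *V y)) I" proof (rule sum_form_bop[OF v])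
  show "cmod (cin x (v i) * cin (v i) y) <= (norm (v i))^2 * norm x * norm y" for i x y
   using mult_mono[OF cmod_cinner_le[of x "v i"] cmod_cinner_le[of "v i" y]] by (simp add: norm_mult power2_eq_square ac_simps)
 qed (simp_all add: cinner_simps algebra_simps)
 then show ?thesis unfolding represents_def using v by blast
qed

lemma represents_trace_class: assumes "represents I v rh" shows "positive_trace_class rh" "Tr rh = (\<Sum>\<^sub>\<infinity>i\<in>I. of_real ((norm (v i))^2))"
proof -
 have "((%i. cor ((cmod (cin (v i) x))^2)) has_sum cin x (rh *V x)) I" for x proof -
  have "cin x (v i) * cin (v i) x = of_real ((cmod (cin (v i) x))^2)" for i
   using cinner_commute[of x "v i"] complex_norm_square[of "cin (v i) x"] by (simp add: mult.commute)
  moreover have "((%i. cin x (v i) * cin (v i) x) has_sum cin x (rh *V x)) I" using assms unfolding represents_def by blast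
  ultimately show ?thesis by (simp only:)
 qed
 then have h: "((%i. cor ((cmod (cin (v i) x))^2)) has_sum cin x (rh *V x)) I" for x .
 have "cin x (rh *V x) : \<real>\<^sub>\<ge>\<^sub>0" for x proof -
  have r: "((%i. (cmod (cin (v i) x))^2) has_sum Re (cin x (rh *V x))) I"
   using has_sum_bounded_linear[OF bounded_linear_Re h[of x]] by (simp add: o_def del: of_real_power)
  then have "cin x (rh *V x) = of_real (Re (cin x (rh *V x)))" by (intro has_sum_unique[OF h[of x]]) (simp only: has_sum_of_real_iff)
  moreover have "0 <= Re (cin x (rh *V x))" by (rule has_sum_nonneg[OF r]) simp
  ultimately show ?thesis by (metis nonneg_Reals_of_real_iff)
 qed
 then show "positive_trace_class rh" unfolding positive_trace_class_def positive_op_def using Tr_represents(2)[OF assms, of 1] by simp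
 show "Tr rh = (\<Sum>\<^sub>\<infinity>i\<in>I. of_real ((norm (v i))^2))" using Tr_represents(1)[OF assms, of 1] by (simp add: cinner_self)
qed

lemma unit_density:
 fixes a :: "'a::chilbert_space" assumes "norm a = 1" shows "EX rh. density_operator rh & (ALL A. Tr (A * rh) = cin a (A *V a))"
proof -
 obtain rh where rh: "represents {()} (%_. a) rh" using represents_exists[of "%_. a" "{()}"] by auto
 then show ?thesis using Tr_represents(1)[OF rh] represents_trace_class[OF rh] assms unfolding density_operator_def by (intro exI[of _ rh]) simp
qed

text \<open>Rank one densities already separate operators. This is the uniqueness behind the
  descriptions of the mean projection and of the slice map.\<close>

lemma bop_eqI_density: assumes "!!rh. density_operator rh ==> Tr (A * rh) = Tr (B * rh)" shows "A = (B::'a::chilbert_space bop)"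
proof (rule bop_eqI_diag)
 fix x :: 'a
 show "cin x (A *V x) = cin x (B *V x)" proof (cases "x = 0")
  case False
  define u where "u = (1 / norm x) *\<^sub>R x"
  have "norm u = 1" and x: "x = norm x *\<^sub>R u" using False by (simp_all add: u_def)
  then obtain rh where "density_operator rh" "!!A. Tr (A * rh) = cin u (A *V u)" using unit_density by blast
  then have "cin u (A *V u) = cin u (B *V u)" using assms by metis
  then show ?thesis by (subst (1 2 3 4) x) (simp add: cinner_scaleR_left cinner_scaleR_right)
 qed simp
qed

section \<open>Bounded self-adjoint operators\<close>

lemma self_adjoint_graph_of: assumes "adj A = (A::'a::chilbert_space bop)" shows "self_adjoint (graph_of A)"
proof -
 have "adj_graph (graph_of A) = graph_of A" proof (intro set_eqI, clarify)
  fix y z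
  have "(y, z) : adj_graph (graph_of A) \<longleftrightarrow> (ALL x. cin x (A *V y) = cin x z)"
   using cinner_adj_right[of _ A y] assms unfolding adj_graph_def graph_of_def by auto
  also have "... \<longleftrightarrow> (y, z) : graph_of A" unfolding graph_of_def using cinner_extI[of "A *V y" z] by auto
  finally show "(y, z) : adj_graph (graph_of A) \<longleftrightarrow> (y, z) : graph_of A" .
 qed
 moreover have "Domain (graph_of A) = UNIV" unfolding graph_of_def by auto
 ultimately show ?thesis unfolding self_adjoint_def by simp
qed

context
 fixes E :: "real set => 'a::chilbert_space bop" assumes E: "pvm E"
begin

text \<open>On the range of E B the quadratic form is an integral of f over B. A strictly positive
  integrand with integral at most 0 leaves no mass on B.\<close>

lemma pvm_eq_0I: assumes B: "B : sets borel" and f: "bborel (%s. cor (f s))" and pos: "!!s. s : B ==> 0 < f s"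
  and le: "!!y. Re (cin (E B *V y) (SI E (%s. of_real (f s)) *V E B *V y)) <= 0" shows "E B = 0"
proof (rule bop_eqI)
 fix y
 let ?\<mu> = "sdist E y" and ?f = "%s. cor (f s)"
 interpret finite_measure ?\<mu> by (rule finite_measure_sdist[OF E])
 have m [measurable]: "f : bmeas" using measurable_compose[OF bborel_measurable[OF f] borel_measurable_Re] by simp
 have fB: "bborel (%s. ind B s * (?f s * ind B s))" using B f by (intro bborel_mult bborel_indicator)
 have "(\<integral>s. ind B s * (?f s * ind B s) \<partial>?\<mu>) =
   cin y (E B *V SI E ?f *V E B *V y)" using B f by (simp add: SI_diag[OF E fB, symmetric] SI_mult[OF E]
   bborel_mult bborel_indicator SI_indicator[OF E])
 also have "... = cin (E B *V y) (SI E ?f *V E B *V y)" by (metis cinner_adj_right pvm_adj[OF E B])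
 finally have "Re (\<integral>s. ind B s * (?f s * ind B s) \<partial>?\<mu>) <= 0" using le[of y] by simp
 moreover have int: "integrable ?\<mu> (%s. ind B s * (?f s * ind B s))" by (rule bborel_integrable[OF E fB])
 moreover have "Re (ind B s * (?f s * ind B s)) = ind B s * f s" for s by (simp add: indicator_def)
 ultimately have le0: "(\<integral>s. ind B s * f s \<partial>?\<mu>) <= 0" and int': "integrable ?\<mu> (%s. ind B s * f s)"
  using integral_Re[OF int] integrable_Re[OF int] by auto
 have nn: "0 <= ind B s * f s" for s using pos[of s] by (auto simp: indicator_def)
 then have "(\<integral>s. ind B s * f s \<partial>?\<mu>) = 0" using le0 by (intro antisym integral_nonneg_AE) auto
 then have "AE s in ?\<mu>. ind B s * f s = 0" using integral_nonneg_eq_0_iff_AE[OF int'] nn by auto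
 then have "AE s in ?\<mu>. s \<notin> B" by eventually_elim (use pos in "auto simp: indicator_def split: if_splits", force)
 then have "emeasure ?\<mu> B = 0" using AE_iff_null_sets[of B ?\<mu>] B by (auto simp: sets_sdist[OF E])
 then show "E B *V y = 0 *V y" using emeasure_sdist[OF E B, of y] by (simp add: ennreal_eq_0_iff)
qed

lemma sgraph_bounded: assumes 1: "E (cutoff n) = 1" shows "sgraph E = graph_of (SI E (idc n))"
proof (intro set_eqI, clarify)
 fix x w
 have "(x, SI E (idc n) *V x) : sgraph E" using sgraph_cut[OF E, of n x] 1 by simp
 then show "(x, w) : sgraph E \<longleftrightarrow> (x, w) : graph_of (SI E (idc n))" using sgraph_unique[OF E] unfolding graph_of_def by auto
qed

text \<open>On a shell M < |s| <= n the spectrum would make A longer than M times the vector, while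
  the norm bound says the opposite; \<open>pvm_eq_0I\<close> with s^2 - M^2 removes all
  shells.\<close>

lemma bounded_sgraph: assumes A: "graph_of A = sgraph E" and M: "norm A <= real M" shows "E (cutoff M) = 1" "A = SI E (idc M)"
proof -
 have A': "E (cutoff n) *V A *V x = SI E (idc n) *V x" for n x using A unfolding graph_of_def sgraph_def by blast
 have "E (cutoff n - cutoff M) = 0" for n proof (rule pvm_eq_0I)
  let ?B = "cutoff n - cutoff M" and ?f = "%s. cor ((s\<^sup>2 - (real M)^2) * ind (cutoff n) s)"
  have f: "?f = (%s. cnj (idc n s) * idc n s - of_real ((real M)^2) * ind (cutoff n) s)" by (auto simp: idc_def indicator_def power2_eq_square algebra_simps)
  show "bborel ?f" unfolding f by (intro bborel_diff bborel_mult bborel_cnj bborel_const bborel_idc bborel_indicator_cut)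
  show "?B : sets borel" by simp
  show "0 < (s\<^sup>2 - (real M)^2) * ind (cutoff n) s" if "s : ?B" for s
   using that abs_le_square_iff[of s "real M"] by (auto simp: cutoff_def indicator_def abs_le_iff)
  fix y
  have "E (cutoff n) * E ?B = E ?B" by (simp add: pvm_Int[OF E] Int_absorb1)
  then have n: "E (cutoff n) *V E ?B *V y = E ?B *V y" by (metis times_bop_apply)
  let ?x = "E ?B *V y"
  have "SI E ?f = adj (SI E (idc n)) * SI E (idc n) - of_real ((real M)^2) *C E (cutoff n)"
   unfolding f by (simp add: SI_diff[OF E] SI_mult[OF E] bborel_mult bborel_cnj
    SI_scale[OF E] SI_indicator[OF E] SI_adj[OF E] bborel_const
    SI_const[OF E] bop_distrib del: of_real_power)
  then have "cin ?x (SI E ?f *V ?x) = of_real ((norm (SI E (idc n) *V ?x))^2) - of_real ((real M)^2) * of_real ((norm ?x)^2)"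
   using n by (simp add: cinner_simps cinner_adj_right cinner_self del: of_real_power)
  moreover have "norm (SI E (idc n) *V ?x) <= M * norm ?x" proof -
   have "norm (SI E (idc n) *V ?x) <= norm (A *V ?x)" unfolding A'[symmetric] by (intro projection_norm_le pvm_projection[OF E]) simp
   also have "... <= M * norm ?x" using order_trans[OF norm_apply_le mult_right_mono[OF M norm_ge_zero]] .
   finally show ?thesis .
  qed
  then have "(norm (SI E (idc n) *V ?x))^2 <= (real M)^2 * (norm ?x)^2"
   using power_mono[of "norm (SI E (idc n) *V ?x)" "M * norm ?x" 2] by (simp add: power_mult_distrib)
  ultimately show "Re (cin ?x (SI E ?f *V ?x)) <= 0" by (simp del: of_real_power flip: of_real_mult of_real_diff)
 qed
 then have "E (cutoff M Un (cutoff n - cutoff M)) = E (cutoff M)" for n by (subst pvm_Un[OF E]) auto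
 moreover have "cutoff M Un (cutoff n - cutoff M) = cutoff n" if "M <= n" for n using that by (auto simp: cutoff_def)
 ultimately have "E (cutoff n) = E (cutoff M)" if "M <= n" for n using that by metis
 then have "(%n. E (cutoff n) *V x) ----> E (cutoff M) *V x" for x
  by (intro tendsto_eventually eventually_sequentiallyI[of M]) (rule arg_cong[where f = "%A. A *V x"])
 then have "E (cutoff M) *V x = x" for x using LIMSEQ_unique cut_tendsto[OF E] by blast
 then show 1: "E (cutoff M) = 1" by (intro bop_eqI) simp
 show "A = SI E (idc M)" using A'[of M] 1 by (intro bop_eqI) simp
qed

end

lemma hermitian_spectral: assumes "adj A = (A::'a::chilbert_space bop)" "norm A <= real M" shows "EX E. pvm E & graph_of A = sgraph E & E (cutoff M) = 1
  & A = SI E (idc M)" using spectral_theorem[OF self_adjoint_graph_of[OF assms(1)]] bounded_sgraph assms(2) by blast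

text \<open>Positivity of A kills the projection of the negative numbers, by
  \<open>pvm_eq_0I\<close> with - s. The root is then the spectral integral of sqrt over
  [0, M].\<close>

lemma positive_sqrt: assumes A: "positive_op (A::'a::chilbert_space bop)" shows "EX R. adj R = R & R * R = A"
proof -
 obtain M where M: "norm A <= real M" using real_arch_simple by blast
 obtain E where E: "pvm E" and EM: "E (cutoff M) = 1" and AE: "A = SI E (idc M)" using hermitian_spectral[OF positive_op_adj[OF A] M] by blast
 have "E (cutoff M Int {..<0}) = 0" proof (rule pvm_eq_0I[OF E])
  have f: "(%s. cor (- s * ind (cutoff M) s)) = (%s. - idc M s)" by (auto simp: idc_def indicator_def)
  show "bborel (%s. cor (- s * ind (cutoff M) s))" unfolding f by (intro bborel_minus bborel_idc)
  have "SI E (%s. - idc M s) = - A" using SI_scale[OF E bborel_idc, of "-1" M] by (simp add: AE scaleC_minus_one)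
  then show "Re (cin (E (cutoff M Int {..<0}) *V y) (SI E (%s. cor (- s * ind (cutoff M) s)) *V
    E (cutoff M Int {..<0}) *V y)) <= 0" for y unfolding f using A unfolding positive_op_def by (auto simp: cinner_minus_right complex_nonneg_Reals_iff)
 qed auto
 then have E0: "E {0..real M} = 1" proof -
  have "cutoff M = (cutoff M Int {..<0}) Un {0..real M}" by (auto simp: cutoff_def)
  then have "E (cutoff M) = E (cutoff M Int {..<0}) + E {0..real M}"
   by (metis (no_types, lifting) pvm_Un[OF E] sets.Int cut_borel lessThan_borel atLeastAtMost_borel
    disjoint_iff Int_iff atLeastAtMost_iff lessThan_iff not_le)
  then show ?thesis using `E (cutoff M Int {..<0}) = 0` EM by simp
 qed
 define r where "r s = cor (sqrt s * ind {0..real M} s)" for s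
 have [measurable]: "r : bmeas" unfolding r_def by measurable
 have r: "bborel r" by (rule bborelI[of _ "sqrt M"]) (auto simp: r_def indicator_def)
 have "SI E r * SI E r = A" unfolding AE SI_mult[OF E r r, symmetric] proof (rule SI_support[OF E _ E0])
  show "r s * r s = idc M s" if "s : {0..real M}" for s using that by (auto simp: r_def idc_def cutoff_def indicator_def simp flip: of_real_mult)
 qed (auto intro: bborel_mult r)
 moreover have "(%s. cnj (r s)) = r" by (rule ext) (simp add: r_def)
 then have "adj (SI E r) = SI E r" by (simp add: SI_adj[OF E r])
 ultimately show ?thesis by blast
qed

text \<open>With R a hermitian root, Parseval's identity between R x and R y gives the decomposition
  into the vectors R e. No diagonalization of \<open>rh\<close> is involved.\<close>

lemma trace_class_represents: assumes rh: "positive_trace_class (rh::'a::chilbert_space bop)" shows "EX v. represents (onb::'a set) v rh"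
proof -
 obtain R where R: "adj R = R" "R * R = rh" using positive_sqrt rh unfolding positive_trace_class_def by blast
 have RR: "cin x (rh *V y) = cin (R *V x) (R *V y)" for x y by (metis R cinner_adj_right times_bop_apply)
 have "(%e. cor ((norm (R *V e))^2)) summable_on onb" using rh unfolding positive_trace_class_def RR cinner_self by blast
 then have "(%e. (norm (R *V e))^2) summable_on onb" using summable_on_bounded_linear[OF bounded_linear_Re, of "%e. cor ((norm (R *V e))^2)"]
  by (simp add: o_def del: of_real_power)
 moreover have "((%e. cin x (R *V e) * cin (R *V e) y) has_sum cin x (rh *V y)) onb" for x y
  using parseval[of "R *V x" "R *V y"] cinner_adj_left[of R x] cinner_adj_left[of R _ y] R(1) by (simp add: RR)
 ultimately show ?thesis unfolding represents_def by (intro exI[of _ "%e. R *V e"]) blast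
qed

section \<open>Tensor products\<close>

lemma closed_sequentialI:
 fixes M :: "'a::metric_space set" assumes "!!x z. (!!n::nat. x n : M) ==> x ----> z ==> z : M" shows "closed M"
 unfolding closed_sequential_limits using assms by blast

text \<open>Extension by continuity for a linear relation. Working with graphs makes
  well-definedness on the algebraic tensor product a consequence of the bound.\<close>

lemma bop_extend:
 fixes Ga :: "('g::chilbert_space \<times> 'g) set" assumes S: "subspace Ga" and scale: "!!c ps ps'. (ps, ps') : Ga ==> (c *C ps, c *C ps') : Ga"
  and K: "!!ps ps'. (ps, ps') : Ga ==> norm ps' <= K * norm ps" "0 <= K" and dense: "closure (Domain Ga) = UNIV"
 shows "EX T. norm T <= K & (ALL (ps, ps'):Ga. T *V ps = ps')"
proof -
 define R where "R ps ps' \<longleftrightarrow> (EX f g. (ALL n. (f n, g n) : Ga) & f ----> ps & g ----> ps')" for ps ps'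
 have add: "(a + b, a' + b') : Ga" if "(a, a') : Ga" "(b, b') : Ga" for a b a' b' using subspace_add[OF S that] by simp
 have diff: "(a - b, a' - b') : Ga" if "(a, a') : Ga" "(b, b') : Ga" for a b a' b' using subspace_diff[OF S that] by simp
 have ex: "EX ps'. R ps ps'" for ps proof -
  have "ps : closure (Domain Ga)" using dense by simp
  then obtain f where f: "!!n. f n : Domain Ga" "f ----> ps" unfolding closure_sequential by blast
  have "EX g. ALL n. (f n, g n) : Ga" using f(1) by (intro choice) auto
  then obtain g where g: "!!n. (f n, g n) : Ga" by blast
  have "Cauchy g" proof (rule metric_CauchyI)
   fix e :: real assume "0 < e"
   then have "0 < e / (K + 1)" using K(2) by simp
   then obtain N where N: "!!m n. m >= N ==> n >= N ==> dist (f m) (f n) < e / (K + 1)" using metric_CauchyD[OF LIMSEQ_imp_Cauchy[OF f(2)]] by blast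
   have "dist (g m) (g n) < e" if "m >= N" "n >= N" for m n proof -
    have "norm (g m - g n) <= (K + 1) * norm (f m - f n)" using K(1)[OF diff[OF g[of m] g[of n]]] mult_right_mono[of K "K + 1" "norm (f m - f n)"] by simp
    also have "... < e" using N[OF that] K(2) by (simp add: dist_norm field_simps)
    finally show ?thesis by (simp add: dist_norm)
   qed
   then show "EX N. ALL m>=N. ALL n>=N. dist (g m) (g n) < e" by blast
  qed
  then obtain ps' where "g ----> ps'" using Cauchy_convergent convergent_def by blast
  then show ?thesis unfolding R_def using f g by blast
 qed
 have bd: "norm ps' <= K * norm ps" if r: "R ps ps'" for ps ps' proof -
  obtain f g where "ALL n. (f n, g n) : Ga" "f ----> ps" "g ----> ps'" using r unfolding R_def by blast
  then show ?thesis by (intro LIMSEQ_le[OF tendsto_norm tendsto_mult_left[OF tendsto_norm]]) (auto intro: K)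
 qed
 have R_add: "R (a + b) (a' + b')" if ab: "R a a'" "R b b'" for a b a' b' proof -
  obtain f g h k where "ALL n. (f n, g n) : Ga" "f ----> a" "g ----> a'" "ALL n. (h n, k n) : Ga" "h ----> b" "k ----> b'" using ab unfolding R_def by blast
  then show ?thesis unfolding R_def by (intro exI[of _ "%n. f n + h n"] exI[of _ "%n. g n + k n"]) (auto intro: tendsto_add add)
 qed
 have R_scale: "R (c *C a) (c *C a')" if a: "R a a'" for c a a' proof -
  obtain f g where "ALL n. (f n, g n) : Ga" "f ----> a" "g ----> a'" using a unfolding R_def by blast
  then show ?thesis unfolding R_def by (intro exI[of _ "%n. c *C f n"] exI[of _ "%n. c *C g n"]) (auto intro: tendsto_scaleC scale)
 qed
 have uniq: "a' = b'" if "R a a'" "R a b'" for a a' b' using bd[OF R_add[OF that(1) R_scale[OF that(2), of "-1"]]] by (simp add: scaleC_minus_one)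
 define f where "f ps = (SOME ps'. R ps ps')" for ps
 have f: "R ps (f ps)" for ps unfolding f_def by (rule someI_ex[OF ex])
 have "clinear f" unfolding clinear_def using uniq[OF f R_add[OF f f]] uniq[OF f R_scale[OF f]] by blast
 then obtain T where T: "!!ps. T *V ps = f ps" using bop_exists[OF _ bd[OF f]] by blast
 have "norm T <= K" using bd[OF f] K(2) by (intro norm_bop_le) (auto simp: T)
 moreover have "R ps ps'" if "(ps, ps') : Ga" for ps ps' unfolding R_def using that by (intro exI[of _ "%_. ps"] exI[of _ "%_. ps'"]) auto
 ultimately show ?thesis using uniq[OF f] by (intro exI[of _ T]) (auto simp: T)
qed

lemma sesquilinear_eq_0:
 fixes B :: "'a::chilbert_space => 'a => complex" assumes addl: "!!x y z. B (x + y) z = B x z + B y z" and scl: "!!c x z. B (c *C x) z = cnj c * B x z"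
  and addr: "!!x y z. B x (y + z) = B x y + B x z" and scr: "!!c x z. B x (c *C z) = c * B x z" and 0: "!!x. B x x = 0" shows "B x y = 0"
proof -
 have "B x y + B y x = 0" using 0[of "x + y"] by (simp add: addl addr 0[of x] 0[of y] add.commute)
 moreover have "\<i> * B x y + - \<i> * B y x = 0" using 0[of "x + \<i> *C y"] by (simp add: addl addr scl scr 0[of x] 0[of y])
 ultimately have "\<i> * (B x y + B x y) = 0" by (simp add: add_eq_0_iff2)
 then show ?thesis by simp
qed

context
 fixes tens :: "'a::chilbert_space => 'b::chilbert_space => 'g::chilbert_space" assumes T: "hilbert_tensor tens"
begin

lemma tens_add_left: "tens (x + x') y = tens x y + tens x' y" and tens_add_right: "tens x (y + y') = tens x y + tens x y'"
 and tens_scaleC_left: "tens (c *C x) y = c *C tens x y" and tens_scaleC_right: "tens x (c *C y) = c *C tens x y"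
 and cinner_tens: "cin (tens x y) (tens x' y') = cin x x' * cin y y'" and tens_dense: "closure (cspan {tens x y |x y. True}) = UNIV"
 using T unfolding hilbert_tensor_def clinear_def by blast+

lemma tens_scaleR_left: "tens (r *\<^sub>R x) y = r *\<^sub>R tens x y" and tens_scaleR_right: "tens x (r *\<^sub>R y) = r *\<^sub>R tens x y"
 by (simp_all add: scaleR_scaleC tens_scaleC_left tens_scaleC_right)

lemma tensor_flip: "hilbert_tensor (%y x. tens x y)"
proof -
 have "{tens x y |y x. True} = {tens x y |x y. True}" by blast
 then show ?thesis using T unfolding hilbert_tensor_def by (simp add: mult.commute)
qed

lemma norm_tens: "norm (tens x y) = norm x * norm y"
proof -
 have "cor ((norm (tens x y))^2) = of_real ((norm x * norm y)^2)" using cinner_tens[of x y x y] by (simp add: cinner_self power_mult_distrib)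
 then have "(norm (tens x y))^2 = (norm x * norm y)^2" by (simp only: of_real_eq_iff)
 then show ?thesis by (simp add: power2_eq_iff_nonneg)
qed

lemma bounded_bilinear_tens: "bounded_bilinear tens" by (rule bounded_bilinear.intro)
  (auto simp: tens_add_left tens_add_right tens_scaleR_left tens_scaleR_right norm_tens intro: exI[of _ 1])

lemmas tendsto_tens = bounded_bilinear.tendsto[OF bounded_bilinear_tens]

lemma tensor_csubspace_eq_UNIV: assumes "closed M" "!!c ps. ps : M ==> c *C ps : M" "!!ps ps'. ps : M ==> ps' : M ==> ps + ps' : M" and "!!x y. tens x y : M"
 shows "M = UNIV"
proof (rule closed_csubspace_superset[OF _ assms(1) _ _ tens_dense])
 show "subspace M" using assms(2)[OF assms(4), of 0] by (intro subspaceI) (auto simp: scaleR_scaleC assms(2,3))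
qed (use assms(2,4) in auto)

lemma bop_eqI_tens: assumes "!!x y. A *V tens x y = B *V tens x y" shows "A = B"
proof -
 have "{ps. A *V ps = B *V ps} = UNIV" proof (rule tensor_csubspace_eq_UNIV)
  show "closed {ps. A *V ps = B *V ps}" by (intro closed_Collect_eq linear_continuous_on bounded_linear_apply)
 qed (use assms in auto)
 then show ?thesis by (intro bop_eqI) blast
qed

lemma tens_eqI: assumes "!!x y. cin (tens x y) ps = cin (tens x y) ps'" shows "ps = ps'"
proof -
 have "{ph. cin ph ps = cin ph ps'} = UNIV" proof (rule tensor_csubspace_eq_UNIV)
  show "closed {ph. cin ph ps = cin ph ps'}" by (intro closed_Collect_eq linear_continuous_on bounded_bilinear.bounded_linear_left[OF bounded_bilinear_cinner])
 qed (use assms in "auto simp: cinner_simps")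
 then show ?thesis by (intro cinner_extI) blast
qed

text \<open>Polarization is applied in each factor separately, first to the left vectors with a
  common right vector, then to the right ones. So diagonal elements at product vectors suffice to
  identify operators on the tensor product.\<close>

lemma bop_eqI_tens_diag: assumes "!!x y. cin (tens x y) (A *V tens x y) = cin (tens x y) (B *V tens x y)" shows "A = B"
proof (rule bop_eqI_tens, rule tens_eqI)
 fix x y x' y'
 define D where "D = A - B"
 have 0: "cin (tens u y) (D *V tens u' y) = 0" for u u' y by (rule sesquilinear_eq_0[where B = "%u u'. cin (tens u y) (D *V tens u' y)"])
   (simp_all add: tens_add_left tens_scaleC_left cinner_simps D_def assms right_diff_distrib)
 have "cin (tens x' y') (D *V tens x y) = 0" by (rule sesquilinear_eq_0[where B = "%y' y. cin (tens x' y') (D *V tens x y)"])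
   (simp_all add: tens_add_right tens_scaleC_right cinner_simps 0)
 then show "cin (tens x' y') (A *V tens x y) = cin (tens x' y') (B *V tens x y)" by (simp add: D_def cinner_simps)
qed

lemma tensor_strong_limit:
 fixes A :: "nat => 'g bop" assumes K: "!!n. norm (A n) <= K" and lim: "!!x y. (%n. A n *V tens x y) ----> B *V tens x y" shows "(%n. A n *V ps) ----> B *V ps"
proof -
 have "{ps. (%n. A n *V ps) ----> B *V ps} = UNIV" proof (rule tensor_csubspace_eq_UNIV)
  show "closed {ps. (%n. A n *V ps) ----> B *V ps}" proof (rule closed_sequentialI, unfold mem_Collect_eq)
   fix x z assume x: "!!k::nat. (%n. A n *V x k) ----> B *V x k" and z: "x ----> z"
   define L where "L = (abs K) + norm B + 1"
   have L: "0 < L" unfolding L_def by (intro add_nonneg_pos add_nonneg_nonneg) auto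
   show "(%n. A n *V z) ----> B *V z" proof (rule LIMSEQ_I)
    fix e :: real assume e: "0 < e"
    then obtain k where k: "norm (x k - z) < e / (2 * L)" using LIMSEQ_D[OF z, of "e / (2 * L)"] L by auto
    obtain N where N: "!!n. n >= N ==> norm (A n *V x k - B *V x k) < e / 2" using LIMSEQ_D[OF x[of k], of "e / 2"] e by auto
    have "norm (A n *V z - B *V z) < e" if "n >= N" for n proof -
     have "A n *V z - B *V z = (A n *V x k - B *V x k) - (A n - B) *V (x k - z)" by (simp add: algebra_simps)
     also have "norm ... <= norm (A n *V x k - B *V x k) + norm ((A n - B) *V (x k - z))" by (rule norm_triangle_ineq4)
     also have "norm ((A n - B) *V (x k - z)) <= L * norm (x k - z)" using norm_triangle_ineq4[of "A n" B] K[of n]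
      by (intro order_trans[OF norm_apply_le mult_right_mono]) (auto simp: L_def)
     also have "L * norm (x k - z) < e / 2" using k L by (simp add: field_simps)
     finally show ?thesis using N[OF that] by simp
    qed
    then show "EX N. ALL n>=N. norm (A n *V z - B *V z) < e" by blast
   qed
  qed
 qed (auto intro: tendsto_intros lim)
 then show ?thesis by blast
qed

text \<open>Boundedness of \<open>A \<otimes> 1\<close> on the algebraic tensor product: with \<open>K = \<parallel>A\<parallel>\<close> and
  \<open>R = \<surd>(K\<^sup>2 - A\<^sup>* A)\<close> one has \<open>K\<^sup>2 \<parallel>ps\<parallel>\<^sup>2 = \<parallel>(A \<otimes> 1) ps\<parallel>\<^sup>2 + \<parallel>(R \<otimes> 1) ps\<parallel>\<^sup>2\<close>.\<close>

lemma tensor_left_exists: "EX S. norm S <= norm A & (ALL x y. S *V tens x y = tens (A *V x) y)"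
proof -
 define K where "K = norm A"
 have "positive_op (of_real (K\<^sup>2) *C 1 - adj A * A)" unfolding positive_op_def proof
  fix x
  have "(norm (A *V x))^2 <= (K * norm x)^2" unfolding K_def by (intro power_mono norm_apply_le norm_ge_zero)
  then show "cin x ((of_real (K\<^sup>2) *C 1 - adj A * A) *V x) : \<real>\<^sub>\<ge>\<^sub>0"
   by (simp add: cinner_simps cinner_adj_right cinner_self power_mult_distrib complex_nonneg_Reals_iff flip: of_real_mult of_real_diff of_real_power)
 qed
 then obtain R where R: "adj R = R" "R * R = of_real (K\<^sup>2) *C 1 - adj A * A" using positive_sqrt by blast
 have RA: "of_real (K\<^sup>2) * cin x y = cin (A *V x) (A *V y) + cin (R *V x) (R *V y)" for x y proof -
  have "cin (R *V x) (R *V y) = cin x ((R * R) *V y)" by (metis R(1) cinner_adj_left times_bop_apply)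
  then show ?thesis unfolding R(2) by (simp add: cinner_simps cinner_adj_right)
 qed
 \<comment> \<open>The third component carries the defect vector along. The form \<open>q\<close>
   vanishes on generators by \<open>RA\<close>, hence on the span, where the defect supplies the
   nonnegative difference of the two squared norms.\<close>
 define G where "G = {(tens x y, tens (A *V x) y, tens (R *V x) y) |x y. True}"
 define q where "q p p' = of_real (K\<^sup>2) * cin (fst p) (fst p') - cin (fst (snd p)) (fst (snd p'))
  - cin (snd (snd p)) (snd (snd p'))" for p p' :: "'g \<times> 'g \<times> 'g"
 have lin: "q p (a + b) = q p a + q p b" "q (a + b) p = q a p + q b p" "q (r *\<^sub>R a) p = of_real r * q a p"
  "q p (r *\<^sub>R a) = of_real r * q p a" "q 0 p = 0" "q p 0 = 0" for p a b r
  by (simp_all add: q_def cinner_simps cinner_scaleR_left cinner_scaleR_right algebra_simps)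
 have qG: "q a b = 0" if "a : G" "b : G" for a b using that RA unfolding G_def q_def by (auto simp: cinner_tens ring_distribs simp flip: mult.assoc)
 have qs: "q a b = 0" if "a : G" "b : span G" for a b using that(2) by (induction rule: span_induct_alt) (use that(1) in "auto simp: lin qG")
 have q0: "q a b = 0" if "b : span G" "a : span G" for a b using that(2) by (induction rule: span_induct_alt) (use that(1) in "auto simp: lin qs")
 define Ga where "Ga = (%p. (fst p, fst (snd p))) ` span G"
 have "EX S. norm S <= K & (ALL (ps, ps'):Ga. S *V ps = ps')" proof (rule bop_extend)
  have lp: "linear (%p::'g \<times> 'g \<times> 'g. (fst p, fst (snd p)))" by (intro linearI) auto
  show "subspace Ga" unfolding Ga_def by (intro linear_subspace_image lp subspace_span)
  show "norm ps' <= K * norm ps" if g: "(ps, ps') : Ga" for ps ps' proof -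
   obtain ps'' where "(ps, ps', ps'') : span G" using g unfolding Ga_def by force
   then have "Re (q (ps, ps', ps'') (ps, ps', ps'')) = 0" using q0 by simp
   then have "K\<^sup>2 * (norm ps)^2 - (norm ps')^2 = (norm ps'')^2" by (simp add: q_def cinner_self flip: of_real_mult of_real_diff of_real_power)
   moreover have "0 <= (norm ps'')^2" by simp
   ultimately have "(norm ps')^2 <= (K * norm ps)^2" unfolding power_mult_distrib by linarith
   then show ?thesis by (rule power2_le_imp_le) (simp add: K_def)
  qed
  show "0 <= K" by (simp add: K_def)
  show "(c *C ps, c *C ps') : Ga" if "(ps, ps') : Ga" for c ps ps' proof -
   let ?s = "%p::'g \<times> 'g \<times> 'g. (c *C fst p, c *C fst (snd p), c *C snd (snd p))"
   have ls: "linear ?s" by (intro linearI) (auto simp: scaleC_add_right scaleC_scaleR_commute)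
   have "?s ` G <= G" unfolding G_def by (force simp flip: tens_scaleC_left apply_scaleC)
   then have "?s ` span G <= span G" unfolding linear_span_image[OF ls, symmetric] by (rule span_mono)
   then show ?thesis using that unfolding Ga_def by force
  qed
  have "tens x y : Domain Ga" for x y unfolding Ga_def G_def
   by (intro DomainI[of _ "tens (A *V x) y"] image_eqI[where x = "(tens x y, tens (A *V x) y, tens (R *V x) y)"] span_base) auto
  then have "c *C tens x y : Domain Ga" for c x y by (metis tens_scaleC_left)
  then have "{c *C x |c x. x : {tens x y |x y. True}} <= fst ` Ga" by (auto simp: fst_eq_Domain)
  moreover have "subspace (fst ` Ga)" unfolding Ga_def by (intro linear_subspace_image lp subspace_span linear_fst)
  ultimately have "cspan {tens x y |x y. True} <= Domain Ga" unfolding cspan_def fst_eq_Domain[symmetric] by (rule span_minimal)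
  then show "closure (Domain Ga) = UNIV" using closure_mono tens_dense by blast
 qed
 moreover have "(tens x y, tens (A *V x) y) : Ga" for x y unfolding Ga_def G_def
  by (intro image_eqI[where x = "(tens x y, tens (A *V x) y, tens (R *V x) y)"] span_base) auto
 ultimately show ?thesis unfolding K_def by fastforce
qed

end

context
 fixes tens :: "'a::chilbert_space => 'b::chilbert_space => 'g::chilbert_space" assumes T: "hilbert_tensor tens"
begin

lemma tensor_op_eqI: assumes "!!x y. S *V tens x y = tens (A *V x) (B *V y)" shows "tensor_op tens A B = S"
 unfolding tensor_op_def by (rule the_equality) (use assms in "auto intro: bop_eqI_tens[OF T]")

lemma tensor_op_apply: "tensor_op tens A B *V tens x y = tens (A *V x) (B *V y)"
proof -
 obtain S where S: "!!x y. S *V tens x y = tens (A *V x) y" using tensor_left_exists[OF T, of A] by blast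
 obtain S' where S': "!!x y. S' *V tens x y = tens x (B *V y)" using tensor_left_exists[OF tensor_flip[OF T], of B] by blast
 have "tensor_op tens A B = S * S'" by (rule tensor_op_eqI) (simp add: S S')
 then show ?thesis by (simp add: S S')
qed

lemma norm_tensor_left: "norm (tensor_op tens A 1) <= norm A"
proof -
 obtain S where S: "norm S <= norm A" "!!x y. S *V tens x y = tens (A *V x) y" using tensor_left_exists[OF T, of A] by blast
 then have "tensor_op tens A 1 = S" by (intro tensor_op_eqI) simp
 then show ?thesis using S by simp
qed

lemma tensor_op_mult: "tensor_op tens A B * tensor_op tens C D = tensor_op tens (A * C) (B * D)" by (rule tensor_op_eqI[symmetric]) (simp add: tensor_op_apply)

lemma tensor_op_one: "tensor_op tens 1 1 = 1" by (rule tensor_op_eqI) simp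

lemma tensor_op_add_left: "tensor_op tens (A + B) C = tensor_op tens A C + tensor_op tens B C"
 by (rule tensor_op_eqI) (simp add: tensor_op_apply tens_add_left[OF T])

lemma tensor_op_scaleC_left: "tensor_op tens (c *C A) C = c *C tensor_op tens A C" by (rule tensor_op_eqI) (simp add: tensor_op_apply tens_scaleC_left[OF T])

lemma tensor_op_zero_left: "tensor_op tens 0 C = 0" using tensor_op_scaleC_left[of 0 0 C] by simp

lemma tensor_op_flip: "tensor_op (%y x. tens x y) B A = tensor_op tens A B" unfolding tensor_op_def by (rule arg_cong[where f = The]) auto

lemma adj_tensor_op: "adj (tensor_op tens A B) = tensor_op tens (adj A) (adj B)"
proof (rule bop_eqI_tens_diag[OF T])
 fix x y
 show "cin (tens x y) (adj (tensor_op tens A B) *V tens x y) = cin (tens x y) (tensor_op tens (adj A) (adj B) *V tens x y)"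
  by (simp add: cinner_adj_right tensor_op_apply cinner_tens[OF T])
qed

lemma projection_tensor: "projection A ==> projection B ==> projection (tensor_op tens A B)"
 unfolding projection_def by (simp add: tensor_op_mult adj_tensor_op)

lemma pvm_tensor_left:
 fixes E :: "'s::topological_space set => 'a bop" assumes E: "pvm E" shows "pvm (%B. tensor_op tens (E B) 1)" unfolding projection_valued_measure_def
proof (intro conjI ballI allI impI)
 have 1: "projection (1::'b bop)" unfolding projection_def by simp
 then show "B : sets borel ==> projection (tensor_op tens (E B) 1)" for B by (intro projection_tensor pvm_projection[OF E])
 show "B \<notin> sets borel ==> tensor_op tens (E B) 1 = 0" for B using E unfolding projection_valued_measure_def by (simp add: tensor_op_zero_left)
 show "tensor_op tens (E UNIV) 1 = 1" by (simp add: pvm_UNIV[OF E] tensor_op_one)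
 fix F :: "nat => 's set" and ps assume F: "range F <= sets borel" "disjoint_family F"
 then have Fb: "F n : sets borel" for n by blast
 have U: "(UN n<N. F n) : sets borel" for N using Fb by (intro sets.finite_UN) auto
 \<comment> \<open>The partial sums are projections, so their norms are bounded uniformly as
   \<open>tensor_strong_limit\<close> demands.\<close>
 have part: "(SUM n<N. E (F n)) = E (UN n<N. F n)" for N proof (induction N)
  case (Suc N)
  have "F n Int F N = {}" if "n < N" for n using disjoint_family_onD[OF F(2), of n N] that by simp
  then have "(UN n<N. F n) Int F N = {}" by blast
  then have "E ((UN n<N. F n) Un F N) = E (UN n<N. F n) + E (F N)" using U Fb by (intro pvm_Un[OF E])
  moreover have "(UN n<Suc N. F n) = (UN n<N. F n) Un F N" by (auto simp: less_Suc_eq)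
  ultimately show ?case using Suc by simp
 qed (simp add: pvm_empty[OF E])
 have tsum: "(SUM n<N. tensor_op tens (E (F n)) 1) = tensor_op tens (SUM n<N. E (F n)) 1" for N
  by (induction N) (simp_all add: tensor_op_zero_left tensor_op_add_left)
 have "(%N. (SUM n<N. tensor_op tens (E (F n)) 1) *V ps) ----> tensor_op tens (E (UN n. F n)) 1 *V ps" proof (rule tensor_strong_limit[OF T])
  show "norm (SUM n<N. tensor_op tens (E (F n)) 1) <= 1" for N unfolding tsum part using projection_norm_le[OF pvm_projection[OF E U[of N]]]
   by (intro order_trans[OF norm_tensor_left] norm_bop_le) auto
  fix x y
  have "(%N. (SUM n<N. E (F n)) *V x) ----> E (UN n. F n) *V x" using pvm_sums[OF E F, of x] unfolding sums_def by (simp add: sum_bop_apply)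
  then show "(%N. (SUM n<N. tensor_op tens (E (F n)) 1) *V tens x y) ----> tensor_op tens (E (UN n. F n)) 1 *V tens x y"
   unfolding tsum tensor_op_apply by (intro tendsto_tens[OF T] tendsto_const)
 qed
 then show "(%n. tensor_op tens (E (F n)) 1 *V ps) sums (tensor_op tens (E (UN n. F n)) 1 *V ps)" unfolding sums_def by (simp add: sum_bop_apply)
qed

lemma SI_tensor_left:
 fixes E :: "'s::topological_space set => 'a bop" assumes E: "pvm E" and f: "bborel f" shows "SI (%B. tensor_op tens (E B) 1) f = tensor_op tens (SI E f) 1"
 using f
proof (induction rule: bborel_induct)
 note E1 = pvm_tensor_left[OF E]
 case (ind B)
 then show ?case using SI_indicator[OF E1] SI_indicator[OF E] by simp
next
 case (add f g)
 then show ?case using SI_add[OF pvm_tensor_left[OF E]] SI_add[OF E] by (simp add: tensor_op_add_left)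
next
 case (mult f c)
 then show ?case using SI_scale[OF pvm_tensor_left[OF E]] SI_scale[OF E] by (simp add: tensor_op_scaleC_left)
next
 case (limit f F K)
 show ?case proof (rule bop_eqI_tens[OF T])
  fix x y
  have "(%i. tensor_op tens (SI E (F i)) 1 *V tens x y) ----> SI (%B. tensor_op tens (E B) 1) f *V tens x y"
   using SI_strong_limit[OF pvm_tensor_left[OF E] limit.hyps(1,2,4)] limit.IH by simp
  moreover have "(%i. tensor_op tens (SI E (F i)) 1 *V tens x y) ----> tensor_op tens (SI E f) 1 *V tens x y" unfolding tensor_op_apply
   by (intro tendsto_tens[OF T] tendsto_const SI_strong_limit[OF E limit.hyps(1,2,4)])
  ultimately show "SI (%B. tensor_op tens (E B) 1) f *V tens x y = tensor_op tens (SI E f) 1 *V tens x y" by (rule LIMSEQ_unique)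
 qed
qed

end

context
 fixes tens :: "'a::chilbert_space => 'b::chilbert_space => 'g::chilbert_space" and E :: "real set => 'a bop" and F :: "real set => 'b bop"
 assumes T: "hilbert_tensor tens" and E: "pvm E" and F: "pvm F"
begin

lemma pvm_tensor_right: "pvm (%B. tensor_op tens 1 (F B))" using pvm_tensor_left[OF tensor_flip[OF T] F] by (simp add: tensor_op_flip[OF T])

lemma SI_tensor_right: "bborel g ==> SI (%B. tensor_op tens 1 (F B)) g = tensor_op tens 1 (SI F g)"
 using SI_tensor_left[OF tensor_flip[OF T] F] by (simp add: tensor_op_flip[OF T])

abbreviation (input) "pm x y == sdist E x \<Otimes>\<^sub>M sdist F y"

lemma sets_prod: "sets (pm x y) = sets borel" using sets_pair_measure_cong[OF sets_sdist[OF E] sets_sdist[OF F]] unfolding borel_prod .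

lemma finite_measure_prod: "finite_measure (pm x y)" by (intro finite_measure_pair_measure finite_measure_sdist E F)

lemma emeasure_prod: assumes "A : sets borel" "B : sets borel" shows "emeasure (pm x y) (A \<times> B) = ennreal ((norm (E A *V x))^2 * (norm (F B *V y))^2)"
proof -
 interpret finite_measure "sdist F y" by (rule finite_measure_sdist[OF F])
 show ?thesis using assms by (simp add: emeasure_pair_measure_Times sets_sdist[OF E] sets_sdist[OF F]
   emeasure_sdist[OF E] emeasure_sdist[OF F] ennreal_mult)
qed

lemma prod_eqI: assumes "sets N = sets borel" and "!!A B. A : sets borel ==> B : sets borel ==> emeasure (pm x y) (A \<times> B) = emeasure N (A \<times> B)"
 shows "pm x y = N" by (rule measure_eqI_rectangles[OF sets_prod assms(1) finite_measure_prod assms(2)])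

text \<open>The reflections \<open>1 - 2 E(C)\<close> preserve all spectral distributions.\<close>

lemma diagonal_commute: assumes S: "!!x y. cin (tens x y) (A *V tens x y) = of_real (measure (pm x y) S)" and C: "C : sets borel" and D: "D : sets borel"
 shows "tensor_op tens (E C) (F D) * A = A * tensor_op tens (E C) (F D)"
proof -
 have refl: "R * R = 1 & adj R = R & (ALL B:sets borel. ALL x. norm (H B *V R *V x) = norm (H B *V x))"
  if H: "pvm H" and C: "C : sets borel" and R: "R = 1 - (H C + H C)" for H :: "real set => 'c::chilbert_space bop" and C R proof -
  have RR: "R * R = 1" unfolding R by (simp add: bop_distrib pvm_idem[OF H C])
  have aR: "adj R = R" unfolding R by (rule adj_eqI) (simp add: cinner_simps flip: cinner_adj_left, simp add: pvm_adj[OF H C])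
  have "norm (R *V x) = norm x" for x proof -
   have "cin (R *V x) (R *V x) = cin x ((adj R * R) *V x)" by (simp add: cinner_adj_right)
   then show ?thesis by (simp add: aR RR cinner_self del: of_real_power)
  qed
  moreover have "H B * R = R * H B" if "B : sets borel" for B unfolding R using pvm_Int[OF H that C] pvm_Int[OF H C that] by (simp add: bop_distrib Int_commute)
  ultimately show ?thesis using RR aR by (metis times_bop_apply)
 qed
 have conj: "V * A = A * V" if V: "V = tensor_op tens R R'" and R: "R * R = 1 & adj R = R & (ALL B:sets borel. ALL x. norm (E B *V R *V x) = norm (E B *V x))"
   and R': "R' * R' = 1 & adj R' = R' & (ALL B:sets borel. ALL y. norm (F B *V R' *V y) = norm (F B *V y))" for V R R' proof -
  have "V * A * V = A" proof (rule bop_eqI_tens_diag[OF T])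
   fix x y
   have aV: "adj V = V" by (simp add: V adj_tensor_op[OF T] R R')
   \<comment> \<open>The reflections preserve the spectral distributions of both factors, hence the
     product measure, and so V A V has the same diagonal as A.\<close>
   have "pm (R *V x) (R' *V y) = pm x y" by (rule prod_eqI[OF sets_prod]) (simp add: emeasure_prod R R')
   then show "cin (tens x y) ((V * A * V) *V tens x y) = cin (tens x y) (A *V tens x y)"
    using S[of "R *V x" "R' *V y"] S[of x y] cinner_adj_right[of "tens x y" V] unfolding aV by (simp add: V tensor_op_apply[OF T])
  qed
  then have "V * V * A * V = V * A" by (simp add: mult.assoc)
  moreover have "V * V = 1" by (simp add: V tensor_op_mult[OF T] R R' tensor_op_one[OF T])
  ultimately show ?thesis by simp
 qed
 have half: "P * A = A * P" if "(1 - (P + P)) * A = A * (1 - (P + P))" for P :: "'g bop" proof (rule bop_eqI)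
  fix z
  have "P * A + P * A = A * P + A * P" using arg_cong[OF that, of uminus] by (simp add: bop_distrib)
  then have "(P * A + P * A) *V z = (A * P + A * P) *V z" by simp
  then have "2 *\<^sub>R ((P * A) *V z) = 2 *\<^sub>R ((A * P) *V z)" by (simp add: scaleR_2)
  then show "(P * A) *V z = (A * P) *V z" by simp
 qed
 have l: "tensor_op tens (1 - (E C + E C)) 1 = 1 - (tensor_op tens (E C) 1 + tensor_op tens (E C) 1)"
  and r: "tensor_op tens 1 (1 - (F D + F D)) = 1 - (tensor_op tens 1 (F D) + tensor_op tens 1 (F D))"
  by (rule tensor_op_eqI[OF T], simp add: tensor_op_apply[OF T] bounded_bilinear.diff_left[OF bounded_bilinear_tens[OF T]]
   bounded_bilinear.add_left[OF bounded_bilinear_tens[OF T]] bounded_bilinear.diff_right[OF bounded_bilinear_tens[OF T]]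
   bounded_bilinear.add_right[OF bounded_bilinear_tens[OF T]])+
 have EC: "tensor_op tens (E C) 1 * A = A * tensor_op tens (E C) 1" by (rule half[OF conj[OF l[symmetric] refl[OF E C]]]) auto
 have FD: "tensor_op tens 1 (F D) * A = A * tensor_op tens 1 (F D)" by (rule half[OF conj[OF r[symmetric] _ refl[OF F D]]]) auto
 have split: "tensor_op tens (E C) (F D) = tensor_op tens (E C) 1 * tensor_op tens 1 (F D)" by (simp add: tensor_op_mult[OF T])
 show ?thesis unfolding split by (simp only: mult.assoc FD) (simp only: EC flip: mult.assoc)
qed

text \<open>An instance of \<open>pvm_of_diagonal\<close> with product vectors, product measures and
  rectangles; the required multiplicativity follows from \<open>diagonal_commute\<close>. The sides
  of a rectangle are recovered as its projections, and if one side is empty both expressions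
  vanish.\<close>

lemma tensor_joint_pvm: "EX G. pvm G & (ALL A:sets borel. ALL B:sets borel. G (A \<times> B) = tensor_op tens (E A) (F B))"
proof -
 define e where "e C = tensor_op tens (E (fst ` C)) (F (snd ` C))" for C
 have zero: "tensor_op tens 0 B = 0" "tensor_op tens A 0 = 0" for A B
  by (rule tensor_op_eqI[OF T], simp add: bounded_bilinear.zero_left[OF bounded_bilinear_tens[OF T]] bounded_bilinear.zero_right[OF bounded_bilinear_tens[OF T]])+
 have e: "e (A \<times> B) = tensor_op tens (E A) (F B)" for A B by (cases "A = {} | B = {}") (auto simp: e_def pvm_empty[OF E] pvm_empty[OF F] zero)
 have "EX G. pvm G & (ALL C:rectangles. G C = e C)" proof (rule pvm_of_diagonal[where M = "%i. pm (fst i) (snd i)" and ph = "%i. tens (fst i) (snd i)"])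
  have meas: "measure (pm x y) (A \<times> B) = (norm (E A *V x))^2 * (norm (F B *V y))^2" if "A : sets borel" "B : sets borel" for x y A B
   using that by (simp add: measure_def emeasure_prod)
  show "measure (pm (fst i) (snd i)) UNIV = (norm (tens (fst i) (snd i)))^2" for i
   using meas[of UNIV UNIV "fst i" "snd i"] by (simp add: pvm_UNIV[OF E] pvm_UNIV[OF F] norm_tens[OF T] power_mult_distrib)
  show "A = B" if "!!i. cin (tens (fst i) (snd i)) (A *V tens (fst i) (snd i)) = cin (tens (fst i) (snd i)) (B *V tens (fst i) (snd i))" for A B
   using that[of "(x, y)" for x y] by (intro bop_eqI_tens_diag[OF T]) simp
  fix C and i :: "'a \<times> 'b" assume "C : (rectangles :: (real * real) set set)"
  then obtain A B where C: "C = A \<times> B" "A : sets borel" "B : sets borel" by (auto simp: rectangles_def)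
  have eC: "e C = tensor_op tens (E A) (F B)" by (simp add: C(1) e)
  have pe: "projection (e C)" unfolding eC using C by (intro projection_tensor[OF T] pvm_projection[OF E] pvm_projection[OF F])
  show "cin (tens (fst i) (snd i)) (e C *V tens (fst i) (snd i)) = of_real (measure (pm (fst i) (snd i)) C)"
   unfolding projection_norm[OF pe] unfolding eC unfolding C(1) meas[OF C(2,3)] by (simp add: tensor_op_apply[OF T] norm_tens[OF T] power_mult_distrib)
  fix S and W :: "'g bop"
  assume S: "S : sets borel" and W: "!!i. cin (tens (fst i) (snd i)) (W *V tens (fst i) (snd i)) = of_real (measure (pm (fst i) (snd i)) S)"
  have W': "cin (tens x y) (W *V tens x y) = of_real (measure (pm x y) S)" for x y using W[of "(x, y)"] by simp
  have comm: "e C * W = W * e C" using diagonal_commute[OF W' C(2,3)] by (simp add: eC)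
  have "e C * W = e C * (e C * W)" using pe by (simp add: projection_def flip: mult.assoc)
  also have "... = e C * (W * e C)" by (simp only: comm)
  also have "... = adj (e C) * W * e C" using pe by (simp add: projection_def mult.assoc)
  finally have "cin (tens (fst i) (snd i)) ((e C * W) *V tens (fst i) (snd i)) = of_real (measure (pm (E A *V fst i) (F B *V snd i)) S)"
   using W' by (simp add: cinner_adj_right) (simp add: eC tensor_op_apply[OF T])
  also have "pm (E A *V fst i) (F B *V snd i) = density (pm (fst i) (snd i)) (ind C)" proof (rule prod_eqI)
   fix A' B' :: "real set" assume AB: "A' : sets borel" "B' : sets borel"
   have "emeasure (density (pm (fst i) (snd i)) (ind C)) (A' \<times> B') = emeasure (pm (fst i) (snd i)) (C Int A' \<times> B')"
    using C AB by (intro emeasure_restricted) (simp_all add: sets_prod Times_borel)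
   also have "C Int A' \<times> B' = (A' Int A) \<times> (B' Int B)" unfolding C(1) by auto
   finally show "emeasure (pm (E A *V fst i) (F B *V snd i)) (A' \<times> B') = emeasure (density (pm (fst i) (snd i)) (ind C)) (A' \<times> B')"
    using C AB by (simp add: emeasure_prod pvm_Int[OF E, symmetric] pvm_Int[OF F, symmetric])
  qed (simp add: sets_prod)
  also have "measure (density (pm (fst i) (snd i)) (ind C)) S = measure (pm (fst i) (snd i)) (C Int S)"
   using C S unfolding measure_def by (subst emeasure_restricted) (simp_all add: sets_prod Times_borel)
  finally show "cin (tens (fst i) (snd i)) ((e C * W) *V tens (fst i) (snd i)) = of_real (measure (pm (fst i) (snd i)) (C Int S))" .
 qed (simp_all add: sets_prod finite_measure_prod Int_stable_rectangles sigma_sets_rectangles)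
 then obtain G where G: "pvm G" "ALL C:rectangles. G C = e C" by blast
 have "G (A \<times> B) = tensor_op tens (E A) (F B)" if "A : sets borel" "B : sets borel" for A B proof -
  have "A \<times> B : rectangles" unfolding rectangles_def using that by blast
  then show ?thesis using G(2) by (simp add: e)
 qed
 with G(1) show ?thesis by blast
qed

definition tensor_pvm :: "(real * real) set => 'g bop" where "tensor_pvm = (SOME G. pvm G &
   (ALL A:sets borel. ALL B:sets borel. G (A \<times> B) = tensor_op tens (E A) (F B)))"

end

lemma fst_snd_borel [measurable]: "(fst :: 's::second_countable_topology \<times> 't::second_countable_topology => 's) : bmeas"
 "(snd :: 's \<times> 't => 't) : bmeas" by (intro continuous_borel continuous_intros)+

context
 fixes tens :: "'a::chilbert_space => 'b::chilbert_space => 'g::chilbert_space" and E :: "real set => 'a bop" and F :: "real set => 'b bop"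
 assumes T: "hilbert_tensor tens" and E: "pvm E" and F: "pvm F"
begin

abbreviation (input) "G == tensor_pvm tens E F"

lemma tensor_pvm: "pvm G" and tensor_pvm_Times: "A : sets borel ==> B : sets borel ==> G (A \<times> B) = tensor_op tens (E A) (F B)"
 using someI_ex[OF tensor_joint_pvm[OF T E F]] unfolding tensor_pvm_def[OF T E F] by blast+

lemma SI_tensor_pvm: assumes f: "bborel f" and g: "bborel g" shows "SI G (%z. f (fst z) * g (snd z)) = tensor_op tens (SI E f) (SI F g)"
proof -
 have "push_pvm fst G = (%B. tensor_op tens (E B) 1)" proof (rule pvm_eqI[OF pvm_push[OF tensor_pvm fst_snd_borel(1)] pvm_tensor_left[OF T E]])
  fix B :: "real set" assume B: "B : sets borel"
  have "(fst -` B :: (real * real) set) = B \<times> UNIV" by auto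
  then show "push_pvm fst G B = tensor_op tens (E B) 1" using B by (simp add: push_pvm_apply tensor_pvm_Times pvm_UNIV[OF F])
 qed
 then have 1: "SI G (%z. f (fst z)) = tensor_op tens (SI E f) 1" using SI_push[OF tensor_pvm fst_snd_borel(1) f] by (simp add: SI_tensor_left[OF T E f])
 have "push_pvm snd G = (%B. tensor_op tens 1 (F B))" proof (rule pvm_eqI[OF pvm_push[OF tensor_pvm fst_snd_borel(2)] pvm_tensor_right[OF T E F]])
  fix B :: "real set" assume B: "B : sets borel"
  have "(snd -` B :: (real * real) set) = UNIV \<times> B" by auto
  then show "push_pvm snd G B = tensor_op tens 1 (F B)" using B by (simp add: push_pvm_apply tensor_pvm_Times pvm_UNIV[OF E])
 qed
 then have 2: "SI G (%z. g (snd z)) = tensor_op tens 1 (SI F g)" using SI_push[OF tensor_pvm fst_snd_borel(2) g] by (simp add: SI_tensor_right[OF T E F g])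
 show ?thesis by (subst SI_mult[OF tensor_pvm bborel_comp[OF f fst_snd_borel(1)] bborel_comp[OF g fst_snd_borel(2)]]) (simp add: 1 2 tensor_op_mult[OF T])
qed

lemma spectral_distribution_tens: "sdist G (tens x y) = sdist E x \<Otimes>\<^sub>M sdist F y" (is "_ = ?M \<Otimes>\<^sub>M ?N")
proof (rule measure_eqI_rectangles)
 interpret M: finite_measure ?M by (rule finite_measure_sdist[OF E])
 interpret N: finite_measure ?N by (rule finite_measure_sdist[OF F])
 show "sets (sdist G (tens x y)) = sets borel" by (rule sets_sdist[OF tensor_pvm])
 show "sets (?M \<Otimes>\<^sub>M ?N) = sets borel" by (subst borel_prod[symmetric]) (rule sets_pair_measure_cong[OF sets_sdist[OF E] sets_sdist[OF F]])
 show "finite_measure (sdist G (tens x y))" by (rule finite_measure_sdist[OF tensor_pvm])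
 fix A B :: "real set" assume AB: "A : sets borel" "B : sets borel"
 have "emeasure (?M \<Otimes>\<^sub>M ?N) (A \<times> B) = ennreal ((norm (E A *V x))^2) * ennreal ((norm (F B *V y))^2)"
  using AB by (subst N.emeasure_pair_measure_Times) (auto simp: sets_sdist[OF E] sets_sdist[OF F]
    emeasure_sdist[OF E] emeasure_sdist[OF F])
 then show "emeasure (sdist G (tens x y)) (A \<times> B) = emeasure (?M \<Otimes>\<^sub>M ?N) (A \<times> B)"
  using AB by (subst emeasure_sdist[OF tensor_pvm Times_borel])
   (simp_all add: tensor_pvm_Times tensor_op_apply[OF T] norm_tens[OF T] power_mult_distrib ennreal_mult)
qed

lemma tensor_pvm_diag: assumes h: "bborel h" shows "cin (tens x y) (SI G h *V tens x y) =
  (\<integral>s. \<integral>p. h (s, p) \<partial>sdist F y \<partial>sdist E x)"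
proof -
 let ?M = "sdist E x" and ?N = "sdist F y"
 interpret M: finite_measure ?M by (rule finite_measure_sdist[OF E])
 interpret N: finite_measure ?N by (rule finite_measure_sdist[OF F])
 interpret pair_sigma_finite ?M ?N ..
 have "integrable (?M \<Otimes>\<^sub>M ?N) h" using bborel_integrable[OF tensor_pvm h, of "tens x y"] by (simp add: spectral_distribution_tens)
 then have "integrable (?M \<Otimes>\<^sub>M ?N) (%(s, p). h (s, p))" by simp
 from integral_fst'[OF this] show ?thesis by (simp add: SI_diag[OF tensor_pvm h] spectral_distribution_tens)
qed

lemma tensor_graph_scaleC: assumes "(ps, ps') : tensor_graph tens (sgraph E) (sgraph F)" shows "(c *C ps, c *C ps') : tensor_graph tens (sgraph E) (sgraph F)"
proof -
 define S where "S = {(tens x y, tens x' y') |x x' y y'. (x, x') : sgraph E & (y, y') : sgraph F}"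
 define s where "s p = (c *C fst p, c *C snd p)" for p :: "'g \<times> 'g"
 have bl: "bounded_linear s" unfolding s_def
  by (intro bounded_linear_Pair bounded_linear_compose[OF bounded_linear_scaleC] bounded_linear_fst bounded_linear_snd)
 have "s ` S <= S" proof
  fix p assume "p : s ` S"
  then obtain x x' y y' where xy: "(x, x') : sgraph E" "(y, y') : sgraph F" "p = (c *C tens x y, c *C tens x' y')" unfolding S_def s_def by auto
  then show "p : S" unfolding S_def mem_Collect_eq using sgraph_scaleC[OF E xy(1), of c]
   by (intro exI[of _ "c *C x"] exI[of _ "c *C x'"] exI[of _ y] exI[of _ y']) (simp add: tens_scaleC_left[OF T])
 qed
 then have "s ` span S <= span S" unfolding linear_span_image[OF bounded_linear.linear[OF bl], symmetric] by (rule span_mono)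
 then have "s ` closure (span S) <= closure (span S)" using closure_bounded_linear_image_subset[OF bl, of "span S"] closure_mono by blast
 then show ?thesis using assms unfolding tensor_graph_def S_def[symmetric] by (auto simp: s_def)
qed

text \<open>With \<open>C\<^sub>m = E[-m, m] \<otimes> F[-m, m]\<close> the bounded operator \<open>S\<^sub>m = C\<^sub>m (X \<otimes> P)\<close> is a tensor product;
  both graphs are the strong limits of the graphs of \<open>C\<^sub>m \<mapsto> S\<^sub>m\<close>.\<close>

lemma tensor_graph_sgraph: "tensor_graph tens (sgraph E) (sgraph F) = sgraph (push_pvm (%z. fst z * snd z) G)"
proof -
 define ph :: "real * real => real" where "ph z = fst z * snd z" for z
 have phm: "ph : bmeas" unfolding ph_def by measurable
 define H where "H = push_pvm ph G"
 have H: "pvm H" unfolding H_def by (rule pvm_push[OF tensor_pvm phm])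
 have IH: "SI H f = SI G (%z. f (ph z))" if "bborel f" for f unfolding H_def by (rule SI_push[OF tensor_pvm phm that])
 have HI: "H B = SI G (%z. ind B (ph z))" if "B : sets borel" for B using IH[of "ind B"] that SI_indicator[OF H] by auto
 define k :: "nat => real * real => complex" where "k m z = ind (cutoff m) (fst z) * ind (cutoff m) (snd z)" for m z
 define d where "d m z = idc m (fst z) * idc m (snd z)" for m and z :: "real * real"
 have bk: "bborel (k m)" and bd: "bborel (d m)" for m
  unfolding k_def d_def by (intro bborel_mult bborel_comp[OF _ fst_snd_borel(1)] bborel_comp[OF _ fst_snd_borel(2)]; simp add: bborel_indicator)+
 have bph: "bborel (%z. f (ph z))" if "bborel f" for f by (rule bborel_comp[OF that phm])
 define C where "C m = SI G (k m)" for m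
 define S where "S m = SI G (d m)" for m
 have C: "C m = tensor_op tens (E (cutoff m)) (F (cutoff m))" for m unfolding C_def k_def by (subst SI_tensor_pvm)
   (auto simp: SI_indicator[OF E] SI_indicator[OF F])
 have S: "S m = tensor_op tens (SI E (idc m)) (SI F (idc m))" for m unfolding S_def d_def by (rule SI_tensor_pvm) simp_all
 have Clim: "(%m. C m *V ps) ----> ps" for ps proof -
  have "(%m. k m z) ----> 1" for z unfolding k_def using tendsto_mult[OF tendsto_indicator_cut[of 1 "fst z"] tendsto_indicator_cut[of 1 "snd z"]] by simp
  then have "(%m. C m *V ps) ----> SI G (%_. 1) *V ps"
   unfolding C_def by (intro SI_strong_limit[OF tensor_pvm bk, where K = 1]) (auto simp: k_def indicator_def)
  then show ?thesis by (simp add: SI_one[OF tensor_pvm])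
 qed
 have Cext: "a = b" if "!!m. C m *V a = C m *V b" for a b using LIMSEQ_unique[OF Clim[of a]] Clim[of b] that by simp
 have mult: "SI G f * SI G g = SI G h" if "bborel f" "bborel g" "!!z. f z * g z = h z" for f g h using SI_mult[OF tensor_pvm that(1,2)] that(3) by simp
 have "tensor_graph tens (sgraph E) (sgraph F) <= sgraph H" unfolding tensor_graph_def
 proof (rule closure_minimal[OF span_minimal[OF _ sgraph_subspace[OF H]] sgraph_closed[OF H]], rule subsetI)
  fix p assume "p : {(tens x y, tens x' y') |x x' y y'. (x, x') : sgraph E & (y, y') : sgraph F}"
  then obtain x x' y y' where p: "p = (tens x y, tens x' y')" and x: "(x, x') : sgraph E" and y: "(y, y') : sgraph F" by blast
  have "H (cutoff n) *V tens x' y' = SI H (idc n) *V tens x y" for n proof (rule Cext)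
   fix m
   have CS: "C m *V tens x' y' = S m *V tens x y" using x y unfolding C S sgraph_def by (simp add: tensor_op_apply[OF T])
   have "C m * H (cutoff n) = H (cutoff n) * C m" unfolding C_def HI[OF cut_borel] by (rule SI_mult_commute[OF tensor_pvm bk bph]) simp
   then have "C m *V H (cutoff n) *V tens x' y' = (H (cutoff n) * S m) *V tens x y" using CS by (metis times_bop_apply)
   also have "H (cutoff n) * S m = C m * SI H (idc n)" proof -
    have "C m * SI H (idc n) = SI G (%z. k m z * idc n (ph z))" unfolding C_def IH[OF bborel_idc] by (rule mult[OF bk bph]) simp_all
    moreover have "H (cutoff n) * S m = SI G (%z. k m z * idc n (ph z))" unfolding HI[OF cut_borel] S_def
     by (rule mult[OF bph bd]) (simp_all add: bborel_indicator d_def k_def idc_def ph_def)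
    ultimately show ?thesis by simp
   qed
   finally show "C m *V H (cutoff n) *V tens x' y' = C m *V SI H (idc n) *V tens x y" by simp
  qed
  then show "p : sgraph H" unfolding sgraph_def p by blast
 qed
 moreover have "(ps, ps') : tensor_graph tens (sgraph E) (sgraph F)" if ps: "(ps, ps') : sgraph H" for ps ps' proof -
  let ?TG = "tensor_graph tens (sgraph E) (sgraph F)"
  have cl: "closed ?TG" unfolding tensor_graph_def by simp
  have sub: "subspace ?TG" unfolding tensor_graph_def by (intro subspace_closure subspace_span)
  have CS: "(C m *V ps, S m *V ps) : ?TG" for m ps proof -
   have "{ps. (C m *V ps, S m *V ps) : ?TG} = UNIV" proof (rule tensor_csubspace_eq_UNIV[OF T])
    show "closed {ps. (C m *V ps, S m *V ps) : ?TG}" proof (rule closed_sequentialI, unfold mem_Collect_eq)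
     fix x z assume x: "!!n::nat. (C m *V x n, S m *V x n) : ?TG" and z: "x ----> z"
     show "(C m *V z, S m *V z) : ?TG" by (rule closed_sequentially[OF cl, of "%n. (C m *V x n, S m *V x n)"], rule x) (intro tendsto_Pair tendsto_apply_bop z)
    qed
    show "c *C ps : {ps. (C m *V ps, S m *V ps) : ?TG}" if "ps : {ps. (C m *V ps, S m *V ps) : ?TG}" for c ps
     using tensor_graph_scaleC[of "C m *V ps" "S m *V ps" c] that by simp
    show "ps + ps' : {ps. (C m *V ps, S m *V ps) : ?TG}" if "ps : {ps. (C m *V ps, S m *V ps) : ?TG}" "ps' : {ps. (C m *V ps, S m *V ps) : ?TG}" for ps ps'
     using subspace_add[OF sub, of "(C m *V ps, S m *V ps)" "(C m *V ps', S m *V ps')"] that by simp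
    show "tens x y : {ps. (C m *V ps, S m *V ps) : ?TG}" for x y proof -
     have "(tens (E (cutoff m) *V x) (F (cutoff m) *V y),
       tens (SI E (idc m) *V x) (SI F (idc m) *V y)) : ?TG" unfolding tensor_graph_def by (rule subsetD[OF closure_subset], rule span_base)
       (use sgraph_cut[OF E, of m x] sgraph_cut[OF F, of m y] in blast)
     then show ?thesis unfolding C S by (simp add: tensor_op_apply[OF T])
    qed
   qed
   then show ?thesis by blast
  qed
  have "C m *V ps' = S m *V ps" for m proof -
   \<comment> \<open>On the square of half side m the product of the coordinates is at most m^2, so
     behind \<open>C m\<close> the truncation of H at m * m changes nothing.\<close>
   have cut: "ph z : cutoff (m * m)" if "fst z : cutoff m" "snd z : cutoff m" for z proof -
    have "(abs (fst z)) <= m" "(abs (snd z)) <= m" using that by (auto simp: cutoff_def)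
    then have "(abs (ph z)) <= real m * real m" unfolding ph_def abs_mult by (intro mult_mono) auto
    then show ?thesis by (auto simp: cutoff_def)
   qed
   have "C m * H (cutoff (m * m)) = C m" unfolding HI[OF cut_borel] C_def
    by (rule mult[OF bk bph[OF bborel_indicator_cut]]) (use cut in "auto simp: k_def indicator_def")
   moreover have "C m * SI H (idc (m * m)) = S m" unfolding IH[OF bborel_idc] C_def S_def
    by (rule mult[OF bk bph[OF bborel_idc]]) (use cut in "auto simp: k_def d_def idc_def indicator_def ph_def")
   moreover have "H (cutoff (m * m)) *V ps' = SI H (idc (m * m)) *V ps" using ps unfolding sgraph_def by blast
   ultimately show ?thesis by (metis times_bop_apply)
  qed
  then have "(%m. (C m *V ps, S m *V ps)) ----> (ps, ps')" using tendsto_Pair[OF Clim[of ps] Clim[of ps']] by simp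
  then show ?thesis by (rule closed_sequentially[OF cl, of "%m. (C m *V ps, S m *V ps)", rotated]) (rule CS)
 qed
 ultimately show ?thesis unfolding H_def ph_def[abs_def] by (intro subset_antisym subrelI) auto
qed

end

section \<open>Slice maps\<close>

lemma has_sum_nonneg_Reals:
 fixes f :: "'i => complex" assumes f: "(f has_sum z) I" and nn: "!!i. f i : \<real>\<^sub>\<ge>\<^sub>0" shows "z : \<real>\<^sub>\<ge>\<^sub>0"
proof -
 have re: "((%i. Re (f i)) has_sum Re z) I" and im: "((%i. Im (f i)) has_sum Im z) I"
  using has_sum_bounded_linear[OF bounded_linear_Re f] has_sum_bounded_linear[OF bounded_linear_Im f] by (simp_all add: o_def)
 have "Im (f i) = 0" "0 <= Re (f i)" for i using nn[of i] by (auto simp: complex_nonneg_Reals_iff)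
 then have "Im z = 0" "0 <= Re z" using has_sum_unique[OF im has_sum_0] has_sum_nonneg[OF re] by auto
 then show ?thesis by (simp add: complex_nonneg_Reals_iff)
qed

lemma has_sum_finite_sum:
 fixes f :: "'k => 'i => complex" assumes "finite K" "!!k. k : K ==> (f k has_sum s k) I" shows "((%i. SUM k:K. f k i) has_sum (SUM k:K. s k)) I"
 using assms by (induction rule: finite_induct) (auto intro: has_sum_add)

lemma rank_one_exists:
 fixes a b :: "'a::chilbert_space" shows "EX R. (ALL x. R *V x = cin b x *C a) & (ALL ta. Tr (R * ta) = cin b (ta *V a))"
proof -
 have "clinear (%x. cin b x *C a)" unfolding clinear_def by (simp add: cinner_simps scaleC_add_left scaleC_scaleC)
 moreover have "norm (cin b x *C a) <= (norm b * norm a) * norm x" for x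
  using mult_right_mono[OF cmod_cinner_le[of b x], of "norm a"] by (simp add: norm_scaleC ac_simps)
 ultimately obtain R where R: "!!x. R *V x = cin b x *C a" using bop_exists[of "%x. cin b x *C a"] by blast
 have "Tr (R * ta) = cin b (ta *V a)" for ta proof -
  have "((%e. cin (adj ta *V b) e * cin e a) has_sum cin (adj ta *V b) a) onb" by (rule parseval)
  then have "((%e. cin e ((R * ta) *V e)) has_sum cin b (ta *V a)) onb" by (simp add: R cinner_simps cinner_adj_left)
  then show ?thesis unfolding Tr_def by (rule infsumI)
 qed
 then show ?thesis using R by blast
qed

context
 fixes tens :: "'a::chilbert_space => 'b::chilbert_space => 'g::chilbert_space" and v :: "'a => 'a" and rh :: "'a bop"
 assumes T: "hilbert_tensor tens" and v: "represents onb v rh"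
begin

lemma v_summable: "(%i. (norm (v i))^2) summable_on onb" using v unfolding represents_def by blast

lemma cmod_tens_form: "cmod (cin (tens x y) (S *V tens x y')) <= norm S * (norm x)^2 * norm y * norm y'"
proof -
 have "cmod (cin (tens x y) (S *V tens x y')) <= norm (tens x y) * (norm S * norm (tens x y'))"
  by (rule order_trans[OF cmod_cinner_le mult_left_mono[OF norm_apply_le]]) simp
 then show ?thesis by (simp add: norm_tens[OF T] power2_eq_square ac_simps)
qed

lemma slice_exists: "EX Ph. ALL S y y'. ((%i. cin (tens (v i) y) (S *V tens (v i) y')) has_sum cin y (Ph S *V y')) onb"
proof (intro choice allI)
 fix S
 show "EX A. ALL y y'. ((%i. cin (tens (v i) y) (S *V tens (v i) y')) has_sum cin y (A *V y')) onb"
  by (rule sum_form_bop[OF summable_on_cmult_right[OF v_summable, of "norm S"] cmod_tens_form])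
   (simp_all add: tens_add_right[OF T] tens_scaleC_right[OF T] cinner_simps)
qed

lemma slice_properties: assumes Ph: "!!S y y'. ((%i. cin (tens (v i) y) (S *V tens (v i) y')) has_sum cin y (Ph S *V y')) onb"
 shows "completely_positive Ph" "normal_map Ph" "Ph (tensor_op tens A B) = Tr (A * rh) *C B"
proof -
 have lin: "clinear Ph" unfolding clinear_def proof (intro conjI allI; rule bop_eqI; rule cinner_extI)
  fix S S' c y y'
  show "cin y (Ph (S + S') *V y') = cin y ((Ph S + Ph S') *V y')" using has_sum_unique[OF Ph[of y "S + S'" y']] has_sum_add[OF Ph[of y S y'] Ph[of y S' y']]
   by (simp add: cinner_simps)
  show "cin y (Ph (c *C S) *V y') = cin y ((c *C Ph S) *V y')" using has_sum_unique[OF Ph[of y "c *C S" y']] has_sum_cmult_right[OF Ph[of y S y'], of c]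
   by (simp add: cinner_simps)
 qed
 show "completely_positive Ph" unfolding completely_positive_def proof (intro conjI lin allI impI)
  fix n :: nat and A :: "nat => nat => 'g bop" and y
  assume A: "ALL x. (SUM i<n. SUM j<n. cin (x i) (A i j *V x j)) : \<real>\<^sub>\<ge>\<^sub>0"
  have "((%k. SUM i<n. SUM j<n. cin (tens (v k) (y i)) (A i j *V tens (v k) (y j))) has_sum (SUM i<n. SUM j<n. cin (y i) (Ph (A i j) *V y j))) onb"
   by (intro has_sum_finite_sum Ph) auto
  then show "(SUM i<n. SUM j<n. cin (y i) (Ph (A i j) *V y j)) : \<real>\<^sub>\<ge>\<^sub>0" by (rule has_sum_nonneg_Reals) (rule A[rule_format])
 qed
 show "Ph (tensor_op tens A B) = Tr (A * rh) *C B" proof (rule bop_eqI, rule cinner_extI)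
  fix y' y
  have "((%i. cin (v i) (A *V v i) * cin y (B *V y')) has_sum (Tr (A * rh) * cin y (B *V y'))) onb" unfolding Tr_represents(1)[OF v]
   by (rule has_sum_cmult_left[OF has_sum_infsum[OF abs_summable_summable[OF form_summable[OF v_summable]]]])
  then show "cin y (Ph (tensor_op tens A B) *V y') = cin y ((Tr (A * rh) *C B) *V y')" using has_sum_unique[OF Ph[of y "tensor_op tens A B" y']]
   by (simp add: tensor_op_apply[OF T] cinner_tens[OF T] cinner_simps)
 qed
 show "normal_map Ph" unfolding normal_map_def proof (intro allI impI)
  fix si :: "'b bop" assume "density_operator si"
  then obtain w where w: "represents (onb::'b set) w si" using trace_class_represents unfolding density_operator_def by blast
  then have ws: "(%j. (norm (w j))^2) summable_on onb" unfolding represents_def by blast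
  \<comment> \<open>The pulled back functional is the trace against rh tensor si, which the tensor
    products of the representing vectors decompose.\<close>
  define u where "u = (%(j, i). tens (v i) (w j))"
  have us: "(%z. (norm (u z))^2) summable_on (onb \<times> onb)" proof (rule summable_on_SigmaI)
   show "((%i. (norm (u (j, i)))^2) has_sum ((\<Sum>\<^sub>\<infinity>i\<in>onb. (norm (v i))^2) * (norm (w j))^2)) onb" for j
    unfolding u_def by (simp add: norm_tens[OF T] power_mult_distrib) (intro has_sum_cmult_left has_sum_infsum v_summable)
  qed (auto intro: summable_on_cmult_right ws)
  then obtain ta where ta: "represents (onb \<times> onb) u ta" using represents_exists by blast
  have "Tr (Ph A * si) = Tr (A * ta)" for A proof -
   have "(%z. cin (u z) (A *V u z)) summable_on (onb \<times> onb)" by (rule abs_summable_summable[OF form_summable[OF us]])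
   then have "(\<Sum>\<^sub>\<infinity>j\<in>onb. \<Sum>\<^sub>\<infinity>i\<in>onb. cin (u (j, i)) (A *V u (j, i))) = Tr (A * ta)"
    unfolding Tr_represents(1)[OF ta] by (rule infsum_Sigma_banach)
   then show ?thesis unfolding Tr_represents(1)[OF w] by (simp add: u_def infsumI[OF Ph])
  qed
  then show "EX ta. positive_trace_class ta & (ALL A. Tr (Ph A * si) = Tr (A * ta))" using represents_trace_class(1)[OF ta] by blast
 qed
qed

text \<open>Normality reduces the comparison to two trace class operators for each state, and these
  are separated by rank one product operators, on which both maps are prescribed.\<close>

lemma slice_unique:
 fixes Ph \<Psi> :: "'g bop => 'b bop" assumes "normal_map Ph" "!!A B. Ph (tensor_op tens A B) = Tr (A * rh) *C B"
  and "normal_map \<Psi>" "!!A B. \<Psi> (tensor_op tens A B) = Tr (A * rh) *C B" shows "Ph = \<Psi>"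
proof (rule ext, rule bop_eqI_density)
 fix S and si :: "'b bop" assume si: "density_operator si"
 obtain ta ta' where ta: "!!A. Tr (Ph A * si) = Tr (A * ta)" "!!A. Tr (\<Psi> A * si) = Tr (A * ta')" using assms(1,3) si unfolding normal_map_def by metis
 have "ta = ta'" proof (rule bop_eqI_tens_diag[OF T])
  fix x :: 'a and y :: 'b
  obtain R1 where R1: "!!z. R1 *V z = cin x z *C x" using rank_one_exists by blast
  obtain R2 where R2: "!!z. R2 *V z = cin y z *C y" using rank_one_exists by blast
  obtain R where R: "!!z. R *V z = cin (tens x y) z *C tens x y" "!!ta. Tr (R * ta) = cin (tens x y) (ta *V tens x y)" using rank_one_exists by blast
  have "tensor_op tens R1 R2 = R" by (rule tensor_op_eqI[OF T])
    (simp add: R R1 R2 cinner_tens[OF T] tens_scaleC_left[OF T] tens_scaleC_right[OF T] scaleC_scaleC mult.commute)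
  then have "Tr (R * ta) = Tr (R * ta')" using ta assms(2,4) by metis
  then show "cin (tens x y) (ta *V tens x y) = cin (tens x y) (ta' *V tens x y)" by (simp add: R)
 qed
 then show "Tr (Ph S * si) = Tr (\<Psi> S * si)" using ta by simp
qed

text \<open>Resolves the definite description: existence from \<open>slice_properties\<close>,
  uniqueness from \<open>slice_unique\<close>. Further properties of the slice map are read off this
  sum.\<close>

lemma slice_map_form: "((%i. cin (tens (v i) y) (S *V tens (v i) y')) has_sum cin y (slice_map tens rh S *V y')) onb"
proof -
 obtain Ph where Ph: "!!S y y'. ((%i. cin (tens (v i) y) (S *V tens (v i) y')) has_sum cin y (Ph S *V y')) onb" using slice_exists by blast
 have "slice_map tens rh = Ph" unfolding slice_map_def by (rule the_equality) (use slice_properties[OF Ph] slice_unique in blast)+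
 then show ?thesis using Ph by simp
qed

lemmas slice_map_properties = slice_properties[OF slice_map_form]

lemma slice_map_add: "slice_map tens rh (S + S') = slice_map tens rh S + slice_map tens rh S'"
 and slice_map_scaleC: "slice_map tens rh (c *C S) = c *C slice_map tens rh S"
 using slice_map_properties(1) unfolding completely_positive_def clinear_def by blast+

lemma slice_map_diff: "slice_map tens rh (S - S') = slice_map tens rh S - slice_map tens rh S'" using slice_map_add[of "S - S'" S'] by simp

lemma slice_map_positive: assumes "positive_op S" shows "positive_op (slice_map tens rh S)" unfolding positive_op_def
 using has_sum_nonneg_Reals[OF slice_map_form] assms unfolding positive_op_def by blast

text \<open>The module property over the second factor. It carries functions of Q from under the
  Dirac state into the tensor product, where they multiply g(X + Q) - g(X).\<close>

lemma slice_map_left: "slice_map tens rh (tensor_op tens 1 B * S) = B * slice_map tens rh S"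
proof (rule bop_eqI, rule cinner_extI)
 fix y' y
 have "cin (tens x y) ((tensor_op tens 1 B * S) *V tens x y') = cin (tens x (adj B *V y)) (S *V tens x y')" for x
  using cinner_adj_left[of "tensor_op tens 1 B" "tens x y"] by (simp add: adj_tensor_op[OF T] tensor_op_apply[OF T])
 then show "cin y (slice_map tens rh (tensor_op tens 1 B * S) *V y') = cin y ((B * slice_map tens rh S) *V y')"
  using has_sum_unique[OF slice_map_form[of y "tensor_op tens 1 B * S" y']] slice_map_form[of "adj B *V y" S y'] by (simp add: cinner_adj_left)
qed

lemma norm_slice_map_le: assumes "Tr rh = 1" shows "norm (slice_map tens rh S) <= norm S"
proof (rule norm_bop_le_form)
 fix y y' :: 'b
 have "((%i. (norm (v i))^2) has_sum Re (Tr rh)) onb" proof -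
  have "cor (\<Sum>\<^sub>\<infinity>i\<in>onb. (norm (v i))^2) = Tr rh" unfolding represents_trace_class(2)[OF v]
   by (rule infsumI[symmetric]) (simp only: has_sum_of_real_iff has_sum_infsum v_summable)
  then show ?thesis using has_sum_infsum[OF v_summable] by (metis Re_complex_of_real)
 qed
 then have s: "((%i. norm S * norm y * norm y' * (norm (v i))^2) has_sum norm S * norm y * norm y' * 1) onb" using assms by (intro has_sum_cmult_right) simp
 show "cmod (cin y (slice_map tens rh S *V y')) <= norm S * norm y * norm y'" proof -
  have "cmod (cin y (slice_map tens rh S *V y')) <= norm S * norm y * norm y' * 1" by (rule norm_infsum_le[OF slice_map_form s])
    (rule order_trans[OF cmod_tens_form], simp add: ac_simps)
  then show ?thesis by simp
 qed
qed simp

end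

section \<open>Means\<close>

lemma bcontfunI: "contn f ==> (!!u. cmod (f u) <= K) ==> f : bcontfun" unfolding bcontfun_def bounded_iff by auto

lemma bcontfun_continuous: "f : bcontfun ==> contn f" unfolding bcontfun_def by blast

lemma bcontfun_bound: "f : bcontfun ==> EX K. ALL u. cmod (f u) <= K" unfolding bcontfun_def bounded_iff by auto

definition ugroup :: "(real set => 'a::chilbert_space bop) => real => 'a bop" where "ugroup E u = SI E (%x. exp (\<i> * cor (u * x)))"

text \<open>The matrix element between w and v of e^{iuX} A e^{-iuX}, with the left unitary moved to
  w.\<close>

definition conj_form :: "(real set => 'a::chilbert_space bop) => 'a bop => 'a => 'a => real => complex" where
 "conj_form E A w v u = cin (ugroup E (- u) *V w) (A *V ugroup E (- u) *V v)"

lemma bborel_exp: "bborel (%x. exp (\<i> * cor (u * x)))" by (rule bborelI[of _ 1]) (auto intro!: continuous_borel continuous_intros)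

context
 fixes E :: "real set => 'a::chilbert_space bop" assumes E: "pvm E"
begin

lemma ugroup_adj: "adj (ugroup E u) = ugroup E (- u)" unfolding ugroup_def SI_adj[OF E bborel_exp] by (simp add: exp_cnj)

lemma norm_unitary_group_le: "norm (ugroup E u *V x) <= norm x"
proof -
 have "norm (ugroup E u) <= 1" unfolding ugroup_def by (rule norm_SI_le[OF E bborel_exp]) auto
 then show ?thesis using order_trans[OF norm_apply_le mult_right_mono[of "norm (ugroup E u)" 1 "norm x"]] by simp
qed

lemma ugroup_continuous: "contn (%u. ugroup E u *V x)" unfolding continuous_on_sequentially
proof (intro allI ballI impI, elim conjE)
 fix u and r :: "nat => real" assume "r ----> u"
 then have "(%n. ugroup E (r n) *V x) ----> ugroup E u *V x" unfolding ugroup_def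
  by (intro SI_strong_limit[OF E bborel_exp, where K = 1]) (auto intro!: tendsto_intros)
 then show "((%u. ugroup E u *V x) o r) ----> ugroup E u *V x" by (simp add: o_def)
qed

lemma conj_form_continuous: "contn (conj_form E A w v)"
proof -
 have W: "contn (%u. ugroup E (- u) *V x)" for x by (rule continuous_on_compose2[OF ugroup_continuous]) (auto intro: continuous_intros)
 show ?thesis unfolding conj_form_def[abs_def] by (intro bounded_bilinear.continuous_on[OF bounded_bilinear_cinner] W
   bounded_linear.continuous_on[OF bounded_linear_apply])
qed

lemma conj_form_bound: "cmod (conj_form E A w v u) <= norm A * norm w * norm v"
proof -
 have "cmod (conj_form E A w v u) <= norm (ugroup E (- u) *V w) * (norm A * norm (ugroup E (- u) *V v))"
  unfolding conj_form_def by (rule order_trans[OF cmod_cinner_le mult_left_mono[OF norm_apply_le]]) simp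
 also have "... <= norm w * (norm A * norm v)" by (intro mult_mono norm_unitary_group_le mult_left_mono) auto
 finally show ?thesis by (simp add: ac_simps)
qed

lemma conj_form_bcontfun: "conj_form E A w v : bcontfun" by (rule bcontfunI[OF conj_form_continuous conj_form_bound])

end

context
 fixes et :: "(real => complex) => complex" assumes et: "mean et"
begin

lemma mean_add: "f : bcontfun ==> g : bcontfun ==> et (%u. f u + g u) = et f + et g" and mean_scale: "f : bcontfun ==> et (%u. c * f u) = c * et f"
 and mean_positive: "f : bcontfun ==> (!!u. f u : \<real>\<^sub>\<ge>\<^sub>0) ==> et f : \<real>\<^sub>\<ge>\<^sub>0" and mean_one: "et (%u. 1) = 1"
 using et unfolding mean_def by blast+

lemma bcontfun_add: "f : bcontfun ==> g : bcontfun ==> (%u. f u + g u :: complex) : bcontfun" by (rule plus_cont)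

lemma bcontfun_scale: assumes "f : bcontfun" shows "(%u::real. c * f u :: complex) : bcontfun"
proof -
 obtain K where "!!u. cmod (f u) <= K" using bcontfun_bound[OF assms] by blast
 then show ?thesis by (intro bcontfunI[of _ "cmod c * K"] continuous_intros bcontfun_continuous[OF assms]) (auto simp: norm_mult intro: mult_left_mono)
qed

lemma mean_real_bound: assumes f: "contn f" and K: "!!u. (abs (f u)) <= K" shows "cmod (et (%u. cor (f u))) <= K"
proof -
 let ?f = "%u. cor (f u)"
 have fb: "?f : bcontfun" by (intro bcontfunI[of _ K] continuous_intros f) (use K in auto)
 have cb: "(%u. cor c) : bcontfun" for c by (intro bcontfunI[of _ "(abs c)"] continuous_intros) auto
 have c: "et (%u. cor K) = of_real K" using mean_scale[OF cb, of "of_real K" 1] mean_one by simp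
 have "et (%u. of_real K + s * ?f u) = of_real K + s * et ?f" for s using mean_add[OF cb bcontfun_scale[OF fb]] mean_scale[OF fb] c by simp
 moreover have "et (%u. of_real K + s * ?f u) : \<real>\<^sub>\<ge>\<^sub>0" if "s = 1 | s = -1" for s proof (rule mean_positive)
  show "(%u. of_real K + s * ?f u) : bcontfun" by (rule bcontfun_add[OF cb bcontfun_scale[OF fb]])
  show "of_real K + s * ?f u : \<real>\<^sub>\<ge>\<^sub>0" for u using K[of u] that by (auto simp: complex_nonneg_Reals_iff abs_le_iff)
 qed
 ultimately have "of_real K + 1 * et ?f : \<real>\<^sub>\<ge>\<^sub>0" "of_real K + (-1) * et ?f : \<real>\<^sub>\<ge>\<^sub>0" by metis+
 then have "Im (et ?f) = 0" "(abs (Re (et ?f))) <= K" by (auto simp: complex_nonneg_Reals_iff)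
 then show ?thesis by (simp add: cmod_eq_Re)
qed

lemma mean_bound: assumes f: "f : bcontfun" and K: "!!u. cmod (f u) <= K" shows "cmod (et f) <= 2 * K"
proof -
 have c: "contn (%u. Re (f u))" "contn (%u. Im (f u))" by (intro continuous_intros bcontfun_continuous[OF f])+
 have b: "(abs (Re (f u))) <= K" "(abs (Im (f u))) <= K" for u using K[of u] abs_Re_le_cmod[of "f u"] abs_Im_le_cmod[of "f u"] by linarith+
 have bc: "(%u. cor (Re (f u))) : bcontfun" "(%u. cor (Im (f u))) : bcontfun" by (intro bcontfunI[of _ K] continuous_intros c; use b in simp)+
 have "f = (%u. cor (Re (f u)) + \<i> * cor (Im (f u)))" by (rule ext) (rule complex_eq)
 then have "et f = et (%u. cor (Re (f u))) + \<i> * et (%u. cor (Im (f u)))"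
  using mean_add[OF bc(1) bcontfun_scale[OF bc(2), of \<i>]] mean_scale[OF bc(2), of \<i>] by simp
 also have "cmod ... <= K + K"
  by (rule order_trans[OF norm_triangle_ineq]) (use mean_real_bound[OF c(1) b(1)] mean_real_bound[OF c(2) b(2)] in "simp add: norm_mult")
 finally show ?thesis by simp
qed

lemma mean_sum: assumes "finite F" "!!i. i : F ==> h i : bcontfun" shows "(%u. SUM i:F. h i u) : bcontfun" "et (%u. SUM i:F. h i u) = (SUM i:F. et (h i))"
proof -
 have 0: "et (%u. 0) = 0" "(%u. 0) : (bcontfun :: (real => complex) set)" using mean_scale[OF bcontfunI[of "%u. 1" 1], of 0] by (auto intro!: bcontfunI[of _ 1])
 have "(%u. SUM i:F. h i u) : bcontfun & et (%u. SUM i:F. h i u) = (SUM i:F. et (h i))"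
  using assms by (induction rule: finite_induct) (auto simp: 0 mean_add intro: bcontfun_add)
 then show "(%u. SUM i:F. h i u) : bcontfun" "et (%u. SUM i:F. h i u) = (SUM i:F. et (h i))" by auto
qed

text \<open>Finite additivity alone does not allow this exchange. \<open>represents_approx\<close>
  provides finite partial sums within ep n * K of the whole series, uniformly in u, and
  \<open>mean_bound\<close> carries the uniform error through the mean.\<close>

lemma mean_infsum:
 fixes v :: "'i => 'a::chilbert_space" and h :: "'i => real => complex"
 assumes v: "(%i. (norm (v i))^2) summable_on I" and K: "0 <= K" "!!i u. cmod (h i u) <= K * (norm (v i))^2" and h: "!!i. contn (h i)"
 shows "(%u. \<Sum>\<^sub>\<infinity>i\<in>I. h i u) : bcontfun" "et (%u. \<Sum>\<^sub>\<infinity>i\<in>I. h i u) = (\<Sum>\<^sub>\<infinity>i\<in>I. et (h i))"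
proof -
 let ?H = "%u. \<Sum>\<^sub>\<infinity>i\<in>I. h i u"
 have hb: "h i : bcontfun" for i by (rule bcontfunI[OF h K(2)])
 define ep where "ep n = inverse (real (Suc n))" for n
 have "EX F. finite F & (ALL h' K. (ALL i. cmod (h' i) <= K * (norm (v i))^2) --> 0 <= K -->
   cmod ((\<Sum>\<^sub>\<infinity>i\<in>I. h' i) - (SUM i:F. h' i)) <= ep n * K)" for n
  using represents_approx[OF v, of "ep n"] unfolding ep_def by (metis inverse_positive_iff_positive of_nat_0_less_iff zero_less_Suc)
 then obtain F where F: "!!n. finite (F n)" and app: "!!n h' K. (!!i. cmod (h' i) <= K * (norm (v i))^2) ==> 0 <= K ==>
   cmod ((\<Sum>\<^sub>\<infinity>i\<in>I. h' i) - (SUM i:F n. h' i)) <= ep n * K" by metis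
 have ep0: "(%n. ep n * c) ----> 0" for c unfolding ep_def using tendsto_mult_right[OF LIMSEQ_inverse_real_of_nat, of c] by simp
 define S where "S n u = (SUM i:F n. h i u)" for n u
 have SH: "cmod (?H u - S n u) <= ep n * K" for n u unfolding S_def by (rule app[OF K(2,1)])
 have Sb: "S n : bcontfun" and etS: "et (S n) = (SUM i:F n. et (h i))" for n using mean_sum[OF F[of n] hb] by (simp_all add: S_def[abs_def])
 have "uniform_limit UNIV S ?H sequentially" proof (rule uniform_limitI)
  fix e :: real assume "0 < e"
  then have "\<forall>\<^sub>F n in sequentially. ep n * K < e" using order_tendstoD(2)[OF ep0] by blast
  then show "\<forall>\<^sub>F n in sequentially. ALL u:UNIV. dist (S n u) (?H u) < e" by eventually_elim (metis SH dist_norm norm_minus_commute le_less_trans)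
 qed
 then have cont: "contn ?H" by (rule uniform_limit_theorem[rotated]) (auto intro: always_eventually bcontfun_continuous Sb)
 obtain C where C: "!!u. cmod (S 0 u) <= C" using bcontfun_bound[OF Sb] by blast
 have "cmod (?H u) <= ep 0 * K + C" for u using norm_triangle_sub[of "?H u" "S 0 u"] SH[of u 0] C[of u] by linarith
 then show Hb: "?H : bcontfun" by (rule bcontfunI[OF cont])
 have "cmod (et ?H - (\<Sum>\<^sub>\<infinity>i\<in>I. et (h i))) <= ep n * (4 * K)" for n proof -
  have "et (%u. ?H u + (-1) * S n u) = et ?H + (-1) * et (S n)" using mean_add[OF Hb bcontfun_scale[OF Sb, of "-1"]] mean_scale[OF Sb, of "-1"] by simp
  moreover have "cmod (et (%u. ?H u + (-1) * S n u)) <= 2 * (ep n * K)" by (rule mean_bound[OF bcontfun_add[OF Hb bcontfun_scale[OF Sb]]]) (use SH in simp)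
  moreover have "cmod ((\<Sum>\<^sub>\<infinity>i\<in>I. et (h i)) - et (S n)) <= ep n * (2 * K)"
   unfolding etS using mean_bound[OF hb K(2)] K(1) by (intro app) (auto simp: mult.assoc)
  ultimately show ?thesis using norm_triangle_ineq4[of "et ?H - et (S n)" "(\<Sum>\<^sub>\<infinity>i\<in>I. et (h i)) - et (S n)"] by simp
 qed
 then have "cmod (et ?H - (\<Sum>\<^sub>\<infinity>i\<in>I. et (h i))) <= 0" by (intro LIMSEQ_le_const[OF ep0]) auto
 then show "et ?H = (\<Sum>\<^sub>\<infinity>i\<in>I. et (h i))" by simp
qed

context
 fixes E :: "real set => 'a::chilbert_space bop" assumes E: "pvm E"
begin

text \<open>The mean of the matrix elements is a bounded sesquilinear form, so it defines an
  operator Z; \<open>mean_infsum\<close> extends the identity from vectors to densities, and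
  \<open>bop_eqI_density\<close> makes Z the described value.\<close>

lemma mean_projection_form: "cin w (mean_projection et (sgraph E) A *V v) = et (conj_form E A w v)"
proof -
 note add = mean_add[OF conj_form_bcontfun[OF E] conj_form_bcontfun[OF E]] and scale = mean_scale[OF conj_form_bcontfun[OF E]]
 have lin: "conj_form E A (w + w') v = (%u. conj_form E A w v u + conj_form E A w' v u)"
  "conj_form E A w (v + v') = (%u. conj_form E A w v u + conj_form E A w v' u)" "conj_form E A (c *C w) v = (%u. cnj c * conj_form E A w v u)"
  "conj_form E A w (c *C v) = (%u. c * conj_form E A w v u)" for w w' v v' c by (simp_all add: conj_form_def cinner_simps fun_eq_iff)
 have "et (conj_form E A (w + w') v) = et (conj_form E A w v) + et (conj_form E A w' v)" "et (conj_form E A (c *C w) v) = cnj c * et (conj_form E A w v)"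
  "et (conj_form E A w (v + v')) = et (conj_form E A w v) + et (conj_form E A w v')"
  "et (conj_form E A w (c *C v)) = c * et (conj_form E A w v)" for w w' v v' c by (simp_all only: lin add scale)
 moreover have "cmod (et (conj_form E A w v)) <= 2 * norm A * norm w * norm v" for w v
  using mean_bound[OF conj_form_bcontfun[OF E] conj_form_bound[OF E], of A w v] by (simp add: mult.assoc)
 ultimately have "EX Z. ALL w v. cin w (Z *V v) = et (conj_form E A w v)" by (rule form_bop)
 then obtain Z where Z: "!!w v. cin w (Z *V v) = et (conj_form E A w v)" by blast
 have TrZ: "Tr (Z * rh) = et (%u. Tr (ugroup E u * A * ugroup E (- u) * rh))" if rh: "density_operator rh" for rh proof -
  obtain v where v: "represents (onb::'a set) v rh" using trace_class_represents rh unfolding density_operator_def by blast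
  have "cin (v i) ((ugroup E u * A * ugroup E (- u)) *V v i) = conj_form E A (v i) (v i) u" for i u
   using cinner_adj_left[of "ugroup E u" "v i"] by (simp add: ugroup_adj[OF E] conj_form_def)
  then have "Tr (ugroup E u * A * ugroup E (- u) * rh) = (\<Sum>\<^sub>\<infinity>i\<in>onb. conj_form E A (v i) (v i) u)" for u
   by (simp add: Tr_represents(1)[OF v])
  moreover have "et (%u. \<Sum>\<^sub>\<infinity>i\<in>onb. conj_form E A (v i) (v i) u) = (\<Sum>\<^sub>\<infinity>i\<in>onb. et (conj_form E A (v i) (v i)))"
   by (rule mean_infsum(2)[of v _ "norm A"])
    (use v conj_form_continuous[OF E] conj_form_bound[OF E] in "auto simp: represents_def power2_eq_square mult.assoc[symmetric]")
  ultimately show ?thesis by (simp add: Tr_represents(1)[OF v] Z)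
 qed
 have neg: "SI E (%x. exp (- \<i> * cor (u * x))) = ugroup E (- u)" for u by (simp add: ugroup_def)
 have "mean_projection et (sgraph E) A = Z" unfolding mean_projection_def fun_calc_sgraph[OF E] ugroup_def[symmetric] neg proof (rule the_equality)
  show "ALL rh. density_operator rh --> Tr (Z * rh) = et (%u. Tr (ugroup E u * A *
    ugroup E (- u) * rh))" using TrZ by simp
  fix Z' assume "ALL rh. density_operator rh --> Tr (Z' * rh) = et (%u. Tr (ugroup E u * A *
    ugroup E (- u) * rh))"
  then show "Z' = Z" using TrZ by (intro bop_eqI_density) simp
 qed
 then show ?thesis using Z by simp
qed

text \<open>Here \<open>F\<close> is the function u |-> Tr[S e^{iuX} A e^{-iuX} rho], the factor S
  being moved to the left vectors. It reappears as a function of momentum in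
  \<open>dirac_slice_momentum\<close>.\<close>

lemma Tr_mean_projection:
 fixes A S rh :: "'a bop" and v :: "'a => 'a" assumes v: "represents (onb::'a set) v rh"
 defines "F == (%u. \<Sum>\<^sub>\<infinity>i\<in>onb. conj_form E A (adj S *V v i) (v i) u)"
 shows "F : bcontfun" "Tr (S * mean_projection et (sgraph E) A * rh) = et F"
proof -
 have b: "cmod (conj_form E A (adj S *V v i) (v i) u) <= norm A * norm (adj S) * (norm (v i))^2" for i u
  using order_trans[OF conj_form_bound[OF E, of A "adj S *V v i" "v i" u]
   mult_right_mono[OF mult_left_mono[OF norm_apply_le[of "adj S" "v i"], of "norm A"], of "norm (v i)"]] by (simp add: power2_eq_square mult.assoc)
 note M = mean_infsum[of v onb "norm A * norm (adj S)" "%i. conj_form E A (adj S *V v i) (v i)", OF _ _ b conj_form_continuous[OF E]]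
 show "F : bcontfun" unfolding F_def by (rule M(1)) (use v in "auto simp: represents_def")
 have "et F = (\<Sum>\<^sub>\<infinity>i\<in>onb. et (conj_form E A (adj S *V v i) (v i)))" unfolding F_def
  by (rule M(2)) (use v in "auto simp: represents_def")
 then show "Tr (S * mean_projection et (sgraph E) A * rh) = et F" by (simp add: Tr_represents(1)[OF v] mean_projection_form[symmetric] cinner_adj_left)
qed

end

end

section \<open>Unitary groups and their generators\<close>

lemma integrable_of_le:
 fixes f :: "'s => 'b::{banach,second_countable_topology}" assumes "integrable M g" "f : borel_measurable M" and le: "!!x. norm (f x) <= g x"
 shows "integrable M f" by (rule Bochner_Integration.integrable_bound[OF assms(1,2)]) (intro AE_I2, unfold real_norm_def, rule order_trans[OF le abs_ge_self])

lemma integrable_segment_const: "integrable lborel (%r::real. ind {a..b} r * K :: real)"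
proof -
 have "emeasure lborel {a..b} < \<infinity>" by (cases "a <= b") (auto simp: emeasure_lborel_Icc_eq)
 then show ?thesis by (intro integrable_mult_left integrable_real_indicator) auto
qed

lemma bounded_integrable_segment: assumes [measurable]: "h : bmeas" and K: "!!r. cmod (h r) <= K"
 shows "integrable lborel (%r. ind {a..b::real} r * (h r :: complex))"
proof -
 have le: "cmod (ind {a..b} r * h r) <= ind {a..b} r * K" for r using K[of r] by (auto simp: indicator_def norm_mult)
 show ?thesis by (rule integrable_of_le[OF integrable_segment_const _ le]) measurable
qed

lemma cmod_segment_le: assumes "h : bmeas" and K: "!!r. r : {0..s} ==> cmod (h r) <= K" and s: "0 <= (s::real)"
 shows "cmod (LBINT r. ind {0..s} r * h r) <= s * K"
proof -
 have "0 <= K" using K[of 0] s order_trans[OF norm_ge_zero] by auto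
 have le: "cmod (ind {0..s} r * h r) <= ind {0..s} r * K" for r using K by (auto simp: indicator_def norm_mult)
 have "cmod (LBINT r. ind {0..s} r * h r) <= (LBINT r. ind {0..s} r * K)" by (rule Bochner_Integration.integral_norm_bound_integral
    [OF integrable_of_le[OF integrable_segment_const _ le] integrable_segment_const le]) (use assms(1) in measurable)
 then show ?thesis using s by simp
qed

text \<open>The exponential density: averaging an orbit of e^{-itP} with it yields the resolvent of
  P at i, up to a factor.\<close>

definition expd :: "real => real" where "expd t = (if t < 0 then 0 else exp (- t))"

lemma expd_measurable [measurable]: "expd : bmeas" unfolding expd_def by measurable

lemma integrable_exp_density: "integrable lborel expd" "(LBINT t. expd t) = 1"
proof -
 interpret prob_space "density lborel (exponential_density 1)" by (rule prob_space_exponential_density) simp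
 have "exponential_density 1 = expd" by (auto simp: exponential_density_def expd_def fun_eq_iff)
 then have "(\<integral>\<^sup>+t. ennreal (expd t) \<partial>lborel) = 1" using emeasure_space_1 by (simp add: emeasure_density)
 moreover have "0 <= expd t" for t by (simp add: expd_def)
 ultimately have "has_bochner_integral lborel expd 1" by (intro has_bochner_integral_nn_integral) auto
 then show "integrable lborel expd" "(LBINT t. expd t) = 1" by (auto simp: has_bochner_integral_iff)
qed

lemma segment_exp_density: assumes s: "0 <= s" shows "(LBINT r. expd (t - r) * ind {0..s} r) =
  ind {0..<s} t + expd (t - s) - expd t"
proof (cases "t < 0")
 case True
 then have "expd (t - r) * ind {0..s} r = 0" for r by (auto simp: expd_def indicator_def)
 then have "(LBINT r. expd (t - r) * ind {0..s} r) = 0" by (simp only: Bochner_Integration.integral_zero)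
 then show ?thesis using True s by (simp add: expd_def)
next
 case False
 define m where "m = min s t"
 have "expd (t - r) * ind {0..s} r = exp (r - t) * ind {0..m} r" for r by (auto simp: expd_def indicator_def m_def)
 moreover have "(LBINT r. exp (r - t) * ind {0..m} r) = exp (m - t) - exp (0 - t)" using False s by (intro integral_FTC_Icc_real)
   (auto simp: m_def intro!: derivative_eq_intros continuous_intros)
 ultimately show ?thesis using False s by (auto simp: m_def expd_def indicator_def min_def)
qed

text \<open>The integrated form of k' = k - g for the forward exponential average k of g. As g is
  merely measurable and bounded, it is obtained from Fubini's theorem and not by
  differentiation.\<close>

lemma expd_resolvent:
 fixes g :: "real => complex" assumes [measurable]: "g : bmeas" and K: "!!t. cmod (g t) <= K" and s: "0 <= s"
 defines "k == %r. \<integral>t. of_real (expd t) * g (t + r) \<partial>lborel" shows "k s - k 0 = (LBINT r. ind {0..s} r * (k r - g r))"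
  and "k : bmeas" and "!!r. cmod (k r) <= K"
proof -
 have K0: "0 <= K" using K[of 0] order_trans[OF norm_ge_zero] by blast
 have pos: "0 <= expd t" for t by (simp add: expd_def)
 have le: "cmod (of_real (expd x) * g y) <= expd x * K" for x y using mult_left_mono[OF K pos] by (simp add: norm_mult pos abs_of_nonneg)
 have ied: "integrable lborel (%t. expd (t - r))" for r using lborel_integrable_real_affine[OF integrable_exp_density(1), of 1 "- r"] by simp
 have ig: "integrable lborel (%t. of_real (expd (t - r)) * g t)" for r by (rule integrable_of_le[OF integrable_mult_left[OF ied[of r], of K] _ le]) measurable
 have k: "k r = (LBINT t. of_real (expd (t - r)) * g t)" for r unfolding k_def by (subst lborel_integral_real_affine[of 1 _ "r"]) (simp_all add: add.commute)
 show km [measurable]: "k : bmeas" unfolding k[abs_def] by measurable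
 show kb: "cmod (k r) <= K" for r proof -
  have "cmod (k r) <= (LBINT t. expd t * K)" unfolding k_def proof (rule Bochner_Integration.integral_norm_bound_integral)
   have "integrable lborel (%t. of_real (expd (t - r)) * g t)" by (rule ig)
   then show "integrable lborel (%t. of_real (expd t) * g (t + r))" by (subst lborel_integrable_real_affine_iff[of 1 _ "-r", symmetric]) simp_all
  qed (simp_all only: le, rule integrable_mult_left[OF integrable_exp_density(1)])
  then show ?thesis by (simp add: integrable_exp_density)
 qed
 let ?G = "%r t. ind {0..s} r * (of_real (expd (t - r)) * g t)"
 have int: "integrable (lborel \<Otimes>\<^sub>M lborel) (%(r, t). ?G r t)" proof (rule lborel_pair.Fubini_integrable)
  show "(%(r, t). ?G r t) : borel_measurable (lborel \<Otimes>\<^sub>M lborel)" by measurable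
  show "AE r in lborel. integrable lborel (%t. case (r, t) of (r, t) => ?G r t)" using ig by (intro AE_I2) simp
  have 1: "cmod (?G r t) = ind {0..s} r * (expd (t - r) * cmod (g t))" for r t using pos by (auto simp: norm_mult indicator_def)
  have 2: "(LBINT t. expd (t - r) * cmod (g t)) <= K" for r proof -
   have "(LBINT t. expd (t - r) * cmod (g t)) <= (LBINT t. expd (t - r) * K)" using integrable_norm[OF ig[of r]] pos K ied[of r]
    by (intro integral_mono) (auto simp: norm_mult intro!: mult_left_mono)
   also have "... = K * (LBINT t. expd (t - r))" by simp
   also have "(LBINT t. expd (t - r)) = 1" using lborel_integral_real_affine[of 1 expd "- r"] by (simp add: integrable_exp_density)
   finally show ?thesis by simp
  qed
  have "0 <= (LBINT t. expd (t - r) * cmod (g t))" for r using pos by (intro integral_nonneg_AE) auto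
  then have "norm (ind {0..s} r * (LBINT t. expd (t - r) * cmod (g t))) <= ind {0..s} r * K" for r using 2[of r] by (simp add: indicator_def)
  then have "integrable lborel (%r. ind {0..s} r * (LBINT t. expd (t - r) * cmod (g t)))" by (intro integrable_of_le[OF integrable_segment_const]) measurable
  then show "integrable lborel (%r. \<integral>t. norm (case (r, t) of (r, t) => ?G r t) \<partial>lborel)" unfolding prod.case 1 by simp
 qed
 have "(LBINT r. ind {0..s} r * k r) = (\<integral>r. \<integral>t. ?G r t \<partial>lborel \<partial>lborel)" unfolding k by simp
 also have "... = (\<integral>t. \<integral>r. ?G r t \<partial>lborel \<partial>lborel)" using lborel_pair.Fubini_integral[OF int] by simp
 also have "(%t. \<integral>r. ?G r t \<partial>lborel) = (%t. (ind {0..<s} t * g t + of_real (expd (t - s)) * g t) - of_real (expd (t - 0)) * g t)" proof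
  fix t
  have "(LBINT r. ?G r t) = (LBINT r. of_real (expd (t - r) * ind {0..s} r) * g t)" by (intro Bochner_Integration.integral_cong) (auto simp: indicator_def)
  also have "... = of_real (LBINT r. expd (t - r) * ind {0..s} r) * g t" by (simp only: integral_mult_left_zero integral_complex_of_real)
  finally show "(LBINT r. ?G r t) = (ind {0..<s} t * g t + of_real (expd (t - s)) * g t) - of_real (expd (t - 0)) * g t"
   unfolding segment_exp_density[OF s] by (simp add: indicator_def ring_distribs)
 qed
 also have "(LBINT t. (ind {0..<s} t * g t + of_real (expd (t - s)) * g t) - of_real (expd (t - 0)) * g t) = (LBINT t. ind {0..<s} t * g t) + k s - k 0" proof -
  have "integrable lborel (%t. ind {0..<s} t * g t)" by (rule Bochner_Integration.integrable_bound[OF bounded_integrable_segment[OF assms(1) K, of 0 s]])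
    (measurable, rule AE_I2, simp add: indicator_def)
  then show ?thesis using ig[of s] ig[of 0] by (simp add: k)
 qed
 also have "(LBINT t. ind {0..<s} t * g t) = (LBINT t. ind {0..s} t * g t)"
  by (rule integral_cong_AE) (use AE_lborel_singleton[of s] in "auto elim!: eventually_mono simp: indicator_def")
 finally have "(LBINT r. ind {0..s} r * k r) = (LBINT t. ind {0..s} t * g t) + k s - k 0" .
 then show "k s - k 0 = (LBINT r. ind {0..s} r * (k r - g r))"
  using bounded_integrable_segment[OF km kb, of 0 s] bounded_integrable_segment[OF assms(1) K, of 0 s] by (simp add: right_diff_distrib)
qed

text \<open>Weak measurability takes the place of strong continuity, which is why the generator
  below is defined by an integral equation.\<close>

definition unitary_rep :: "(real => 'a::chilbert_space bop) => bool" where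
 "unitary_rep U \<longleftrightarrow> U 0 = 1 & (ALL s t. U (s + t) = U s * U t) & (ALL s. adj (U s) = U (- s)) & (ALL om ph. (%r. cin om (U r *V ph)) : bmeas)"

text \<open>The weak form of \<open>U\<^sub>s ph - ph = - \<i> \<integral>\<^sub>0\<^sup>s U\<^sub>r ps dr\<close>, that is, of \<open>U\<^sub>s = e\<^sup>-\<^sup>i\<^sup>s\<^sup>P\<close>, \<open>ps = P ph\<close>\<close>

definition generator :: "(real => 'a::chilbert_space bop) => ('a \<times> 'a) set" where "generator U = {(ph, ps). ALL om s. 0 <= s -->
   cin om (U s *V ph) - cin om ph = - \<i> * (LBINT r. ind {0..s} r * cin om (U r *V ps))}"

lemma unitary_rep_reflect: assumes U: "unitary_rep U" shows "unitary_rep (%s. U (- s))" unfolding unitary_rep_def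
proof (intro conjI allI)
 show "U (- (s + t)) = U (- s) * U (- t)" for s t using U unfolding unitary_rep_def minus_add_distrib by blast
 have "(%r. cin om (U r *V ph)) : bmeas" for om ph using U unfolding unitary_rep_def by blast
 from measurable_compose[OF _ this, of uminus]
 show "(%r. cin om (U (- r) *V ph)) : bmeas" for om ph by simp
qed (use U in "simp_all add: unitary_rep_def")

context
 fixes U :: "real => 'a::chilbert_space bop" assumes U: "unitary_rep U"
begin

lemma U_zero: "U 0 = 1" and U_add: "U (s + t) = U s * U t" and U_adj: "adj (U s) = U (- s)" and U_measurable: "(%r. cin om (U r *V ph)) : bmeas"
 using U unfolding unitary_rep_def by blast+

lemma U_apply_add: "U s *V U t *V ph = U (s + t) *V ph" by (simp add: U_add)

lemma U_cinner: "cin (U s *V om) ph = cin om (U (- s) *V ph)" by (metis U_adj cinner_adj_right)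

lemma norm_U: "norm (U s *V ph) = norm ph" using U_cinner[of s ph "U s *V ph"] Re_cinner_self[of "U s *V ph"] Re_cinner_self[of ph]
 by (simp add: U_apply_add U_zero power2_eq_iff_nonneg)

lemma U_bound: "cmod (cin om (U r *V ph)) <= norm om * norm ph" using cmod_cinner_le[of om "U r *V ph"] by (simp add: norm_U)

lemmas U_integrable = bounded_integrable_segment[OF U_measurable U_bound]

lemma generatorD: "(ph, ps) : generator U ==> 0 <= s ==> cin om (U s *V ph) - cin om ph = - \<i> * (LBINT r. ind {0..s} r * cin om (U r *V ps))"
 unfolding generator_def by blast

lemma generator_lipschitz: assumes g: "(ph, ps) : generator U" and s: "0 <= s" shows "norm (U s *V ph - ph) <= s * norm ps"
proof -
 let ?om = "U s *V ph - ph"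
 have "cin ?om ?om = - \<i> * (LBINT r. ind {0..s} r * cin ?om (U r *V ps))" using generatorD[OF g s, of ?om] by (simp add: cinner_diff_right)
 then have "cmod (cin ?om ?om) <= s * (norm ?om * norm ps)" using cmod_segment_le[OF U_measurable U_bound s, of ?om ps] by (simp add: norm_mult)
 then have "norm ?om * norm ?om <= norm ?om * (s * norm ps)" by (simp add: cinner_self norm_mult power2_eq_square ac_simps)
 then show ?thesis using s by (cases "norm ?om = 0") (auto simp: mult_le_cancel_left)
qed

lemma generator_diff: assumes "(ph, ps) : generator U" "(ph', ps') : generator U" shows "(ph - ph', ps - ps') : generator U"
 unfolding generator_def mem_Collect_eq prod.case
proof (intro allI impI)
 fix om and s :: real assume s: "0 <= s"
 show "cin om (U s *V (ph - ph')) - cin om (ph - ph') = - \<i> * (LBINT r. ind {0..s} r * cin om (U r *V (ps - ps')))"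
  using generatorD[OF assms(1) s, of om] generatorD[OF assms(2) s, of om]
   U_integrable[of 0 s om ps] U_integrable[of 0 s om ps'] by (simp add: cinner_diff_right right_diff_distrib) (simp add: algebra_simps)
qed

lemma generator_scaleC: assumes "(ph, ps) : generator U" shows "(c *C ph, c *C ps) : generator U" unfolding generator_def mem_Collect_eq prod.case
proof (intro allI impI)
 fix om and s :: real assume s: "0 <= s"
 have "(LBINT r. ind {0..s} r * cin om (U r *V c *C ps)) = c * (LBINT r. ind {0..s} r * cin om (U r *V ps))"
  by (subst integral_mult_right_zero[symmetric]) (simp add: cinner_simps mult.left_commute)
 moreover have "cin om (U s *V c *C ph) - cin om (c *C ph) = c * (cin om (U s *V ph) - cin om ph)" by (simp add: cinner_simps right_diff_distrib)
 ultimately show "cin om (U s *V c *C ph) - cin om (c *C ph) = - \<i> * (LBINT r. ind {0..s} r * cin om (U r *V c *C ps))" by (simp add: generatorD[OF assms s])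
qed

lemma generator_invariant: assumes "(ph, ps) : generator U" shows "(U t *V ph, U t *V ps) : generator U" unfolding generator_def mem_Collect_eq prod.case
proof (intro allI impI)
 fix om and s :: real assume s: "0 <= s"
 have "cin om (U r *V U t *V x) = cin (U (- t) *V om) (U r *V x)" for r x by (simp add: U_cinner U_apply_add add.commute)
 moreover have "cin om (U t *V ph) = cin (U (- t) *V om) ph" by (simp add: U_cinner)
 ultimately show "cin om (U s *V U t *V ph) - cin om (U t *V ph) = - \<i> * (LBINT r. ind {0..s} r * cin om (U r *V U t *V ps))"
  by (simp add: generatorD[OF assms s])
qed

lemma generator_reflect: assumes g: "(ph, ps) : generator U" shows "(ph, - ps) : generator (%s. U (- s))" unfolding generator_def mem_Collect_eq prod.case
proof (intro allI impI)
 fix om and s :: real assume s: "0 <= s"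
 have "(LBINT r. ind {0..s} r * cin (U s *V om) (U r *V ps)) = (LBINT r. ind {0..s} r * cin om (U (- r) *V ps))"
  by (subst lborel_integral_real_affine[of "-1" _ s]) (auto simp: U_cinner U_apply_add indicator_def intro!: Bochner_Integration.integral_cong)
 then show "cin om (U (- s) *V ph) - cin om ph = - \<i> * (LBINT r. ind {0..s} r * cin om (U (- r) *V - ps))" using generatorD[OF g s, of "U s *V om"]
  by (simp add: U_cinner U_apply_add U_zero cinner_minus_right) (simp add: algebra_simps)
qed

text \<open>The solution is the exponential average of the orbit of \<open>ps\<close>, that is (1 +
  i P)^{-1} ps. Then P ph = i (ph - ps), and \<open>expd_resolvent\<close> is the integral equation
  to be checked.\<close>

lemma generator_resolvent: "EX ph. (ph, \<i> *C (ph - ps)) : generator U"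
proof -
 let ?B = "%om ps r. \<integral>t. of_real (expd t) * cin om (U (t + r) *V ps) \<partial>lborel"
 have int: "integrable lborel (%t. of_real (expd t) * cin om (U t *V ps))" for om ps proof (rule integrable_of_le)
  show "integrable lborel (%t. expd t * (norm om * norm ps))" by (intro integrable_mult_left integrable_exp_density)
  have "0 <= expd t" for t by (simp add: expd_def)
  then show "cmod (of_real (expd t) * cin om (U t *V ps)) <= expd t * (norm om * norm ps)" for t
   using mult_left_mono[OF U_bound[of om t ps]] by (simp add: norm_mult)
  show "(%t. of_real (expd t) * cin om (U t *V ps)) : borel_measurable lborel" using U_measurable[of om ps] by measurable
 qed
 have "EX R. ALL om ps. cin om (R *V ps) = (LBINT t. of_real (expd t) * cin om (U t *V ps))" proof (rule form_bop[where K = 1])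
  fix x y z and c :: complex
  show "cmod (LBINT t. of_real (expd t) * cin x (U t *V y)) <= 1 * norm x * norm y"
   using expd_resolvent(3)[OF U_measurable[of x y] U_bound order_refl, of 0] by simp
  show "(LBINT t. of_real (expd t) * cin (x + y) (U t *V z)) = (LBINT t. of_real (expd t) * cin x (U t *V z)) + (LBINT t. of_real (expd t) * cin y (U t *V z))"
   "(LBINT t. of_real (expd t) * cin x (U t *V (y + z))) = (LBINT t. of_real (expd t) * cin x (U t *V y)) + (LBINT t. of_real (expd t) * cin x (U t *V z))"
   by (simp_all add: cinner_simps ring_distribs int)
  show "(LBINT t. of_real (expd t) * cin (c *C x) (U t *V z)) = cnj c * (LBINT t. of_real (expd t) * cin x (U t *V z))"
   "(LBINT t. of_real (expd t) * cin x (U t *V c *C z)) = c * (LBINT t. of_real (expd t) * cin x (U t *V z))"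
   by (subst integral_mult_right_zero[symmetric], simp add: cinner_simps mult.left_commute)+
 qed
 then obtain R where R: "!!om ps. cin om (R *V ps) = (LBINT t. of_real (expd t) * cin om (U t *V ps))" by blast
 have UR: "cin om (U r *V R *V ps) = ?B om ps r" for om r
  using U_cinner[of "- r" om "R *V ps"] R[of "U (- r) *V om" ps] by (simp add: U_cinner U_apply_add add.commute)
 have "(R *V ps, \<i> *C (R *V ps - ps)) : generator U" unfolding generator_def mem_Collect_eq prod.case proof (intro allI impI)
  fix om and s :: real assume s: "0 <= s"
  have "cin om (U s *V R *V ps) - cin om (R *V ps) = (LBINT r. ind {0..s} r * (?B om ps r - cin om (U r *V ps)))"
   using expd_resolvent(1)[OF U_measurable[of om ps] U_bound s] by (simp add: UR R)
  also have "... = (LBINT r. - \<i> * (ind {0..s} r * cin om (U r *V \<i> *C (R *V ps - ps))))"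
   unfolding UR[symmetric] by (intro Bochner_Integration.integral_cong refl) (simp add: cinner_simps algebra_simps)
  finally show "cin om (U s *V R *V ps) - cin om (R *V ps) = - \<i> * (LBINT r. ind {0..s} r * cin om (U r *V \<i> *C (R *V ps - ps)))"
   by (simp only: integral_mult_right_zero)
 qed
 then show ?thesis by blast
qed

end

lemma eq_of_linear_bound:
 fixes a b :: complex assumes "!!h. 0 < h ==> cmod (of_real h * (a - b)) <= h * (h * C)" shows "a = b"
proof (rule ccontr)
 assume "a ~= b"
 then have d: "0 < cmod (a - b)" by simp
 define h where "h = cmod (a - b) / (2 * ((abs C) + 1))"
 have h: "0 < h" using d by (simp add: h_def)
 then have "cmod (a - b) <= h * C" using assms[of h] by (simp add: norm_mult)
 also have "... <= h * ((abs C) + 1)" using h by (intro mult_left_mono) auto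
 also have "... = cmod (a - b) / 2" by (simp add: h_def field_simps add_nonneg_eq_0_iff)
 finally show False using d by simp
qed

context
 fixes U :: "real => 'a::chilbert_space bop" assumes U: "unitary_rep U"
begin

text \<open>The error is of second order because \<open>om\<close> is in the domain as well: moving
  the unitary to \<open>om\<close> makes the integrand Lipschitz in r.\<close>

lemma generator_first_order: assumes g: "(ph, ps) : generator U" and g': "(om, \<xi>) : generator U" and s: "0 <= s"
 shows "cmod (cin om (U s *V ph) - cin om ph + \<i> * of_real s * cin om ps) <= s * (s * norm \<xi> * norm ps)"
proof -
 have m [measurable]: "(%r. cin om (U r *V ps)) : bmeas" by (rule U_measurable[OF U])
 have c: "integrable lborel (%r. ind {0..s} r * cin om ps)" by (rule bounded_integrable_segment[of _ "cmod (cin om ps)"]) auto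
 have "(LBINT r. ind {0..s} r * (cin om (U r *V ps) - cin om ps)) = (LBINT r. ind {0..s} r * cin om (U r *V ps)) - (LBINT r. ind {0..s} r * cin om ps)"
  using U_integrable[OF U, of 0 s om ps] c by (simp add: right_diff_distrib)
 also have "(LBINT r. ind {0..s} r * cin om ps) = of_real s * cin om ps" proof -
  have "(ind {0..s} :: real => complex) = (%r. cor (ind {0..s} r))" by (auto simp: indicator_def)
  then have "(LBINT r. ind {0..s} r) = cor s" using s by (simp only: integral_complex_of_real) simp
  then show ?thesis by simp
 qed
 finally have int: "(LBINT r. ind {0..s} r * (cin om (U r *V ps) - cin om ps)) = (LBINT r. ind {0..s} r * cin om (U r *V ps)) - of_real s * cin om ps" .
 have eq: "cin om (U s *V ph) - cin om ph + \<i> * of_real s * cin om ps = - \<i> * (LBINT r. ind {0..s} r * (cin om (U r *V ps) - cin om ps))"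
  unfolding generatorD[OF U g s] int by (simp add: right_diff_distrib)
 have "cmod (cin om (U r *V ps) - cin om ps) <= s * norm \<xi> * norm ps" if "r : {0..s}" for r proof -
  have "cin om (U r *V ps) - cin om ps = cin (U (- r) *V om - om) ps" by (simp add: cinner_simps U_cinner[OF U])
  also have "cmod ... <= norm (U (- r) *V om - om) * norm ps" by (rule cmod_cinner_le)
  also have "norm (U (- r) *V om - om) <= r * norm (- \<xi>)"
   using that by (intro generator_lipschitz[OF unitary_rep_reflect[OF U] generator_reflect[OF U g']]) simp
  also have "r * norm (- \<xi>) <= s * norm \<xi>" using that by (simp add: mult_right_mono)
  finally show ?thesis by (simp add: mult_right_mono)
 qed
 then show ?thesis unfolding eq using cmod_segment_le[of "%r. cin om (U r *V ps) - cin om ps" s "s * norm \<xi> * norm ps"] s by (simp add: norm_mult)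
qed

end

context
 fixes U :: "real => 'a::chilbert_space bop" assumes U: "unitary_rep U"
begin

text \<open>The increment of <om, U_h ph> can be expanded by acting on \<open>ph\<close> or on
  \<open>om\<close>. The two first order terms must agree, since both errors are quadratic in
  h.\<close>

lemma generator_symmetric: assumes g: "(ph, ps) : generator U" and g': "(om, \<xi>) : generator U" shows "cin \<xi> ph = cin om ps"
proof (rule eq_of_linear_bound)
 fix h :: real assume h: "0 < h"
 let ?d = "cin om (U h *V ph) - cin om ph"
 have 1: "cmod (?d + \<i> * of_real h * cin om ps) <= h * (h * norm \<xi> * norm ps)" using h by (intro generator_first_order[OF U g g']) simp
 have "cmod (cin ph (U (- h) *V om) - cin ph om + \<i> * of_real h * cin ph (- \<xi>)) <= h * (h * norm (- ps) * norm (- \<xi>))"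
  using h by (intro generator_first_order[OF unitary_rep_reflect[OF U] generator_reflect[OF U g'] generator_reflect[OF U g]]) simp
 also have "cin ph (U (- h) *V om) - cin ph om + \<i> * of_real h * cin ph (- \<xi>) = cnj (?d + \<i> * of_real h * cin \<xi> ph)"
  using U_cinner[OF U, of h ph om] cinner_commute[of om "U h *V ph"] cinner_commute[of om ph] cinner_commute[of \<xi> ph] by (simp add: cinner_minus_right)
 finally have 2: "cmod (?d + \<i> * of_real h * cin \<xi> ph) <= h * (h * norm \<xi> * norm ps)" unfolding complex_mod_cnj by (simp add: ac_simps)
 have eq: "\<i> * (of_real h * (cin \<xi> ph - cin om ps)) = (?d + \<i> * of_real h * cin \<xi> ph) - (?d + \<i> * of_real h * cin om ps)"
  by (simp add: algebra_simps)
 have "cmod (\<i> * (of_real h * (cin \<xi> ph - cin om ps))) <= h * (h * norm \<xi> * norm ps) + h * (h * norm \<xi> * norm ps)"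
  unfolding eq by (rule order_trans[OF norm_triangle_ineq4 add_mono[OF 2 1]])
 then show "cmod (of_real h * (cin \<xi> ph - cin om ps)) <= h * (h * (2 * norm \<xi> * norm ps))" by (simp add: norm_mult ac_simps)
qed

lemma generator_range: assumes "si = \<i> | si = - \<i>" shows "EX x w. (x, w) : generator U & y = w + si *C x" using assms
proof
 assume si: "si = - \<i>"
 obtain ph where ph: "(ph, \<i> *C (ph - \<i> *C y)) : generator U" using generator_resolvent[OF U] by blast
 have "y = \<i> *C (ph - \<i> *C y) + si *C ph" by (simp add: si scaleC_diff_right scaleC_add_right scaleC_scaleC scaleC_minus_left)
 then show ?thesis using ph by blast
next
 assume si: "si = \<i>"
 obtain ph where ph: "(ph, \<i> *C (ph - (- \<i>) *C y)) : generator (%s. U (- s))" using generator_resolvent[OF unitary_rep_reflect[OF U]] by blast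
 have "(ph, - (\<i> *C (ph - (- \<i>) *C y))) : generator U" using generator_reflect[OF unitary_rep_reflect[OF U] ph] by simp
 moreover have "y = - (\<i> *C (ph - (- \<i>) *C y)) + si *C ph" by (simp add: si scaleC_diff_right scaleC_add_right scaleC_scaleC scaleC_minus_left)
 ultimately show ?thesis by blast
qed

text \<open>The basic criterion: a symmetric operator for which w + i x and w - i x both exhaust the
  space. Density of the domain comes from \<open>single\<close>: a vector u orthogonal to it has the
  form w + i x, symmetry forces x = 0, and then (0, u) is in the generator.\<close>

lemma self_adjoint_generator: assumes single: "!!w. (0, w) : generator U ==> w = 0" shows "self_adjoint (generator U)" unfolding self_adjoint_def
proof
 have sub: "generator U <= adj_graph (generator U)" unfolding adj_graph_def using generator_symmetric by auto
 show "adj_graph (generator U) = generator U" proof (intro subset_antisym sub subrelI)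
  fix y z assume yz: "(y, z) : adj_graph (generator U)"
  obtain x w where xw: "(x, w) : generator U" "z + \<i> *C y = w + \<i> *C x" using generator_range[of \<i>] by blast
  have "(y - x, z - w) : adj_graph (generator U)"
   using adj_graph_add[OF yz adj_graph_scaleC[of x w "generator U" "-1"]] sub xw(1) by (auto simp: scaleC_minus_one)
  moreover have zw: "z - w = - (\<i> *C (y - x))" using xw(2) by (simp add: scaleC_diff_right algebra_simps)
  ultimately have *: "cin w' (y - x) = cin x' (- (\<i> *C (y - x)))" if "(x', w') : generator U" for x' w' using that unfolding adj_graph_def by auto
  obtain x' w' where xw': "(x', w') : generator U" "y - x = w' + (- \<i>) *C x'" using generator_range[of "- \<i>"] by blast
  have "cin (w' + (- \<i>) *C x') (y - x) = 0" using *[OF xw'(1)] by (simp add: cinner_add_left cinner_scaleC_left cinner_minus_right cinner_scaleC_right)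
  then have "cin (y - x) (y - x) = 0" using xw'(2) by simp
  then have "y = x" by (simp add: cinner_self)
  then show "(y, z) : generator U" using xw(1) zw by (simp add: scaleC_zero_right)
 qed
 have "closure (cspan (Domain (generator U))) = UNIV" proof (rule closure_cspan_eq_UNIV)
  fix u assume u: "!!x. x : Domain (generator U) ==> cin u x = 0"
  obtain x w where xw: "(x, w) : generator U" "u = w + \<i> *C x" using generator_range[of \<i>] by blast
  have "cin u x = 0" using u xw(1) by blast
  then have "cin w x = \<i> * of_real ((norm x)^2)" unfolding xw(2) by (simp add: cinner_simps cinner_self add_eq_0_iff)
  moreover have "cin w x = cnj (cin w x)" using generator_symmetric[OF xw(1) xw(1)] cinner_commute[of x w] by simp
  then have "Im (cin w x) = - Im (cin w x)" by (metis cnj.simps(2))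
  ultimately have "(norm x)^2 = 0" by simp
  then have "x = 0" by simp
  then show "u = 0" using single xw by (simp add: scaleC_zero_right)
 qed
 moreover have "cspan (Domain (generator U)) <= Domain (generator U)" unfolding cspan_def proof (rule span_minimal)
  show "{c *C x |c x. x : Domain (generator U)} <= Domain (generator U)" using generator_scaleC[OF U] by blast
  have s: "c *\<^sub>R x : Domain (generator U)" if "x : Domain (generator U)" for c x using generator_scaleC[OF U] that unfolding scaleR_scaleC by blast
  have "x + y : Domain (generator U)" if xy: "x : Domain (generator U)" "y : Domain (generator U)" for x y proof -
   obtain x' y' where g: "(x, x') : generator U" "((-1) *C y, y') : generator U" using xy generator_scaleC[OF U] by blast
   then show ?thesis using generator_diff[OF U g] by (auto simp: scaleC_minus_one)
  qed
  moreover obtain x w where "(x, w) : generator U" using generator_range[of \<i>] by blast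
  then have "0 : Domain (generator U)" using s[of x 0] by auto
  ultimately show "subspace (Domain (generator U))" using s by (intro subspaceI)
 qed
 ultimately show "closure (Domain (generator U)) = UNIV" using closure_mono by blast
qed

end

text \<open>N steps of length s / N contribute at most s^2 C / N in total.\<close>

lemma constant_of_quadratic:
 fixes f :: "real => complex" assumes f: "!!t h. 0 <= t ==> 0 <= h ==> h <= 1 ==> cmod (f (t + h) - f t) <= h * h * C" and s: "0 <= s" shows "f s = f 0"
proof -
 have bound: "cmod (f s - f 0) <= s * s * C * inverse (real N)" if N: "s <= real N" "0 < N" for N proof -
  define h where "h = s / real N"
  have h: "0 <= h" "h <= 1" using s N by (simp_all add: h_def)
  have "cmod (f (real k * h) - f 0) <= real k * (h * h * C)" for k proof (induction k)
   case (Suc k)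
   have "f (real (Suc k) * h) - f 0 = (f (real k * h + h) - f (real k * h)) + (f (real k * h) - f 0)" by (simp add: algebra_simps)
   then have "cmod (f (real (Suc k) * h) - f 0) <= cmod (f (real k * h + h) - f (real k * h)) + cmod (f (real k * h) - f 0)" by (metis norm_triangle_ineq)
   also have "... <= h * h * C + real k * (h * h * C)" using h by (intro add_mono f Suc.IH) auto
   finally show ?case by (simp add: algebra_simps)
  qed simp
  from this[of N] show ?thesis using N(2) by (simp add: h_def field_simps)
 qed
 have "(%N. s * s * C * inverse (real N)) ----> 0" using tendsto_mult_right[OF LIMSEQ_inverse_real_of_nat] lim_inverse_n by (intro tendsto_mult_right_zero) auto
 moreover have "\<forall>\<^sub>F N in sequentially. cmod (f s - f 0) <= s * s * C * inverse (real N)"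
  using eventually_ge_at_top[of "Suc (nat \<lceil>s\<rceil>)"] proof eventually_elim
  case (elim N)
  then show ?case using real_nat_ceiling_ge[of s] by (intro bound) linarith+
 qed
 ultimately have "cmod (f s - f 0) <= 0" by (intro tendsto_lowerbound) auto
 then show ?thesis by simp
qed

context
 fixes U :: "real => 'a::chilbert_space bop" and N :: "real set => 'a bop" assumes U: "unitary_rep U" and N: "pvm N" and UN: "generator U = sgraph N"
begin

lemma ugroup_apply_add: "ugroup N s *V ugroup N t *V x = ugroup N (s + t) *V x"
proof -
 have "ugroup N s * ugroup N t = ugroup N (s + t)" unfolding ugroup_def SI_mult[OF N bborel_exp bborel_exp, symmetric] by (simp add: ring_distribs exp_add)
 then show ?thesis by (metis times_bop_apply)
qed

lemma norm_unitary_group: "norm (ugroup N s *V x) = norm x"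
proof -
 have "ugroup N 0 = 1" by (simp add: ugroup_def SI_one[OF N])
 then have "norm x <= norm (ugroup N s *V x)" using norm_unitary_group_le[OF N, of "- s" "ugroup N s *V x"] by (simp add: ugroup_apply_add)
 then show ?thesis using norm_unitary_group_le[OF N, of s x] by simp
qed

text \<open>\<open>t \<mapsto> \<langle>U\<^sub>t ph, e\<^sup>-\<^sup>i\<^sup>t\<^sup>P ph\<rangle>\<close> has derivative zero.\<close>

lemma unitary_rep_eq_unitary_group_cut: assumes s: "0 <= s" and ph: "N (cutoff n) *V ph = ph" shows "U s *V ph = ugroup N (- s) *V ph"
proof -
 define V where "V t = ugroup N (- t)" for t
 define ps where "ps = SI N (idc n) *V ph"
 have g: "(ph, ps) : generator U" unfolding UN ps_def using sgraph_cut[OF N, of n ph] ph by simp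
 have comm: "V t *V SI N f *V x = SI N f *V V t *V x" if "bborel f" for f t x
  using SI_mult_commute[OF N bborel_exp that] unfolding V_def ugroup_def by (metis times_bop_apply)
 have commE: "V t *V N (cutoff m) *V x = N (cutoff m) *V V t *V x" for m t x using comm[of "ind (cutoff m)"] by (simp add: SI_indicator[OF N])
 have gV: "(V t *V ph, V t *V ps) : generator U" for t using g unfolding UN sgraph_def by (simp add: commE[symmetric] comm[symmetric])
 \<comment> \<open>On the spectral subspace of \<open>cutoff n\<close> the Taylor remainder of exp
   (- i h x) is at most (h x)^2, with |x| <= n.\<close>
 have V1: "norm (V h *V ph' - ph' + (\<i> * of_real h) *C (SI N (idc n) *V ph')) <= h * h * (real n)^2 * norm ph'"
  if h: "0 <= h" and ph': "N (cutoff n) *V ph' = ph'" for h ph' proof -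
  let ?c = "ind (cutoff n) :: real => complex"
  define e where "e x = exp (\<i> * cor (- h * x))" for x
  have be: "bborel e" unfolding e_def by (rule bborel_exp)
  have Ve: "V h = SI N e" unfolding V_def ugroup_def e_def ..
  define f where "f x = e x * ?c x - ?c x + (\<i> * of_real h) * idc n x" for x
  have bf: "bborel f" unfolding f_def by (intro bborel_add bborel_diff bborel_mult be bborel_const bborel_idc bborel_indicator_cut)
  have "SI N f = V h * N (cutoff n) - N (cutoff n) + (\<i> * of_real h) *C SI N (idc n)" unfolding f_def Ve
   by (simp add: SI_add[OF N] SI_diff[OF N] SI_scale[OF N]
    SI_mult[OF N] SI_indicator[OF N] be bborel_mult bborel_diff bborel_const)
  then have "V h *V ph' - ph' + (\<i> * of_real h) *C (SI N (idc n) *V ph') = SI N f *V ph'" by (simp add: ph')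
  also have "norm ... <= h * h * (real n)^2 * norm ph'" proof (rule order_trans[OF norm_apply_le mult_right_mono[OF norm_SI_le[OF N bf]]])
   fix x
   show "cmod (f x) <= h * h * (real n)^2" proof (cases "x : cutoff n")
    case True
    then have "f x = iexp (- h * x) - (SUM k<=1. (\<i> * (- h * x)) ^ k / fact k)" by (simp add: f_def e_def idc_def algebra_simps)
    then have "cmod (f x) <= (abs (- h * x)) ^ Suc 1 / fact (Suc 1)" using iexp_approx1[of "- h * x" 1] by simp
    also have "... <= (h * x)^2" using zero_le_power2[of "h * x"] by (simp add: numeral_2_eq_2[symmetric])
    also have "... = h * h * x\<^sup>2" by (simp add: power2_eq_square)
    also have "x\<^sup>2 <= (real n)^2" using True by (auto simp: cutoff_def abs_le_square_iff[symmetric] abs_le_iff)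
    finally show ?thesis using h by (simp add: mult_left_mono)
   qed (simp add: f_def idc_def)
  qed (use h in simp_all)
  finally show ?thesis .
 qed
 define C where "C = (norm ps)^2 + (real n)^2 * (norm ph)^2 + norm ps * ((real n)^2 * norm ph + norm ps)"
 have nV: "norm (V t *V x) = norm x" for t x unfolding V_def by (rule norm_unitary_group)
 define f where "f t = cin (U t *V ph) (V t *V ph)" for t
 have "f s = f 0" proof (rule constant_of_quadratic[OF _ s])
  fix t h :: real assume "0 <= t" and h: "0 <= h" "h <= 1"
  let ?ph1 = "U t *V ph" and ?ps1 = "U t *V ps" and ?ph2 = "V t *V ph" and ?ps2 = "V t *V ps"
  define a where "a = U h *V ?ph1 - ?ph1"
  define b where "b = V h *V ?ph2 - ?ph2"
  note g1 = generator_invariant[OF U g, of t] and g2 = gV[of t]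
  have "cmod (cin ?ph2 a + \<i> * of_real h * cin ?ph2 ?ps1) <= h * (h * norm ps * norm ps)"
   using generator_first_order[OF U g1 g2 h(1)] by (simp add: a_def cinner_diff_right nV norm_U[OF U])
  also have "cin ?ph2 a + \<i> * of_real h * cin ?ph2 ?ps1 = cnj (cin a ?ph2 - \<i> * of_real h * cin ?ps1 ?ph2)"
   using cinner_commute[of ?ph2 a] cinner_commute[of ?ph2 ?ps1] by simp
  finally have A: "cmod (cin a ?ph2 - \<i> * of_real h * cin ?ps1 ?ph2) <= h * h * (norm ps)^2"
   unfolding complex_mod_cnj by (simp add: power2_eq_square ac_simps)
  have "?ps2 = SI N (idc n) *V ?ph2" "N (cutoff n) *V ?ph2 = ?ph2" using comm[OF bborel_idc] commE[of t n ph] ph by (simp_all add: ps_def)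
  then have B0: "norm (b + (\<i> * of_real h) *C ?ps2) <= h * h * (real n)^2 * norm ph" using V1[OF h(1), of ?ph2] by (simp add: b_def nV)
  have "cin ?ph1 b + \<i> * of_real h * cin ?ph1 ?ps2 = cin ?ph1 (b + (\<i> * of_real h) *C ?ps2)" by (simp add: cinner_simps)
  also have "cmod ... <= norm ph * (h * h * (real n)^2 * norm ph)"
   using order_trans[OF cmod_cinner_le mult_left_mono[OF B0 norm_ge_zero], of ?ph1] by (simp only: norm_U[OF U])
  finally have B: "cmod (cin ?ph1 b + \<i> * of_real h * cin ?ph1 ?ps2) <= h * h * ((real n)^2 * (norm ph)^2)" by (simp add: power2_eq_square ac_simps)
  have "norm a <= h * norm ps" unfolding a_def using generator_lipschitz[OF U g1 h(1)] by (simp add: norm_U[OF U])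
  moreover have "norm b <= h * ((real n)^2 * norm ph + norm ps)" proof -
   have "norm b <= norm (b + (\<i> * of_real h) *C ?ps2) + norm ((\<i> * of_real h) *C ?ps2)" by (metis add_diff_cancel norm_triangle_ineq4)
   also have "... <= h * h * (real n)^2 * norm ph + h * norm ps" using B0 h by (simp add: norm_scaleC norm_mult nV)
   also have "h * h * (real n)^2 * norm ph <= h * (real n)^2 * norm ph" using h mult_left_le[of h h] by (intro mult_right_mono) auto
   finally show ?thesis by (simp add: algebra_simps)
  qed
  ultimately have D: "cmod (cin a b) <= h * h * (norm ps * ((real n)^2 * norm ph + norm ps))"
   using order_trans[OF cmod_cinner_le mult_mono[of "norm a" "h * norm ps" "norm b" "h * ((real n)^2 * norm ph + norm ps)"]] h by (simp add: ac_simps)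
  have "f (t + h) = cin (?ph1 + a) (?ph2 + b)" unfolding f_def a_def b_def V_def by (simp add: U_apply_add[OF U] ugroup_apply_add add.commute)
  \<comment> \<open>The two first order terms inserted here cancel by symmetry of the generator, so
    only the second order bounds \<open>A\<close>, \<open>B\<close> and \<open>D\<close>
    remain.\<close>
  then have "f (t + h) - f t = (cin a ?ph2 - \<i> * of_real h * cin ?ps1 ?ph2) + (cin ?ph1 b + \<i> * of_real h * cin ?ph1 ?ps2) + cin a b"
   using generator_symmetric[OF U g2 g1] by (simp add: f_def cinner_simps)
  then have "cmod (f (t + h) - f t) <= h * h * (norm ps)^2 + h * h * ((real n)^2 * (norm ph)^2) + h * h * (norm ps * ((real n)^2 * norm ph + norm ps))"
   by (simp only:) (intro order_trans[OF norm_triangle_ineq add_mono] A B D)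
  then show "cmod (f (t + h) - f t) <= h * h * C" by (simp add: C_def ring_distribs)
 qed
 moreover have "f 0 = of_real ((norm ph)^2)" by (simp add: f_def U_zero[OF U] V_def ugroup_def SI_one[OF N] cinner_self)
 ultimately have "(norm (U s *V ph - V s *V ph))^2 = 0" unfolding norm_diff_square by (simp add: f_def[symmetric] norm_U[OF U] nV del: of_real_power)
 then show ?thesis by (simp add: V_def)
qed

lemma unitary_rep_eq_unitary_group: "U s = ugroup N (- s)"
proof -
 have pos: "U s = ugroup N (- s)" if s: "0 <= s" for s proof (rule bop_eqI)
  fix x
  have "N (cutoff n) *V N (cutoff n) *V x = N (cutoff n) *V x" for n using pvm_idem[OF N cut_borel[of n]] by (metis times_bop_apply)
  then have "U s *V N (cutoff n) *V x = ugroup N (- s) *V N (cutoff n) *V x" for n by (rule unitary_rep_eq_unitary_group_cut[OF s])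
  moreover have "(%n. U s *V N (cutoff n) *V x) ----> U s *V x" "(%n. ugroup N (- s) *V N (cutoff n) *V x) ----> ugroup N (- s) *V x"
   by (intro tendsto_apply_bop cut_tendsto[OF N])+
  ultimately show "U s *V x = ugroup N (- s) *V x" using LIMSEQ_unique by auto
 qed
 show ?thesis proof (cases "0 <= s")
  case False
  then have "adj (U (- s)) = adj (ugroup N (- (- s)))" using pos[of "- s"] by simp
  then show ?thesis using U_adj[OF U, of "- s"] ugroup_adj[OF N, of s] by simp
 qed (rule pos)
qed

end

section \<open>Position and momentum\<close>

lemma rep_L2_measurable [measurable]: "rep_L2 f : bmeas" using square_integrable_rep_L2[of f] unfolding square_integrable_def by simp

lemma L2_eqI:  assumes "AE x in lborel. rep_L2 f x = rep_L2 g x" shows "f = g"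
proof -
 have "(\<integral>\<^sup>+x. ennreal ((cmod (rep_L2 f x - rep_L2 g x))^2) \<partial>lborel) = (\<integral>\<^sup>+x. 0 \<partial>(lborel::real measure))"
  by (rule nn_integral_cong_AE) (use assms in "eventually_elim, simp")
 then show ?thesis unfolding nn_integral_L2_diff by simp
qed

lemma rep_L2_scaleC: "AE x in lborel. rep_L2 (c *C f) x = c * rep_L2 f x"
proof -
 have "c *C f = abs_L2 (%x. c * rep_L2 f x)" using scaleC_L2.abs_eq[of "rep_L2 f" c] square_integrable_rep_L2[of f] by (simp add: L2_rel_def abs_rep_L2)
 then show ?thesis using rep_abs_L2[OF square_integrable_scale[OF square_integrable_rep_L2[of f], of c]] by simp
qed

lemma rep_L2_add: "AE x in lborel. rep_L2 (f + g) x = rep_L2 f x + rep_L2 g x" using rep_L2_diff[of "f + g" g] by eventually_elim simp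

lemma norm_L2_square: "(norm f)^2 = (LBINT x. (cmod (rep_L2 f x))^2)" by (simp add: power2_norm_eq_inner inner_L2_def cinner_L2'_self)

lemma integrable_rep_L2: "integrable lborel (%x. (cmod (rep_L2 f x))^2)" using square_integrable_rep_L2[of f] unfolding square_integrable_def by simp

lemma AE_shift: assumes "AE x in lborel. P x" shows "AE x in lborel. P (x - s :: real)"
proof -
 obtain N where N: "N : null_sets lborel" "{x. ~ P x} <= N" using assms unfolding eventually_ae_filter by auto
 then have "{x. x - s : N} : null_sets lborel" using null_sets_translation[of N s] by simp
 then show ?thesis unfolding eventually_ae_filter using N(2) by (intro bexI[of _ "{x. x - s : N}"]) auto
qed

lemma integral_shift: "(LBINT x. f (x - s :: real)) = (\<integral>x. f x \<partial>lborel :: complex)"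
 using lborel_integral_real_affine[of 1 "%x. f (x - s)" s] by simp

lemma integrable_shift: "integrable lborel f ==> integrable lborel (%x. f (x - s :: real) :: real)" using lborel_integrable_real_affine[of f 1 "- s"] by simp

lemma L2_op_exists: assumes m: "bborel m" shows "EX A. ALL ph. AE q in lborel. rep_L2 (A *V ph) q = m q * rep_L2 ph (q - s)"
proof -
 have [measurable]: "m : bmeas" using m by measurable
 obtain K where K: "!!q. cmod (m q) <= K" using m unfolding bborel_def by blast
 then have K0: "0 <= K" using order_trans[OF norm_ge_zero] by blast
 define f where "f ph = abs_L2 (%q. m q * rep_L2 ph (q - s))" for ph
 have le: "norm ((cmod (m q * rep_L2 ph (q - s)))^2) <= K\<^sup>2 * (cmod (rep_L2 ph (q - s)))^2" for ph q
  using power_mono[OF K[of q] norm_ge_zero, of 2] by (simp add: norm_mult power_mult_distrib mult_right_mono)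
 have int: "integrable lborel (%q. K\<^sup>2 * (cmod (rep_L2 ph (q - s)))^2)" for ph using integrable_shift[OF integrable_rep_L2[of ph], of s] by simp
 have sq: "square_integrable (%q. m q * rep_L2 ph (q - s))" for ph unfolding square_integrable_def proof
  show "integrable lborel (%x. (cmod (m x * rep_L2 ph (x - s)))^2)" by (rule integrable_of_le[OF int _ le]) measurable
 qed measurable
 have f: "AE q in lborel. rep_L2 (f ph) q = m q * rep_L2 ph (q - s)" for ph unfolding f_def by (rule rep_abs_L2[OF sq])
 have "clinear f" unfolding clinear_def proof (intro conjI allI)
  fix x y :: L2 and c
  show "f (x + y) = f x + f y" by (rule L2_eqI)
    (use f[of "x + y"] f[of x] f[of y] rep_L2_add[of "f x" "f y"] AE_shift[OF rep_L2_add[of x y], of s] in "eventually_elim, simp add: distrib_left")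
  show "f (c *C x) = c *C f x" by (rule L2_eqI)
    (use f[of "c *C x"] f[of x] rep_L2_scaleC[of c "f x"] AE_shift[OF rep_L2_scaleC[of c x], of s] in "eventually_elim, simp")
 qed
 moreover have "norm (f ph) <= K * norm ph" for ph proof (rule power2_le_imp_le)
  have "(norm (f ph))^2 = (LBINT q. (cmod (m q * rep_L2 ph (q - s)))^2)"
   unfolding norm_L2_square by (rule integral_cong_AE) (measurable, use f[of ph] in "eventually_elim, simp")
  also have "... <= (LBINT q. K\<^sup>2 * (cmod (rep_L2 ph (q - s)))^2)"
   using sq[of ph] int[of ph] le[of _ ph] unfolding square_integrable_def by (intro integral_mono) auto
  also have "... = K\<^sup>2 * (norm ph)^2" using lborel_integral_real_affine[of 1 "%q. (cmod (rep_L2 ph (q - s)))^2" s] by (simp add: norm_L2_square)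
  finally show "(norm (f ph))^2 <= (K * norm ph)^2" by (simp add: power_mult_distrib)
 qed (simp add: K0)
 ultimately obtain A where "!!ph. A *V ph = f ph" using bop_exists by blast
 then show ?thesis using f by (intro exI[of _ A]) simp
qed

text \<open>Weighted translations: s = 0 gives multiplication operators, the weight 1 gives
  translations, and products and adjoints stay in the family. So the Weyl relations are instances of
  \<open>L2_op_mult\<close>.\<close>

definition L2_op :: "(real => complex) => real => L2 bop" where "L2_op m s = (SOME A. ALL ph. AE q in lborel. rep_L2 (A *V ph) q = m q * rep_L2 ph (q - s))"

lemma L2_op: "bborel m ==> AE q in lborel. rep_L2 (L2_op m s *V ph) q = m q * rep_L2 ph (q - s)" using someI_ex[OF L2_op_exists] unfolding L2_op_def by blast

lemma cinner_L2_op: assumes m: "bborel m" shows "cin ph (L2_op m s *V ps) = (LBINT q. cnj (rep_L2 ph q) * (m q * rep_L2 ps (q - s)))"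
proof -
 have [measurable]: "m : bmeas" using m by measurable
 show ?thesis unfolding cinner_L2_eq by (rule integral_cong_AE) (measurable, use L2_op[OF m, of s ps] in "eventually_elim, simp")
qed

lemma L2_op_mult: assumes m: "bborel m" and m': "bborel m'" shows "L2_op m s * L2_op m' s' = L2_op (%q. m q * m' (q - s)) (s + s')"
proof (rule bop_eqI, rule L2_eqI)
 fix ph
 have "bborel (%q. m q * m' (q - s))" by (intro bborel_mult m bborel_comp[OF m']) measurable
 from L2_op[OF this, of "s + s'" ph] L2_op[OF m, of s "L2_op m' s' *V ph"] AE_shift[OF L2_op[OF m', of s' ph], of s]
 show "AE x in lborel. rep_L2 ((L2_op m s * L2_op m' s') *V ph) x = rep_L2 (L2_op (%q. m q * m' (q - s)) (s + s') *V ph) x"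
  by eventually_elim (simp add: diff_diff_eq)
qed

lemma L2_op_one: "L2_op (%_. 1) 0 = 1" by (rule bop_eqI, rule L2_eqI) (use L2_op[OF bborel_const, of 1 0] in simp)

lemma adj_L2_op:  assumes m: "bborel m" shows "adj (L2_op m s) = L2_op (%q. cnj (m (q + s))) (- s)"
proof (rule adj_eqI)
 fix x y
 have m': "bborel (%q. cnj (m (q + s)))" by (intro bborel_cnj bborel_comp[OF m]) measurable
 have "cin (L2_op m s *V x) y = cnj (LBINT q. cnj (rep_L2 y q) * (m q * rep_L2 x (q - s)))" by (subst cinner_commute) (simp add: cinner_L2_op[OF m])
 also have "... = (LBINT q. cnj (cnj (rep_L2 y q) * (m q * rep_L2 x (q - s))))" by (rule Bochner_Integration.integral_cnj[symmetric])
 also have "... = (LBINT q. cnj (rep_L2 x (q - s)) * (cnj (m ((q - s) + s)) * rep_L2 y ((q - s) - - s)))" by (simp add: ac_simps)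
 also have "... = cin x (L2_op (%q. cnj (m (q + s))) (- s) *V y)" unfolding cinner_L2_op[OF m'] by (rule integral_shift)
 finally show "cin (L2_op m s *V x) y = cin x (L2_op (%q. cnj (m (q + s))) (- s) *V y)" .
qed

definition Qpvm :: "real set => L2 bop" where "Qpvm B = (if B : sets borel then L2_op (ind B) 0 else 0)"

definition L2_density :: "L2 => real measure" where "L2_density ph = density lborel (%q. ennreal ((cmod (rep_L2 ph q))^2))"

lemma L2_density: "sets (L2_density ph) = sets borel" "space (L2_density ph) = UNIV" "finite_measure (L2_density ph)"
proof -
 have "(\<integral>\<^sup>+q. ennreal ((cmod (rep_L2 ph q))^2) \<partial>lborel) < \<infinity>"
  using integrable_rep_L2[of ph] by (subst nn_integral_eq_integral) auto
 then show "finite_measure (L2_density ph)" by (intro finite_measureI) (simp add: L2_density_def emeasure_density)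
qed (simp_all add: L2_density_def)

lemma cinner_mult_op: assumes m: "bborel m" shows "cin ph (L2_op m 0 *V ph) = (LINT q|L2_density ph. m q)"
proof -
 have [measurable]: "m : bmeas" using m by measurable
 have "(LINT q|L2_density ph. m q) = (LBINT q. (cmod (rep_L2 ph q))^2 *\<^sub>R m q)" unfolding L2_density_def by (subst integral_density) auto
 also have "... = (LBINT q. cnj (rep_L2 ph q) * (m q * rep_L2 ph (q - 0)))" by (intro Bochner_Integration.integral_cong refl)
   (simp add: scaleR_conv_of_real complex_norm_square mult.commute mult.left_commute del: of_real_power)
 finally show ?thesis by (simp add: cinner_L2_op[OF m])
qed

lemma cinner_position_pvm: assumes "B : sets borel" shows "cin ph (Qpvm B *V ph) = of_real (measure (L2_density ph) B)"
 using cinner_mult_op[OF bborel_indicator[OF assms], of ph]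
  integral_indicator_complex[OF L2_density(3), of B ph] assms by (simp add: Qpvm_def L2_density)

lemma Qpvm: "pvm Qpvm"
proof (rule pvmI)
 fix B :: "real set" assume B: "B : sets borel"
 have "(%q. ind B q * ind B (q - 0)) = (ind B :: real => complex)" "(%q. cnj (ind B (q + 0))) = (ind B :: real => complex)" by (auto simp: indicator_def)
 then show "projection (Qpvm B)" using B L2_op_mult[OF bborel_indicator[OF B] bborel_indicator[OF B], of 0 0] adj_L2_op[OF bborel_indicator[OF B], of 0]
  unfolding projection_def Qpvm_def by simp
next
 have "ind UNIV = (%_::real. 1::complex)" by auto
 then show "Qpvm UNIV = 1" by (simp add: Qpvm_def L2_op_one)
next
 fix F :: "nat => real set" and x assume F: "range F <= sets borel" "disjoint_family F"
 interpret finite_measure "L2_density x" by (rule L2_density)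
 have "(%n. measure (L2_density x) (F n)) sums measure (L2_density x) (UN n. F n)" by (rule finite_measure_UNION) (use F in "auto simp: L2_density")
 moreover have "F n : sets borel" "(UN n. F n) : sets borel" for n using F by auto
 ultimately show "(%n. Re (cin x (Qpvm (F n) *V x))) sums Re (cin x (Qpvm (UN n. F n) *V x))" by (simp only: cinner_position_pvm Re_complex_of_real)
qed (simp add: Qpvm_def)

lemma spectral_distribution_position: "sdist Qpvm ph = L2_density ph"
proof (rule measure_eqI)
 interpret finite_measure "L2_density ph" by (rule L2_density)
 fix B assume "B : sets (sdist Qpvm ph)"
 then have B: "B : sets borel" by (simp add: sets_sdist[OF Qpvm])
 have "(norm (Qpvm B *V ph))^2 = measure (L2_density ph) B" using projection_norm[OF pvm_projection[OF Qpvm B], of ph] cinner_position_pvm[OF B, of ph]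
  by (simp del: of_real_power)
 then show "emeasure (sdist Qpvm ph) B = emeasure (L2_density ph) B" by (simp add: emeasure_sdist[OF Qpvm B] emeasure_eq_measure)
qed (simp add: sets_sdist[OF Qpvm] L2_density)

lemma SI_position: "bborel f ==> SI Qpvm f = L2_op f 0" by (rule SI_eqI[OF Qpvm]) (simp add: cinner_mult_op spectral_distribution_position)

lemma position_op_eq: "position_op = sgraph Qpvm"
proof (intro set_eqI, clarify)
 fix ph ps
 have "Qpvm (cutoff n) *V ps = SI Qpvm (idc n) *V ph \<longleftrightarrow> (AE q in lborel. ind (cutoff n) q * rep_L2 ps q = idc n q * rep_L2 ph q)" for n
 proof -
  have 1: "AE q in lborel. rep_L2 (Qpvm (cutoff n) *V ps) q = ind (cutoff n) q * rep_L2 ps q"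
   using L2_op[OF bborel_indicator_cut, of n 0 ps] by (simp add: Qpvm_def)
  have 2: "AE q in lborel. rep_L2 (SI Qpvm (idc n) *V ph) q = idc n q * rep_L2 ph q" using L2_op[OF bborel_idc, of n 0 ph] by (simp add: SI_position)
  show ?thesis proof
   assume "AE q in lborel. ind (cutoff n) q * rep_L2 ps q = idc n q * rep_L2 ph q"
   with 1 2 have "AE q in lborel. rep_L2 (Qpvm (cutoff n) *V ps) q = rep_L2 (SI Qpvm (idc n) *V ph) q" by eventually_elim simp
   then show "Qpvm (cutoff n) *V ps = SI Qpvm (idc n) *V ph" by (rule L2_eqI)
  next
   assume "Qpvm (cutoff n) *V ps = SI Qpvm (idc n) *V ph"
   with 1 have "AE q in lborel. rep_L2 (SI Qpvm (idc n) *V ph) q = ind (cutoff n) q * rep_L2 ps q" by simp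
   with 2 show "AE q in lborel. ind (cutoff n) q * rep_L2 ps q = idc n q * rep_L2 ph q" by eventually_elim simp
  qed
 qed
 then have "(ph, ps) : sgraph Qpvm \<longleftrightarrow> (AE q in lborel. ALL n. ind (cutoff n) q * rep_L2 ps q = idc n q * rep_L2 ph q)"
  unfolding sgraph_def AE_all_countable by simp
 moreover have "(ALL n. ind (cutoff n) q * rep_L2 ps q = idc n q * rep_L2 ph q) \<longleftrightarrow> rep_L2 ps q = cor q * rep_L2 ph q" for q proof -
  obtain n where "q : cutoff n" using eventually_happens[OF eventually_in_cut[of q]] by auto
  then show ?thesis unfolding idc_def indicator_def by auto
 qed
 ultimately show "(ph, ps) : position_op \<longleftrightarrow> (ph, ps) : sgraph Qpvm" unfolding position_op_def by simp
qed

section \<open>Translations and the momentum operator\<close>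

definition translation :: "real => L2 bop" where "translation s = L2_op (%_. 1) s"

lemma rep_translation: "AE q in lborel. rep_L2 (translation s *V ph) q = rep_L2 ph (q - s)"
 using L2_op[OF bborel_const, of 1 s ph] by (simp add: translation_def)

lemma cinner_translation: "cin ph (translation s *V ps) = (LBINT q. cnj (rep_L2 ph q) * rep_L2 ps (q - s))"
 using cinner_L2_op[OF bborel_const, of ph 1 s ps] by (simp add: translation_def)

lemma unitary_rep_translation: "unitary_rep translation" unfolding unitary_rep_def
proof (intro conjI allI)
 show "translation 0 = 1" by (simp add: translation_def L2_op_one)
 show "translation (s + t) = translation s * translation t" for s t using L2_op_mult[OF bborel_const bborel_const, of 1 s 1 t] by (simp add: translation_def)
 show "adj (translation s) = translation (- s)" for s using adj_L2_op[OF bborel_const, of 1 s] by (simp add: translation_def)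
 show "(%r. cin om (translation r *V ph)) : bmeas" for om ph unfolding cinner_translation by measurable
qed

lemma translation_conj: assumes g: "bborel g" shows "cin (translation s *V ph) (SI Qpvm g *V translation s *V ph) = (LINT q|sdist Qpvm ph. g (q + s))"
proof -
 have g': "bborel (%q. g (q + s))" by (rule bborel_comp[OF g]) measurable
 have "translation (- s) * (L2_op g 0 * translation s) = L2_op (%q. g (q + s)) 0" using g by (simp add: translation_def L2_op_mult bborel_const)
 then have "translation (- s) *V L2_op g 0 *V translation s *V ph = L2_op (%q. g (q + s)) 0 *V ph" by (metis times_bop_apply)
 then show ?thesis by (simp add: U_cinner[OF unitary_rep_translation] SI_position[OF g] cinner_mult_op[OF g']
   spectral_distribution_position)
qed

lemma indicator_scaleR: "ind A t *\<^sub>R (z::complex) = ind A t * z" by (simp add: indicator_def)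

lemma L2_segment_integrable: "integrable lborel (%t. ind {a..b} t * rep_L2 ps t)"
proof (rule integrable_of_le)
 show "integrable lborel (%t. ind {a..b} t * 1 + (cmod (rep_L2 ps t))^2)"
  by (intro Bochner_Integration.integrable_add integrable_segment_const integrable_rep_L2)
 have "c <= 1 + c\<^sup>2" if "0 <= c" for c :: real using sum_squares_ge_zero[of "c - 1" 0] that by (simp add: power2_eq_square algebra_simps)
 then show "cmod (ind {a..b} t * rep_L2 ps t) <= ind {a..b} t * 1 + (cmod (rep_L2 ps t))^2" for t by (auto simp: indicator_def norm_mult)
qed measurable

text \<open>The function that represents the weak integral of the translates of \<open>ps\<close>
  over [0, s]. By \<open>movint_eq\<close> it is the integral of \<open>ps\<close> over [q - s, q],
  which links the generator to indefinite integrals.\<close>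

definition movint :: "real => L2 => real => complex" where "movint s ps q = (LBINT r. ind {0..s} r * rep_L2 ps (q - r))"

lemma movint_eq: "movint s ps q = (LBINT t. ind {q - s..q} t * rep_L2 ps t)"
proof -
 have "(LBINT t. ind {q - s..q} t * rep_L2 ps t) = (LBINT r. ind {q - s..q} (q + -1 * r) * rep_L2 ps (q + -1 * r))"
  using lborel_integral_real_affine[of "-1" "%t. ind {q - s..q} t * rep_L2 ps t" q] by simp
 also have "... = movint s ps q" unfolding movint_def by (intro Bochner_Integration.integral_cong) (auto simp: indicator_def)
 finally show ?thesis ..
qed

lemma movint_measurable [measurable]: "movint s ps : bmeas" unfolding movint_def[abs_def] by measurable

lemma movint_fubini: "integrable lborel (%q. cnj (rep_L2 om q) * movint s ps q)" "(LBINT q. cnj (rep_L2 om q) * movint s ps q) =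
  (LBINT r. ind {0..s} r * cin om (translation r *V ps))"
proof -
 let ?G = "%r q. ind {0..s} r * (cnj (rep_L2 om q) * rep_L2 ps (q - r))"
 let ?b = "%r q. (cmod (rep_L2 om q))^2 + (cmod (rep_L2 ps (q - r)))^2"
 define C where "C = (norm om)^2 + (norm ps)^2"
 have ab: "a * b <= a\<^sup>2 + b\<^sup>2" for a b :: real proof -
  have "2 * (a * b) <= a\<^sup>2 + b\<^sup>2" using sum_squares_ge_zero[of "a - b" 0] by (simp add: power2_eq_square algebra_simps)
  moreover have "0 <= a\<^sup>2 + b\<^sup>2" by simp
  ultimately show ?thesis by linarith
 qed
 have b: "integrable lborel (?b r)" for r by (intro Bochner_Integration.integrable_add integrable_rep_L2 integrable_shift)
 have le: "cmod (cnj (rep_L2 om q) * rep_L2 ps (q - r)) <= ?b r q" for r q by (simp only: norm_mult complex_mod_cnj ab)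
 have i: "integrable lborel (%q. cnj (rep_L2 om q) * rep_L2 ps (q - r))" for r by (rule integrable_of_le[OF b _ le]) measurable
 have bC: "(LBINT q. ?b r q) = C" for r using lborel_integral_real_affine[of 1 "%q. (cmod (rep_L2 ps (q - r)))^2" r]
   integrable_shift[OF integrable_rep_L2[of ps], of r] integrable_rep_L2[of om] by (simp add: C_def norm_L2_square)
 have int: "integrable (lborel \<Otimes>\<^sub>M lborel) (%(r, q). ?G r q)" proof (rule lborel_pair.Fubini_integrable)
  show "(%(r, q). ?G r q) : borel_measurable (lborel \<Otimes>\<^sub>M lborel)" by measurable
  show "AE r in lborel. integrable lborel (%q. case (r, q) of (r, q) => ?G r q)" using i by (intro AE_I2) simp
  have "norm (LBINT q. cmod (?G r q)) <= ind {0..s} r * C" for r proof -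
   have "(LBINT q. cmod (cnj (rep_L2 om q) * rep_L2 ps (q - r))) <= C" unfolding bC[of r, symmetric] by (rule integral_mono[OF integrable_norm[OF i] b le])
   then show ?thesis by (simp add: norm_mult[of "ind {0..s} r"] indicator_def)
  qed
  then have "integrable lborel (%r. \<integral>q. cmod (?G r q) \<partial>lborel)" by (intro integrable_of_le[OF integrable_segment_const]) measurable
  then show "integrable lborel (%r. \<integral>q. norm (case (r, q) of (r, q) => ?G r q) \<partial>lborel)" by simp
 qed
 have inner: "(LBINT r. ?G r q) = cnj (rep_L2 om q) * movint s ps q" for q
  unfolding movint_def by (subst integral_mult_right_zero[symmetric]) (simp add: mult.left_commute)
 show "integrable lborel (%q. cnj (rep_L2 om q) * movint s ps q)" using lborel_pair.integrable_snd[OF int] by (simp add: inner)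
 show "(LBINT q. cnj (rep_L2 om q) * movint s ps q) = (LBINT r. ind {0..s} r * cin om (translation r *V ps))"
  using lborel_pair.Fubini_integral[OF int] by (simp add: inner cinner_translation)
qed

text \<open>\<open>d\<close> is not assumed square integrable and cannot be tested against itself;
  indicators of bounded Borel sets are in L2 and suffice.\<close>

lemma AE_eq_0_of_tests: assumes int: "!!om. integrable lborel (%q. cnj (rep_L2 om q) * d q)" and m [measurable]: "d : bmeas"
  and 0: "!!om. (LBINT q. cnj (rep_L2 om q) * d q) = 0" shows "AE q in lborel. d q = 0"
proof -
 have test: "integrable lborel (%q. ind (A Int cutoff n) q * d q) & (LBINT q. ind (A Int cutoff n) q * d q) = 0" if A [measurable]: "A : sets borel" for A n
 proof -
  have "integrable lborel (%q. (cmod (ind (A Int cutoff n) q :: complex))^2)" by (rule integrable_of_le[OF integrable_segment_const[of "- real n" "real n" 1]])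
    (auto simp: indicator_def cutoff_def)
  then have "square_integrable (ind (A Int cutoff n))" unfolding square_integrable_def by simp
  from rep_abs_L2[OF this]
  have ae: "AE q in lborel. cnj (rep_L2 (abs_L2 (ind (A Int cutoff n))) q) * d q = ind (A Int cutoff n) q * d q" by eventually_elim (simp add: indicator_def)
  have "integrable lborel (%q. ind (A Int cutoff n) q * d q)" by (rule integrable_cong_AE_imp[OF int _ ae]) measurable
  moreover have "(LBINT q. ind (A Int cutoff n) q * d q) = 0" unfolding 0[of "abs_L2 (ind (A Int cutoff n))", symmetric]
   by (rule integral_cong_AE) (measurable, rule AE_symmetric[OF ae])
  ultimately show ?thesis by blast
 qed
 have "AE q in lborel. ind (cutoff n) q * d q = 0" for n proof (rule sigma_finite_measure.density_zero[OF lborel.sigma_finite_measure_axioms])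
  show "integrable lborel (%q. ind (cutoff n) q * d q)" using test[of UNIV n] by simp
  fix A :: "real set" assume "A : sets lborel"
  then have "(LBINT q. ind (A Int cutoff n) q * d q) = 0" using test by simp
  then show "set_lebesgue_integral lborel A (%q. ind (cutoff n) q * d q) = 0"
   unfolding set_lebesgue_integral_def by (simp add: indicator_scaleR indicator_inter_arith mult.assoc)
 qed
 then have "AE q in lborel. ALL n. ind (cutoff n) q * d q = 0" unfolding AE_all_countable by blast
 then show ?thesis proof eventually_elim
  case (elim q)
  obtain n where "q : cutoff n" using eventually_happens[OF eventually_in_cut[of q]] by auto
  then show ?case using elim[rule_format, of n] by simp
 qed
qed

text \<open>The weak equation for all test vectors becomes a pointwise one for almost all q,
  separately for each s, by Fubini and \<open>AE_eq_0_of_tests\<close>.\<close>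

lemma generator_translation_iff: "(ph, ps) : generator translation \<longleftrightarrow>
  (ALL s>=0. AE q in lborel. rep_L2 ph (q - s) - rep_L2 ph q = - \<i> * movint s ps q)"
proof -
 have "(ALL om. cin om (translation s *V ph) - cin om ph = - \<i> * (LBINT r. ind {0..s} r * cin om (translation r *V ps))) \<longleftrightarrow>
   (AE q in lborel. rep_L2 ph (q - s) - rep_L2 ph q = - \<i> * movint s ps q)" for s proof -
  define D where "D = translation s *V ph - ph"
  define d where "d q = rep_L2 D q + \<i> * movint s ps q" for q
  have [measurable]: "d : bmeas" unfolding d_def by measurable
  have D: "AE q in lborel. rep_L2 D q = rep_L2 ph (q - s) - rep_L2 ph q"
   unfolding D_def using rep_L2_diff[of "translation s *V ph" ph] rep_translation[of s ph] by eventually_elim simp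
  have d: "integrable lborel (%q. cnj (rep_L2 om q) * d q)" "(LBINT q. cnj (rep_L2 om q) * d q) = cin om (translation s *V ph) - cin om ph +
    \<i> * (LBINT r. ind {0..s} r * cin om (translation r *V ps))" for om proof -
   have eq: "cnj (rep_L2 om q) * d q = cnj (rep_L2 om q) * rep_L2 D q + \<i> * (cnj (rep_L2 om q) * movint s ps q)" for q
    by (simp add: d_def distrib_left mult.left_commute)
   have i: "integrable lborel (%q. cnj (rep_L2 om q) * rep_L2 D q)" by (intro square_integrable_mult square_integrable_rep_L2)
   show "integrable lborel (%q. cnj (rep_L2 om q) * d q)" unfolding eq by (intro Bochner_Integration.integrable_add i integrable_mult_right movint_fubini)
   show "(LBINT q. cnj (rep_L2 om q) * d q) = cin om (translation s *V ph) - cin om ph + \<i> * (LBINT r. ind {0..s} r * cin om (translation r *V ps))"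
    unfolding eq movint_fubini(2)[symmetric] by (subst Bochner_Integration.integral_add[OF i integrable_mult_right[OF movint_fubini(1)]])
     (simp add: cinner_L2_eq[symmetric] D_def cinner_diff_right)
  qed
  have "(ALL om. cin om (translation s *V ph) - cin om ph = - \<i> * (LBINT r. ind {0..s} r * cin om (translation r *V ps)))
    \<longleftrightarrow> (ALL om. (LBINT q. cnj (rep_L2 om q) * d q) = 0)" unfolding d by (simp add: add_eq_0_iff2)
  also have "... \<longleftrightarrow> (AE q in lborel. d q = 0)" proof
   assume "AE q in lborel. d q = 0"
   then have "AE q in lborel. cnj (rep_L2 om q) * d q = 0" for om by eventually_elim simp
   then have "(LBINT q. cnj (rep_L2 om q) * d q) = (\<integral>q. 0 \<partial>(lborel::real measure))" for om by (intro integral_cong_AE) measurable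
   then show "ALL om. (LBINT q. cnj (rep_L2 om q) * d q) = 0" by simp
  qed (rule AE_eq_0_of_tests[OF d(1)], auto)
  also have "... \<longleftrightarrow> (AE q in lborel. rep_L2 ph (q - s) - rep_L2 ph q = - \<i> * movint s ps q)" proof
   assume "AE q in lborel. d q = 0"
   with D show "AE q in lborel. rep_L2 ph (q - s) - rep_L2 ph q = - \<i> * movint s ps q" by eventually_elim (simp add: d_def add_eq_0_iff2)
  next
   assume "AE q in lborel. rep_L2 ph (q - s) - rep_L2 ph q = - \<i> * movint s ps q"
   with D show "AE q in lborel. d q = 0" by eventually_elim (simp add: d_def)
  qed
  finally show ?thesis .
 qed
 then show ?thesis unfolding generator_def by auto
qed

abbreviation (input) "primitive ps q == LBINT t=0..ereal q. rep_L2 ps t"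

lemma primitive_diff: assumes s: "0 <= s" shows "primitive ps q - primitive ps (q - s) = movint s ps q"
proof -
 have int: "set_integrable lborel {a<..<b} (rep_L2 ps)" for a b proof -
  have "set_integrable lborel {a..b} (rep_L2 ps)" using L2_segment_integrable[of a b ps] unfolding set_integrable_def by (simp add: indicator_scaleR)
  then show ?thesis by (rule set_integrable_subset) auto
 qed
 have "interval_lebesgue_integrable lborel (ereal a) (ereal b) (rep_L2 ps)" for a b unfolding interval_lebesgue_integrable_def by (simp add: int)
 \<comment> \<open>\<open>interval_integral_sum\<close> asks for integrability over the hull of the
   three points 0, q - s and q.\<close>
 from this[of "min 0 (min (q - s) q)" "max 0 (max (q - s) q)"]
 have "interval_lebesgue_integrable lborel (min 0 (min (ereal (q - s)) (ereal q))) (max 0 (max (ereal (q - s)) (ereal q))) (rep_L2 ps)"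
  by (simp add: zero_ereal_def del: ereal_min ereal_max flip: ereal_min ereal_max)
 from interval_integral_sum[OF this]
 have "primitive ps q - primitive ps (q - s) = (LBINT t=ereal (q - s)..ereal q. rep_L2 ps t)" by (simp add: algebra_simps)
 also have "... = (LBINT t:{q - s..q}. rep_L2 ps t)" using s by (intro interval_integral_Icc) simp
 also have "... = movint s ps q" unfolding movint_eq set_lebesgue_integral_def by (intro Bochner_Integration.integral_cong) (auto simp: indicator_def)
 finally show ?thesis .
qed

lemma primitive_measurable [measurable]: "(%q. primitive ps q) : bmeas"
proof -
 have "primitive ps q = (if 0 <= q then movint q ps q else - movint (- q) ps 0)" for q
  using primitive_diff[where s = q and q = q] primitive_diff[where s = "- q" and q = 0]
  by (auto simp: zero_ereal_def interval_lebesgue_integral_def set_lebesgue_integral_def)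
 moreover have "(%q. if 0 <= q then movint q ps q else - movint (- q) ps 0) : bmeas" unfolding movint_def indicator_def atLeastAtMost_iff by measurable
 ultimately show ?thesis by simp
qed

text \<open>For h = ph - i * primitive of ps, membership in the momentum operator says that h is
  almost everywhere constant, membership in the generator that each translate of h equals h almost
  everywhere.\<close>

lemma momentum_op_eq: "momentum_op = generator translation"
proof (intro set_eqI, clarify)
 fix ph ps
 define h where "h q = rep_L2 ph q - \<i> * primitive ps q" for q
 have [measurable]: "h : bmeas" unfolding h_def by measurable
 have eq: "rep_L2 ph (q - s) - rep_L2 ph q = - \<i> * movint s ps q \<longleftrightarrow> h (q - s) = h q" if "0 <= s" for s q
  unfolding primitive_diff[OF that, symmetric] h_def by (auto simp: algebra_simps)
 have "(ph, ps) : generator translation \<longleftrightarrow> (ALL s>=0. AE q in lborel. h (q - s) = h q)" unfolding generator_translation_iff using eq by auto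
 also have "... \<longleftrightarrow> (EX c. AE q in lborel. h q = c)" proof
  assume "EX c. AE q in lborel. h q = c"
  then obtain c where c: "AE q in lborel. h q = c" by blast
  show "ALL s>=0. AE q in lborel. h (q - s) = h q" proof (intro allI impI)
   fix s
   from c AE_shift[OF c, of s] show "AE q in lborel. h (q - s) = h q" by eventually_elim simp
  qed
 next
  assume h: "ALL s>=0. AE q in lborel. h (q - s) = h q"
  have "AE q in lborel. h (q + s) = h q" for s proof (cases "0 <= s")
   case True
   then have "AE q in lborel. h (q - s) = h q" using h by blast
   from AE_shift[OF this, of "- s"] show ?thesis by eventually_elim simp
  next
   case False
   then have "AE q in lborel. h (q - (- s)) = h q" using h by (simp del: diff_minus_eq_add)
   then show ?thesis by simp
  qed
  \<comment> \<open>The exceptional set of q depends on s. Fubini exchanges the quantifiers and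
    yields one q with h (q + s) = h q for almost all s, so h q is the constant.\<close>
  then have "AE s in lborel. AE q in lborel. h (q + s) = h q" by simp
  then have "AE q in lborel. AE s in lborel. h (q + s) = h q" by (subst (asm) lborel_pair.AE_commute) measurable
  moreover have "ae_filter (lborel::real measure) ~= bot" by (simp add: ae_filter_eq_bot_iff)
  ultimately have "EX q. AE s in lborel. h (q + s) = h q" by (rule eventually_happens'[rotated])
  then obtain q where "AE s in lborel. h (q + s) = h q" by blast
  from AE_shift[OF this, of q] show "EX c. AE q in lborel. h q = c" by auto
 qed
 also have "... \<longleftrightarrow> (ph, ps) : momentum_op" unfolding momentum_op_def mem_Collect_eq prod.case h_def by (simp add: diff_eq_eq add.commute)
 finally show "(ph, ps) : momentum_op \<longleftrightarrow> (ph, ps) : generator translation" by blast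
qed

lemma movint_continuous: "contn (movint s ps)" unfolding continuous_on_sequentially
proof (intro allI ballI impI, elim conjE)
 fix q and x :: "nat => real" assume x: "x ----> q"
 then obtain R where R: "!!n. (abs (x n)) <= R" using convergent_imp_Bseq[of x] unfolding convergent_def Bseq_def by auto
 let ?w = "%t. cmod (ind {- R - (abs s)..R} t * rep_L2 ps t)"
 have "(%n. \<integral>t. ind {x n - s..x n} t * rep_L2 ps t \<partial>lborel) ----> (LBINT t. ind {q - s..q} t * rep_L2 ps t)"
 proof (rule integral_dominated_convergence[where w = ?w])
  show "integrable lborel ?w" by (intro integrable_norm L2_segment_integrable)
  show "AE t in lborel. (%n. ind {x n - s..x n} t * rep_L2 ps t) ----> ind {q - s..q} t * rep_L2 ps t"
   using AE_lborel_singleton[of "q - s"] AE_lborel_singleton[of q] proof eventually_elim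
   case (elim t)
   have "\<forall>\<^sub>F n in sequentially. (x n - s <= t \<longleftrightarrow> q - s <= t) & (t <= x n \<longleftrightarrow> t <= q)"
   proof (intro eventually_conj)
    show "\<forall>\<^sub>F n in sequentially. x n - s <= t \<longleftrightarrow> q - s <= t"
     using order_tendstoD[OF tendsto_diff[OF x tendsto_const[of s]], of t] elim by (cases "q - s < t") (auto elim!: eventually_mono)
    show "\<forall>\<^sub>F n in sequentially. t <= x n \<longleftrightarrow> t <= q" using order_tendstoD[OF x, of t] elim
     by (cases "q < t") (auto elim!: eventually_mono)
   qed
   then have "\<forall>\<^sub>F n in sequentially. ind {x n - s..x n} t * rep_L2 ps t = ind {q - s..q} t * rep_L2 ps t"
    by eventually_elim (simp add: indicator_def)
   then show ?case by (rule tendsto_eventually)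
  qed
  show "AE t in lborel. norm (ind {x n - s..x n} t * rep_L2 ps t) <= ?w t" for n using R[of n] by (intro AE_I2) (auto simp: indicator_def norm_mult abs_le_iff)
 qed measurable
 then show "(movint s ps o x) ----> movint s ps q" by (simp add: movint_eq o_def)
qed

lemma sets_borel_atMost: "sets (borel::real measure) = sigma_sets UNIV (range atMost)" by (subst borel_eq_atMost) simp

lemma Int_stable_atMost: "Int_stable (range atMost :: real set set)" by (auto simp: Int_stable_def)

text \<open>All integrals of w over intervals vanish, hence by a Dynkin argument over half lines
  those over bounded Borel sets, and w is 0. This is the hypothesis \<open>single\<close> of
  \<open>self_adjoint_generator\<close>.\<close>

lemma generator_translation_single: assumes g: "(0, w) : generator translation" shows "w = 0"
proof -
 have seg: "(LBINT t. ind {a..b} t * rep_L2 w t) = 0" for a b proof (cases "a <= b")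
  case True
  have z: "AE q in lborel. rep_L2 0 q = 0" using rep_L2_diff[of 0 0] by simp
  have "AE q in lborel. rep_L2 0 (q - (b - a)) - rep_L2 0 q = - \<i> * movint (b - a) w q" using g True unfolding generator_translation_iff by simp
  then have "AE q in lborel. movint (b - a) w q = 0" using z AE_shift[OF z, of "b - a"] by eventually_elim simp
  \<comment> \<open>The integral is continuous in q, so its zero set is closed; being of full
    measure, it is the whole line and contains the endpoint b.\<close>
  then have "AE q in lebesgue. q : {q. movint (b - a) w q = 0}" by (simp add: AE_completion)
  then have "b : {q. movint (b - a) w q = 0}" by (intro mem_closed_if_AE_lebesgue closed_Collect_eq movint_continuous continuous_on_const) auto
  then show ?thesis by (simp add: movint_eq)
 qed simp
 have "AE t in lborel. ind (cutoff n) t * rep_L2 w t = 0" for n proof (rule sigma_finite_measure.density_zero[OF lborel.sigma_finite_measure_axioms])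
  let ?f = "%t. ind (cutoff n) t * rep_L2 w t"
  have f: "integrable lborel ?f" using L2_segment_integrable[of "- real n" "real n" w] by (simp add: cutoff_def)
  then show "integrable lborel ?f" .
  have sf: "set_integrable lborel A ?f" if "A : sets borel" for A unfolding set_integrable_def using that by (intro integrable_mult_indicator f) simp
  have UN: "(LBINT t. ?f t) = 0" using seg[of "- real n" "real n"] by (simp add: cutoff_def)
  fix A :: "real set" assume "A : sets lborel"
  then have A: "A : sigma_sets UNIV (range atMost)" by (simp add: sets_borel_atMost)
  have P: "range atMost <= Pow (UNIV::real set)" by simp
  from Int_stable_atMost P A show "set_lebesgue_integral lborel A ?f = 0" proof (induction rule: sigma_sets_induct_disjoint)
   case (basic A)
   then obtain x where x: "A = {..x}" by auto
   have "(%t. ind A t *\<^sub>R ?f t) = (%t. ind {- real n..min x (real n)} t * rep_L2 w t)" by (auto simp: x indicator_def cutoff_def fun_eq_iff)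
   then show ?case unfolding set_lebesgue_integral_def by (simp only: seg)
  next
   case (compl A)
   then have "A : sets borel" by (simp add: sets_borel_atMost)
   then have "(LINT t:UNIV|lborel. ?f t) = (LINT t:A|lborel. ?f t) + (LINT t:UNIV - A|lborel. ?f t)"
    using set_integral_Un[of A "UNIV - A" lborel ?f] sf[of A] sf[of "UNIV - A"] by (simp add: Un_absorb1)
   then show ?case using compl UN by (simp add: set_lebesgue_integral_def)
  next
   case (union A)
   then have "A i : sets borel" for i by (auto simp: sets_borel_atMost)
   then have "(LINT t:(UN i. A i)|lborel. ?f t) = (\<Sum>i. (LINT t:(A i)|lborel. ?f t))"
    using union(1) by (intro lebesgue_integral_countable_add sf) (auto simp: disjoint_family_on_def)
   then show ?case using union by simp
  qed (auto simp: set_lebesgue_integral_def)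
 qed
 then have "AE t in lborel. ALL n. ind (cutoff n) t * rep_L2 w t = 0" unfolding AE_all_countable by blast
 then have "AE t in lborel. rep_L2 w t = rep_L2 0 t" using rep_L2_diff[of 0 0] proof eventually_elim
  case (elim q)
  obtain n where "q : cutoff n" using eventually_happens[OF eventually_in_cut[of q]] by auto
  then show ?case using elim by (auto dest: spec[of _ n])
 qed
 then show ?thesis by (rule L2_eqI)
qed

lemma momentum_spectral: "EX N. pvm N & momentum_op = sgraph N & (ALL s. ugroup N (- s) = translation s)"
proof -
 obtain N where N: "pvm N" "generator translation = sgraph N"
  using spectral_theorem[OF self_adjoint_generator[OF unitary_rep_translation generator_translation_single]] by blast
 then show ?thesis using unitary_rep_eq_unitary_group[OF unitary_rep_translation N] momentum_op_eq by auto
qed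

section \<open>The measuring unitary\<close>

definition coupling :: "('a::chilbert_space => 'b::chilbert_space => 'g::chilbert_space) => (real set => 'a bop) => (real set => 'b bop) => 'g bop" where
 "coupling tens E F = SI (tensor_pvm tens E F) (%z. exp (- \<i> * cor (fst z * snd z)))"

lemma bborel_exp_prod: assumes [measurable]: "f : bmeas" shows "bborel (%z::real * real. exp (- \<i> * cor (fst z * f (snd z))))"
proof (rule bborelI[of _ 1])
 have "(%t. exp (- \<i> * cor t)) : bmeas" by (intro continuous_borel continuous_intros)
 moreover have "(%z::real * real. fst z * f (snd z)) : bmeas" by measurable
 ultimately show "(%z::real * real. exp (- \<i> * cor (fst z * f (snd z)))) : bmeas" using measurable_compose by blast
qed simp

context
 fixes tens :: "'a::chilbert_space => 'b::chilbert_space => 'g::chilbert_space" and E :: "real set => 'a bop" and F :: "real set => 'b bop"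
 assumes T: "hilbert_tensor tens" and E: "pvm E" and F: "pvm F"
begin

lemma coupling_unitary: "adj (coupling tens E F) * coupling tens E F = 1" "coupling tens E F * adj (coupling tens E F) = 1"
proof -
 note G = tensor_pvm[OF T E F]
 have b: "bborel (%z::real * real. exp (- \<i> * cor (fst z * snd z)))" using bborel_exp_prod[of "%x. x"] by simp
 have e: "cnj (exp (- \<i> * cor t)) * exp (- \<i> * cor t) = 1" for t by (simp add: exp_cnj flip: exp_add)
 show "adj (coupling tens E F) * coupling tens E F = 1" "coupling tens E F * adj (coupling tens E F) = 1" unfolding coupling_def SI_adj[OF G b]
   SI_mult[OF G bborel_cnj[OF b] b, symmetric] SI_mult[OF G b bborel_cnj[OF b], symmetric] by (simp_all only: e mult.commute[of "exp _" "cnj _"] SI_one[OF G])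
qed

text \<open>The kernel is symmetric in its variables, so \<open>coupling_conj\<close> may be used
  with the roles of X and P exchanged; this computes the shifted pointer.\<close>

lemma coupling_swap: "coupling (%y x. tens x y) F E = coupling tens E F"
proof -
 let ?G = "tensor_pvm tens E F" and ?H = "tensor_pvm (%y x. tens x y) F E"
 note G = tensor_pvm[OF T E F] and H = tensor_pvm[OF tensor_flip[OF T] F E]
 have sw: "(prod.swap :: real * real => real * real) : bmeas" by (intro continuous_borel) (simp add: continuous_on_swap)
 have "push_pvm prod.swap ?G = ?H" proof (rule pvm_eqI_rectangles[OF pvm_push[OF G sw] H])
  fix A B :: "real set" assume AB: "A : sets borel" "B : sets borel"
  have "prod.swap -` (A \<times> B) = B \<times> A" by auto
  then show "push_pvm prod.swap ?G (A \<times> B) = ?H (A \<times> B)" using AB by (simp add: push_pvm_apply Times_borel tensor_pvm_Times[OF T E F]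
    tensor_pvm_Times[OF tensor_flip[OF T] F E] tensor_op_flip[OF T])
 qed
 moreover have "bborel (%z::real * real. exp (- \<i> * cor (fst z * snd z)))" using bborel_exp_prod[of "%x. x"] by simp
 ultimately show ?thesis unfolding coupling_def using SI_push[OF G sw] by (simp add: mult.commute)
qed

text \<open>Approximating the second variable by simple functions turns \<open>U\<close> into finite sums
  \<open>\<Sum>\<^sub>c e\<^sup>-\<^sup>i\<^sup>c\<^sup>X \<otimes> F\<^sub>c\<close>.\<close>

lemma coupling_conj: "cin (coupling tens E F *V tens w ph) (tensor_op tens A 1 *V coupling tens E F *V tens v ph) = (LINT p|sdist F ph. conj_form E A w v p)"
proof -
 let ?G = "tensor_pvm tens E F" and ?\<nu> = "sdist F ph"
 note G = tensor_pvm[OF T E F]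
 interpret finite_measure ?\<nu> by (rule finite_measure_sdist[OF F])
 obtain s :: "nat => real => real" where s: "!!n. simple_function borel (s n)" and lim: "!!p. (%n. s n p) ----> p"
  using borel_measurable_implies_sequence_metric[of "%p::real. p" borel 0] by auto
 have sm [measurable]: "s n : bmeas" for n by (rule borel_measurable_simple_function[OF s])
 define U where "U n = SI ?G (%z. exp (- \<i> * cor (fst z * s n (snd z))))" for n
 have Ulim: "(%n. U n *V x) ----> coupling tens E F *V x" for x unfolding U_def coupling_def by (rule SI_strong_limit[OF G bborel_exp_prod[OF sm], where K = 1])
   (auto intro!: tendsto_intros lim)
 have Us: "cin (U n *V tens w ph) (tensor_op tens A 1 *V U n *V tens v ph) = (\<integral>p. conj_form E A w v (s n p) \<partial>?\<nu>)" for n proof -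
  define S where "S = range (s n)"
  define B where "B c = s n -` {c}" for c
  have S: "finite S" using s[of n] unfolding simple_function_def S_def by simp
  have B: "B c : sets borel" for c using measurable_sets[OF sm[of n], of "{c}"] by (simp add: B_def)
  have ind: "f (s n p) = (SUM c:S. f c * ind (B c) p)" for f :: "real => complex" and p proof -
   have "(SUM c:S. f c * ind (B c) p) = (SUM c:S. if c = s n p then f c else 0)" by (intro sum.cong) (auto simp: B_def indicator_def)
   then show ?thesis using S by (simp add: S_def)
  qed
  have "U n = (SUM c:S. tensor_op tens (ugroup E (- c)) (F (B c)))" proof -
   have eq: "exp (- \<i> * cor (x * s n p)) = (SUM c:S. exp (\<i> * cor (- c * x)) * ind (B c) p)" for x p
    by (subst ind[of "%c. exp (\<i> * cor (- c * x))", symmetric]) (simp add: mult.commute)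
   have b1: "bborel (%z. exp (\<i> * cor (- c * fst z)) * ind (B c) (snd z))" for c
    by (intro bborel_mult bborel_comp[OF bborel_exp] bborel_comp[OF bborel_indicator[OF B]] fst_snd_borel)
   have "SI ?G (%z. exp (\<i> * cor (- c * fst z)) * ind (B c) (snd z)) = tensor_op tens (ugroup E (- c)) (F (B c))" for c
    unfolding SI_tensor_pvm[OF T E F bborel_exp bborel_indicator[OF B]] by (simp only: ugroup_def SI_indicator[OF F B])
   then show ?thesis unfolding U_def eq using SI_sum[OF G, of S, OF b1] by simp
  qed
  then have Ux: "U n *V tens x ph = (SUM c:S. tens (ugroup E (- c) *V x) (F (B c) *V ph))" for x by (simp add: sum_bop_apply tensor_op_apply[OF T])
  \<comment> \<open>The level sets of a simple function are disjoint, so the double sum over its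
    values reduces to the diagonal.\<close>
  have orth: "cin (F (B c) *V ph) (F (B d) *V ph) = (if c = d then of_real (measure ?\<nu> (B c)) else 0)" for c d proof (cases "c = d")
   case True
   then show ?thesis by (simp add: cinner_self measure_sdist[OF F B] del: of_real_power)
  next
   case False
   then have "F (B c) * F (B d) = 0" by (intro pvm_disjoint[OF F B B]) (auto simp: B_def)
   then have "F (B c) *V F (B d) *V ph = 0" by (metis times_bop_apply zero_bop_apply)
   then show ?thesis using False cinner_adj_right[of ph "F (B c)" "F (B d) *V ph"] by (simp add: pvm_adj[OF F B])
  qed
  have "cin (U n *V tens w ph) (tensor_op tens A 1 *V U n *V tens v ph) =
    (SUM c:S. SUM d:S. cin (ugroup E (- d) *V w) (A *V ugroup E (- c) *V v) * (if d = c then of_real (measure ?\<nu> (B d)) else 0))"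
   unfolding Ux by (simp add: apply_sum tensor_op_apply[OF T] cinner_sum_left cinner_sum_right cinner_tens[OF T] orth)
  also have "... = (SUM c:S. conj_form E A w v c * of_real (measure ?\<nu> (B c)))" using S by (simp add: conj_form_def if_distrib sum.delta cong: if_cong)
  also have "... = (SUM c:S. \<integral>p. conj_form E A w v c * ind (B c) p \<partial>?\<nu>)"
   using B by (simp add: integral_indicator_complex[OF finite_measure_sdist[OF F]] sets_sdist[OF F])
  also have "... = (\<integral>p. (SUM c:S. conj_form E A w v c * ind (B c) p) \<partial>?\<nu>)"
   by (intro Bochner_Integration.integral_sum[symmetric] integrable_mult_right bborel_integrable[OF F] bborel_indicator B)
  finally show ?thesis by (simp only: ind[symmetric])
 qed
 have cf: "conj_form E A w v : bmeas" by (intro continuous_borel conj_form_continuous[OF E])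
 have "(%n. \<integral>p. conj_form E A w v (s n p) \<partial>?\<nu>) ----> (\<integral>p. conj_form E A w v p \<partial>?\<nu>)"
 proof (rule bborel_tendsto_integral[OF F])
  show "cmod (conj_form E A w v (s i p)) <= norm A * norm w * norm v" for i p by (rule conj_form_bound[OF E])
  show "bborel (conj_form E A w v)" by (rule bborelI[OF cf conj_form_bound[OF E]])
  then show "bborel (%p. conj_form E A w v (s i p))" for i by (rule bborel_comp) (rule sm)
  show "(%i. conj_form E A w v (s i p)) ----> conj_form E A w v p" for p using continuous_on_tendsto_compose[OF conj_form_continuous[OF E] lim] by auto
 qed
 moreover have "(%n. cin (U n *V tens w ph) (tensor_op tens A 1 *V U n *V tens v ph)) ---->
   cin (coupling tens E F *V tens w ph) (tensor_op tens A 1 *V coupling tens E F *V tens v ph)" by (intro tendsto_cinner tendsto_apply_bop Ulim)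
 ultimately show ?thesis using LIMSEQ_unique by (simp add: Us)
qed

end

context
 fixes tens :: "'a::chilbert_space => L2 => 'g::chilbert_space" and E :: "real set => 'a bop" and N :: "real set => L2 bop"
 assumes T: "hilbert_tensor tens" and E: "pvm E" and N: "pvm N" and mom: "momentum_op = sgraph N" and trans: "!!s. ugroup N (- s) = translation s"
begin

lemma measuring_unitary_eq: "measuring_unitary tens (sgraph E) = coupling tens E N"
proof -
 have m: "(%z::real * real. fst z * snd z) : bmeas" by measurable
 have b: "bborel (%t. exp (- \<i> * cor t))" using bborel_exp[of "-1"] by simp
 show ?thesis unfolding measuring_unitary_def mom tensor_graph_sgraph[OF T E N] coupling_def unfolding fun_calc_sgraph[OF pvm_push[OF tensor_pvm[OF T E N] m]]
  by (rule SI_push[OF tensor_pvm[OF T E N] m b])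
qed

text \<open>\<open>U\<^sup>* (1 \<otimes> g(Q)) U = g(X \<otimes> 1 + 1 \<otimes> Q)\<close>\<close>

lemma coupling_position: assumes g: "bborel g" shows "adj (coupling tens E N) * tensor_op tens 1 (SI Qpvm g) * coupling tens E N =
  SI (tensor_pvm tens E Qpvm) (%z. g (snd z + fst z))"
proof (rule bop_eqI_tens_diag[OF T])
 fix v ph
 let ?U = "coupling tens E N"
 have g': "bborel (%z::real * real. g (snd z + fst z))" by (rule bborel_comp[OF g]) measurable
 \<comment> \<open>With the factors exchanged the coupling is, for each spectral value s of X, the
   translation by s in the pointer space.\<close>
 have "cin (?U *V tens v ph) (tensor_op tens 1 (SI Qpvm g) *V ?U *V tens v ph) = (LINT s|sdist E v. conj_form N (SI Qpvm g) ph ph s)"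
  using coupling_conj[OF tensor_flip[OF T] N E, where w = ph and ph = v and A = "SI Qpvm g" and v = ph]
  by (simp add: coupling_swap[OF T E N] tensor_op_flip[OF T])
 also have "... = (\<integral>s. \<integral>q. g (q + s) \<partial>sdist Qpvm ph \<partial>sdist E v)" by (simp add: conj_form_def trans translation_conj[OF g])
 also have "... = cin (tens v ph) (SI (tensor_pvm tens E Qpvm) (%z. g (snd z + fst z)) *V tens v ph)" by (simp add: tensor_pvm_diag[OF T E Qpvm g'])
 finally show "cin (tens v ph) ((adj ?U * tensor_op tens 1 (SI Qpvm g) * ?U) *V tens v ph) =
   cin (tens v ph) (SI (tensor_pvm tens E Qpvm) (%z. g (snd z + fst z)) *V tens v ph)" by (simp add: cinner_adj_right)
qed

text \<open>The factor ta(Q) confines Q to the region where g(X + Q) and g(X) differ by at most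
  \<open>ep\<close>. Commuting spectral calculus turns this pointwise estimate into an operator norm
  estimate, the only kind the Dirac state respects.\<close>

lemma coupling_position_approx: assumes g: "bborel g" and ta: "bborel ta" and ep: "0 <= ep" "!!s q. cmod (ta q * (g (q + s) - g s)) <= ep"
 shows "norm (tensor_op tens 1 (SI Qpvm ta) * (adj (coupling tens E N) * tensor_op tens 1 (SI Qpvm g) * coupling tens E N -
   tensor_op tens (SI E g) 1)) <= ep"
proof -
 let ?G = "tensor_pvm tens E Qpvm"
 note G = tensor_pvm[OF T E Qpvm] and IG = SI_tensor_pvm[OF T E Qpvm]
 have b: "bborel (%z::real * real. g (snd z + fst z))" "bborel (%z::real * real. g (fst z))" "bborel (%z::real * real. ta (snd z))"
  by (rule bborel_comp[OF g] bborel_comp[OF ta], measurable)+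
 have 1: "tensor_op tens 1 (SI Qpvm ta) = SI ?G (%z. ta (snd z))" using IG[OF bborel_const[of 1] ta] by (simp add: SI_one[OF E])
 have 2: "tensor_op tens (SI E g) 1 = SI ?G (%z. g (fst z))" using IG[OF g bborel_const[of 1]] by (simp add: SI_one[OF Qpvm])
 have "tensor_op tens 1 (SI Qpvm ta) * (adj (coupling tens E N) * tensor_op tens 1 (SI Qpvm g) * coupling tens E N -
   tensor_op tens (SI E g) 1) = SI ?G (%z. ta (snd z) * (g (snd z + fst z) - g (fst z)))" unfolding coupling_position[OF g] 1 2
  by (simp only: SI_mult[OF G b(3) bborel_diff[OF b(1,2)]] SI_diff[OF G b(1,2)])
 then show ?thesis using norm_SI_le[OF G bborel_mult[OF b(3) bborel_diff[OF b(1,2)]] _ ep(1)] ep(2) by simp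
qed

end

section \<open>Dirac states\<close>

lemma positive_op_adj_mult: "positive_op (adj C * C)"
 unfolding positive_op_def by (simp add: cinner_adj_right cinner_self complex_nonneg_Reals_iff del: of_real_power)

context
 fixes de :: "'b::chilbert_space bop => complex" assumes de: "state de"
begin

lemma state_add: "de (A + B) = de A + de B" and state_scaleC: "de (c *C A) = c * de A"
 and state_positive: "positive_op A ==> de A : \<real>\<^sub>\<ge>\<^sub>0" using de unfolding state_def clinear_def scaleC_complex_def by blast+

lemma state_diff: "de (A - B) = de A - de B" using state_add[of "A - B" B] by simp

lemma state_bound: "cmod (de A) <= norm A" using onorm[of de A] de unfolding state_def by simp

text \<open>Cauchy--Schwarz for a null vector: \<open>\<langle>(t A + B)\<^sup>* (t A + B), de\<rangle> \<ge> 0\<close> is affine in \<open>t\<close>.\<close>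

lemma state_null: assumes A: "de (adj A * A) = 0" shows "de (adj A * B) = 0"
proof -
 have expand: "de (adj (t *C A + B) * (t *C A + B)) = cnj t * de (adj A * B) + t * de (adj B * A) + de (adj B * B)" for t
  by (simp add: adj_add adj_scaleC bop_distrib state_add state_scaleC A)
 have pos: "0 <= Re (cnj t * de (adj A * B) + t * de (adj B * A)) + Re (de (adj B * B))" and im: "Im (cnj t * de (adj A * B) + t * de (adj B * A)) = 0" for t
  using state_positive[OF positive_op_adj_mult, of "t *C A + B"] state_positive[OF positive_op_adj_mult, of B]
  unfolding expand by (auto simp: complex_nonneg_Reals_iff)
 have eq: "de (adj B * A) = cnj (de (adj A * B))" using im[of 1] im[of \<i>] by (simp add: complex_eq_iff)
 define z where "z = de (adj A * B)"
 have nn: "0 <= 2 * Re (cnj t * z) + Re (de (adj B * B))" for t using pos[of t] unfolding eq z_def[symmetric] by simp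
 \<comment> \<open>The choice t = - r z makes the linear term - 2 r |z|^2, which becomes arbitrarily
   negative unless z = 0.\<close>
 have le: "0 <= - 2 * r * (cmod z)^2 + Re (de (adj B * B))" for r
  using nn[of "- of_real r * z"] unfolding cmod_power2 by (simp add: power2_eq_square algebra_simps)
 have "(cmod z)^2 = 0" proof (rule ccontr)
  assume "(cmod z)^2 ~= 0"
  then show False using le[of "((abs (Re (de (adj B * B)))) + 1) / (cmod z)^2"] by auto
 qed
 then show ?thesis by (simp add: z_def)
qed

end

context
 fixes tens :: "'a::chilbert_space => L2 => 'g::chilbert_space" and E :: "real set => 'a bop" and N :: "real set => L2 bop"
  and et :: "(real => complex) => complex" and de :: "L2 bop => complex" and rh :: "'a bop" and v :: "'a => 'a"
 assumes T: "hilbert_tensor tens" and E: "pvm E" and N: "pvm N" and mom: "momentum_op = sgraph N" and trans: "!!s. ugroup N (- s) = translation s"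
  and et: "mean et" and de: "dirac_state et de" and v: "represents onb v rh" and rh: "Tr rh = 1"
begin

lemma dirac_is_state: "state de" and dirac_position: "f : bcontfun ==> de (SI Qpvm f) = f 0" and dirac_momentum: "f : bcontfun ==> de (SI N f) = et f"
 using de unfolding dirac_state_def position_op_eq mom fun_calc_sgraph[OF Qpvm]
  fun_calc_sgraph[OF N] by blast+

lemma bcontfun_bborel: "f : bcontfun ==> bborel (f :: real => complex)" using bcontfun_bound[of f] bcontfun_continuous[of f] continuous_borel bborelI by blast

text \<open>By (D1) the state vanishes at the square of 1 - ta(Q), because 1 - ta is 0 at the
  origin; so \<open>state_null\<close> removes 1 - ta(Q) as a left factor.\<close>

lemma dirac_cut: assumes ta: "contn ta" "!!q. (abs (ta q)) <= 1" "ta 0 = 1" shows "de (SI Qpvm (%q. cor (ta q)) * S) = de S"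
proof -
 let ?I = "SI Qpvm"
 define f where "f q = 1 - cor (ta q)" for q
 have c: "contn f" "contn (%q. cor (ta q))" unfolding f_def by (intro continuous_intros ta(1))+
 have fb: "cmod (f q) <= 2" for q using norm_triangle_ineq4[of 1 "cor (ta q)"] ta(2)[of q] by (simp add: f_def)
 have bf: "bborel f" and bta: "bborel (%q. cor (ta q))" using ta(2) by (auto intro!: bcontfun_bborel bcontfunI[OF c(1) fb] bcontfunI[OF c(2), of 1])
 have "(%q. cnj (f q)) = f" by (rule ext) (simp add: f_def)
 then have "adj (?I f) = ?I f" unfolding SI_adj[OF Qpvm bf] by simp
 moreover have "cmod (f q * f q) <= 2 * 2" for q unfolding norm_mult using fb by (intro mult_mono) auto
 then have "de (?I (%q. f q * f q)) = f 0 * f 0" by (intro dirac_position bcontfunI[of _ "2 * 2"] continuous_intros c)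
 ultimately have "de (adj (?I f) * ?I f) = 0" using ta(3) by (simp add: SI_mult[OF Qpvm bf bf] f_def[of 0])
 then have "de (?I f * S) = 0" using state_null[OF dirac_is_state, of "?I f" S] `adj (?I f) = ?I f` by simp
 moreover have "?I f = 1 - ?I (%q. cor (ta q))" unfolding f_def[abs_def] by (simp add: SI_diff[OF Qpvm bborel_const bta] SI_one[OF Qpvm])
 ultimately show ?thesis by (simp add: bop_distrib state_diff[OF dirac_is_state])
qed

abbreviation (input) "Ph == slice_map tens rh"
abbreviation (input) "\<U> == coupling tens E N"

lemma norm_isometry_le:  assumes "adj U * U = 1" shows "norm (U :: 'g bop) <= 1"
proof (rule norm_bop_le)
 fix x
 have "cin (U *V x) (U *V x) = cin x x" using cinner_adj_right[of x U "U *V x"] assms by (metis times_bop_apply one_bop_apply)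
 then show "norm (U *V x) <= 1 * norm x" using Re_cinner_self[of "U *V x"] Re_cinner_self[of x] by (simp add: power2_eq_iff_nonneg)
qed simp

lemma dirac_slice_position: assumes g: "uniformly_continuous_on UNIV g" "!!s. cmod (g s) <= K"
 shows "de (Ph (adj \<U> * tensor_op tens 1 (SI Qpvm g) * \<U> * S)) = de (Ph (tensor_op tens (SI E g) 1 * S))"
proof -
 let ?R = "adj \<U> * tensor_op tens 1 (SI Qpvm g) * \<U>" and ?g = "tensor_op tens (SI E g) 1"
 have bg: "bborel g" by (intro bcontfun_bborel bcontfunI[OF uniformly_continuous_imp_continuous[OF g(1)] g(2)])
 have le: "cmod (de (Ph ((?R - ?g) * S))) <= ep * norm S" if ep: "0 < ep" for ep proof -
  obtain r where r: "0 < r" "!!s t. dist s t < r ==> dist (g s) (g t) < ep" using g(1) ep unfolding uniformly_continuous_on_def by (metis UNIV_I)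
  \<comment> \<open>A tent with value 1 at 0 and zero for |q| >= r, where r is the modulus of
    uniform continuity for \<open>ep\<close>.\<close>
  define ta where "ta q = max 0 (1 - (abs q) / r)" for q
  have ta: "contn ta" "(abs (ta q)) <= 1" "ta 0 = 1" for q unfolding ta_def using r(1) by (auto intro!: continuous_intros)
  have bta: "bborel (%q. cor (ta q))" by (intro bcontfun_bborel bcontfunI[of _ 1] continuous_intros ta(1)) (use ta(2) in simp)
  have "cmod (cor (ta q) * (g (q + s) - g s)) <= ep" for s q proof (cases "(abs q) < r")
   case True
   then have "cmod (g (q + s) - g s) <= ep" using r(2)[of "q + s" s] by (simp add: dist_norm)
   then show ?thesis using mult_mono[OF ta(2)[of q], of "cmod (g (q + s) - g s)" ep] by (simp add: norm_mult)
  next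
   case False
   then have "ta q = 0" using r(1) by (simp add: ta_def)
   then show ?thesis using ep by simp
  qed
  then have n: "norm (tensor_op tens 1 (SI Qpvm (%q. cor (ta q))) * (?R - ?g)) <= ep"
   using ep by (intro coupling_position_approx[OF T E N mom trans bg bta]) auto
  have "de (Ph ((?R - ?g) * S)) = de (SI Qpvm (%q. cor (ta q)) * Ph ((?R - ?g) * S))" by (rule dirac_cut[OF ta, symmetric])
  also have "... = de (Ph (tensor_op tens 1 (SI Qpvm (%q. cor (ta q))) * (?R - ?g) * S))" by (simp add: slice_map_left[OF T v] mult.assoc)
  also have "cmod ... <= norm (tensor_op tens 1 (SI Qpvm (%q. cor (ta q))) * (?R - ?g) * S)"
   by (rule order_trans[OF state_bound[OF dirac_is_state] norm_slice_map_le[OF T v rh]])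
  also have "... <= ep * norm S" by (rule order_trans[OF norm_bop_mult_le mult_right_mono[OF n]]) simp
  finally show ?thesis .
 qed
 have "de (Ph ((?R - ?g) * S)) = 0" proof (rule ccontr)
  assume "de (Ph ((?R - ?g) * S)) ~= 0"
  then have p: "0 < cmod (de (Ph ((?R - ?g) * S)))" by simp
  \<comment> \<open>\<open>le\<close> is used with ep = |value| / (2 (|S| + 1)), which bounds the
    value by half of itself.\<close>
  have "cmod (de (Ph ((?R - ?g) * S))) <= cmod (de (Ph ((?R - ?g) * S))) / (2 * (norm S + 1)) * norm S" by (rule le) (use p in "simp add: add_nonneg_pos")
  also have "... <= cmod (de (Ph ((?R - ?g) * S))) / (2 * (norm S + 1)) * (norm S + 1)" by (intro mult_left_mono) (simp_all add: add_nonneg_nonneg)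
  also have "... = cmod (de (Ph ((?R - ?g) * S))) / 2" by (simp add: field_simps add_nonneg_eq_0_iff)
  finally show False using p by simp
 qed
 then show ?thesis by (simp add: bop_distrib slice_map_diff[OF T v] state_diff[OF dirac_is_state])
qed

lemma dirac_slice_momentum: "de (Ph (tensor_op tens S 1 * (adj \<U> * tensor_op tens H 1 * \<U>))) = Tr (S * mean_projection et (sgraph E) H * rh)"
proof -
 define F where "F = (%u. \<Sum>\<^sub>\<infinity>i\<in>onb. conj_form E H (adj S *V v i) (v i) u)"
 note TrF = Tr_mean_projection[OF et E v, where A = H and S = S, folded F_def]
 let ?O = "tensor_op tens S 1 * (adj \<U> * tensor_op tens H 1 * \<U>)"
 have vs: "(%i. (norm (v i))^2) summable_on onb" using v unfolding represents_def by blast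
 \<comment> \<open>The slice is exactly the function F of the momentum, so (D2) applies without any
   limit under the state. The vector 0 is separate because its distribution cannot be normalized to
   a mean.\<close>
 have "Ph ?O = SI N F" proof (rule SI_eqI[OF N, symmetric])
  fix ph
  let ?\<nu> = "sdist N ph"
  have "cin (tens (v i) ph) (?O *V tens (v i) ph) = (\<integral>p. conj_form E H (adj S *V v i) (v i) p \<partial>?\<nu>)" for i proof -
   have "cin (tens (v i) ph) (?O *V tens (v i) ph) =
     cin (adj (tensor_op tens S 1) *V tens (v i) ph) (adj \<U> *V tensor_op tens H 1 *V \<U> *V tens (v i) ph)" by (simp add: cinner_adj_left)
   also have "... = cin (\<U> *V tens (adj S *V v i) ph) (tensor_op tens H 1 *V \<U> *V tens (v i) ph)"
    by (simp add: cinner_adj_right adj_tensor_op[OF T] tensor_op_apply[OF T])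
   finally show ?thesis by (simp add: coupling_conj[OF T E N])
  qed
  then have slice: "cin ph (Ph ?O *V ph) = (\<Sum>\<^sub>\<infinity>i\<in>onb. \<integral>p. conj_form E H (adj S *V v i) (v i) p \<partial>?\<nu>)"
   using infsumI[OF slice_map_form[OF T v, of ph ?O ph]] by simp
  show "cin ph (Ph ?O *V ph) = (\<integral>p. F p \<partial>?\<nu>)" proof (cases "ph = 0")
   case True
   have "emeasure ?\<nu> UNIV = 0" using emeasure_sdist[OF N, of UNIV ph] True by simp
   then have "AE p in ?\<nu>. F p = 0" by (intro AE_I[of _ _ UNIV]) (auto simp: sets_sdist[OF N])
   then have "(\<integral>p. F p \<partial>?\<nu>) = 0" using integral_eq_zero_AE by blast
   then show ?thesis using True by simp
  next
   case False
   text \<open>The normalized distribution is itself a mean.\<close>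
   define m where "m f = (\<integral>p. f p \<partial>?\<nu>) / of_real ((norm ph)^2)" for f :: "real => complex"
   have int: "f : bcontfun ==> integrable ?\<nu> f" for f :: "real => complex" by (intro bborel_integrable[OF N] bcontfun_bborel)
   have m: "mean m" unfolding mean_def proof (intro conjI ballI allI impI)
    fix f g :: "real => complex" and c assume f: "f : bcontfun"
    show "g : bcontfun ==> m (%u. f u + g u) = m f + m g" using f by (simp add: m_def int add_divide_distrib)
    show "m (%u. c * f u) = c * m f" by (simp add: m_def)
    assume "ALL u. f u : \<real>\<^sub>\<ge>\<^sub>0"
    then have "(\<integral>p. f p \<partial>?\<nu>) : \<real>\<^sub>\<ge>\<^sub>0" using SI_positive[OF N bcontfun_bborel[OF f]]
     unfolding positive_op_def SI_diag[OF N bcontfun_bborel[OF f]] by blast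
    then show "m f : \<real>\<^sub>\<ge>\<^sub>0"
     unfolding m_def by (auto simp: complex_nonneg_Reals_iff Re_divide_of_real Im_divide_of_real simp del: of_real_power)
   next
    have "(\<integral>p. 1 \<partial>?\<nu>) = cor ((norm ph)^2)" using SI_diag[OF N bborel_const[of 1], of ph] by (simp add: SI_one[OF N] cinner_self)
    then show "m (%u. 1) = 1" using False by (simp add: m_def del: of_real_power)
   qed
   have b: "cmod (conj_form E H (adj S *V v i) (v i) u) <= norm H * norm (adj S) * (norm (v i))^2" for i u
    using order_trans[OF conj_form_bound[OF E, of H "adj S *V v i" "v i" u]
     mult_right_mono[OF mult_left_mono[OF norm_apply_le[of "adj S" "v i"], of "norm H"], of "norm (v i)"]] by (simp add: power2_eq_square mult.assoc)
   have "m F = (\<Sum>\<^sub>\<infinity>i\<in>onb. m (conj_form E H (adj S *V v i) (v i)))"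
    unfolding F_def by (rule mean_infsum(2)[OF m vs _ b conj_form_continuous[OF E]]) simp
   then have "m F = cin ph (Ph ?O *V ph) / of_real ((norm ph)^2)" unfolding slice by (simp add: m_def divide_inverse infsum_cmult_left')
   then show ?thesis using False by (simp add: m_def)
  qed
 qed
 then show ?thesis using TrF dirac_momentum by simp
qed

lemma dirac_slice_expectation: assumes "uniformly_continuous_on UNIV g" "!!s. cmod (g s) <= K"
 shows "de (Ph (adj \<U> * (tensor_op tens 1 (SI Qpvm g) * tensor_op tens H 1) * \<U>)) =
  Tr (SI E g * mean_projection et (sgraph E) H * rh)"
proof -
 \<comment> \<open>Inserting the coupling times its adjoint between the two factors separates the
   pointer observable from the system observable.\<close>
 have "adj \<U> * (tensor_op tens 1 (SI Qpvm g) * tensor_op tens H 1) * \<U> =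
   adj \<U> * tensor_op tens 1 (SI Qpvm g) * (\<U> * adj \<U>) * (tensor_op tens H 1 * \<U>)" unfolding coupling_unitary(2)[OF T E N] by (simp add: mult.assoc)
 also have "... = adj \<U> * tensor_op tens 1 (SI Qpvm g) * \<U> * (adj \<U> * tensor_op tens H 1 * \<U>)" by (simp only: mult.assoc)
 finally show ?thesis by (simp only: dirac_slice_position[OF assms] dirac_slice_momentum)
qed

end

section \<open>Positive functionals on the extended plane\<close>

text \<open>A homeomorphism of [0, 1] onto the extended line, prolonged by its end values so that it
  is continuous on all of R. It moves measure theory on the extended plane to the unit
  square.\<close>

definition kap :: "real => ereal" where "kap t = (if t <= 0 then - \<infinity> else if 1 <= t then \<infinity> else ereal (tan (pi * (t - 1 / 2))))"

definition kap_inv :: "ereal => real" where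
 "kap_inv x = (if x = - \<infinity> then 0 else if x = \<infinity> then 1 else 1 / 2 + arctan (real_of_ereal x) / pi)"

lemma arctan_pi: "- (1 / 2) < arctan x / pi" "arctan x / pi < 1 / 2" using arctan_bounded[of x] by (simp_all add: field_simps)

lemma kap_inv_ereal: "0 < kap_inv (ereal r)" "kap_inv (ereal r) < 1"
proof -
 have "kap_inv (ereal r) = 1 / 2 + arctan r / pi" by (simp add: kap_inv_def)
 then show "0 < kap_inv (ereal r)" "kap_inv (ereal r) < 1" using arctan_pi[of r] by linarith+
qed

lemma kap_kap_inv: "kap (kap_inv x) = x"
proof (cases x)
 case (real r)
 have "pi * (kap_inv (ereal r) - 1 / 2) = arctan r" by (simp add: kap_inv_def)
 then show ?thesis using kap_inv_ereal[of r] unfolding real kap_def by (simp add: tan_arctan)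
qed (simp_all add: kap_def kap_inv_def)

lemma kap_inv_kap: assumes "t : {0..1}" shows "kap_inv (kap t) = t"
proof (cases "0 < t & t < 1")
 case True
 have "pi * t < pi * 1" using True by (intro mult_strict_left_mono) auto
 then have "arctan (tan (pi * (t - 1 / 2))) = pi * (t - 1 / 2)" using True by (intro arctan_tan) (auto simp: algebra_simps)
 then show ?thesis using True by (simp add: kap_def kap_inv_def)
qed (use assms in "auto simp: kap_def kap_inv_def")

lemma kap_inv_range: "kap_inv x : {0..1}"
proof (cases x)
 case (real r)
 then show ?thesis using kap_inv_ereal[of r] by simp
qed (simp_all add: kap_inv_def)

lemma kap_inv_mono: "x <= y ==> kap_inv x <= kap_inv y" using kap_inv_range[of x] kap_inv_range[of y]
 by (cases x; cases y) (auto simp: kap_inv_def divide_right_mono arctan_le_iff)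

text \<open>A monotone function with open image is continuous, and compactness of [0, 1] makes the
  inverse continuous.\<close>

lemma continuous_kap: "contn kap" and continuous_kap_inv: "contn kap_inv"
proof -
 have image: "kap ` {0..1} = UNIV" using kap_kap_inv kap_inv_range by (metis UNIV_eq_I image_eqI)
 have "continuous_on {0..1} kap" proof (rule continuous_onI_mono)
  show "open (kap ` {0..1})" by (simp add: image)
  fix s t :: real assume st: "s : {0..1}" "t : {0..1}" "s <= t"
  show "kap s <= kap t" proof (rule ccontr)
   assume "~ kap s <= kap t"
   then have "kap_inv (kap t) <= kap_inv (kap s)" by (intro kap_inv_mono) simp
   then have "s = t" using st by (simp add: kap_inv_kap)
   then show False using `~ kap s <= kap t` by simp
  qed
 qed
 note c = this
 have "contn (%t. kap (max 0 (min 1 t)))" by (rule continuous_on_compose2[OF c]) (auto intro!: continuous_intros)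
 moreover have "kap (max 0 (min 1 t)) = kap t" for t by (auto simp: kap_def max_def min_def)
 ultimately show "contn kap" by simp
 show "contn kap_inv" using continuous_on_inv[OF c compact_Icc] kap_inv_kap unfolding image by blast
qed

definition kap2 :: "real * real => ereal * ereal" where "kap2 z = (kap (fst z), kap (snd z))"
definition kap2_inv :: "ereal * ereal => real * real" where "kap2_inv z = (kap_inv (fst z), kap_inv (snd z))"

lemma kap2_kap2_inv: "kap2 (kap2_inv z) = z" by (simp add: kap2_def kap2_inv_def kap_kap_inv)

lemma continuous_kap2: "contn kap2" and continuous_kap2_inv: "contn kap2_inv" unfolding kap2_def kap2_inv_def
 by (intro continuous_on_Pair continuous_on_compose2[OF continuous_kap] continuous_on_compose2[OF continuous_kap_inv]
  continuous_on_fst continuous_on_snd continuous_on_id subset_UNIV)+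

lemma measurable_kap2 [measurable]: "kap2 : bmeas" "kap2_inv : bmeas" by (intro continuous_borel continuous_kap2 continuous_kap2_inv)+

text \<open>In the coordinates of the square, indicators of closed sets are bounded limits of
  continuous functions. This is the uniqueness of the joint distribution.\<close>

lemma measure_eqI_continuous_extended:
 fixes \<mu> \<nu> :: "(ereal * ereal) measure"
 assumes \<mu>: "sets \<mu> = sets borel" "finite_measure \<mu>" and \<nu>: "sets \<nu> = sets borel" "finite_measure \<nu>"
  and eq: "!!f::ereal * ereal => complex. contn f ==> (LINT z|\<mu>. f z) = (LINT z|\<nu>. f z)" shows "\<mu> = \<nu>"
proof -
 have m: "kap2_inv : measurable \<mu> borel" "kap2_inv : measurable \<nu> borel"
  using measurable_kap2(2) by (simp_all add: measurable_cong_sets[OF \<mu>(1) refl] measurable_cong_sets[OF \<nu>(1) refl])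
 have fin: "finite_measure (distr \<mu> borel kap2_inv)" "finite_measure (distr \<nu> borel kap2_inv)"
  using finite_measure.finite_measure_distr[OF \<mu>(2) m(1)] finite_measure.finite_measure_distr[OF \<nu>(2) m(2)] by auto
 have "distr \<mu> borel kap2_inv = distr \<nu> borel kap2_inv" proof (rule measure_eqI_closed)
  fix C :: "(real * real) set" assume C: "closed C"
  obtain g :: "nat => real * real => complex" where g: "!!k. contn (g k)" "!!k z. cmod (g k z) <= 1" "!!z. (%k. g k z) ----> ind C z"
   using closed_approx[OF C] by blast
  have gm: "g k : bmeas" for k by (rule continuous_borel[OF g(1)])
  have Cb: "C : sets borel" using C by simp
  have lim: "(%k. \<integral>z. g k z \<partial>distr M borel kap2_inv) ----> of_real (measure (distr M borel kap2_inv) C)"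
   if "finite_measure (distr M borel kap2_inv)" for M using finite_measure_integral_tendsto[OF that _ gm g(2,3)] Cb
   by (simp add: integral_indicator_complex[OF that])
  have "(LINT z|distr \<mu> borel kap2_inv. g k z) = (LINT z|distr \<nu> borel kap2_inv. g k z)" for k
   unfolding integral_distr[OF m(1) gm] integral_distr[OF m(2) gm] by (intro eq continuous_on_compose2[OF g(1) continuous_kap2_inv]) auto
  then have "cor (measure (distr \<mu> borel kap2_inv) C) = of_real (measure (distr \<nu> borel kap2_inv) C)"
   using LIMSEQ_unique[OF lim[OF fin(1)]] lim[OF fin(2)] by (simp only:)
  then have "measure (distr \<mu> borel kap2_inv) C = measure (distr \<nu> borel kap2_inv) C" by (simp only: of_real_eq_iff)
  then show "emeasure (distr \<mu> borel kap2_inv) C = emeasure (distr \<nu> borel kap2_inv) C"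
   by (simp add: finite_measure.emeasure_eq_measure[OF fin(1)] finite_measure.emeasure_eq_measure[OF fin(2)])
 qed (use fin in auto)
 then have "distr (distr \<mu> borel kap2_inv) borel kap2 = distr (distr \<nu> borel kap2_inv) borel kap2" by simp
 moreover have "distr (distr M borel kap2_inv) borel kap2 = M" if "sets M = sets borel" "kap2_inv : measurable M borel" for M proof -
  have "distr (distr M borel kap2_inv) borel kap2 = distr M borel (%z. z)" by (subst distr_distr[OF measurable_kap2(1) that(2)]) (simp add: o_def kap2_kap2_inv)
  also have "... = distr M M (%z. z)" by (rule distr_cong) (use that in auto)
  finally show ?thesis by (simp add: distr_id)
 qed
 ultimately show ?thesis using \<mu>(1) \<nu>(1) m by metis
qed

section \<open>A partition of unity and the Riesz measure\<close>

definition ramp :: "nat => nat => real => real" where "ramp N i t = max 0 (min 1 (real N * t - real i + 1))"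

text \<open>The piecewise linear hat with peak at i / N, written as a difference of ramps so that
  sums telescope.\<close>

definition hat :: "nat => nat => real => real" where "hat N i t = ramp N i t - ramp N (Suc i) t"

lemma hat_nonneg: "0 <= hat N i t"  by (auto simp: hat_def ramp_def max_def min_def)

lemma hat_sum: "t : {0..1} ==> (SUM i<=N. hat N i t) = 1"
proof -
 assume t: "t : {0..1}"
 then have "real N * t <= real N * 1" by (intro mult_left_mono) auto
 moreover have "(SUM i<=k. hat N i t) = ramp N 0 t - ramp N (Suc k) t" for k by (induction k) (simp_all add: hat_def)
 ultimately show ?thesis using t by (simp add: ramp_def)
qed

text \<open>The node is i / (N + 1) and not i / N, because \<open>square_weak_limit\<close> demands
  points below 1 and i = N occurs. The shift costs the second 1 / N of the bound.\<close>

lemma hat_support: assumes "hat N i t ~= 0" "i <= N" "0 < N" shows "(abs (t - real i / real (Suc N))) <= 2 / real N"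
proof -
 have "(abs (real N * t - real i)) < 1" using assms(1) by (auto simp: hat_def ramp_def max_def min_def split: if_splits)
 then have "(abs (real N * t - real i)) / real N <= 1 / real N" using assms(3) by (intro divide_right_mono) auto
 moreover have "t - real i / real N = (real N * t - real i) / real N" using assms(3) by (simp add: field_simps)
 ultimately have "(abs (t - real i / real N)) <= 1 / real N" by (simp only: abs_divide abs_of_nat)
 moreover have "(abs (real i / real N - real i / real (Suc N))) <= 1 / real N" proof -
  have "real i / real N - real i / real (Suc N) = real i / (real N * real (Suc N))" using assms(3) by (simp add: field_simps)
  also have "... <= real (Suc N) / (real N * real (Suc N))" using assms(2) by (intro divide_right_mono) auto
  also have "... = 1 / real N" by simp
  finally show ?thesis using assms(3) by (simp add: abs_le_iff divide_left_mono field_simps)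
 qed
 ultimately show ?thesis by (simp add: abs_le_iff add_divide_distrib[symmetric])
qed

text \<open>The values of L on a partition of unity are the weights of discrete measures. Their
  integrals of f tend to L f by uniform continuity, and along a subsequence to the integral against
  a limit measure, which therefore represents L.\<close>

lemma riesz_extended:
 fixes L :: "(ereal * ereal => complex) => complex" assumes add: "!!f g. contn f ==> contn g ==> L (%z. f z + g z) = L f + L g"
  and scale: "!!c f. contn f ==> L (%z. c * f z) = c * L f"
  and pos: "!!f. contn f ==> (!!z. f z : \<real>\<^sub>\<ge>\<^sub>0) ==> L f : \<real>\<^sub>\<ge>\<^sub>0"
  and bound: "!!f K. contn f ==> (!!z. cmod (f z) <= K) ==> cmod (L f) <= K" and one: "L (%_. 1) = 1"
 shows "EX \<mu>. sets \<mu> = sets borel & emeasure \<mu> (space \<mu>) = 1 & (ALL f. contn f --> (LINT z|\<mu>. f z) = L f)"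
proof -
 have Lsum: "L (%z. SUM i:I. c i * f i z) = (SUM i:I. c i * L (f i))" if "finite I" "!!i. contn (f i)" for I :: "'i set" and c and f :: "'i => _" using that(1)
 proof (induction rule: finite_induct)
  case empty
  then show ?case using scale[of "%_. 1" 0] by simp
 next
  case (insert i I)
  then show ?case
   by (simp add: add[OF continuous_on_mult[OF continuous_on_const that(2)] continuous_on_sum[OF continuous_on_mult[OF continuous_on_const that(2)]]]
    scale[OF that(2)])
 qed
 define h where "h n i z = cor (hat (Suc n) (fst i) (kap_inv (fst z)) * hat (Suc n) (snd i) (kap_inv (snd z)))" for n and i :: "nat \<times> nat" and z
 define I where "I n = {..Suc n} \<times> {..Suc n}" for n
 define p where "p n i = (real (fst i) / real (Suc (Suc n)), real (snd i) / real (Suc (Suc n)))" for n :: nat and i :: "nat \<times> nat"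
 define w where "w n i = Re (L (h n i))" for n i
 have hc: "contn (h n i)" for n i unfolding h_def hat_def ramp_def by (intro continuous_intros continuous_on_compose2[OF continuous_kap_inv]) auto
 have hpos: "h n i z : \<real>\<^sub>\<ge>\<^sub>0" for n i z unfolding h_def by (simp only: nonneg_Reals_of_real_iff) (intro mult_nonneg_nonneg hat_nonneg)
 have w: "0 <= w n i" "of_real (w n i) = L (h n i)" for n i using pos[OF hc hpos, of n i] by (auto simp: w_def complex_nonneg_Reals_iff complex_eq_iff)
 have hsum: "(SUM i:I n. h n i z) = 1" for n z proof -
  have "(SUM i:I n. h n i z) = of_real ((SUM i<=Suc n. hat (Suc n) i (kap_inv (fst z))) * (SUM i<=Suc n. hat (Suc n) i (kap_inv (snd z))))"
   unfolding sum_product sum.cartesian_product I_def h_def by (simp add: case_prod_unfold)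
  then show ?thesis by (simp only: hat_sum[OF kap_inv_range]) simp
 qed
 have fI: "finite (I n)" for n by (simp add: I_def)
 have "cor (SUM i:I n. w n i) = L (%z. SUM i:I n. 1 * h n i z)" for n unfolding Lsum[OF fI hc] by (simp add: w(2))
 then have "cor (SUM i:I n. w n i) = 1" for n by (simp only: mult_1 hsum one)
 then have W: "(SUM i:I n. w n i) = 1" for n using of_real_eq_1_iff by blast
 have p: "p n i : {0..<1} \<times> {0..<1}" if "i : I n" for n i using that by (auto simp: I_def p_def)
 obtain s M where s: "strict_mono s" and M: "sets M = sets borel" "finite_measure M" "measure M UNIV = 1" and lim0: "ALL f::real * real => complex. contn f -->
   (%n. SUM i:I (s n). of_real (w (s n) i) * f (p (s n) i)) ----> (LINT x|M. f x)"
  using square_weak_limit[of I p w 1, OF fI p w(1) W, simplified] by (elim exE conjE) (rule that, assumption+)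
 note lim = lim0[rule_format]
 have Mm: "kap2 : measurable M borel" using measurable_kap2(1) by (simp add: measurable_cong_sets[OF M(1) refl])
 have int: "(LINT z|distr M borel kap2. f z) = L f" if f: "contn f" for f proof -
  define F where "F z = f (kap2 z)" for z
  have F: "contn F" unfolding F_def by (rule continuous_on_compose2[OF f continuous_kap2]) simp
  have "(%n. (SUM i:I n. of_real (w n i) * F (p n i))) ----> L f" proof (rule metric_LIMSEQ_I)
   fix e :: real assume e: "0 < e"
   have "compact ({0..1} \<times> {0..1} :: (real * real) set)" by (intro compact_Times compact_Icc)
   then have "uniformly_continuous_on ({0..1} \<times> {0..1}) F" by (rule compact_uniformly_continuous[OF continuous_on_subset[OF F subset_UNIV]])
   then obtain d where d: "0 < d" "!!a b. a : {0..1} \<times> {0..1} ==> b : {0..1} \<times> {0..1} ==> dist a b < d ==> dist (F a) (F b) < e / 2"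
    unfolding uniformly_continuous_on_def using e by (metis half_gt_zero)
   \<comment> \<open>Each of the two coordinates is within 2 / (n + 1) of its node.\<close>
   obtain n0 where n0: "4 / d < real n0" using reals_Archimedean2 by blast
   have "dist (SUM i:I n. of_real (w n i) * F (p n i)) (L f) < e" if n: "n >= n0" for n proof -
    define D where "D z = f z + (SUM i:I n. (- F (p n i)) * h n i z)" for z
    have c: "contn (%z. SUM i:I n. (- F (p n i)) * h n i z)" by (intro continuous_on_sum continuous_on_mult continuous_on_const hc)
    have LD: "L D = L f - (SUM i:I n. of_real (w n i) * F (p n i))" unfolding D_def add[OF f c] Lsum[OF fI hc] by (simp add: w(2) sum_negf mult.commute)
    have "cmod (D z) <= e / 2" for z proof -
     have "D z = (SUM i:I n. h n i z) * f z + (SUM i:I n. (- F (p n i)) * h n i z)" unfolding hsum D_def by simp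
     also have "... = (SUM i:I n. h n i z * (f z - F (p n i)))" by (simp add: sum_distrib_right flip: sum.distrib) (simp add: algebra_simps)
     finally have "cmod (D z) <= (SUM i:I n. cmod (h n i z) * cmod (f z - F (p n i)))"
      using norm_sum[of "%i. h n i z * (f z - F (p n i))" "I n"] by (simp add: norm_mult)
     also have "... <= (SUM i:I n. cmod (h n i z) * (e / 2))" proof (rule sum_mono)
      fix i assume i: "i : I n"
      show "cmod (h n i z) * cmod (f z - F (p n i)) <= cmod (h n i z) * (e / 2)" proof (cases "h n i z = 0")
       case False
       then have ne: "hat (Suc n) (fst i) (kap_inv (fst z)) ~= 0" "hat (Suc n) (snd i) (kap_inv (snd z)) ~= 0" by (auto simp: h_def)
       have le: "(abs (kap_inv (fst z) - fst (p n i))) <= 2 / real (Suc n)" "(abs (kap_inv (snd z) - snd (p n i))) <= 2 / real (Suc n)"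
        unfolding p_def using hat_support[OF ne(1)] hat_support[OF ne(2)] i by (auto simp: I_def)
       have "dist (kap2_inv z) (p n i) <= (abs (kap_inv (fst z) - fst (p n i))) + (abs (kap_inv (snd z) - snd (p n i)))"
        unfolding dist_prod_def kap2_inv_def dist_real_def fst_conv snd_conv using sqrt_sum_squares_le_sum_abs by simp
       also have "... <= 4 / real (Suc n)" using le by simp
       also have "... < d" proof -
        have "4 / d < real (Suc n)" using n0 n by linarith
        then show ?thesis using d(1) by (simp add: field_simps)
       qed
       finally have "dist (F (kap2_inv z)) (F (p n i)) < e / 2" using p[OF i] kap_inv_range by (intro d(2)) (auto simp: kap2_inv_def less_imp_le)
       then show ?thesis by (intro mult_left_mono) (simp_all add: F_def kap2_kap2_inv dist_norm)
      qed simp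
     qed
     also have "... = e / 2" proof -
      have "cmod (h n i z) = Re (h n i z)" for i using hpos[of n i z] by (auto simp: complex_nonneg_Reals_iff cmod_eq_Re)
      then have "(SUM i:I n. cmod (h n i z)) = Re (SUM i:I n. h n i z)" by (simp add: Re_sum)
      then show ?thesis unfolding sum_distrib_right[symmetric] by (simp only: hsum) simp
     qed
     finally show ?thesis .
    qed
    then have "cmod (L D) <= e / 2" unfolding D_def by (intro bound continuous_on_add f c)
    then show ?thesis using e unfolding LD by (simp add: dist_norm norm_minus_commute)
   qed
   then show "EX n0. ALL n>=n0. dist (SUM i:I n. of_real (w n i) * F (p n i)) (L f) < e" by blast
  qed
  from LIMSEQ_subseq_LIMSEQ[OF this s] have "(LINT x|M. F x) = L f" using LIMSEQ_unique[OF lim[OF F]] by (simp add: o_def)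
  then show ?thesis by (subst integral_distr[OF Mm continuous_borel[OF f]]) (simp add: F_def)
 qed
 have "space M = UNIV" using sets_eq_imp_space_eq[OF M(1)] by simp
 then have "emeasure (distr M borel kap2) (space (distr M borel kap2)) = 1"
  using M(3) by (simp add: emeasure_distr[OF Mm] finite_measure.emeasure_eq_measure[OF M(2)])
 then show ?thesis using int by (intro exI[of _ "distr M borel kap2"]) simp
qed

section \<open>The joint distribution\<close>

lemma bounded_continuous_extended:
 fixes f :: "ereal * ereal => complex" assumes f: "contn f" shows "bborel (%z. f (ereal (fst z), ereal (snd z)))"
proof -
 have "compact ((%z. f (kap2 z)) ` ({0..1} \<times> {0..1}))" by (intro compact_continuous_image compact_Times compact_Icc
   continuous_on_subset[OF continuous_on_compose2[OF f continuous_kap2] subset_UNIV]) auto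
 then have "bounded ((%z. f (kap2 z)) ` ({0..1} \<times> {0..1}))" by (rule compact_imp_bounded)
 then obtain K where KB: "ALL x:(%z. f (kap2 z)) ` ({0..1} \<times> {0..1}). cmod x <= K" unfolding bounded_iff by blast
 then have K: "cmod (f (kap2 z)) <= K" if "z : {0..1} \<times> {0..1}" for z using KB imageI[OF that, of "%z. f (kap2 z)"] by blast
 have "kap2_inv z : {0..1} \<times> {0..1}" for z using kap_inv_range by (simp add: kap2_inv_def)
 from K[OF this] have "cmod (f z) <= K" for z by (simp add: kap2_kap2_inv)
 moreover have "contn (%z::real * real. f (ereal (fst z), ereal (snd z)))"
  by (intro continuous_on_compose2[OF f] continuous_on_Pair continuous_on_ereal continuous_intros) auto
 ultimately show ?thesis by (intro bborelI continuous_borel)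
qed

text \<open>Truncation at -R and R, continuous up to the infinite points. It makes y a bounded
  continuous test function, and R = M loses nothing because |y| <= M almost surely.\<close>

definition clip :: "real => ereal => real" where "clip R x = real_of_ereal (max (ereal (- R)) (min (ereal R) x))"

lemma clip_ereal: "clip R (ereal x) = max (- R) (min R x)" by (simp add: clip_def flip: ereal_min ereal_max)

lemma clip_infty: "0 <= R ==> clip R \<infinity> = R" "0 <= R ==> clip R (- \<infinity>) = - R" by (simp_all add: clip_def max_def)

lemma clip_bound: assumes "0 <= R" shows "(abs (clip R x)) <= R" using assms by (cases x) (auto simp: clip_ereal clip_infty)

lemma continuous_clip: assumes "0 <= R" shows "contn (clip R)" unfolding clip_def[abs_def]
proof (rule continuous_on_compose2[OF continuous_on_real])
 show "contn (%x. max (ereal (- R)) (min (ereal R) x))" by (intro continuous_intros)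
 show "(%x. max (ereal (- R)) (min (ereal R) x)) ` UNIV <= UNIV - {\<infinity>, - \<infinity>}" by (auto simp: max_def min_def split: if_splits)
qed

lemma clip_lipschitz: "(abs (clip R (ereal s) - clip R (ereal t))) <= (abs (s - t))" unfolding clip_ereal by (auto simp: max_def min_def)

text \<open>Meant for the difference of the two sides of the claim as functionals of a function of
  x. Additivity and bounded limits are what a Dynkin induction from half lines needs; limits also
  provide the whole line.\<close>

lemma borel_functional_eq_0:
 fixes d :: "(real => complex) => complex" assumes add: "!!f g. bborel f ==> bborel g ==> d (%s. f s + g s) = d f + d g"
  and lim: "!!F f K. (!!i. bborel (F i)) ==> (!!i s. cmod (F i s) <= K) ==> (!!s. (%i::nat. F i s) ----> f s) ==> (%i. d (F i)) ----> d f"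
  and basic: "!!a. d (ind {..a}) = 0" and B: "B : sets borel" shows "d (ind B) = 0"
proof -
 have U: "d (ind UNIV) = 0" proof -
  have "(%i::nat. ind {..real i} s) ----> (ind UNIV s :: complex)" for s using eventually_ge_at_top[of "nat \<lceil>s\<rceil>"]
   by (intro tendsto_eventually) (auto elim!: eventually_mono simp: indicator_def nat_le_iff ceiling_le_iff)
  then have "(%i. d (ind {..real i})) ----> d (ind UNIV)" by (intro lim[of _ 1] bborel_indicator) (auto simp: indicator_def)
  then have "(%i::nat. 0::complex) ----> d (ind UNIV)" by (simp only: basic)
  then show ?thesis by (rule LIMSEQ_unique[OF _ tendsto_const])
 qed
 have nil: "d (ind {}) = 0" proof -
  have "ind UNIV = (%s. ind UNIV s + ind {} s :: complex)" by auto
  then have "d (ind UNIV) = d (ind UNIV) + d (ind {})" using add[OF bborel_indicator bborel_indicator, of UNIV "{}"] by simp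
  then show ?thesis by (simp only: add_cancel_right_right)
 qed
 have A: "B : sigma_sets UNIV (range atMost)" using B by (simp add: sets_borel_atMost)
 have P: "range atMost <= Pow (UNIV::real set)" by simp
 from Int_stable_atMost P A show ?thesis proof (induction rule: sigma_sets_induct_disjoint)
  case empty
  show ?case by (rule nil)
 next
  case (compl A)
  then have "A : sets borel" by (simp add: sets_borel_atMost)
  moreover have "ind UNIV = (%s. ind A s + ind (UNIV - A) s :: complex)" by (auto simp: indicator_def)
  ultimately have "d (ind UNIV) = d (ind A) + d (ind (UNIV - A))" using add[OF bborel_indicator bborel_indicator, of A "UNIV - A"] by simp
  then show ?case using U compl by simp
 next
  case (union A)
  then have Ab: "A i : sets borel" for i by (auto simp: sets_borel_atMost)
  define F where "F n = (ind (UN i<n. A i) :: real => complex)" for n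
  have Fb: "bborel (F n)" for n unfolding F_def using Ab by (intro bborel_indicator sets.finite_UN) auto
  have "d (F n) = 0" for n proof (induction n)
   case 0
   have "F 0 = ind {}" by (simp add: F_def)
   then show ?case by (simp only: nil)
  next
   case (Suc n)
   have "A i Int A n = {}" if "i < n" for i using disjoint_family_onD[OF union(1), of i n] that by simp
   then have "F (Suc n) = (%s. F n s + ind (A n) s)" unfolding F_def by (auto simp: fun_eq_iff indicator_def less_Suc_eq split: if_splits)
   then show ?case using add[OF Fb bborel_indicator[OF Ab], of n n] Suc union(3) by simp
  qed
  moreover have "(%n. F n s) ----> ind (UN i. A i) s" for s unfolding F_def by (rule LIMSEQ_indicator_UN)
  then have "(%n. d (F n)) ----> d (ind (UN i. A i))" by (intro lim[of _ 1] Fb) (auto simp: F_def indicator_def)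
  ultimately have "(%n::nat. 0::complex) ----> d (ind (UN i. A i))" by (simp only:)
  then show ?case by (rule LIMSEQ_unique[OF _ tendsto_const])
 qed (use basic in auto)
qed

lemma Tr_spectral_add:
 fixes E :: "real set => 'a::chilbert_space bop" assumes E: "pvm E" and v: "represents onb v rh" and f: "bborel f" "bborel g"
 shows "Tr (SI E (%s. f s + g s) * Z * rh) = Tr (SI E f * Z * rh) + Tr (SI E g * Z * rh)"
proof -
 have vs: "(%i. (norm (v i))^2) summable_on onb" using v unfolding represents_def by blast
 show ?thesis unfolding Tr_represents(1)[OF v] SI_add[OF E f]
  by (subst infsum_add[symmetric]) (simp_all add: abs_summable_summable[OF form_summable[OF vs]] cinner_simps del: times_bop_apply,
   simp add: bop_distrib cinner_simps)
qed

text \<open>Weak convergence handles finitely many representing vectors, and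
  \<open>represents_approx\<close> bounds the remaining ones uniformly in n, since all functions
  share the bound K.\<close>

lemma Tr_spectral_limit:
 fixes E :: "real set => 'a::chilbert_space bop" assumes E: "pvm E" and v: "represents onb v rh"
  and F: "!!i. bborel (F i)" "!!i s. cmod (F i s) <= K" "!!s. (%i::nat. F i s) ----> f s" shows "(%n. Tr (SI E (F n) * Z * rh)) ----> Tr (SI E f * Z * rh)"
proof (rule LIMSEQ_I)
 fix e :: real assume e: "0 < e"
 have vs: "(%i. (norm (v i))^2) summable_on onb" using v unfolding represents_def by blast
 have K0: "0 <= K" using F(2)[of 0 0] order_trans[OF norm_ge_zero] by blast
 define C where "C = K * norm Z"
 have C0: "0 <= C" using K0 by (simp add: C_def)
 have bf: "bborel f" by (rule bborel_limit[OF F])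
 have fK: "cmod (f s) <= K" for s by (rule LIMSEQ_le_const2[OF tendsto_norm[OF F(3)]]) (use F(2) in auto)
 have bound: "cmod (cin (v i) ((SI E g * Z) *V v i)) <= C * (norm (v i))^2" if g: "bborel g" "!!s. cmod (g s) <= K" for g i proof -
  have "norm (SI E g * Z) <= C" unfolding C_def using norm_SI_le[OF E g K0] by (intro order_trans[OF norm_bop_mult_le] mult_right_mono) auto
  then have "norm ((SI E g * Z) *V v i) <= C * norm (v i)" by (rule order_trans[OF norm_apply_le mult_right_mono]) simp
  from order_trans[OF cmod_cinner_le mult_left_mono[OF this norm_ge_zero], of "v i"] show ?thesis by (simp add: power2_eq_square mult.left_commute)
 qed
 obtain S where S: "finite S" and app: "!!h. (!!i. cmod (h i) <= C * (norm (v i))^2) ==>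
   cmod ((\<Sum>\<^sub>\<infinity>i\<in>onb. h i) - (SUM i:S. h i)) <= e / (4 * (C + 1)) * C"
  using represents_approx[OF vs, of "e / (4 * (C + 1))"] e C0 by auto
 have small: "e / (4 * (C + 1)) * C <= e / 4" using e C0 by (simp add: field_simps)
 define h where "h g i = cin (v i) ((SI E g * Z) *V v i)" for g i
 have "(%n. SUM i:S. h (F n) i) ----> (SUM i:S. h f i)" unfolding h_def times_bop_apply by (intro tendsto_sum SI_weak_limit[OF E F])
 then obtain n0 where n0: "!!n. n >= n0 ==> cmod ((SUM i:S. h (F n) i) - (SUM i:S. h f i)) < e / 4"
  using LIMSEQ_D[of _ _ "e / 4"] e by (metis divide_pos_pos zero_less_numeral)
 have "norm (Tr (SI E (F n) * Z * rh) - Tr (SI E f * Z * rh)) < e" if "n >= n0" for n proof -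
  have t: "Tr (SI E g * Z * rh) = (\<Sum>\<^sub>\<infinity>i\<in>onb. h g i)" for g by (simp only: Tr_represents(1)[OF v] h_def)
  have 1: "cmod ((\<Sum>\<^sub>\<infinity>i\<in>onb. h (F n) i) - (SUM i:S. h (F n) i)) <= e / 4"
   by (rule order_trans[OF app small]) (unfold h_def, rule bound[OF F(1,2)])
  have 2: "cmod ((\<Sum>\<^sub>\<infinity>i\<in>onb. h f i) - (SUM i:S. h f i)) <= e / 4"
   by (rule order_trans[OF app small]) (unfold h_def, rule bound[OF bf fK])
  have tri: "cmod (a - b) <= cmod (a - a') + cmod (b - b') + cmod (a' - b')" for a b a' b' :: complex
   using norm_triangle_ineq[of "a - a'" "a' - b"] norm_triangle_ineq[of "a' - b'" "b' - b"] norm_minus_commute[of b b'] by simp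
  show ?thesis
   unfolding t using tri[of "\<Sum>\<^sub>\<infinity>i\<in>onb. h (F n) i" "\<Sum>\<^sub>\<infinity>i\<in>onb. h f i" "SUM i:S. h (F n) i" "SUM i:S. h f i"] 1 2 n0[OF that] e
   by linarith
 qed
 then show "EX n0. ALL n>=n0. norm (Tr (SI E (F n) * Z * rh) - Tr (SI E f * Z * rh)) < e" by blast
qed

text \<open>The identity is the self-adjoint operator whose spectral measure sits at the point 1,
  which makes this a case of \<open>tensor_graph_sgraph\<close>. The product map restricted to the
  line fst z = 1 is the second coordinate.\<close>

lemma tensor_graph_one_position:
 fixes tens :: "'a::chilbert_space => L2 => 'g::chilbert_space" and E :: "real set => 'a bop" assumes T: "hilbert_tensor tens" and E: "pvm E"
 shows "tensor_graph tens (graph_of 1) position_op = sgraph (%B. tensor_op tens 1 (Qpvm B))"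
proof -
 have m: "(%_::real. 1::real) : bmeas" by measurable
 have m': "(%z::real * real. fst z * snd z) : bmeas" by measurable
 define D where "D = push_pvm (%_::real. 1::real) E"
 have D: "pvm D" unfolding D_def by (rule pvm_push[OF E m])
 have D1: "D B = 1" if "B : sets borel" "1 : B" for B using that by (simp add: D_def push_pvm_apply pvm_UNIV[OF E])
 have "sgraph D = graph_of (SI D (idc 1))" by (rule sgraph_bounded[OF D D1]) (auto simp: cutoff_def)
 moreover have "SI D (idc 1) = 1" using SI_push[OF E m bborel_idc, of 1] by (simp add: D_def idc_def cutoff_def SI_one[OF E])
 ultimately have g1: "graph_of 1 = sgraph D" by simp
 let ?G = "tensor_pvm tens D Qpvm"
 note G = tensor_pvm[OF T D Qpvm] and Gt = tensor_pvm_Times[OF T D Qpvm]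
 have "push_pvm (%z. fst z * snd z) ?G = (%B. tensor_op tens 1 (Qpvm B))" proof (rule pvm_eqI[OF pvm_push[OF G m'] pvm_tensor_right[OF T E Qpvm]])
  fix B :: "real set" assume B: "B : sets borel"
  let ?S = "(%z::real * real. fst z * snd z) -` B"
  have S: "?S : sets borel" using measurable_sets[OF m' B] by simp
  have s1: "{1::real} : sets borel" by simp
  have "?G ({1} \<times> UNIV) = 1" using D1[OF s1] by (simp add: Gt pvm_UNIV[OF Qpvm] tensor_op_one[OF T])
  then have "?G ?S = ?G ?S * ?G ({1} \<times> UNIV)" by simp
  also have "... = ?G (?S Int {1} \<times> UNIV)" by (intro pvm_Int[OF G] S Times_borel) auto
  also have "?S Int {1} \<times> UNIV = {1} \<times> B" by auto
  also have "?G ({1} \<times> B) = tensor_op tens 1 (Qpvm B)" using B D1[OF s1] by (simp add: Gt)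
  finally show "push_pvm (%z. fst z * snd z) ?G B = tensor_op tens 1 (Qpvm B)" using B by (simp add: push_pvm_apply)
 qed
 then show ?thesis unfolding g1 position_op_eq tensor_graph_sgraph[OF T D Qpvm] by simp
qed

text \<open>The pointer is the first argument of f but the second tensor factor, hence the exchanged
  factors. The joint spectral measure is pinned down by its rectangles.\<close>

lemma joint_fun_calc_eq:
 fixes tens :: "'a::chilbert_space => L2 => 'g::chilbert_space" and F :: "real set => 'a bop" assumes T: "hilbert_tensor tens" and F: "pvm F"
  and Y: "Y = SI F (idc M)" "F (cutoff M) = 1" shows "joint_fun_calc f (tensor_graph tens (graph_of 1) position_op) (graph_of (tensor_op tens Y 1)) =
  SI (tensor_pvm (%y x. tens x y) Qpvm F) f"
proof -
 let ?G = "tensor_pvm (%y x. tens x y) Qpvm F"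
 note T' = tensor_flip[OF T]
 note G = tensor_pvm[OF T' Qpvm F] and Gt = tensor_pvm_Times[OF T' Qpvm F]
 note PY = pvm_tensor_left[OF T F] and PQ = pvm_tensor_right[OF T F Qpvm]
 have "sgraph (%B. tensor_op tens (F B) 1) = graph_of (SI (%B. tensor_op tens (F B) 1) (idc M))"
  by (rule sgraph_bounded[OF PY]) (simp add: Y tensor_op_one[OF T])
 then have gY: "graph_of (tensor_op tens Y 1) = sgraph (%B. tensor_op tens (F B) 1)" by (simp add: SI_tensor_left[OF T F bborel_idc] Y(1))
 have rect: "?G (A \<times> B) = tensor_op tens 1 (Qpvm A) * tensor_op tens (F B) 1" if "A : sets borel" "B : sets borel" for A B
  using that by (simp add: Gt tensor_op_flip[OF T] tensor_op_mult[OF T])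
 have "joint_spectral_measure (tensor_graph tens (graph_of 1) position_op) (graph_of (tensor_op tens Y 1)) = ?G"
  unfolding joint_spectral_measure_def tensor_graph_one_position[OF T F] gY
   spectral_measure_sgraph[OF PQ] spectral_measure_sgraph[OF PY] proof (rule the_equality)
  show "pvm ?G & (ALL A:sets borel. ALL B:sets borel. ?G (A \<times> B) = tensor_op tens 1 (Qpvm A) * tensor_op tens (F B) 1)" using G rect by blast
  show "H = ?G" if "pvm H & (ALL A:sets borel. ALL B:sets borel. H (A \<times> B) = tensor_op tens 1 (Qpvm A) * tensor_op tens (F B) 1)" for H
   using that rect by (intro pvm_eqI_rectangles[OF _ G]) auto
 qed
 then show ?thesis unfolding joint_fun_calc_def by simp
qed

text \<open>For k >= 1 it is 1 up to a and falls with slope k to 0 at a + 1 / k. Clipping at |a| + 1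
  leaves these values unchanged and makes the function continuous at the infinite points, and it is
  Lipschitz on the reals as \<open>outcome_product\<close> requires.\<close>

definition sramp :: "nat => real => ereal => real" where "sramp k a x = max 0 (min 1 (1 - real k * (clip ((abs a) + 1) x - a)))"

lemma sramp_bounds: "0 <= sramp k a x" "sramp k a x <= 1" by (simp_all add: sramp_def)

lemma continuous_sramp: "contn (sramp k a)" unfolding sramp_def[abs_def] by (intro continuous_intros continuous_clip) auto

lemma uniformly_continuous_sramp: "uniformly_continuous_on UNIV (%s. cor (sramp k a (ereal s)))"
proof (rule lipschitz_on_uniformly_continuous[OF lipschitz_onI[where L = "real k"]])
 fix s t :: real
 have cut: "(abs (max 0 (min 1 (1 - p)) - max 0 (min 1 (1 - q)))) <= (abs (p - q))" for p q :: real by (auto simp: max_def min_def)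
 have "(abs (sramp k a (ereal s) - sramp k a (ereal t))) <= (abs (real k * (clip ((abs a) + 1) (ereal s) - a) - real k * (clip ((abs a) + 1) (ereal t) - a)))"
  unfolding sramp_def by (rule cut)
 also have "... = real k * (abs (clip ((abs a) + 1) (ereal s) - clip ((abs a) + 1) (ereal t)))" by (simp add: abs_mult flip: right_diff_distrib)
 also have "... <= real k * (abs (s - t))" by (intro mult_left_mono clip_lipschitz) auto
 finally show "dist (cor (sramp k a (ereal s))) (cor (sramp k a (ereal t))) <= real k * dist s t" by (simp add: dist_norm flip: of_real_diff)
qed auto

lemma sramp_tendsto: "(%k. sramp k a x) ----> ind {..ereal a} x"
proof (cases "x <= ereal a")
 case True
 then have "clip ((abs a) + 1) x <= a" by (cases x) (auto simp: clip_ereal clip_infty)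
 then have "sramp k a x = 1" for k by (auto simp: sramp_def max_def min_def mult_le_0_iff)
 then show ?thesis using True by simp
next
 case False
 define p where "p = clip ((abs a) + 1) x - a"
 have "0 < p" unfolding p_def using False by (cases x) (auto simp: clip_ereal clip_infty)
 then obtain n :: nat where n: "1 < real n * p" using reals_Archimedean3 by blast
 have "sramp k a x = 0" if "n <= k" for k proof -
  have "real n * p <= real k * p" using that `0 < p` by (intro mult_right_mono) auto
  then show ?thesis using n by (simp add: sramp_def flip: p_def)
 qed
 then show ?thesis using False by (intro tendsto_eventually eventually_sequentiallyI[of n]) simp
qed

context
 fixes tens :: "'a::chilbert_space => L2 => 'g::chilbert_space" and E :: "real set => 'a bop" and N :: "real set => L2 bop"
  and et :: "(real => complex) => complex" and de :: "L2 bop => complex"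
  and rh :: "'a bop" and v :: "'a => 'a" and F :: "real set => 'a bop" and M :: nat and Y :: "'a bop"
 assumes T: "hilbert_tensor tens" and E: "pvm E" and N: "pvm N" and mom: "momentum_op = sgraph N" and trans: "!!s. ugroup N (- s) = translation s"
  and et: "mean et" and de: "dirac_state et de" and v: "represents onb v rh" and rh: "Tr rh = 1"
  and F: "pvm F" and Y: "Y = SI F (idc M)" and FM: "F (cutoff M) = 1"
begin

abbreviation (input) "U == coupling tens E N"
abbreviation (input) "final S == de (slice_map tens rh (adj U * S * U))"
abbreviation (input) "joint == tensor_pvm (%y x. tens x y) Qpvm F"
abbreviation (input) "outcome f == final (SI joint (%z. f (ereal (fst z), ereal (snd z))))"
abbreviation (input) "Z == mean_projection et (sgraph E) Y"

lemmas st = dirac_is_state[OF T E N mom trans et de v rh]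
lemmas pvm_joint = tensor_pvm[OF tensor_flip[OF T] Qpvm F]

lemma final_add: "final (A + B) = final A + final B" by (simp add: bop_distrib slice_map_add[OF T v] state_add[OF st])

lemma final_scaleC: "final (c *C A) = c * final A" by (simp add: bop_distrib slice_map_scaleC[OF T v] state_scaleC[OF st])

lemma final_positive: assumes "positive_op A" shows "final A : \<real>\<^sub>\<ge>\<^sub>0"
proof -
 have "positive_op (adj U * A * U)" using assms unfolding positive_op_def by (simp add: cinner_adj_right)
 then show ?thesis by (intro state_positive[OF st] slice_map_positive[OF T v])
qed

lemma final_bound: assumes "norm A <= K" shows "cmod (final A) <= K"
proof -
 have U1: "norm U <= 1" by (rule norm_isometry_le[OF T E N mom trans et de v rh coupling_unitary(1)[OF T E N]])
 have "norm (adj U * A * U) <= norm (adj U * A) * norm U" by (rule norm_bop_mult_le)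
 also have "... <= (norm (adj U) * norm A) * 1" by (intro mult_mono norm_bop_mult_le U1) auto
 also have "... <= 1 * norm A" using norm_isometry_le[OF T E N mom trans et de v rh, of "adj U"] coupling_unitary(2)[OF T E N]
   mult_right_mono[of "norm (adj U)" 1 "norm A"] by (simp add: adj_adj)
 finally have "norm (adj U * A * U) <= K" using assms by simp
 then show ?thesis by (rule order_trans[OF state_bound[OF st] order_trans[OF norm_slice_map_le[OF T v rh]]])
qed

lemma final_one: "final 1 = 1"
proof -
 have "(%_::real. 1::complex) : bcontfun" by (rule const_bcontfun)
 from dirac_position[OF T E N mom trans et de v rh this] have "de 1 = 1" by (simp add: SI_one[OF Qpvm])
 moreover have "slice_map tens rh 1 = 1" using slice_map_properties(3)[OF T v, of 1 1] by (simp add: tensor_op_one[OF T] rh)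
 ultimately show ?thesis by (simp add: coupling_unitary(1)[OF T E N])
qed

lemma outcome_distribution: "EX \<mu>. sets \<mu> = sets borel & emeasure \<mu> (space \<mu>) = 1 & (ALL f. contn f --> (LINT z|\<mu>. f z) = outcome f)"
proof (rule riesz_extended)
 note bb = bounded_continuous_extended
 show "outcome (%z. f z + g z) = outcome f + outcome g" if "contn f" "contn g" for f g
  by (simp only: SI_add[OF pvm_joint bb[OF that(1)] bb[OF that(2)]] final_add)
 show "outcome (%z. c * f z) = c * outcome f" if "contn f" for c f by (simp only: SI_scale[OF pvm_joint bb[OF that]] final_scaleC)
 show "outcome f : \<real>\<^sub>\<ge>\<^sub>0" if "contn f" "!!z. f z : \<real>\<^sub>\<ge>\<^sub>0" for f
  by (intro final_positive SI_positive[OF pvm_joint bb[OF that(1)]] that(2))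
 show "cmod (outcome f) <= K" if "contn f" "!!z. cmod (f z) <= K" for f K using that(2)[of undefined] order_trans[OF norm_ge_zero]
  by (intro final_bound norm_SI_le[OF pvm_joint bb[OF that(1)]] that(2)) blast
 show "outcome (%_. 1) = 1" by (simp only: SI_one[OF pvm_joint] final_one)
qed

text \<open>Resolves the definite description once a Riesz measure is at hand: the defining
  functional is identified with \<open>outcome\<close>, and continuous functions determine the
  measure.\<close>

lemma joint_distribution_eq: assumes \<mu>: "sets \<mu> = sets borel" "emeasure \<mu> (space \<mu>) = 1" "!!f. contn f ==> (LINT z|\<mu>. f z) = outcome f"
 shows "joint_distribution tens de (sgraph E) Y rh = \<mu>"
proof -
 have eq: "transformed_state (measuring_unitary tens (sgraph E)) (product_state tens rh de)
   (joint_fun_calc (%(x, y). f (ereal x, ereal y)) (tensor_graph tens (graph_of 1) position_op) (graph_of (tensor_op tens Y 1))) = outcome f" for f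
  unfolding transformed_state_def product_state_def measuring_unitary_eq[OF T E N mom trans]
   joint_fun_calc_eq[OF T F Y FM] by (simp add: case_prod_beta')
 show ?thesis unfolding joint_distribution_def eq proof (rule the_equality)
  show "sets \<mu> = sets borel & emeasure \<mu> (space \<mu>) = 1 & (ALL f. contn f --> (LINT z|\<mu>. f z) = outcome f)" using \<mu> by blast
  show "\<nu> = \<mu>" if \<nu>: "sets \<nu> = sets borel & emeasure \<nu> (space \<nu>) = 1 & (ALL f. contn f --> (LINT z|\<nu>. f z) = outcome f)" for \<nu>
   using \<nu> \<mu> by (intro measure_eqI_continuous_extended finite_measureI) auto
 qed
qed

lemma joint_support: "joint (UNIV \<times> cutoff M) = 1" by (simp add: tensor_pvm_Times[OF tensor_flip[OF T] Qpvm F] FM pvm_UNIV[OF Qpvm]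
  tensor_op_one[OF tensor_flip[OF T]])

lemma outcome_product: assumes g: "contn g" "uniformly_continuous_on UNIV (%s. cor (g (ereal s)))" "!!x. (abs (g x)) <= K"
 shows "outcome (%z. cor (g (fst z) * clip (real M) (snd z))) =
  Tr (SI E (%s. cor (g (ereal s))) * Z * rh)"
proof -
 have bg: "bborel (%s. cor (g (ereal s)))" using g(3) by (intro bborelI[of _ K] continuous_borel uniformly_continuous_imp_continuous g(2)) simp
 have "contn (%s. cor (clip (real M) (ereal s)))"
  by (intro continuous_on_of_real continuous_on_compose2[OF continuous_clip] continuous_on_ereal continuous_on_id) auto
 then have bc: "bborel (%s. cor (clip (real M) (ereal s)))" using clip_bound by (intro bborelI[of _ "real M"] continuous_borel) auto
 \<comment> \<open>The spectral measure F lives on \<open>cutoff M\<close>, where clipping is the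
   identity.\<close>
 have "SI F (%s. cor (clip (real M) (ereal s))) = Y" unfolding Y by (rule SI_support[OF F _ FM bc bborel_idc]) (auto simp: idc_def clip_ereal cutoff_def)
 then have "SI joint (%z. cor (g (ereal (fst z))) * cor (clip (real M) (ereal (snd z)))) =
   tensor_op tens 1 (SI Qpvm (%s. cor (g (ereal s)))) * tensor_op tens Y 1" using SI_tensor_pvm[OF tensor_flip[OF T] Qpvm F bg bc]
  by (simp add: tensor_op_flip[OF T] tensor_op_mult[OF T])
 then show ?thesis using dirac_slice_expectation[OF T E N mom trans et de v rh g(2), of K Y] g(3) by simp
qed

context
 fixes \<mu> :: "(ereal * ereal) measure" assumes \<mu>: "sets \<mu> = sets borel" "finite_measure \<mu>"
  and expectation: "!!f. contn f ==> (LINT z|\<mu>. f z) = outcome f"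
begin

lemma expectation_measurable: "f : bmeas ==> f : borel_measurable \<mu>" by (simp add: measurable_cong_sets[OF \<mu>(1) refl])

lemma finite_integrable:
 fixes f :: "ereal * ereal => 'b::{banach,second_countable_topology}" assumes "f : bmeas" "!!z. norm (f z) <= K" shows "integrable \<mu> f"
 by (rule integrable_of_le[OF finite_measure.integrable_const[OF \<mu>(2)] expectation_measurable[OF assms(1)] assms(2)])

lemma clip_snd_borel [measurable]: "(%z. clip R (snd z)) : borel_measurable (borel :: (ereal * ereal) measure)" if "0 <= R" for R
 by (intro continuous_borel continuous_on_compose2[OF continuous_clip[OF that]] continuous_intros) auto

text \<open>A continuous function vanishing exactly where \<open>\<bar>y\<bar> \<le> M\<close> has mean zero.\<close>

lemma AE_bounded_outcome: "AE z in \<mu>. (abs (snd z)) <= ereal (real M)"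
proof -
 define k where "k z = (abs (clip (real M + 1) (snd z) - clip (real M) (snd z)))" for z :: "ereal * ereal"
 have ck: "contn k" unfolding k_def[abs_def] by (intro continuous_intros continuous_on_compose2[OF continuous_clip]) auto
 then have c: "contn (%z. cor (k z))" by (intro continuous_intros)
 have "SI joint (%z. cor (k (ereal (fst z), ereal (snd z)))) = SI joint (%_. 0)"
  by (rule SI_support[OF pvm_joint _ joint_support bounded_continuous_extended[OF c] bborel_const]) (auto simp: k_def clip_ereal cutoff_def intro!: Times_borel)
 also have "... = 0" using SI_scale[OF pvm_joint bborel_const, of 0 0] by simp
 finally have "(LINT z|\<mu>. cor (k z)) = final 0" by (simp only: expectation[OF c])
 also have "... = 0" using final_bound[of 0 0] by simp
 finally have 0: "(LINT z|\<mu>. k z) = 0" by simp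
 have b: "norm (k z) <= 2 * real M + 1" for z using clip_bound[of "real M + 1" "snd z"] clip_bound[of "real M" "snd z"] by (simp add: k_def)
 have "AE z in \<mu>. k z = 0" using 0 integral_nonneg_eq_0_iff_AE[OF finite_integrable[OF continuous_borel[OF ck] b]] by (simp add: k_def)
 moreover have "k z ~= 0" if "~ (abs (snd z)) <= ereal (real M)" for z
  using that by (cases "snd z") (auto simp: k_def clip_ereal clip_infty max_def min_def split: if_splits)
 ultimately show ?thesis by (auto elim!: eventually_mono)
qed

abbreviation (input) "c z == clip (real M) (snd z)"

lemma clip_bound_outcome: "0 <= h ==> h <= 1 ==> cmod (cor (h * c z)) <= real M"
 using clip_bound[of "real M" "snd z"] mult_mono[of h 1 "(abs (c z))" "real M"] by (simp add: abs_mult del: of_real_mult)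

lemma fst_borel: "(%z::ereal * ereal. fst z) : bmeas" by (intro continuous_borel continuous_intros)

lemma half_line_measurable: "(%z::ereal * ereal. cor (ind {..a} (fst z) * c z)) : bmeas"
proof -
 note [measurable] = clip_snd_borel[OF of_nat_0_le_iff, of M] measurable_compose[OF fst_borel borel_measurable_indicator[of "{..a}"]]
 show ?thesis by measurable
qed

lemma expectation_half_line: "(LINT z|\<mu>. cor (ind {..ereal a} (fst z) * c z)) = Tr (SI E (ind {..a}) * Z * rh)"
proof (rule LIMSEQ_unique)
 have cont: "contn (%z. cor (sramp k a (fst z) * c z))" for k
  by (intro continuous_intros continuous_on_compose2[OF continuous_clip] continuous_on_compose2[OF continuous_sramp]) auto
 show "(%k. \<integral>z. cor (sramp k a (fst z) * c z) \<partial>\<mu>) ----> (LINT z|\<mu>. cor (ind {..ereal a} (fst z) * c z))"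
  by (rule finite_measure_integral_tendsto[OF \<mu>(2,1) continuous_borel[OF cont] clip_bound_outcome[OF sramp_bounds] _ half_line_measurable])
   (intro tendsto_of_real tendsto_mult sramp_tendsto tendsto_const)
 have "(%k. cor (sramp k a (ereal s))) ----> ind {..a} s" for s
  using tendsto_of_real[OF sramp_tendsto[of a "ereal s"], where 'a = complex] by (cases "s <= a") simp_all
 moreover have "bborel (%s. cor (sramp k a (ereal s)))" for k using sramp_bounds[of k a]
  by (intro bborelI[of _ 1] continuous_borel uniformly_continuous_imp_continuous uniformly_continuous_sramp) simp
 ultimately have "(%k. Tr (SI E (%s. cor (sramp k a (ereal s))) * Z * rh)) ----> Tr (SI E (ind {..a}) * Z * rh)"
  using sramp_bounds by (intro Tr_spectral_limit[OF E v, of _ 1]) auto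
 moreover have "(abs (sramp k a x)) <= 1" for k x using sramp_bounds[of k a x] by simp
 then have "outcome (%z. cor (sramp k a (fst z) * c z)) = Tr (SI E (%s. cor (sramp k a (ereal s))) * Z * rh)" for k
  by (rule outcome_product[OF continuous_sramp uniformly_continuous_sramp])
 ultimately show "(%k. \<integral>z. cor (sramp k a (fst z) * c z) \<partial>\<mu>) ----> Tr (SI E (ind {..a}) * Z * rh)" by (simp only: expectation[OF cont])
qed

lemma Tr_zero: "Tr (SI E (%_. 0) * Z * rh) = 0" using Tr_spectral_add[OF E v bborel_const bborel_const, of 0 0 Z] by simp

text \<open>The half lines up to -n shrink to the point at minus infinity in the extended line but
  to the empty set in R. Comparing the limits of both sides of \<open>expectation_half_line\<close>
  gives 0.\<close>

lemma expectation_minus_infinity: "(LINT z|\<mu>. cor (ind {..-\<infinity>} (fst z) * c z)) = 0"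
proof (rule LIMSEQ_unique)
 have ev: "\<forall>\<^sub>F n in sequentially. ind {..ereal (- real n)} x = (ind {..-\<infinity>} x :: real)" for x proof (cases x)
  case (real r)
  obtain m :: nat where "- r < real m" using reals_Archimedean2 by blast
  then show ?thesis by (intro eventually_sequentiallyI[of m]) (simp add: real indicator_def)
 qed auto
 have "(%n. cor (ind {..ereal (- real n)} (fst z) * c z)) ----> cor (ind {..-\<infinity>} (fst z) * c z)" for z :: "ereal * ereal"
  by (intro tendsto_of_real tendsto_mult tendsto_eventually[OF ev] tendsto_const)
 from finite_measure_integral_tendsto[OF \<mu>(2,1) half_line_measurable clip_bound_outcome this half_line_measurable]
 show "(%n. \<integral>z. cor (ind {..ereal (- real n)} (fst z) * c z) \<partial>\<mu>) ----> (LINT z|\<mu>. cor (ind {..-\<infinity>} (fst z) * c z))" by simp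
 have "(%n. ind {..- real n} s) ----> (0::complex)" for s
  using ev[of "ereal s"] by (intro tendsto_eventually) (auto elim!: eventually_mono simp: indicator_def split: if_splits)
 then have "(%n. Tr (SI E (ind {..- real n}) * Z * rh)) ----> Tr (SI E (%_. 0) * Z * rh)"
  by (intro Tr_spectral_limit[OF E v, of _ 1]) (auto simp: indicator_def)
 then show "(%n. \<integral>z. cor (ind {..ereal (- real n)} (fst z) * c z) \<partial>\<mu>) ----> 0" unfolding expectation_half_line Tr_zero .
qed

abbreviation (input) "fin f z == ind (UNIV - {\<infinity>, -\<infinity>}) (fst z) * f (real_of_ereal (fst z)) * cor (c z)"

lemma fin_measurable:
 fixes f :: "real => complex" assumes f: "f : bmeas" shows "(%z. fin f z) : bmeas"
proof -
 note [measurable] = clip_snd_borel[OF of_nat_0_le_iff, of M]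
  measurable_compose[OF borel_measurable_real_of_ereal[OF fst_borel] f]
  measurable_compose[OF fst_borel borel_measurable_indicator[of "UNIV - {\<infinity>, -\<infinity>}"]]
 show ?thesis by measurable
qed

lemma fin_bound: assumes "cmod (f (real_of_ereal (fst z))) <= K" shows "cmod (fin f z) <= K * real M"
proof -
 have "0 <= K" using assms norm_ge_zero order_trans by blast
 then show ?thesis using mult_mono[OF assms clip_bound[of "real M" "snd z"]] by (auto simp: norm_mult indicator_def)
qed

lemma expectation_borel: assumes B: "B : sets borel" shows "(LINT z|\<mu>. fin (ind B) z) = Tr (E B * Z * rh)"
proof -
 define d where "d f = (LINT z|\<mu>. fin f z) - Tr (SI E f * Z * rh)" for f :: "real => complex"
 have int: "integrable \<mu> (%z. fin f z)" if f: "bborel f" for f :: "real => complex" proof -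
  from f obtain K where K: "!!s. cmod (f s) <= K" by (auto simp: bborel_def)
  show ?thesis by (rule finite_integrable[OF fin_measurable[OF bborel_measurable[OF f]] fin_bound[where f = f, OF K]])
 qed
 have "d (ind B) = 0" proof (rule borel_functional_eq_0[OF _ _ _ B])
  show "d (%s. f s + g s) = d f + d g" if f: "bborel f" and g: "bborel g" for f g proof -
   have "(%z. fin (%s. f s + g s) z) = (%z. fin f z + fin g z)" by (simp add: algebra_simps)
   then show ?thesis unfolding d_def Tr_spectral_add[OF E v f g] using Bochner_Integration.integral_add[OF int[OF f] int[OF g]] by simp
  qed
  show "(%i. d (H i)) ----> d h" if H: "!!i. bborel (H i)" "!!i s. cmod (H i s) <= K" "!!s. (%i::nat. H i s) ----> h s" for H h K proof -
   have bound: "cmod (fin (H i) z) <= K * real M" for i z by (rule fin_bound[OF H(2)])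
   have lim: "(%i. fin (H i) z) ----> fin h z" for z by (intro tendsto_mult tendsto_const H(3))
   show ?thesis unfolding d_def by (intro tendsto_diff Tr_spectral_limit[OF E v H] finite_measure_integral_tendsto[OF \<mu>(2,1)
     fin_measurable[OF bborel_measurable[OF H(1)]] bound lim fin_measurable[OF bborel_measurable[OF bborel_limit[OF H]]]])
  qed
  show "d (ind {..a}) = 0" for a proof -
   have int: "integrable \<mu> (%z. cor (ind {..b} (fst z) * c z))" for b
    by (rule finite_integrable[OF half_line_measurable clip_bound_outcome]) (auto simp: indicator_def)
   \<comment> \<open>A half line of R is the extended half line without its infinite endpoint, whose
     contribution was just shown to vanish.\<close>
   have "fin (ind {..a}) z = cor (ind {..ereal a} (fst z) * c z) - cor (ind {..-\<infinity>} (fst z) * c z)" for z by (cases "fst z") (auto simp: indicator_def)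
   then have "(LINT z|\<mu>. fin (ind {..a}) z) = (LINT z|\<mu>. cor (ind {..ereal a} (fst z) * c z) - cor (ind {..-\<infinity>} (fst z) * c z))"
    by (simp only:)
   also have "... = Tr (SI E (ind {..a}) * Z * rh) - 0" unfolding expectation_half_line[symmetric] expectation_minus_infinity[symmetric]
    by (intro Bochner_Integration.integral_diff int)
   finally show ?thesis unfolding d_def by simp
  qed
 qed
 then show ?thesis by (simp add: d_def SI_indicator[OF E B])
qed

text \<open>The section measure is the image of \<open>\<mu>\<close> restricted to the strip over B
  under the real value of y. Since |y| <= M almost everywhere, infinite values of y are negligible
  and y may be replaced by its continuous truncation.\<close>

lemma section_measure_integral: assumes B: "B : sets borel" shows "integrable (section_measure \<mu> B) (%y. y)"
  and "cor (LINT y|section_measure \<mu> B. y) = Tr (E B * Z * rh)"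
proof -
 define A where "A = ereal ` B \<times> (UNIV :: ereal set)"
 have eb: "ereal ` C : sets borel" if "C : sets borel" for C proof -
  have "real_of_ereal -` C Int space borel : sets (borel :: ereal measure)"
   by (rule measurable_sets[OF borel_measurable_real_of_ereal[OF measurable_ident_sets[OF refl]] that])
  then have "(real_of_ereal -` C Int space borel) - {\<infinity>, -\<infinity>} : sets (borel :: ereal measure)" by (rule sets.Diff) auto
  also have "(real_of_ereal -` C Int space borel) - {\<infinity>, -\<infinity>} = ereal ` C" proof (intro set_eqI)
   show "x : (real_of_ereal -` C Int space borel) - {\<infinity>, -\<infinity>} \<longleftrightarrow> x : ereal ` C" for x by (cases x) auto
  qed
  finally show ?thesis .
 qed
 have A: "A : sets \<mu>" unfolding A_def \<mu>(1) by (intro Times_borel eb B) auto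
 have s: "(%z::ereal * ereal. real_of_ereal (snd z)) : bmeas" by (intro borel_measurable_real_of_ereal continuous_borel continuous_intros)
 define D where "D = density \<mu> (%z. ennreal (ind A z))"
 have sD: "(%z. real_of_ereal (snd z)) : measurable D borel" using expectation_measurable[OF s] by (simp add: D_def)
 define \<nu> where "\<nu> = distr D borel (%z. real_of_ereal (snd z))"
 have "emeasure \<nu> C = emeasure \<mu> (ereal ` B \<times> ereal ` C)" if C: "C : sets borel" for C proof -
  let ?P = "(%z. real_of_ereal (snd z)) -` C Int space D"
  have P: "?P : sets \<mu>" using measurable_sets[OF sD C] by (simp add: D_def)
  have "emeasure \<nu> C = (\<integral>\<^sup>+z. ennreal (ind A z) * ind ?P z \<partial>\<mu>)" unfolding \<nu>_def emeasure_distr[OF sD C] unfolding D_def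
   by (rule emeasure_density) (use A P in "auto simp: D_def")
  also have "... = (\<integral>\<^sup>+z. ind (ereal ` B \<times> ereal ` C) z \<partial>\<mu>)" proof (rule nn_integral_cong_AE)
   show "AE z in \<mu>. ennreal (ind A z) * ind ?P z = ind (ereal ` B \<times> ereal ` C) z" using AE_bounded_outcome AE_space proof eventually_elim
    case (elim z)
    then obtain t where "snd z = ereal t" by (cases "snd z") auto
    then show ?case using elim(2) by (cases z) (auto simp: A_def D_def indicator_def)
   qed
  qed
  also have "... = emeasure \<mu> (ereal ` B \<times> ereal ` C)" by (rule nn_integral_indicator) (unfold \<mu>(1), intro Times_borel eb B C)
  finally show ?thesis .
 qed
 \<comment> \<open>Agreement on Borel sets with a genuine measure is essential:
   \<open>measure_of\<close> would return the zero measure for a set function that is not countably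
   additive.\<close>
 then have "section_measure \<mu> B = measure_of UNIV (sets borel) (emeasure \<nu>)"
  unfolding section_measure_def by (intro measure_of_eq) (auto simp: sets.sigma_sets_eq[of borel, simplified])
 also have "... = \<nu>" using measure_of_of_measure[of \<nu>] by (simp add: \<nu>_def)
 finally have sec: "section_measure \<mu> B = \<nu>" .
 have cb: "norm (ind A z * c z :: real) <= real M" for z using clip_bound[of "real M" "snd z"] by (simp add: indicator_def)
 have cm: "(%z. ind A z * c z :: real) : bmeas" using A clip_snd_borel[OF of_nat_0_le_iff, of M] unfolding \<mu>(1) by (intro borel_measurable_times) auto
 have ae: "AE z in \<mu>. ind A z * c z = ind A z *\<^sub>R real_of_ereal (snd z)" using AE_bounded_outcome proof eventually_elim
  case (elim z)
  then obtain t where "snd z = ereal t" by (cases "snd z") auto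
  then show ?case using elim by (simp add: clip_ereal)
 qed
 have im: "(%z. ind A z :: real) : borel_measurable \<mu>" using A by simp
 have "integrable \<mu> (%z. ind A z *\<^sub>R real_of_ereal (snd z))"
  using integrable_cong_AE_imp[OF finite_integrable[OF cm cb] _ ae] A expectation_measurable[OF s] by auto
 then show "integrable (section_measure \<mu> B) (%y. y)" unfolding sec \<nu>_def integrable_distr_eq[OF sD measurable_ident_sets[OF refl]] unfolding D_def
  using integrable_density[OF expectation_measurable[OF s] im] by simp
 have "(LINT y|section_measure \<mu> B. y) = (LINT z|D. real_of_ereal (snd z))"
  unfolding sec \<nu>_def by (rule integral_distr[OF sD measurable_ident_sets[OF refl]])
 also have "... = (LINT z|\<mu>. ind A z *\<^sub>R real_of_ereal (snd z))" unfolding D_def by (rule integral_density[OF expectation_measurable[OF s] im]) simp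
 also have "... = (LINT z|\<mu>. ind A z * c z)" using ae A expectation_measurable[OF s] expectation_measurable[OF cm] by (intro integral_cong_AE) auto
 finally have "cor (LINT y|section_measure \<mu> B. y) = (LINT z|\<mu>. cor (ind A z * c z))" by (simp only: integral_complex_of_real)
 also have "(%z. cor (ind A z * c z)) = (%z. fin (ind B) z)" proof (rule ext)
  show "cor (ind A z * c z) = fin (ind B) z" for z by (cases "fst z") (auto simp: A_def indicator_def mem_Times_iff)
 qed
 finally show "cor (LINT y|section_measure \<mu> B. y) = Tr (E B * Z * rh)" by (simp only: expectation_borel[OF B])
qed

end

end

theorem theorem5p5:
  fixes tens :: "'h::chilbert_space \<Rightarrow> L2 \<Rightarrow> 'g::chilbert_space"
    and \<eta> :: "(real \<Rightarrow> complex) \<Rightarrow> complex"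
    and \<delta> :: "L2 bop \<Rightarrow> complex"
    and X :: "('h \<times> 'h) set"
  assumes "separable_space (euclidean :: 'h topology)"
    and "hilbert_tensor tens"
    and "topologically_invariant_mean \<eta>"
    and "dirac_state \<eta> \<delta>"
    and "self_adjoint X"
  shows "\<forall>Y B. hermitian Y \<longrightarrow> B \<in> sets borel \<longrightarrow>
    (\<forall>\<rho>. density_operator \<rho> \<longrightarrow>
      integrable (section_measure (joint_distribution tens \<delta> X Y \<rho>) B) (\<lambda>y. y) \<and>
      complex_of_real (\<integral>y. y \<partial>section_measure (joint_distribution tens \<delta> X Y \<rho>) B) =
        Tr (spectral_measure X B * mean_projection \<eta> X Y * \<rho>))"
proof (intro allI impI)
 fix Y :: "'h bop" and B :: "real set" and \<rho> :: "'h bop"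
 assume Y: "hermitian Y" and B: "B : sets borel" and \<rho>: "density_operator \<rho>"
 have mean: "mean \<eta>" using assms(3) unfolding topologically_invariant_mean_def by blast
 obtain E where E: "pvm E" "X = sgraph E" using spectral_theorem[OF assms(5)] by blast
 obtain N where N: "pvm N" "momentum_op = sgraph N" "!!s. ugroup N (- s) = translation s" using momentum_spectral by blast
 obtain M :: nat where "norm Y <= real M" using real_arch_simple by blast
 with Y obtain F where F: "pvm F" "F (cutoff M) = 1" "Y = SI F (idc M)" using hermitian_spectral unfolding hermitian_def by blast
 have \<rho>': "positive_trace_class \<rho>" and Tr1: "Tr \<rho> = 1" using \<rho> unfolding density_operator_def by blast+
 obtain v where v: "represents (onb::'h set) v \<rho>" using trace_class_represents[OF \<rho>'] by blast
 note ctx = assms(2) E(1) N mean assms(4) v Tr1 F(1,3,2)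
 obtain \<mu> where \<mu>: "sets \<mu> = sets borel" "emeasure \<mu> (space \<mu>) = 1"
  "!!f. contn f ==> (\<integral>z. f z \<partial>\<mu>) = \<delta> (slice_map tens \<rho> (adj (coupling tens E N) *
   SI (tensor_pvm (%y x. tens x y) Qpvm F) (%z. f (ereal (fst z), ereal (snd z))) * coupling tens E N))" using outcome_distribution[OF ctx] by blast
 have "finite_measure \<mu>" by (rule finite_measureI) (simp add: \<mu>(2))
 note result = section_measure_integral[OF ctx \<mu>(1) this \<mu>(3) B]
 have "joint_distribution tens \<delta> X Y \<rho> = \<mu>" unfolding E(2) by (rule joint_distribution_eq[OF ctx \<mu>])
 then show "integrable (section_measure (joint_distribution tens \<delta> X Y \<rho>) B) (%y. y) &
   cor (\<integral>y. y \<partial>section_measure (joint_distribution tens \<delta> X Y \<rho>) B) =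
    Tr (spectral_measure X B * mean_projection \<eta> X Y * \<rho>)" using result by (simp add: E(2) spectral_measure_sgraph[OF E(1)])
qed

end
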